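(* Let $S=\mathbb{H}/G$ be a finite area hyperbolic 2-orbifold, let $\gamma_1,\ldots,\gamma_k$ be disjoint simple closed geodesics on $S$ which together bound a subsurface $M$ of $S$, let $\Gamma=\bigcup_i\gamma_i$ be the boundary of $M$ and $l(\Gamma)=\sum_{i=1}^k l(\gamma_i)$ its total length. Then for almost all $v\in T_1S$ the excursion parameters $\{(t_i,s_i)\}_{i=1}^\infty$ of the geodesic ray $\alpha_v$ into $M$ satisfy $$\lim_{n\to\infty}\frac1n\sum_{i=1}^n(s_i-t_i)=\frac{\pi\,\mathrm{area}(M)}{l(\Gamma)}.$$
   Context: $\mathbb{H}$ is the Poincaré upper half-plane, $G\subset \mathrm{PSL}_2(\mathbb{R})$ is a discrete group, and $S=\mathbb{H}/G$ has finite hyperbolic area. $l(\beta)$ denotes the hyperbolic length of a closed geodesic $\beta$, and $\mathrm{area}(T)$ the hyperbolic area of $T\subset S$. $T_1S$ is the unit tangent bundle and $G_t$ the geodesic flow on it. "Almost all $v\in T_1S$" is with respect to the flow-invariant Liouville probability measure, whose lift to $T_1\mathbb{H}=\mathbb{H}\times S^1$ is $\frac{1}{2\pi\,\mathrm{area}(S)}\,dA\,d\phi$. That $\gamma_1,\dots,\gamma_k$ bound $M$ means that $M$ is a subsurface with boundary $\Gamma$, lying locally on one side of each $\gamma_i$. For $v\in T_1S$, $\alpha_v:[0,\infty)\to S$ is the unit-speed geodesic ray obtained by projecting the forward orbit $\{G_t(v)\mid t\ge 0\}$ to $S$; $\alpha_v$ also denotes its image. If $\alpha_v$ intersects $\Gamma$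 infinitely often, there is a sequence of pairs of parameter values $\{(t_i,s_i)\}_{i=1}^\infty$ with $t_i<s_i<t_{i+1}$ such that $\alpha_v$ meets $M$ in precisely the arcs of $\alpha_v$ over the parameter intervals from $t_i$ to $s_i$, i.e. $\bigcup_{i=1}^\infty\alpha_v[(t_i,s_i)]=\alpha_v\cap M$. These arcs are the excursions of $\alpha_v$ into $M$, and the pairs $(t_i,s_i)$ are the excursion parameters of $\alpha_v$; the length of the $i$-th excursion is $s_i-t_i$. (Almost every $v$ has $\alpha_v$ meeting $\Gamma$ infinitely often.) *)

theory Defs
  imports "HOL-Analysis.Analysis" "HOL-Algebra.Coset"
begin

definition quotient_topology :: "'a topology \<Rightarrow> ('a \<Rightarrow> 'b) \<Rightarrow> 'b topology" where
  "quotient_topology X p =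
     topology (\<lambda>U. U \<subseteq> p ` topspace X \<and> openin X {x \<in> topspace X. p x \<in> U})"

lemma openin_quotient_topology:
  "openin (quotient_topology X p) U \<longleftrightarrow>
     U \<subseteq> p ` topspace X \<and> openin X {x \<in> topspace X. p x \<in> U}"
proof -
  have "istopology (\<lambda>U. U \<subseteq> p ` topspace X \<and> openin X {x \<in> topspace X. p x \<in> U})"
    unfolding istopology_def
  proof (intro conjI allI impI)
    fix S T
    assume a: "S \<subseteq> p ` topspace X \<and> openin X {x \<in> topspace X. p x \<in> S}"
      "T \<subseteq> p ` topspace X \<and> openin X {x \<in> topspace X. p x \<in> T}"
    then show "S \<inter> T \<subseteq> p ` topspace X" by blast
    have "{x \<in> topspace X. p x \<in> S \<inter> T} =
        {x \<in> topspace X. p x \<in> S} \<inter> {x \<in> topspace X. p x \<in> T}" by blast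
    then show "openin X {x \<in> topspace X. p x \<in> S \<inter> T}" using a by (simp add: openin_Int)
  next
    fix K
    assume a: "\<forall>S\<in>K. S \<subseteq> p ` topspace X \<and> openin X {x \<in> topspace X. p x \<in> S}"
    then show "\<Union>K \<subseteq> p ` topspace X" by blast
    have "{x \<in> topspace X. p x \<in> \<Union>K} = \<Union>((\<lambda>S. {x \<in> topspace X. p x \<in> S}) ` K)" by blast
    then show "openin X {x \<in> topspace X. p x \<in> \<Union>K}" using a by auto
  qed
  then show ?thesis by (simp add: quotient_topology_def topology_inverse')
qed

lemma topspace_quotient_topology: "topspace (quotient_topology X p) = p ` topspace X"
proof -
  have "{x \<in> topspace X. p x \<in> p ` topspace X} = topspace X" by blast
  then have "openin (quotient_topology X p) (p ` topspace X)"
    by (simp add: openin_quotient_topology)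
  then show ?thesis
    by (metis openin_quotient_topology openin_subset openin_topspace subset_antisym)
qed

lemma quotient_map_quotient_topology: "quotient_map X (quotient_topology X p) p"
  by (auto simp: quotient_map_def topspace_quotient_topology openin_quotient_topology)

definition borel_of_topology :: "'a topology \<Rightarrow> 'a measure" where
  "borel_of_topology X = sigma (topspace X) {U. openin X U}"

text \<open>
  \<open>p\<close> is the orbit map of a countable group preserving \<open>\<mu>\<close>. A measurable fundamental
  domain meets almost every orbit exactly once, and the measure of \<open>T\<close> in the quotient is
  the \<open>\<mu>\<close>-measure of the part of the domain lying over \<open>T\<close>; by invariance of \<open>\<mu>\<close> this does
  not depend on the domain. Locally, away from points with stabilizer, \<open>\<mu>\<close> is the lift of
  the quotient measure.
\<close>

definition fundamental_domain :: "'a measure \<Rightarrow> ('a \<Rightarrow> 'b) \<Rightarrow> 'a set \<Rightarrow> bool" where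
  "fundamental_domain \<mu> p F \<longleftrightarrow> F \<in> sets \<mu> \<and> (AE x in \<mu>. \<exists>!y. y \<in> F \<and> p y = p x)"

definition quotient_measure :: "'a measure \<Rightarrow> 'a topology \<Rightarrow> ('a \<Rightarrow> 'b) \<Rightarrow> 'b measure" where
  "quotient_measure \<mu> X p =
     distr (restrict_space \<mu> (SOME F. fundamental_domain \<mu> p F))
       (borel_of_topology (quotient_topology X p)) p"

definition half_plane :: "complex set" where
  "half_plane = {z. 0 < Im z}"

definition hyp_dist :: "complex \<Rightarrow> complex \<Rightarrow> real" where
  "hyp_dist z w = arcosh (1 + (norm (z - w))\<^sup>2 / (2 * Im z * Im w))"

definition hyp_area :: "complex measure" where
  "hyp_area = restrict_space (density lborel (\<lambda>z. ennreal (1 / (Im z)\<^sup>2))) half_plane"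

text \<open>
  \<open>(z, u)\<close> with \<open>norm u = 1\<close> stands for the tangent vector \<open>Im z *\<^sub>R u\<close> at \<open>z\<close>, which has
  hyperbolic norm 1. This is the identification of the unit tangent bundle with the product
  of the half-plane and the circle.
\<close>

definition unit_tangent :: "(complex \<times> complex) set" where
  "unit_tangent = half_plane \<times> sphere 0 1"

definition angle_measure :: "complex measure" where
  "angle_measure =
     distr (restrict_space lborel {0..<2 * pi}) (restrict_space borel (sphere 0 1)) cis"

text \<open>
  Hyperbolic geodesics minimize length globally, so the complete unit speed geodesics are the
  isometric embeddings of the real line.
\<close>

definition hyp_geodesic :: "(real \<Rightarrow> complex) \<Rightarrow> bool" where
  "hyp_geodesic c \<longleftrightarrow>
     (\<forall>t. c t \<in> half_plane) \<and> (\<forall>s t. hyp_dist (c s) (c t) = \<bar>s - t\<bar>)"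

definition geodesic_from :: "complex \<times> complex \<Rightarrow> real \<Rightarrow> complex" where
  "geodesic_from v = (THE c. hyp_geodesic c \<and> c 0 = fst v \<and>
     (c has_vector_derivative Im (fst v) *\<^sub>R snd v) (at 0))"

definition geodesic_flow :: "real \<Rightarrow> complex \<times> complex \<Rightarrow> complex \<times> complex" where
  "geodesic_flow t v =
     (geodesic_from v t, sgn (vector_derivative (geodesic_from v) (at t)))"

definition SL2R :: "(real^2^2) monoid" where
  "SL2R = \<lparr>carrier = {A. det A = 1}, mult = (**), one = mat 1\<rparr>"

definition PSL2R :: "(real^2^2) set monoid" where
  "PSL2R = SL2R Mod {mat 1, - mat 1}"

lemma group_SL2R: "group SL2R"
proof (rule groupI)
  fix A assume "A \<in> carrier SL2R"
  then have d: "det A = 1" by (simp add: SL2R_def)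
  then have "invertible A" by (simp add: invertible_det_nz)
  then obtain B where B: "B ** A = mat 1" unfolding invertible_def by blast
  then have "det B = 1" using d by (metis det_I det_mul mult.right_neutral)
  with B show "\<exists>B\<in>carrier SL2R. B \<otimes>\<^bsub>SL2R\<^esub> A = \<one>\<^bsub>SL2R\<^esub>" by (auto simp: SL2R_def)
qed (auto simp: SL2R_def det_mul matrix_mul_assoc)

lemma normal_center_SL2R: "{mat 1, - mat 1} \<lhd> SL2R"
proof -
  interpret group SL2R by (rule group_SL2R)
  have neg: "(- mat 1) ** A = - A" "A ** (- mat 1) = - A" for A :: "real^2^2"
    by (simp_all add: vec_eq_iff matrix_matrix_mult_def mat_def sum_2 forall_2)
  have det: "det (- mat 1 :: real^2^2) = 1" by (simp add: det_2 mat_def)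
  have inv: "inv\<^bsub>SL2R\<^esub> (- mat 1) = - mat 1"
    by (rule inv_equality) (simp_all add: SL2R_def neg det)
  have sub: "subgroup {mat 1, - mat 1} SL2R"
  proof (rule subgroupI)
    show "inv\<^bsub>SL2R\<^esub> a \<in> {mat 1, - mat 1}" if "a \<in> {mat 1, - mat 1}" for a
      using that inv inv_one by (auto simp: SL2R_def)
  qed (auto simp: SL2R_def det neg)
  show ?thesis
    by (rule normalI[OF sub]) (auto simp: r_coset_def l_coset_def SL2R_def neg)
qed

lemma group_PSL2R: "group PSL2R"
  unfolding PSL2R_def by (rule normal.factorgroup_is_group[OF normal_center_SL2R])

text \<open>
  The elements of \<open>PSL2R\<close> are the sets \<open>{A, - A}\<close>, so \<open>\<Union>G\<close> is the preimage of \<open>G\<close> in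
  \<open>SL2R\<close>. As the kernel is finite, \<open>G\<close> is discrete iff this preimage is.
\<close>

definition discrete_subgroup_PSL2R :: "(real^2^2) set set \<Rightarrow> bool" where
  "discrete_subgroup_PSL2R G \<longleftrightarrow> subgroup G PSL2R \<and> discrete (\<Union>G)"

definition moebius :: "real^2^2 \<Rightarrow> complex \<Rightarrow> complex" where
  "moebius A z = (complex_of_real (A$1$1) * z + complex_of_real (A$1$2)) /
                 (complex_of_real (A$2$1) * z + complex_of_real (A$2$2))"

definition moebius_tangent :: "real^2^2 \<Rightarrow> complex \<times> complex \<Rightarrow> complex \<times> complex" where
  "moebius_tangent A v =
     (moebius A (fst v), sgn (deriv (moebius A) (fst v) * snd v))"

definition orbit :: "(real^2^2) set set \<Rightarrow> complex \<Rightarrow> complex set" where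
  "orbit G z = (\<lambda>A. moebius A z) ` \<Union>G"

definition tangent_orbit ::
    "(real^2^2) set set \<Rightarrow> complex \<times> complex \<Rightarrow> (complex \<times> complex) set" where
  "tangent_orbit G v = (\<lambda>A. moebius_tangent A v) ` \<Union>G"

definition orbifold :: "(real^2^2) set set \<Rightarrow> complex set set" where
  "orbifold G = orbit G ` half_plane"

definition orbifold_topology :: "(real^2^2) set set \<Rightarrow> complex set topology" where
  "orbifold_topology G = quotient_topology (top_of_set half_plane) (orbit G)"

definition orbifold_area :: "(real^2^2) set set \<Rightarrow> complex set measure" where
  "orbifold_area G = quotient_measure hyp_area (top_of_set half_plane) (orbit G)"

definition liouville :: "(real^2^2) set set \<Rightarrow> (complex \<times> complex) set measure" where
  "liouville G =
     quotient_measure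
       (scale_measure (ennreal (1 / (2 * pi * measure (orbifold_area G) (orbifold G))))
         (hyp_area \<Otimes>\<^sub>M angle_measure))
       (top_of_set unit_tangent) (tangent_orbit G)"

text \<open>
  A point \<open>v\<close> of the unit tangent bundle of the orbifold is an orbit of tangent vectors. The
  flow commutes with the group action, so its image under the flow is again an orbit, and the
  base points of the vectors in that orbit form a point of the orbifold.
\<close>

definition geodesic_ray :: "(complex \<times> complex) set \<Rightarrow> real \<Rightarrow> complex set" where
  "geodesic_ray v t = fst ` geodesic_flow t ` v"

text \<open>
  \<open>c\<close> is a unit speed parametrization, so its simple period \<open>l\<close> is the length of the closed
  geodesic.
\<close>

definition simple_closed_geodesic ::
    "(real^2^2) set set \<Rightarrow> (real \<Rightarrow> complex set) \<Rightarrow> real \<Rightarrow> bool" where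
  "simple_closed_geodesic G c l \<longleftrightarrow>
     (\<exists>g. hyp_geodesic g \<and> (\<forall>t. c t = orbit G (g t))) \<and>
     0 < l \<and> (\<forall>t. c (t + l) = c t) \<and> inj_on c {0..<l}"

text \<open>
  The charts say that \<open>M\<close> is a surface with boundary \<open>\<Gamma>\<close> along \<open>\<Gamma>\<close> and lies there on exactly
  one side of \<open>\<Gamma>\<close>; the remaining points of \<open>M\<close> are interior.
\<close>

definition bounds_subsurface ::
    "(real^2^2) set set \<Rightarrow> complex set set \<Rightarrow> complex set set \<Rightarrow> bool" where
  "bounds_subsurface G \<Gamma> M \<longleftrightarrow>
     closedin (orbifold_topology G) M \<and>
     orbifold_topology G frontier_of M = \<Gamma> \<and>
     (\<forall>p\<in>\<Gamma>. \<exists>U \<phi>. openin (orbifold_topology G) U \<and> p \<in> U \<and>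
        homeomorphic_map (subtopology (orbifold_topology G) U)
          (top_of_set (ball (0::complex) 1)) \<phi> \<and>
        \<phi> p = 0 \<and>
        \<phi> ` (U \<inter> \<Gamma>) = {z \<in> ball 0 1. Im z = 0} \<and>
        \<phi> ` (U \<inter> M) = {z \<in> ball 0 1. Im z \<ge> 0})"

definition excursion_parameters ::
    "complex set set \<Rightarrow> (complex \<times> complex) set \<Rightarrow> (nat \<Rightarrow> real) \<Rightarrow> (nat \<Rightarrow> real) \<Rightarrow> bool" where
  "excursion_parameters M v t s \<longleftrightarrow>
     (\<forall>i. t i < s i \<and> s i < t (Suc i)) \<and>
     {\<tau>. 0 \<le> \<tau> \<and> geodesic_ray v \<tau> \<in> M} = (\<Union>i. {t i..s i})"

end

theory Submission
  imports Defs
begin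

text \<open>
  Unit tangent vectors are classes of real 2 by 2 matrices of positive determinant up to scaling,
  the group acts by left multiplication and the geodesic flow is right multiplication by
  diagonal matrices. Lebesgue measure on matrices is invariant under both, and cutting it off at
  determinant 1 over a fundamental domain yields a multiple of Liouville measure. The flow is
  ergodic by the Mautner phenomenon: a set invariant under the diagonal matrices is invariant under
  the unipotent ones that they contract.

  By Birkhoff's theorem the time that almost every ray spends in \<open>M\<close> grows at a rate proportional
  to \<open>area M\<close>, and the number of its crossings of the boundary at a rate proportional to the measure
  of the vectors that cross within unit time. In the coordinates given by time and position of the
  crossing the latter is computed to be a multiple of the boundary length. Almost every ray avoids
  the points with stabilizer, so it changes sides at each crossing, and there are two crossings per
  excursion; the quotient of the rates is the average length.
\<close>

section \<open>Birkhoff's ergodic theorem\<close>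

text \<open>Matrices of positive determinant carry plain Lebesgue measure, whose invariance is
  checked on elementary shears; it plays the role of Haar measure on \<open>PSL2R\<close>. The price
  is the scaling, absorbed by cones cut off at determinant 1, and a double count, since
  \<open>g\<close> and \<open>- g\<close> act alike. Two volumes produce the constants: the cut cone
  over a set of area \<open>a\<close> has volume \<open>pi / 2 * a\<close>, and the cut flow box
  over an arc of length \<open>l\<close> has volume \<open>l\<close>. If the total mass is
  \<open>m\<close>, the time in \<open>M\<close> grows at rate \<open>pi / 2 * area M / m\<close>
  and the crossings at rate \<open>l / m\<close>, so two crossings per excursion give
  \<open>pi * area M / l\<close>. Birkhoff's theorem is applied to the time-one map, so both
  observables are collected over a half-open time window of length 1; successive windows tile the
  ray. Liouville measure is matched with the cone measure only through null sets: an invariant null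
  cone has a null image. At a boundary point with stabilizer several lifts of the boundary may meet,
  so sides are compared only along rays that avoid such points.\<close>

definition ergodic_on :: "'a measure \<Rightarrow> ('a \<Rightarrow> 'a) \<Rightarrow> bool" where
  "ergodic_on M T \<longleftrightarrow>
     (\<forall>E\<in>sets M. T -` E \<inter> space M = E \<longrightarrow> E \<in> null_sets M \<or> space M - E \<in> null_sets M)"

context
  fixes M :: "'a measure" and T :: "'a \<Rightarrow> 'a"
  assumes finM: "finite_measure M" and T[measurable]: "T \<in> measurable M M"
    and pres: "distr M M T = M" and erg: "ergodic_on M T"
begin

definition birkhoff_sum :: "('a \<Rightarrow> real) \<Rightarrow> nat \<Rightarrow> 'a \<Rightarrow> real" where
  "birkhoff_sum f n x = (\<Sum>k<n. f ((T ^^ k) x))"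

lemma birkhoff_sum_Suc: "birkhoff_sum f (Suc n) x = f x + birkhoff_sum f n (T x)"
  by (simp add: birkhoff_sum_def sum.lessThan_Suc_shift funpow_swap1 del: sum.lessThan_Suc)

lemma measurable_funpow[measurable]: "(T ^^ k) \<in> measurable M M"
proof (induction k)
  case (Suc k)
  then show ?case using measurable_comp[OF Suc T] by simp
qed (simp add: id_def)

lemma measurable_comp_funpow[measurable]:
  "f \<in> borel_measurable M \<Longrightarrow> (\<lambda>x. f ((T ^^ k) x)) \<in> borel_measurable M"
  using measurable_comp[OF measurable_funpow, of f borel k] by (simp add: comp_def)

lemma measurable_birkhoff_sum[measurable]:
  "f \<in> borel_measurable M \<Longrightarrow> birkhoff_sum f n \<in> borel_measurable M"
  unfolding birkhoff_sum_def by measurable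

lemma integrable_comp_pres: 
  fixes f :: "'a \<Rightarrow> real"
  assumes "integrable M f" shows "integrable M (\<lambda>x. f (T x))"
  using assms integrable_distr[OF T, of f] by (simp add: pres)

lemma integral_comp_pres: 
  fixes f :: "'a \<Rightarrow> real"
  assumes "integrable M f" shows "(\<integral>x. f (T x) \<partial>M) = (\<integral>x. f x \<partial>M)"
proof -
  have "(\<integral>x. f x \<partial>distr M M T) = (\<integral>x. f (T x) \<partial>M)"
    using assms by (intro integral_distr) auto
  then show ?thesis by (simp add: pres)
qed

text \<open>The largest of the Birkhoff sums of length 1 to \<open>n + 1\<close>. The recursion by
  splitting off the first term relates it to its own translate by \<open>T\<close>, which is what
  the maximal argument integrates.\<close>

fun running_max :: "('a \<Rightarrow> real) \<Rightarrow> nat \<Rightarrow> 'a \<Rightarrow> real" where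
  "running_max f 0 x = f x"
| "running_max f (Suc n) x = f x + max 0 (running_max f n (T x))"

lemma running_max_mono: "running_max f n x \<le> running_max f (Suc n) x"
proof (induction n arbitrary: x)
  case (Suc n)
  then have "running_max f n (T x) \<le> running_max f (Suc n) (T x)" .
  then show ?case by (simp only: running_max.simps)
qed simp

lemma running_max_ge: "f x \<le> running_max f n x"
  by (cases n) auto

lemma birkhoff_sum_le_running_max: "k \<le> n \<Longrightarrow> birkhoff_sum f (Suc k) x \<le> running_max f n x"
proof (induction n arbitrary: k x)
  case 0 then show ?case by (simp add: birkhoff_sum_def)
next
  case (Suc n)
  show ?case
  proof (cases k)
    case 0 then show ?thesis by (simp add: birkhoff_sum_def)
  next
    case (Suc j)
    with Suc.prems Suc.IH[of j "T x"] show ?thesis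
      by (simp add: birkhoff_sum_Suc[of f "Suc j"] le_max_iff_disj)
  qed
qed

lemma integrable_running_max:
  assumes "integrable M f" shows "integrable M (running_max f n)"
proof (induction n)
  case (Suc n)
  have "integrable M (\<lambda>x. f x + max 0 (running_max f n (T x)))"
    using integrable_comp_pres[OF Suc] assms by (intro Bochner_Integration.integrable_add integrable_max) simp_all
  then show ?case by (simp cong: integrable_cong)
qed (use assms in simp)

text \<open>A maximal ergodic argument. The set \<open>E\<close> of points with sums unbounded above
  is invariant, hence null or conull. If it were conull, the integrated recursion for
  \<open>running_max\<close> would read \<open>0 \<le> \<integral>f + \<integral>g n\<close> with
  \<open>g n\<close> tending to 0, against \<open>\<integral>f < 0\<close>.\<close>

lemma AE_birkhoff_sum_bounded:
  assumes f: "integrable M f" and neg: "(\<integral>x. f x \<partial>M) < 0"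
  shows "AE x in M. \<exists>B. \<forall>n. birkhoff_sum f n x \<le> B"
proof -
  have [measurable]: "f \<in> borel_measurable M" using f by auto
  define E where "E = {x \<in> space M. \<forall>B::nat. \<exists>n. birkhoff_sum f n x > real B}"
  have E[measurable]: "E \<in> sets M" unfolding E_def by measurable
  \<comment> \<open>The sums at \<open>x\<close> and at \<open>T x\<close> differ by the one term
    \<open>f x\<close> and an index shift, so being unbounded is invariant.\<close>
  have shift: "(\<forall>B::nat. \<exists>n. birkhoff_sum f n (T x) > real B) \<longleftrightarrow>
      (\<forall>B::nat. \<exists>n. birkhoff_sum f n x > real B)" for x
  proof safe
    fix B :: nat
    assume *: "\<forall>B::nat. \<exists>n. birkhoff_sum f n (T x) > real B"
    obtain B' :: nat where "real B' \<ge> real B - f x" using real_arch_simple by blast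
    moreover from * obtain n where "birkhoff_sum f n (T x) > real B'" by blast
    ultimately show "\<exists>n. birkhoff_sum f n x > real B"
      by (intro exI[of _ "Suc n"]) (simp add: birkhoff_sum_Suc)
  next
    fix B :: nat
    assume *: "\<forall>B::nat. \<exists>n. birkhoff_sum f n x > real B"
    obtain B' :: nat where B': "real B' \<ge> real B + \<bar>f x\<bar>" using real_arch_simple by blast
    from * obtain n where n: "birkhoff_sum f n x > real B'" by blast
    \<comment> \<open>The empty sum is 0 and does not exceed \<open>B'\<close>, so \<open>n\<close>
      is positive.\<close>
    obtain m where m: "n = Suc m"
      using n B' by (cases n) (auto simp: birkhoff_sum_def)
    show "\<exists>n. birkhoff_sum f n (T x) > real B"
      using n B' unfolding m by (intro exI[of _ m]) (simp add: birkhoff_sum_Suc)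
  qed
  have "T -` E \<inter> space M = E"
    using measurable_space[OF T] by (auto simp: E_def shift)
  with erg have "E \<in> null_sets M \<or> space M - E \<in> null_sets M"
    using E unfolding ergodic_on_def by blast
  then show ?thesis
  proof
    assume "E \<in> null_sets M"
    then have "AE x in M. x \<notin> E" by (rule AE_not_in)
    then show ?thesis
      by (rule AE_mp) (rule AE_I2, auto simp: E_def not_less)
  next
    assume "space M - E \<in> null_sets M"
    then have aeE: "AE x in M. x \<in> E"
      by (rule AE_I') auto
    \<comment> \<open>The negative part of the running maximum: \<open>max 0 r\<close> is
      \<open>r\<close> plus its negative part, so the maximum in the recursion becomes
      additive.\<close>
    define g where "g n x = max 0 (- running_max f n x)" for n x
    have [measurable]: "running_max f n \<in> borel_measurable M" for n
      using integrable_running_max[OF f, of n] by auto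
    have g_int: "integrable M (g n)" for n
      unfolding g_def by (intro integrable_max integrable_running_max f Bochner_Integration.integrable_minus) auto
    have ge: "0 \<le> (\<integral>x. f x \<partial>M) + (\<integral>x. g n x \<partial>M)" for n
    proof -
      have "(\<integral>x. running_max f n x \<partial>M) \<le> (\<integral>x. running_max f (Suc n) x \<partial>M)"
        by (intro integral_mono integrable_running_max f running_max_mono)
      also have "\<dots> = (\<integral>x. f x + (running_max f n (T x) + g n (T x)) \<partial>M)"
        by (intro Bochner_Integration.integral_cong refl) (auto simp: g_def)
      also have "\<dots> = (\<integral>x. f x \<partial>M) + ((\<integral>x. running_max f n (T x) \<partial>M) + (\<integral>x. g n (T x) \<partial>M))"
        using f integrable_comp_pres[OF integrable_running_max[OF f, of n]] integrable_comp_pres[OF g_int[of n]]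
        by (simp only: Bochner_Integration.integral_add Bochner_Integration.integrable_add)
      also have "\<dots> = (\<integral>x. f x \<partial>M) + ((\<integral>x. running_max f n x \<partial>M) + (\<integral>x. g n x \<partial>M))"
        by (simp add: integral_comp_pres integrable_running_max f g_int)
      finally show ?thesis by simp
    qed
    have "(\<lambda>n. \<integral>x. g n x \<partial>M) \<longlonglongrightarrow> (\<integral>x. 0 \<partial>M)"
    \<comment> \<open>The dominating function is \<open>\<bar>f\<bar>\<close>, because the running
      maximum never drops below \<open>f\<close>.\<close>
    proof (rule integral_dominated_convergence[where w="\<lambda>x. \<bar>f x\<bar>"])
      show "AE x in M. (\<lambda>n. g n x) \<longlonglongrightarrow> 0"
        using aeE
      proof eventually_elim
        fix x assume "x \<in> E"
        then obtain n where n: "birkhoff_sum f n x > real 0" unfolding E_def by blast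
        then obtain m where m: "n = Suc m" by (cases n) (auto simp: birkhoff_sum_def)
        \<comment> \<open>A single positive sum makes all later running maxima positive.\<close>
        have "g k x = 0" if "k \<ge> m" for k
          using birkhoff_sum_le_running_max[OF that, of f x] n unfolding m g_def by simp
        then show "(\<lambda>n. g n x) \<longlonglongrightarrow> 0"
          by (intro tendsto_eventually) (auto simp: eventually_sequentially)
      qed
      show "AE x in M. norm (g n x) \<le> \<bar>f x\<bar>" for n
      proof (rule AE_I2)
        fix x show "norm (g n x) \<le> \<bar>f x\<bar>"
          using running_max_ge[of f x n] by (auto simp: g_def)
      qed
    qed (use f in \<open>auto simp: g_def\<close>)
    then have "(\<lambda>n. (\<integral>x. f x \<partial>M) + (\<integral>x. g n x \<partial>M)) \<longlonglongrightarrow> (\<integral>x. f x \<partial>M) + 0"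
      by (intro tendsto_intros) simp
    then have "0 \<le> (\<integral>x. f x \<partial>M) + 0"
      by (rule LIMSEQ_le_const) (use ge in auto)
    with neg show ?thesis by simp
  qed
qed

text \<open>For \<open>d\<close> strictly between the mean and \<open>c\<close> the function
  \<open>f - d\<close> has negative integral, so its sums are bounded by some \<open>B\<close>;
  after division by \<open>n\<close> the bound disappears in the gap \<open>c - d\<close>.\<close>

lemma AE_birkhoff_limsup:
  assumes f: "integrable M f" and pos: "measure M (space M) > 0"
    and c: "(\<integral>x. f x \<partial>M) / measure M (space M) < c"
  shows "AE x in M. \<forall>\<^sub>F n in sequentially. birkhoff_sum f n x / n < c"
proof -
  interpret finite_measure M by (rule finM)
  obtain d where d: "(\<integral>x. f x \<partial>M) / measure M (space M) < d" "d < c" using c dense by blast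
  have "AE x in M. \<exists>B. \<forall>n. birkhoff_sum (\<lambda>x. f x - d) n x \<le> B"
  proof (rule AE_birkhoff_sum_bounded)
    show "integrable M (\<lambda>x. f x - d)" using f by auto
    have "(\<integral>x. f x - d \<partial>M) = (\<integral>x. f x \<partial>M) - d * measure M (space M)"
      using f by (subst Bochner_Integration.integral_diff) auto
    then show "(\<integral>x. f x - d \<partial>M) < 0" using d pos by (simp add: field_simps)
  qed
  then show ?thesis
  proof eventually_elim
    fix x assume "\<exists>B. \<forall>n. birkhoff_sum (\<lambda>x. f x - d) n x \<le> B"
    then obtain B where B: "\<And>n. birkhoff_sum (\<lambda>x. f x - d) n x \<le> B" by blast
    obtain N :: nat where N: "real N > max B 0 / (c - d)" using reals_Archimedean2 by blast
    have "birkhoff_sum f n x / n < c" if "n \<ge> Suc N" for n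
    proof -
      have "birkhoff_sum f n x - real n * d \<le> B"
        using B[of n] by (simp add: birkhoff_sum_def sum_subtractf)
      moreover have "max B 0 / (c - d) < real n" using N that by linarith
      then have "B < real n * (c - d)" using d by (simp add: field_simps)
      ultimately have "birkhoff_sum f n x < c * real n" by (simp add: algebra_simps)
      then show ?thesis using that by (simp add: field_simps)
    qed
    then show "\<forall>\<^sub>F n in sequentially. birkhoff_sum f n x / n < c"
      by (auto simp: eventually_sequentially)
  qed
qed

text \<open>The one-sided estimate for \<open>f\<close> and for \<open>- f\<close>, each with the
  countably many margins \<open>1 / Suc m\<close>, so that one null set serves all of them.\<close>

theorem birkhoff_ergodic:
  assumes f: "integrable M f" and pos: "measure M (space M) > 0"
  shows "AE x in M. (\<lambda>n. birkhoff_sum f n x / n) \<longlonglongrightarrow> (\<integral>x. f x \<partial>M) / measure M (space M)"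
proof -
  let ?c = "(\<integral>x. f x \<partial>M) / measure M (space M)"
  have up: "AE x in M. \<forall>m::nat. \<forall>\<^sub>F n in sequentially. birkhoff_sum f n x / n < ?c + 1 / Suc m"
    unfolding AE_all_countable by (intro allI AE_birkhoff_limsup f pos) simp
  have "AE x in M. \<forall>m::nat. \<forall>\<^sub>F n in sequentially. birkhoff_sum (\<lambda>x. - f x) n x / n < - ?c + 1 / Suc m"
    unfolding AE_all_countable by (intro allI AE_birkhoff_limsup pos) (use f in auto)
  with up show ?thesis
  proof eventually_elim
    fix x 
    assume u: "\<forall>m::nat. \<forall>\<^sub>F n in sequentially. birkhoff_sum f n x / n < ?c + 1 / Suc m"
      and l: "\<forall>m::nat. \<forall>\<^sub>F n in sequentially. birkhoff_sum (\<lambda>x. - f x) n x / n < - ?c + 1 / Suc m"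
    show "(\<lambda>n. birkhoff_sum f n x / n) \<longlonglongrightarrow> ?c"
    proof (rule tendstoI)
      fix e :: real assume "e > 0"
      then obtain m :: nat where m: "1 / Suc m < e" using nat_approx_posE by blast
      show "\<forall>\<^sub>F n in sequentially. dist (birkhoff_sum f n x / n) ?c < e"
        using u[rule_format, of m] l[rule_format, of m]
      proof eventually_elim
        case (elim n)
        have "birkhoff_sum (\<lambda>x. - f x) n x = - birkhoff_sum f n x"
          by (simp add: birkhoff_sum_def sum_negf)
        with elim m show ?case by (simp add: dist_real_def abs_if)
      qed
    qed
  qed
qed

end

section \<open>Lebesgue measure on matrices\<close>

definition lpres :: "('a::euclidean_space \<Rightarrow> 'a) \<Rightarrow> bool" where
  "lpres T \<longleftrightarrow> T \<in> borel_measurable borel \<and> distr lborel borel T = lborel"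

lemma lpres_measurable: "lpres T \<Longrightarrow> T \<in> borel_measurable borel"
  by (simp add: lpres_def)

lemma lpres_comp:
  assumes "lpres S" "lpres T" shows "lpres (\<lambda>x. S (T x))"
proof -
  have [measurable]: "S \<in> borel_measurable borel" "T \<in> borel_measurable borel"
    using assms by (auto simp: lpres_def)
  have "distr (distr lborel borel T) borel S = distr lborel borel (S \<circ> T)"
    by (rule distr_distr) auto
  with assms show ?thesis by (auto simp: lpres_def comp_def)
qed

lemma lpres_nn_integral:
  assumes "lpres T" "f \<in> borel_measurable borel"
  shows "(\<integral>\<^sup>+x. f (T x) \<partial>lborel) = (\<integral>\<^sup>+x. f x \<partial>lborel)"
proof -
  have "(\<integral>\<^sup>+x. f x \<partial>distr lborel borel T) = (\<integral>\<^sup>+x. f (T x) \<partial>lborel)"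
    using assms by (intro nn_integral_distr) (auto simp: lpres_def)
  then show ?thesis using assms by (simp add: lpres_def)
qed

lemma lpres_emeasure:
  assumes "lpres T" "A \<in> sets borel"
  shows "emeasure lborel (T -` A) = emeasure lborel A"
proof -
  have "emeasure (distr lborel borel T) A = emeasure lborel (T -` A \<inter> space lborel)"
    using assms by (intro emeasure_distr) (auto simp: lpres_def)
  then show ?thesis using assms by (simp add: lpres_def)
qed

lemma lpresI:
  assumes [measurable]: "T \<in> borel_measurable borel"
    and "\<And>A. A \<in> sets borel \<Longrightarrow> emeasure lborel (T -` A) = emeasure lborel A"
  shows "lpres T"
  unfolding lpres_def
proof
  show "distr lborel borel T = lborel"
    by (rule measure_eqI) (auto simp: emeasure_distr assms(2))
qed fact

lemma emeasure_lborel_prod: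
  assumes A: "A \<in> sets (borel :: ('a::euclidean_space \<times> 'b::euclidean_space) measure)"
  shows "emeasure lborel A = (\<integral>\<^sup>+y. emeasure lborel {x. (x, y) \<in> A} \<partial>lborel)"
    and "emeasure lborel A = (\<integral>\<^sup>+x. emeasure lborel {y. (x, y) \<in> A} \<partial>lborel)"
proof -
  have A': "A \<in> sets (lborel \<Otimes>\<^sub>M lborel)" using A by (metis lborel_prod sets_lborel)
  have "emeasure lborel A = emeasure (lborel \<Otimes>\<^sub>M lborel) A" by (simp add: lborel_prod)
  also have "\<dots> = (\<integral>\<^sup>+y. emeasure lborel ((\<lambda>x. (x, y)) -` A) \<partial>lborel)"
    using lborel_pair.emeasure_pair_measure_alt2[OF A'] .
  finally show "emeasure lborel A = (\<integral>\<^sup>+y. emeasure lborel {x. (x, y) \<in> A} \<partial>lborel)"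
    by (simp add: vimage_def)
  have "emeasure lborel A = emeasure (lborel \<Otimes>\<^sub>M lborel) A" by (simp add: lborel_prod)
  also have "\<dots> = (\<integral>\<^sup>+x. emeasure lborel (Pair x -` A) \<partial>lborel)"
    using lborel.emeasure_pair_measure_alt[OF A'] .
  finally show "emeasure lborel A = (\<integral>\<^sup>+x. emeasure lborel {y. (x, y) \<in> A} \<partial>lborel)"
    by (simp add: vimage_def)
qed

lemma lpres_translation: "lpres (\<lambda>x::'a::euclidean_space. x + c)"
proof -
  have "(\<lambda>x. x + c) = (+) c" by (auto simp: add.commute)
  then show ?thesis unfolding lpres_def using lborel_distr_plus[of c] by simp
qed

lemma section_borel1:
  "A \<in> sets (borel :: ('a::euclidean_space \<times> 'b::euclidean_space) measure) \<Longrightarrow> {x. (x, y) \<in> A} \<in> sets borel"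
proof -
  assume A: "A \<in> sets borel"
  have "(\<lambda>x. (x, y)) -` A \<inter> space borel \<in> sets borel"
    by (rule measurable_sets[OF _ A]) (intro borel_measurable_continuous_onI continuous_intros)
  then show ?thesis by (simp add: vimage_def)
qed

lemma section_borel2:
  "A \<in> sets (borel :: ('a::euclidean_space \<times> 'b::euclidean_space) measure) \<Longrightarrow> {y. (x, y) \<in> A} \<in> sets borel"
proof -
  assume A: "A \<in> sets borel"
  have "(\<lambda>y. (x, y)) -` A \<inter> space borel \<in> sets borel"
    by (rule measurable_sets[OF _ A]) (intro borel_measurable_continuous_onI continuous_intros)
  then show ?thesis by (simp add: vimage_def)
qed

lemma borel_measurable_fst: "(fst :: 'a::euclidean_space \<times> 'b::euclidean_space \<Rightarrow> 'a) \<in> borel_measurable borel"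
  and borel_measurable_snd: "(snd :: 'a \<times> 'b \<Rightarrow> 'b) \<in> borel_measurable borel"
  by (rule borel_measurable_continuous_onI, intro continuous_intros)+

text \<open>On each slice with fixed second coordinate the map is a translation, so Fubini applies;
  \<open>f\<close> may be any Borel function.\<close>

lemma lpres_shear1:
  fixes f :: "'b::euclidean_space \<Rightarrow> 'a::euclidean_space"
  assumes [measurable]: "f \<in> borel_measurable borel"
  shows "lpres (\<lambda>p. (fst p + f (snd p), snd p))"
proof (rule lpresI)
  have 1: "(\<lambda>p::'a \<times> 'b. f (snd p)) \<in> borel_measurable borel"
    by (rule measurable_compose[OF borel_measurable_snd assms])
  show m[measurable]: "(\<lambda>p. (fst p + f (snd p), snd p)) \<in> borel_measurable borel"
    by (intro borel_measurable_Pair borel_measurable_add 1)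
       (auto intro!: borel_measurable_continuous_onI continuous_intros)
  fix A :: "('a \<times> 'b) set" assume A: "A \<in> sets borel"
  have A': "(\<lambda>p. (fst p + f (snd p), snd p)) -` A \<in> sets borel"
    using measurable_sets[OF m A] by simp
  have "emeasure lborel {x. (x, y) \<in> (\<lambda>p. (fst p + f (snd p), snd p)) -` A} = emeasure lborel {x. (x, y) \<in> A}" for y
    using lpres_emeasure[OF lpres_translation[of "f y"] section_borel1[OF A, of y]] by (simp add: vimage_def)
  then show "emeasure lborel ((\<lambda>p. (fst p + f (snd p), snd p)) -` A) = emeasure lborel A"
    by (simp add: emeasure_lborel_prod(1)[OF A'] emeasure_lborel_prod(1)[OF A])
qed

lemma lpres_prod:
  fixes S :: "'a::euclidean_space \<Rightarrow> 'a" and T :: "'b::euclidean_space \<Rightarrow> 'b"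
  assumes S: "lpres S" and T: "lpres T"
  shows "lpres (\<lambda>p. (S (fst p), T (snd p)))"
proof (rule lpresI)
  have 1: "(\<lambda>p::'a \<times> 'b. S (fst p)) \<in> borel_measurable borel"
    by (rule measurable_compose[OF borel_measurable_fst lpres_measurable[OF S]])
  have 2: "(\<lambda>p::'a \<times> 'b. T (snd p)) \<in> borel_measurable borel"
    by (rule measurable_compose[OF borel_measurable_snd lpres_measurable[OF T]])
  show m: "(\<lambda>p. (S (fst p), T (snd p))) \<in> borel_measurable borel"
    by (intro borel_measurable_Pair 1 2)
  fix A :: "('a \<times> 'b) set" assume A: "A \<in> sets borel"
  let ?B = "(\<lambda>p. (S (fst p), snd p)) -` A"
  have m1: "(\<lambda>p::'a\<times>'b. (S (fst p), snd p)) \<in> borel_measurable borel"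
    by (intro borel_measurable_Pair 1) (auto intro!: borel_measurable_continuous_onI continuous_intros)
  have B: "?B \<in> sets borel" using measurable_sets[OF m1 A] by simp
  have A': "(\<lambda>p. (S (fst p), T (snd p))) -` A \<in> sets borel"
    using measurable_sets[OF m A] by simp
  have "emeasure lborel ((\<lambda>p. (S (fst p), T (snd p))) -` A) = emeasure lborel ?B"
    unfolding emeasure_lborel_prod(2)[OF A'] emeasure_lborel_prod(2)[OF B]
  proof (rule nn_integral_cong)
    fix x
    show "emeasure lborel {y. (x, y) \<in> (\<lambda>p. (S (fst p), T (snd p))) -` A} = emeasure lborel {y. (x, y) \<in> ?B}"
      using lpres_emeasure[OF T section_borel2[OF A, of "S x"]] by (simp add: vimage_def)
  qed
  also have "\<dots> = emeasure lborel A"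
    unfolding emeasure_lborel_prod(1)[OF A] emeasure_lborel_prod(1)[OF B]
  proof (rule nn_integral_cong)
    fix y
    show "emeasure lborel {x. (x, y) \<in> ?B} = emeasure lborel {x. (x, y) \<in> A}"
      using lpres_emeasure[OF S section_borel1[OF A, of y]] by (simp add: vimage_def)
  qed
  finally show "emeasure lborel ((\<lambda>p. (S (fst p), T (snd p))) -` A) = emeasure lborel A" .
qed

lemma lpres_shear2:
  fixes f :: "'a::euclidean_space \<Rightarrow> 'b::euclidean_space"
  assumes [measurable]: "f \<in> borel_measurable borel"
  shows "lpres (\<lambda>p. (fst p, snd p + f (fst p)))"
proof (rule lpresI)
  have 1: "(\<lambda>p::'a \<times> 'b. f (fst p)) \<in> borel_measurable borel"
    by (rule measurable_compose[OF borel_measurable_fst assms])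
  show m[measurable]: "(\<lambda>p. (fst p, snd p + f (fst p))) \<in> borel_measurable borel"
    by (intro borel_measurable_Pair borel_measurable_add 1)
       (auto intro!: borel_measurable_continuous_onI continuous_intros)
  fix A :: "('a \<times> 'b) set" assume A: "A \<in> sets borel"
  have A': "(\<lambda>p. (fst p, snd p + f (fst p))) -` A \<in> sets borel"
    using measurable_sets[OF m A] by simp
  have "emeasure lborel {y. (x, y) \<in> (\<lambda>p. (fst p, snd p + f (fst p))) -` A} = emeasure lborel {y. (x, y) \<in> A}" for x
    using lpres_emeasure[OF lpres_translation[of "f x"] section_borel2[OF A, of x]] by (simp add: vimage_def)
  then show "emeasure lborel ((\<lambda>p. (fst p, snd p + f (fst p))) -` A) = emeasure lborel A"
    by (simp add: emeasure_lborel_prod(2)[OF A'] emeasure_lborel_prod(2)[OF A])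
qed

text \<open>Lebesgue measure is characterized by its values on boxes, and the identification of
  pairs with complex numbers matches boxes with boxes.\<close>

lemma distr_lborel_Complex:
  "distr lborel borel (\<lambda>p. Complex (fst p) (snd p)) = lborel"
proof (rule lborel_eqI[symmetric])
  have m: "(\<lambda>p. Complex (fst p) (snd p)) \<in> borel_measurable borel"
    by (intro borel_measurable_continuous_onI) (auto simp: Complex_eq intro!: continuous_intros)
  fix l u :: complex assume le: "\<And>b. b \<in> Basis \<Longrightarrow> l \<bullet> b \<le> u \<bullet> b"
  have le': "Re l \<le> Re u" "Im l \<le> Im u"
    using le[of 1] le[of \<i>] by (auto simp: Basis_complex_def inner_complex_def)
  have "(\<lambda>p. Complex (fst p) (snd p)) -` box l u = box (Re l, Im l) (Re u, Im u)"
    by (auto simp: box_def Basis_complex_def inner_complex_def Basis_prod_def)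
  then have "emeasure (distr lborel borel (\<lambda>p. Complex (fst p) (snd p))) (box l u) =
     emeasure lborel (box (Re l, Im l) (Re u, Im u))"
    using m by (subst emeasure_distr) auto
  also have "\<dots> = ennreal (\<Prod>b\<in>Basis. ((Re u, Im u) - (Re l, Im l)) \<bullet> b)"
    using le' by (intro emeasure_lborel_box) (auto simp: Basis_prod_def)
  also have "(\<Prod>b\<in>Basis. ((Re u, Im u) - (Re l, Im l)) \<bullet> b) = (Re u - Re l) * (Im u - Im l)"
    by (simp add: Basis_prod_def)
  also have "\<dots> = (\<Prod>b\<in>Basis. (u - l) \<bullet> b)"
    by (simp add: Basis_complex_def inner_complex_def)
  finally show "emeasure (distr lborel borel (\<lambda>p. Complex (fst p) (snd p))) (box l u) = (\<Prod>b\<in>Basis. (u - l) \<bullet> b)" .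
qed auto

lemma measurable_Complex: "(\<lambda>p. Complex (fst p) (snd p)) \<in> borel_measurable borel"
  by (intro borel_measurable_continuous_onI) (auto simp: Complex_eq intro!: continuous_intros)

lemma nn_integral_lborel_complex:
  assumes f[measurable]: "f \<in> borel_measurable borel"
  shows "(\<integral>\<^sup>+w. f w \<partial>lborel) = (\<integral>\<^sup>+x. \<integral>\<^sup>+y. f (Complex x y) \<partial>lborel \<partial>lborel)"
proof -
  have [measurable]: "(\<lambda>p. f (Complex (fst p) (snd p))) \<in> borel_measurable borel"
    by (rule measurable_compose[OF measurable_Complex f])
  have "(\<integral>\<^sup>+w. f w \<partial>lborel) = (\<integral>\<^sup>+w. f w \<partial>distr lborel borel (\<lambda>p. Complex (fst p) (snd p)))"
    by (simp add: distr_lborel_Complex)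
  also have "\<dots> = (\<integral>\<^sup>+p. f (Complex (fst p) (snd p)) \<partial>lborel)"
    by (rule nn_integral_distr) (auto simp: measurable_Complex)
  also have "\<dots> = (\<integral>\<^sup>+p. f (Complex (fst p) (snd p)) \<partial>(lborel \<Otimes>\<^sub>M lborel))"
    by (simp add: lborel_prod)
  also have "\<dots> = (\<integral>\<^sup>+x. \<integral>\<^sup>+y. f (Complex x y) \<partial>lborel \<partial>lborel)"
    by (subst lborel.nn_integral_fst[symmetric]) (auto simp: lborel_prod)
  finally show ?thesis .
qed

text \<open>Transports maps of the real plane to \<open>complex\<close>, where a row of a matrix is
  encoded.\<close>

lemma lpres_complex:
  assumes "lpres T" shows "lpres (\<lambda>w. (\<lambda>p. Complex (fst p) (snd p)) (T (Re w, Im w)))"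
  unfolding lpres_def
proof
  have [measurable]: "T \<in> borel_measurable borel" using assms by (simp add: lpres_def)
  have mr: "(\<lambda>w. (Re w, Im w)) \<in> borel_measurable borel"
    by (intro borel_measurable_continuous_onI) (auto intro!: continuous_intros)
  let ?C = "\<lambda>p. Complex (fst p) (snd p)"
  note measurable_Complex[measurable] mr[measurable]
  show m: "(\<lambda>w. ?C (T (Re w, Im w))) \<in> borel_measurable borel"
    by (intro measurable_compose[OF _ measurable_Complex] measurable_compose[OF mr]) auto
  have "distr lborel borel (\<lambda>w. ?C (T (Re w, Im w))) =
      distr (distr lborel borel ?C) borel (\<lambda>w. ?C (T (Re w, Im w)))"
    by (simp only: distr_lborel_Complex)
  also have "\<dots> = distr lborel borel ((\<lambda>w. ?C (T (Re w, Im w))) \<circ> ?C)"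
    using m by (intro distr_distr) (auto simp: measurable_Complex)
  also have "(\<lambda>w. ?C (T (Re w, Im w))) \<circ> ?C = ?C \<circ> T" by auto
  also have "distr lborel borel (?C \<circ> T) = distr (distr lborel borel T) borel ?C"
    by (rule distr_distr[symmetric]) (auto simp: measurable_Complex)
  also have "\<dots> = lborel" using assms by (simp add: lpres_def distr_lborel_Complex)
  finally show "distr lborel borel (\<lambda>w. ?C (T (Re w, Im w))) = lborel" .
qed

section \<open>Algebra of 2 by 2 matrices in complex coordinates\<close>

text \<open>
  The real matrix with rows \<open>(a, b)\<close> and \<open>(c, d)\<close> is encoded as the pair of complex numbers
  \<open>(b + \<i> a, d + \<i> c)\<close>: then the quotient of the two components is the image of \<open>\<i>\<close> under
  the Moebius transformation of the matrix.
\<close>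

type_synonym cmat = "complex \<times> complex"

definition pdet :: "cmat \<Rightarrow> real" where
  "pdet p = Im (fst p) * Re (snd p) - Re (fst p) * Im (snd p)"

definition pmul :: "cmat \<Rightarrow> cmat \<Rightarrow> cmat" (infixl "\<odot>" 70) where
  "x \<odot> g = (Im (fst x) *\<^sub>R fst g + Re (fst x) *\<^sub>R snd g, Im (snd x) *\<^sub>R fst g + Re (snd x) *\<^sub>R snd g)"

definition pid :: cmat where "pid = (\<i>, 1)"

text \<open>The adjugate divided by the determinant; a singular \<open>x\<close> yields 0.\<close>

definition pinv :: "cmat \<Rightarrow> cmat" where
  "pinv x = (1 / pdet x) *\<^sub>R (Complex (- Re (fst x)) (Re (snd x)), Complex (Im (fst x)) (- Im (snd x)))"

text \<open>The upper and, in the next line, the lower unipotent matrices. They generate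
  \<open>SL2R\<close>, and they are the directions that the geodesic flow contracts and
  expands.\<close>

definition shear_u :: "real \<Rightarrow> cmat" where "shear_u s = (Complex s 1, 1)"
definition shear_l :: "real \<Rightarrow> cmat" where "shear_l s = (\<i>, Complex 1 s)"

definition pt :: "cmat \<Rightarrow> complex" where "pt p = fst p / snd p"

definition PW :: "cmat set" where "PW = {p. 0 < pdet p}"

lemma cmat_eqI:
  "Re (fst p) = Re (fst q) \<Longrightarrow> Im (fst p) = Im (fst q) \<Longrightarrow> Re (snd p) = Re (snd q) \<Longrightarrow>
   Im (snd p) = Im (snd q) \<Longrightarrow> (p::cmat) = q"
  by (simp add: prod_eq_iff complex_eq_iff)

lemma pmul_simps [simp]:
  "Re (fst (x \<odot> g)) = Im (fst x) * Re (fst g) + Re (fst x) * Re (snd g)"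
  "Im (fst (x \<odot> g)) = Im (fst x) * Im (fst g) + Re (fst x) * Im (snd g)"
  "Re (snd (x \<odot> g)) = Im (snd x) * Re (fst g) + Re (snd x) * Re (snd g)"
  "Im (snd (x \<odot> g)) = Im (snd x) * Im (fst g) + Re (snd x) * Im (snd g)"
  by (simp_all add: pmul_def)

lemma pmul_assoc: "(x \<odot> y) \<odot> z = x \<odot> (y \<odot> z)"
  by (rule cmat_eqI) (simp_all add: algebra_simps)

lemma pid_simps[simp]: "fst pid = \<i>" "snd pid = 1"
  by (simp_all add: pid_def)

lemma pid_left[simp]: "pid \<odot> x = x" and pid_right[simp]: "x \<odot> pid = x"
  by (rule cmat_eqI; simp)+

lemma pdet_pid[simp]: "pdet pid = 1" by (simp add: pdet_def)

lemma pdet_mul[simp]: "pdet (x \<odot> y) = pdet x * pdet y"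
  by (simp add: pdet_def algebra_simps)

lemma pdet_scaleR[simp]: "pdet (r *\<^sub>R x) = r\<^sup>2 * pdet x"
  by (simp add: pdet_def algebra_simps power2_eq_square)

lemma pmul_scaleR_left: "(r *\<^sub>R x) \<odot> y = r *\<^sub>R (x \<odot> y)"
  and pmul_scaleR_right: "x \<odot> (r *\<^sub>R y) = r *\<^sub>R (x \<odot> y)"
  by (rule cmat_eqI; simp add: algebra_simps)+

lemma pmul_minus_left: "(- x) \<odot> y = - (x \<odot> y)"
  and pmul_minus_right: "x \<odot> (- y) = - (x \<odot> y)"
  by (rule cmat_eqI; simp)+

lemma pinv_left: "pdet x \<noteq> 0 \<Longrightarrow> pinv x \<odot> x = pid"
  and pinv_right: "pdet x \<noteq> 0 \<Longrightarrow> x \<odot> pinv x = pid"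
  by (rule cmat_eqI; simp add: pinv_def; simp add: field_simps; simp add: pdet_def algebra_simps)+

lemma pdet_pinv: "pdet (pinv x) = 1 / pdet x"
proof (cases "pdet x = 0")
  case True then show ?thesis by (simp add: pinv_def) (simp add: pdet_def)
next
  case False
  then have "pdet (pinv x) * pdet x = 1" using pinv_left[of x] pdet_mul[of "pinv x" x] by simp
  with False show ?thesis by (simp add: field_simps)
qed

lemma pmul_pinv_cancel[simp]:
  "pdet x \<noteq> 0 \<Longrightarrow> pinv x \<odot> (x \<odot> y) = y" "pdet x \<noteq> 0 \<Longrightarrow> x \<odot> (pinv x \<odot> y) = y"
  "pdet x \<noteq> 0 \<Longrightarrow> (y \<odot> x) \<odot> pinv x = y" "pdet x \<noteq> 0 \<Longrightarrow> (y \<odot> pinv x) \<odot> x = y"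
  by (simp_all add: pmul_assoc pinv_left pinv_right flip: pmul_assoc[of "pinv x" x] pmul_assoc[of x "pinv x"])

text \<open>The unipotent matrices generate the group of determinant 1: with lower left entry
  \<open>c \<noteq> 0\<close> three of them suffice, and \<open>c = 0\<close> is reduced to this
  case by one row operation. Measure invariance and ergodicity are both proved through this
  induction.\<close>

lemma pdet_SL_induct [consumes 1]:
  assumes det: "pdet x = 1"
    and mul: "\<And>x y. P x \<Longrightarrow> P y \<Longrightarrow> P (x \<odot> y)"
    and u: "\<And>s. P (shear_u s)" and l: "\<And>s. P (shear_l s)"
  shows "P x"
proof -
  have main: "P x" if "pdet x = 1" "Im (snd x) \<noteq> 0" for x
  proof -
    obtain a b c d where x: "x = (Complex b a, Complex d c)" by (metis complex_surj prod.exhaust)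
    have c: "c \<noteq> 0" and "a * d - b * c = 1" using that by (simp_all add: x pdet_def)
    then have b: "b = (a * d - 1) / c" by (simp add: field_simps)
    \<comment> \<open>In the product of three shears the diagonal entries are linear in the outer
      parameters, which are thereby read off from \<open>a\<close> and \<open>d\<close>.\<close>
    have "x = shear_u ((a - 1) / c) \<odot> shear_l c \<odot> shear_u ((d - 1) / c)"
      using c by (intro cmat_eqI) (simp_all add: x b shear_u_def shear_l_def field_simps)
    then show ?thesis using mul u l by metis
  qed
  show ?thesis
  proof (cases "Im (snd x) = 0")
    case True
    \<comment> \<open>With \<open>c = 0\<close> the entry \<open>a\<close> is nonzero, and adding
      the first row to the second makes \<open>a\<close> the lower left entry.\<close>
    with det have "Im (fst x) \<noteq> 0" by (auto simp: pdet_def)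
    then have "P (shear_l 1 \<odot> x)"
      using True det by (intro main) (simp_all add: shear_l_def, simp add: pdet_def)
    moreover have "x = shear_l (-1) \<odot> (shear_l 1 \<odot> x)"
      by (rule cmat_eqI) (simp_all add: shear_l_def)
    ultimately show ?thesis using mul l by metis
  qed (use det main in auto)
qed

text \<open>The generators add a multiple of one row to the other, which is a shear of
  \<open>cmat\<close>.\<close>

lemma lpres_left: "pdet x = 1 \<Longrightarrow> lpres (\<lambda>g. x \<odot> g)"
proof (induction rule: pdet_SL_induct)
  case (1 x y)
  then show ?case using lpres_comp[of "\<lambda>g. x \<odot> g" "\<lambda>g. y \<odot> g"] by (simp add: pmul_assoc)
next
  case (2 s)
  have "(\<lambda>g. shear_u s \<odot> g) = (\<lambda>p. (fst p + s *\<^sub>R snd p, snd p))"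
    by (rule ext, rule cmat_eqI) (simp_all add: shear_u_def)
  then show ?case using lpres_shear1[of "\<lambda>y::complex. s *\<^sub>R y"] by simp
next
  case (3 s)
  have "(\<lambda>g. shear_l s \<odot> g) = (\<lambda>p. (fst p, snd p + s *\<^sub>R fst p))"
    by (rule ext, rule cmat_eqI) (simp_all add: shear_l_def)
  then show ?case using lpres_shear2[of "\<lambda>y::complex. s *\<^sub>R y"] by simp
qed

text \<open>Right multiplication acts on the two rows separately; this is its action on one
  row.\<close>

definition rmul :: "cmat \<Rightarrow> complex \<Rightarrow> complex" where
  "rmul g w = Im w *\<^sub>R fst g + Re w *\<^sub>R snd g"

lemma pmul_rmul: "x \<odot> g = (rmul g (fst x), rmul g (snd x))"
  by (simp add: pmul_def rmul_def)

lemma rmul_rmul: "rmul h (rmul g w) = rmul (g \<odot> h) w"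
  by (simp add: complex_eq_iff rmul_def algebra_simps)

text \<open>Again only the generators matter; on a single row they are shears of the real
  plane.\<close>

lemma lpres_rmul: "pdet g = 1 \<Longrightarrow> lpres (rmul g)"
proof (induction rule: pdet_SL_induct)
  case (1 x y)
  then show ?case using lpres_comp[of "rmul y" "rmul x"] by (simp add: rmul_rmul)
next
  case (2 s)
  have "rmul (shear_u s) = (\<lambda>w. (\<lambda>p. Complex (fst p) (snd p)) ((\<lambda>p. (fst p + s *\<^sub>R snd p, snd p)) (Re w, Im w)))"
    by (rule ext) (simp add: rmul_def shear_u_def complex_eq_iff)
  then show ?case using lpres_complex[OF lpres_shear1[of "\<lambda>y::real. s *\<^sub>R y"]] by simp
next
  case (3 s)
  have "rmul (shear_l s) = (\<lambda>w. (\<lambda>p. Complex (fst p) (snd p)) ((\<lambda>p. (fst p, snd p + s *\<^sub>R fst p)) (Re w, Im w)))"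
    by (rule ext) (simp add: rmul_def shear_l_def complex_eq_iff)
  then show ?case using lpres_complex[OF lpres_shear2[of "\<lambda>y::real. s *\<^sub>R y"]] by simp
qed

lemma lpres_right: "pdet g = 1 \<Longrightarrow> lpres (\<lambda>x. x \<odot> g)"
  unfolding pmul_rmul by (intro lpres_prod lpres_rmul)

lemma continuous_on_pmul[continuous_intros]:
  "continuous_on S f \<Longrightarrow> continuous_on S g \<Longrightarrow> continuous_on S (\<lambda>x. f x \<odot> g x)"
  unfolding pmul_def by (intro continuous_intros)

lemma continuous_on_pdet[continuous_intros]:
  "continuous_on S f \<Longrightarrow> continuous_on S (\<lambda>x. pdet (f x))"
  unfolding pdet_def by (intro continuous_intros)

lemma open_PW: "open PW"
  unfolding PW_def by (intro open_Collect_less continuous_intros)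

lemma pt_simps: "Im (pt p) = pdet p / (cmod (snd p))\<^sup>2"
  "Re (pt p) = (Im (fst p) * Im (snd p) + Re (fst p) * Re (snd p)) / (cmod (snd p))\<^sup>2"
  unfolding pt_def Re_divide Im_divide cmod_power2 pdet_def by (simp_all add: algebra_simps)

lemma PW_snd: "p \<in> PW \<Longrightarrow> snd p \<noteq> 0"
  by (auto simp: PW_def pdet_def)

lemma PW_iff_pt: "p \<in> PW \<longleftrightarrow> Im (pt p) > 0"
  using PW_snd[of p] by (cases "snd p = 0") (auto simp: pt_simps PW_def zero_less_divide_iff)

lemma pt_scaleR[simp]: "r \<noteq> 0 \<Longrightarrow> pt (r *\<^sub>R p) = pt p"
  by (simp add: pt_def scaleR_conv_of_real)

section \<open>The flow box of geodesics crossing the imaginary axis\<close>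

lemma nn_integral_real_scale:
  fixes c :: real
  assumes "f \<in> borel_measurable borel" "c \<noteq> 0"
  shows "(\<integral>\<^sup>+x. f x \<partial>lborel) = ennreal \<bar>c\<bar> * (\<integral>\<^sup>+x. f (c * x) \<partial>lborel)"
  using nn_integral_real_affine[OF assms, of 0] by simp

lemma nn_integral_cong_nonzero:
  fixes f g :: "real \<Rightarrow> ennreal"
  assumes "\<And>x. x \<noteq> 0 \<Longrightarrow> f x = g x"
  shows "(\<integral>\<^sup>+x. f x \<partial>lborel) = (\<integral>\<^sup>+x. g x \<partial>lborel)"
  by (rule nn_integral_cong_AE, rule AE_mp[OF AE_lborel_singleton[of 0]]) (use assms in auto)

text \<open>\<open>dx / \<bar>x\<bar>\<close> is the Haar measure of the multiplicative group, hence the scale invariance.\<close>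

lemma nn_integral_mult_haar:
  fixes c :: real
  assumes [measurable]: "f \<in> borel_measurable borel" and c: "c \<noteq> 0"
  shows "(\<integral>\<^sup>+x. ennreal (1 / \<bar>x\<bar>) * f (c * x) \<partial>lborel) = (\<integral>\<^sup>+x. ennreal (1 / \<bar>x\<bar>) * f x \<partial>lborel)"
proof -
  have "(\<integral>\<^sup>+x. ennreal (1 / \<bar>x\<bar>) * f x \<partial>lborel)
      = ennreal \<bar>c\<bar> * (\<integral>\<^sup>+x. ennreal (1 / \<bar>c * x\<bar>) * f (c * x) \<partial>lborel)"
    using c by (subst nn_integral_real_scale[where c=c]) auto
  also have "\<dots> = (\<integral>\<^sup>+x. ennreal (1 / \<bar>x\<bar>) * f (c * x) \<partial>lborel)"
    using c by (subst nn_integral_cmult[symmetric], simp, intro nn_integral_cong)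
      (simp add: abs_mult mult.assoc[symmetric] flip: ennreal_mult)
  finally show ?thesis by simp
qed

lemma nn_integral_inverse_interval:
  fixes a b :: real
  assumes "0 < a" "a \<le> b"
  shows "(\<integral>\<^sup>+x. ennreal (1 / \<bar>x\<bar>) * indicator {a..<b} x \<partial>lborel) = ln (b / a)"
proof -
  have "(\<integral>\<^sup>+x. ennreal (1 / \<bar>x\<bar>) * indicator {a..<b} x \<partial>lborel) =
        (\<integral>\<^sup>+x. ennreal (1 / x) * indicator {a..b} x \<partial>lborel)"
    by (rule nn_integral_cong_AE, rule AE_mp[OF AE_lborel_singleton[of b]])
       (use assms in \<open>auto intro!: AE_I2 split: split_indicator\<close>)
  also have "\<dots> = ennreal (ln b - ln a)"
    by (rule nn_integral_FTC_Icc) (use assms in \<open>auto intro!: derivative_eq_intros\<close>)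
  finally show ?thesis using assms by (simp add: ln_div)
qed

text \<open>The set consists of an interval and its mirror image. By invariance of the Haar measure
  under -1 both contribute \<open>ln (sqrt B / sqrt A)\<close>, which is half of the total.\<close>

lemma nn_integral_inverse_squares:
  fixes A B :: real
  assumes A: "0 < A" "A \<le> B"
  shows "(\<integral>\<^sup>+x. ennreal (1 / \<bar>x\<bar>) * indicator {x. A \<le> x\<^sup>2 \<and> x\<^sup>2 < B} x \<partial>lborel) = ln (B / A)"
proof -
  have sq: "A \<le> x\<^sup>2 \<and> x\<^sup>2 < B \<longleftrightarrow> sqrt A \<le> \<bar>x\<bar> \<and> \<bar>x\<bar> < sqrt B" for x
    using A by (metis abs_ge_zero power2_abs real_less_rsqrt real_sqrt_abs real_sqrt_le_iff real_sqrt_less_iff)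
  let ?I = "\<lambda>x. indicator {sqrt A..<sqrt B} x :: ennreal"
  have "(\<integral>\<^sup>+x. ennreal (1 / \<bar>x\<bar>) * indicator {x. A \<le> x\<^sup>2 \<and> x\<^sup>2 < B} x \<partial>lborel) =
    (\<integral>\<^sup>+x. ennreal (1 / \<bar>x\<bar>) * ?I x + ennreal (1 / \<bar>x\<bar>) * ?I ((-1) * x) \<partial>lborel)"
  proof (rule nn_integral_cong)
    fix x :: real
    obtain r s where rs: "r = sqrt A" "s = sqrt B" and "0 < r" using A by simp
    then show "ennreal (1 / \<bar>x\<bar>) * indicator {x. A \<le> x\<^sup>2 \<and> x\<^sup>2 < B} x =
        ennreal (1 / \<bar>x\<bar>) * ?I x + ennreal (1 / \<bar>x\<bar>) * ?I ((-1) * x)"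
      unfolding sq mem_Collect_eq indicator_def rs[symmetric] by (auto simp: abs_if)
  qed
  also have "\<dots> = (\<integral>\<^sup>+x. ennreal (1 / \<bar>x\<bar>) * ?I x \<partial>lborel) + (\<integral>\<^sup>+x. ennreal (1 / \<bar>x\<bar>) * ?I ((-1) * x) \<partial>lborel)"
    by (rule nn_integral_add) auto
  also have "(\<integral>\<^sup>+x. ennreal (1 / \<bar>x\<bar>) * ?I ((-1) * x) \<partial>lborel) = (\<integral>\<^sup>+x. ennreal (1 / \<bar>x\<bar>) * ?I x \<partial>lborel)"
    by (rule nn_integral_mult_haar) auto
  also have "(\<integral>\<^sup>+x. ennreal (1 / \<bar>x\<bar>) * ?I x \<partial>lborel) = ln (sqrt B / sqrt A)"
    using A by (intro nn_integral_inverse_interval) auto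
  also have "ln (sqrt B / sqrt A) = ln (B / A) / 2"
    using A by (simp add: ln_sqrt flip: real_sqrt_divide)
  also have "ennreal (ln (B / A) / 2) + ennreal (ln (B / A) / 2) = ln (B / A)"
    using A by (subst ennreal_plus[symmetric]) auto
  finally show ?thesis .
qed

text \<open>The range of the two summands \<open>D = a * d\<close> and \<open>E = - b * c\<close> of
  the determinant, when both are positive and the determinant is below 1.\<close>

lemma emeasure_triangle:
  "(\<integral>\<^sup>+E. \<integral>\<^sup>+D. indicator {p::real\<times>real. 0 < fst p \<and> 0 < snd p \<and> fst p + snd p < 1} (D, E) \<partial>lborel \<partial>lborel) = ennreal (1/2)"
proof -
  have "(\<integral>\<^sup>+D. indicator {p::real\<times>real. 0 < fst p \<and> 0 < snd p \<and> fst p + snd p < 1} (D, E) \<partial>lborel)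
     = ennreal (1 - E) * indicator {0..1} E" if "E \<noteq> 0" for E :: real
  proof -
    have "(\<integral>\<^sup>+D. indicator {p::real\<times>real. 0 < fst p \<and> 0 < snd p \<and> fst p + snd p < 1} (D, E) \<partial>lborel)
     = (\<integral>\<^sup>+D. indicator {0<..<1-E} D * indicator {0..1} E \<partial>lborel)"
      using that by (intro nn_integral_cong) (auto split: split_indicator)
    also have "\<dots> = emeasure lborel {0<..<1-E} * indicator {0..1} E"
      by (subst nn_integral_multc) auto
    also have "\<dots> = ennreal (1 - E) * indicator {0..1} E"
      by (auto split: split_indicator)
    finally show ?thesis .
  qed
  then have "(\<integral>\<^sup>+E. \<integral>\<^sup>+D. indicator {p::real\<times>real. 0 < fst p \<and> 0 < snd p \<and> fst p + snd p < 1} (D, E) \<partial>lborel \<partial>lborel)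
     = (\<integral>\<^sup>+E. ennreal (1 - E) * indicator {0..1} E \<partial>lborel)"
    by (intro nn_integral_cong_nonzero)
  also have "\<dots> = ennreal ((1 - 1^2/2) - (0 - 0^2/2))"
    by (rule nn_integral_FTC_Icc[where F="\<lambda>E. E - E^2/2"]) (auto intro!: derivative_eq_intros)
  finally show ?thesis by simp
qed

text \<open>
  If \<open>crosses p\<close>, then \<open>t = cross_time p\<close> is the only time at which the geodesic with initial
  vector \<open>p\<close> meets the imaginary axis, and it does so at the point \<open>\<i> * exp (cross_pos p)\<close>.
\<close>

definition cross_time :: "cmat \<Rightarrow> real" where
  "cross_time p = ln (- (Re (fst p) * Re (snd p)) / (Im (fst p) * Im (snd p))) / 2"
definition cross_pos :: "cmat \<Rightarrow> real" where
  "cross_pos p = ln (- (Im (fst p) * Re (fst p)) / (Im (snd p) * Re (snd p))) / 2"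
definition crosses :: "cmat \<Rightarrow> bool" where
  "crosses p \<longleftrightarrow> (Im (fst p) * Im (snd p)) * (Re (fst p) * Re (snd p)) < 0"

text \<open>The flow box over the segment of the imaginary axis from \<open>\<i>\<close> to
  \<open>\<i> * exp l\<close>. It is half-open in time, so that unit time windows tile the ray, and
  half-open in position, so that one period of a closed geodesic is covered exactly once.\<close>

definition cross_box :: "real \<Rightarrow> cmat set" where
  "cross_box l = {p \<in> PW. crosses p \<and> 0 < cross_time p \<and> cross_time p \<le> 1 \<and> 0 \<le> cross_pos p \<and> cross_pos p < l}"

text \<open>In the coordinates \<open>a\<close>, \<open>b\<close>, \<open>D = a * d\<close>,
  \<open>E = - b * c\<close> the determinant is \<open>D + E\<close>, a crossing means that
  \<open>D\<close> and \<open>E\<close> have the same sign, the position constrains only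
  \<open>(a * b)\<^sup>2\<close>, and the time constrains \<open>a\<^sup>2\<close> once
  \<open>a * b\<close> is fixed. This separates the variables for the volume computation.\<close>

lemma cross_box_param:
  assumes l: "l > 0" and a: "a \<noteq> 0" and b: "b \<noteq> 0"
  shows "(Complex b a, Complex (D / a) (- E / b)) \<in> cross_box l \<and> pdet (Complex b a, Complex (D / a) (- E / b)) < 1 \<longleftrightarrow>
    0 < D \<and> 0 < E \<and> D + E < 1 \<and>
    D * E \<le> (a * b)\<^sup>2 \<and> (a * b)\<^sup>2 < exp (2 * l) * (D * E) \<and>
    sqrt ((a * b)\<^sup>2 * D / E) / exp 1 \<le> a\<^sup>2 \<and> a\<^sup>2 < sqrt ((a * b)\<^sup>2 * D / E)" (is "?L \<longleftrightarrow> ?R")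
proof -
  have det: "pdet (Complex b a, Complex (D / a) (- E / b)) = D + E"
    using a b by (simp add: pdet_def)
  have cr: "crosses (Complex b a, Complex (D / a) (- E / b)) \<longleftrightarrow> D * E > 0"
    using a b by (simp add: crosses_def mult.commute)
  show ?thesis
  proof (cases "D > 0 \<and> E > 0")
    case False
    then show ?thesis unfolding cross_box_def
      using det cr by (auto simp: PW_def zero_less_mult_iff)
  next
    case True
    then have D: "D > 0" and E: "E > 0" by auto
    let ?p = "(Complex b a, Complex (D / a) (- E / b))"
    have ct: "cross_time ?p = ln (b\<^sup>2 * D / (a\<^sup>2 * E)) / 2"
      using a b E by (simp add: cross_time_def power2_eq_square field_simps)
    have cp: "cross_pos ?p = ln ((a * b)\<^sup>2 / (D * E)) / 2"
      using a b E D by (simp add: cross_pos_def power2_eq_square field_simps)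
    have X: "b\<^sup>2 * D / (a\<^sup>2 * E) > 0" and Y: "(a * b)\<^sup>2 / (D * E) > 0" using a b D E by auto
    \<comment> \<open>Up to sign \<open>a * b\<close> is all that enters \<open>?k\<close> besides
      \<open>D\<close> and \<open>E\<close>, and \<open>cross_time\<close> equals
      \<open>ln (?k / a\<^sup>2)\<close>.\<close>
    let ?k = "sqrt ((a * b)\<^sup>2 * D / E)"
    have k: "?k > 0" using a b D E by auto
    have k2: "?k\<^sup>2 = (a * b)\<^sup>2 * D / E" using a b D E by simp
    have keq: "b\<^sup>2 * D / (a\<^sup>2 * E) = (?k / a\<^sup>2)\<^sup>2"
      using a b D E unfolding power_divide k2 by (simp add: field_simps power2_eq_square)
    have ct': "cross_time ?p = ln (?k / a\<^sup>2)"
      unfolding ct keq using k a by (subst ln_realpow) auto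
    have 1: "0 < cross_time ?p \<longleftrightarrow> a\<^sup>2 < ?k"
      unfolding ct' using k a by (subst ln_gt_zero_iff) auto
    have 2: "cross_time ?p \<le> 1 \<longleftrightarrow> ?k / exp 1 \<le> a\<^sup>2"
    proof -
      have "cross_time ?p \<le> 1 \<longleftrightarrow> ln (?k / a\<^sup>2) \<le> ln (exp 1)" unfolding ct' by simp
      also have "\<dots> \<longleftrightarrow> ?k / a\<^sup>2 \<le> exp 1" using k a by (subst ln_le_cancel_iff) auto
      also have "\<dots> \<longleftrightarrow> ?k / exp 1 \<le> a\<^sup>2" using a by (simp add: field_simps)
      finally show ?thesis .
    qed
    have 3: "0 \<le> cross_pos ?p \<longleftrightarrow> D * E \<le> (a * b)\<^sup>2"
      unfolding cp using Y D E by (simp add: ln_ge_zero_iff field_simps)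
    have 4: "cross_pos ?p < l \<longleftrightarrow> (a * b)\<^sup>2 < exp (2 * l) * (D * E)"
    proof -
      have "cross_pos ?p < l \<longleftrightarrow> ln ((a * b)\<^sup>2 / (D * E)) < ln (exp (2 * l))" unfolding cp by auto
      also have "\<dots> \<longleftrightarrow> (a * b)\<^sup>2 / (D * E) < exp (2 * l)" using Y by (subst ln_less_cancel_iff) auto
      also have "\<dots> \<longleftrightarrow> (a * b)\<^sup>2 < exp (2 * l) * (D * E)" using D E by (simp add: field_simps)
      finally show ?thesis .
    qed
    show ?thesis unfolding cross_box_def using D E det cr 1 2 3 4 by (auto simp: PW_def)
  qed
qed

lemma borel_cross_box[measurable]: "cross_box l \<in> sets borel"
proof -
  have [measurable]: "(\<lambda>p::cmat. Re (fst p)) \<in> borel_measurable borel" "(\<lambda>p::cmat. Im (fst p)) \<in> borel_measurable borel"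
    "(\<lambda>p::cmat. Re (snd p)) \<in> borel_measurable borel" "(\<lambda>p::cmat. Im (snd p)) \<in> borel_measurable borel"
    by (intro borel_measurable_continuous_onI continuous_intros)+
  have "Measurable.pred borel (\<lambda>p. p \<in> cross_box l)"
    unfolding cross_box_def cross_time_def cross_pos_def crosses_def PW_def pdet_def mem_Collect_eq by measurable
  then show ?thesis by (simp add: pred_def)
qed

lemma nn_integral_lborel_cmat:
  assumes f[measurable]: "f \<in> borel_measurable borel"
  shows "(\<integral>\<^sup>+p. f p \<partial>lborel) = (\<integral>\<^sup>+w. \<integral>\<^sup>+v. f (w, v) \<partial>lborel \<partial>(lborel :: complex measure))"
proof -
  have "(\<integral>\<^sup>+p. f p \<partial>lborel) = (\<integral>\<^sup>+p. f p \<partial>(lborel \<Otimes>\<^sub>M lborel))"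
    by (simp add: lborel_prod)
  also have "\<dots> = (\<integral>\<^sup>+w. \<integral>\<^sup>+v. f (w, v) \<partial>lborel \<partial>lborel)"
    by (subst lborel.nn_integral_fst[symmetric]) (auto simp: lborel_prod)
  finally show ?thesis .
qed

text \<open>Replacing \<open>d\<close> and \<open>c\<close> by \<open>D\<close> and \<open>E\<close>
  produces the density \<open>1 / (\<bar>a\<bar> * \<bar>b\<bar>)\<close>, and replacing
  \<open>b\<close> by \<open>u = a * b\<close> leaves a product of Haar measures. The time window
  contributes \<open>ln (exp 1) = 1\<close>, the position window \<open>2 * l\<close>, the triangle
  of admissible \<open>(D, E)\<close> the area 1/2.\<close>

lemma emeasure_cross_box:
  assumes l: "l > 0"
  shows "emeasure lborel (cross_box l \<inter> {p. pdet p < 1}) = ennreal l"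
proof -
  let ?B = "cross_box l \<inter> {p. pdet p < 1}"
  have pd[measurable]: "pdet \<in> borel_measurable borel"
    by (intro borel_measurable_continuous_onI continuous_intros)
  have B[measurable]: "?B \<in> sets borel" by measurable
  let ?f = "\<lambda>b a d c. indicator ?B (Complex b a, Complex d c) :: ennreal"
  have fm: "(\<lambda>(b, a, d, c). ?f b a d c) \<in> borel_measurable (borel :: (real \<times> real \<times> real \<times> real) measure)"
  proof -
    have "(\<lambda>q::real\<times>real\<times>real\<times>real. (Complex (fst q) (fst (snd q)), Complex (fst (snd (snd q))) (snd (snd (snd q))))) \<in> borel_measurable borel"
      by (intro borel_measurable_continuous_onI) (auto simp: Complex_eq intro!: continuous_intros)
    from measurable_compose[OF this borel_measurable_indicator[OF B]] show ?thesis
      by (simp add: case_prod_unfold)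
  qed
  have fm1[measurable]: "(\<lambda>x. ?f (B x) (A x) (D x) (C x)) \<in> borel_measurable M"
    if [measurable]: "B \<in> borel_measurable M" "A \<in> borel_measurable M" "D \<in> borel_measurable M" "C \<in> borel_measurable M"
    for A B C D and M :: "'z measure"
    using measurable_compose[OF _ fm, of "\<lambda>x. (B x, A x, D x, C x)" M] by simp
  define tri where "tri = {p::real\<times>real. 0 < fst p \<and> 0 < snd p \<and> fst p + snd p < 1}"
  have tri[measurable]: "tri \<in> sets borel"
  proof -
    have "open tri" unfolding tri_def by (intro open_Collect_conj open_Collect_less continuous_intros)
    then show ?thesis by simp
  qed
  define P where "P D E a u \<longleftrightarrow> sqrt (u\<^sup>2 * D / E) / exp 1 \<le> a\<^sup>2 \<and> a\<^sup>2 < sqrt (u\<^sup>2 * D / E)" for D E a u :: real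
  define Q where "Q D E u \<longleftrightarrow> D * E \<le> u\<^sup>2 \<and> u\<^sup>2 < exp (2 * l) * (D * E)" for D E u :: real
  have PQ: "?f b a (D / a) (- E / b) = indicator tri (D, E) * (of_bool (Q D E (a * b)) * of_bool (P D E a (a * b)))"
    if "a \<noteq> 0" "b \<noteq> 0" for a b D E
    using cross_box_param[OF l that, of D E] unfolding P_def Q_def tri_def
    by (auto simp: indicator_def)
  have [measurable]: "(\<lambda>x. of_bool (Q (D x) (E x) (u x)) :: ennreal) \<in> borel_measurable M"
    if [measurable]: "D \<in> borel_measurable M" "E \<in> borel_measurable M" "u \<in> borel_measurable M" for D E u and M :: "'z measure"
    unfolding Q_def of_bool_def by measurable
  have [measurable]: "(\<lambda>x. of_bool (P (D x) (E x) (a x) (u x)) :: ennreal) \<in> borel_measurable M"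
    if [measurable]: "D \<in> borel_measurable M" "E \<in> borel_measurable M" "a \<in> borel_measurable M" "u \<in> borel_measurable M" for D E a u and M :: "'z measure"
    unfolding P_def of_bool_def by measurable
  have [measurable]: "(\<lambda>x. indicator tri (D x, E x) :: ennreal) \<in> borel_measurable M"
    if [measurable]: "D \<in> borel_measurable M" "E \<in> borel_measurable M" for D E and M :: "'z measure"
    using measurable_compose[OF _ borel_measurable_indicator[OF tri], of "\<lambda>x. (D x, E x)" M] by simp
  let ?g = "\<lambda>D E a b. indicator tri (D, E) * (of_bool (Q D E (a * b)) * of_bool (P D E a (a * b))) :: ennreal"
  \<comment> \<open>The substitutions \<open>d = D / a\<close> and \<open>c = - E / b\<close> in the
    second row.\<close>
  have inner: "(\<integral>\<^sup>+d. \<integral>\<^sup>+c. ?f b a d c \<partial>lborel \<partial>lborel) =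
     ennreal (1 / \<bar>a\<bar>) * (ennreal (1 / \<bar>b\<bar>) * (\<integral>\<^sup>+D. \<integral>\<^sup>+E. ?g D E a b \<partial>lborel \<partial>lborel))"
    if a: "a \<noteq> 0" and b: "b \<noteq> 0" for a b
  proof -
    have "(\<integral>\<^sup>+d. \<integral>\<^sup>+c. ?f b a d c \<partial>lborel \<partial>lborel) =
      (\<integral>\<^sup>+d. ennreal (1 / \<bar>b\<bar>) * (\<integral>\<^sup>+E. ?f b a d (- E / b) \<partial>lborel) \<partial>lborel)"
      using b by (subst nn_integral_real_scale[where c="-1/b" and f="\<lambda>c. ?f b a d c" for d]) (auto simp: abs_divide)
    also have "\<dots> = ennreal (1 / \<bar>b\<bar>) * (\<integral>\<^sup>+d. \<integral>\<^sup>+E. ?f b a d (- E / b) \<partial>lborel \<partial>lborel)"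
      by (rule nn_integral_cmult) measurable
    also have "(\<integral>\<^sup>+d. \<integral>\<^sup>+E. ?f b a d (- E / b) \<partial>lborel \<partial>lborel) =
      ennreal \<bar>1 / a\<bar> * (\<integral>\<^sup>+D. \<integral>\<^sup>+E. ?f b a ((1 / a) * D) (- E / b) \<partial>lborel \<partial>lborel)"
      using a by (intro nn_integral_real_scale) auto
    finally show ?thesis using PQ[OF a b] by (simp add: abs_divide mult_ac)
  qed
  have "emeasure lborel ?B = (\<integral>\<^sup>+p. indicator ?B p \<partial>lborel)" by simp
  also have "\<dots> = (\<integral>\<^sup>+w. \<integral>\<^sup>+v. indicator ?B (w, v) \<partial>lborel \<partial>(lborel :: complex measure))"
    by (rule nn_integral_lborel_cmat) auto
  also have "\<dots> = (\<integral>\<^sup>+w. \<integral>\<^sup>+d. \<integral>\<^sup>+c. indicator ?B (w, Complex d c) \<partial>lborel \<partial>lborel \<partial>(lborel :: complex measure))"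
  proof (intro nn_integral_cong nn_integral_lborel_complex)
    fix w :: complex
    have "(\<lambda>v::complex. (w, v)) \<in> borel_measurable borel" by (intro borel_measurable_continuous_onI continuous_intros)
    from measurable_compose[OF this borel_measurable_indicator[OF B]]
    show "(\<lambda>v. indicator ?B (w, v)) \<in> borel_measurable borel" .
  qed
  also have "\<dots> = (\<integral>\<^sup>+b. \<integral>\<^sup>+a. \<integral>\<^sup>+d. \<integral>\<^sup>+c. ?f b a d c \<partial>lborel \<partial>lborel \<partial>lborel \<partial>lborel)"
  proof (rule nn_integral_lborel_complex)
    have "(\<lambda>q::complex\<times>real\<times>real. (fst q, Complex (fst (snd q)) (snd (snd q)))) \<in> borel_measurable borel"
      by (intro borel_measurable_continuous_onI) (auto simp: Complex_eq intro!: continuous_intros)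
    from measurable_compose[OF this borel_measurable_indicator[OF B]]
    have m: "(\<lambda>(w, d, c). indicator ?B (w, Complex d c) :: ennreal) \<in> borel_measurable (borel :: (complex \<times> real \<times> real) measure)"
      by (simp add: case_prod_unfold)
    have [measurable]: "(\<lambda>x. indicator ?B (W x, Complex (D x) (C x)) :: ennreal) \<in> borel_measurable M"
      if [measurable]: "W \<in> borel_measurable M" "D \<in> borel_measurable M" "C \<in> borel_measurable M" for W D C and M :: "'z measure"
      using measurable_compose[OF _ m, of "\<lambda>x. (W x, D x, C x)" M] by simp
    show "(\<lambda>w. \<integral>\<^sup>+d. \<integral>\<^sup>+c. indicator ?B (w, Complex d c) \<partial>lborel \<partial>lborel) \<in> borel_measurable (borel :: complex measure)"
      by measurable
  qed
  also have "\<dots> = (\<integral>\<^sup>+b. \<integral>\<^sup>+a. ennreal (1 / \<bar>a\<bar>) * (ennreal (1 / \<bar>b\<bar>) * (\<integral>\<^sup>+D. \<integral>\<^sup>+E. ?g D E a b \<partial>lborel \<partial>lborel)) \<partial>lborel \<partial>lborel)"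
    by (intro nn_integral_cong_nonzero inner)
  also have "\<dots> = (\<integral>\<^sup>+b. \<integral>\<^sup>+a. \<integral>\<^sup>+D. \<integral>\<^sup>+E. ennreal (1 / \<bar>a\<bar>) * (ennreal (1 / \<bar>b\<bar>) * ?g D E a b) \<partial>lborel \<partial>lborel \<partial>lborel \<partial>lborel)"
    by (simp add: nn_integral_cmult)
  \<comment> \<open>The integrals are interchanged until \<open>D\<close> and \<open>E\<close> are
    outermost.\<close>
  also have "\<dots> = (\<integral>\<^sup>+b. \<integral>\<^sup>+D. \<integral>\<^sup>+a. \<integral>\<^sup>+E. ennreal (1 / \<bar>a\<bar>) * (ennreal (1 / \<bar>b\<bar>) * ?g D E a b) \<partial>lborel \<partial>lborel \<partial>lborel \<partial>lborel)"
    by (intro nn_integral_cong lborel_pair.Fubini') measurable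
  also have "\<dots> = (\<integral>\<^sup>+D. \<integral>\<^sup>+b. \<integral>\<^sup>+a. \<integral>\<^sup>+E. ennreal (1 / \<bar>a\<bar>) * (ennreal (1 / \<bar>b\<bar>) * ?g D E a b) \<partial>lborel \<partial>lborel \<partial>lborel \<partial>lborel)"
    by (intro lborel_pair.Fubini') measurable
  also have "\<dots> = (\<integral>\<^sup>+D. \<integral>\<^sup>+b. \<integral>\<^sup>+E. \<integral>\<^sup>+a. ennreal (1 / \<bar>a\<bar>) * (ennreal (1 / \<bar>b\<bar>) * ?g D E a b) \<partial>lborel \<partial>lborel \<partial>lborel \<partial>lborel)"
    by (intro nn_integral_cong lborel_pair.Fubini') measurable
  also have "\<dots> = (\<integral>\<^sup>+D. \<integral>\<^sup>+E. \<integral>\<^sup>+b. \<integral>\<^sup>+a. ennreal (1 / \<bar>a\<bar>) * (ennreal (1 / \<bar>b\<bar>) * ?g D E a b) \<partial>lborel \<partial>lborel \<partial>lborel \<partial>lborel)"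
    by (intro nn_integral_cong lborel_pair.Fubini') measurable
  also have "\<dots> = (\<integral>\<^sup>+D. \<integral>\<^sup>+E. \<integral>\<^sup>+a. \<integral>\<^sup>+b. ennreal (1 / \<bar>a\<bar>) * (ennreal (1 / \<bar>b\<bar>) * ?g D E a b) \<partial>lborel \<partial>lborel \<partial>lborel \<partial>lborel)"
    by (intro nn_integral_cong lborel_pair.Fubini') measurable
  also have "\<dots> = (\<integral>\<^sup>+D. \<integral>\<^sup>+E. indicator tri (D, E) * ennreal (2 * l) \<partial>lborel \<partial>lborel)"
  proof (intro nn_integral_cong)
    fix D E :: real
    show "(\<integral>\<^sup>+a. \<integral>\<^sup>+b. ennreal (1 / \<bar>a\<bar>) * (ennreal (1 / \<bar>b\<bar>) * ?g D E a b) \<partial>lborel \<partial>lborel) = indicator tri (D, E) * ennreal (2 * l)"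
    proof (cases "(D, E) \<in> tri")
      case False then show ?thesis by simp
    next
      case True
      then have D: "D > 0" and E: "E > 0" by (auto simp: tri_def)
      have "(\<integral>\<^sup>+a. \<integral>\<^sup>+b. ennreal (1 / \<bar>a\<bar>) * (ennreal (1 / \<bar>b\<bar>) * ?g D E a b) \<partial>lborel \<partial>lborel) =
        (\<integral>\<^sup>+a. ennreal (1 / \<bar>a\<bar>) * (\<integral>\<^sup>+b. ennreal (1 / \<bar>b\<bar>) * (of_bool (Q D E (a * b)) * of_bool (P D E a (a * b))) \<partial>lborel) \<partial>lborel)"
        using True by (simp add: nn_integral_cmult)
      \<comment> \<open>The substitution \<open>u = a * b\<close> for fixed \<open>a\<close> costs
        no factor, by invariance of the Haar measure.\<close>
      also have "\<dots> = (\<integral>\<^sup>+a. ennreal (1 / \<bar>a\<bar>) * (\<integral>\<^sup>+u. ennreal (1 / \<bar>u\<bar>) * (of_bool (Q D E u) * of_bool (P D E a u)) \<partial>lborel) \<partial>lborel)"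
      proof (rule nn_integral_cong_nonzero)
        fix a :: real assume "a \<noteq> 0"
        then show "ennreal (1 / \<bar>a\<bar>) * (\<integral>\<^sup>+b. ennreal (1 / \<bar>b\<bar>) * (of_bool (Q D E (a * b)) * of_bool (P D E a (a * b))) \<partial>lborel) =
          ennreal (1 / \<bar>a\<bar>) * (\<integral>\<^sup>+u. ennreal (1 / \<bar>u\<bar>) * (of_bool (Q D E u) * of_bool (P D E a u)) \<partial>lborel)"
          by (subst nn_integral_mult_haar[where f="\<lambda>u. of_bool (Q D E u) * of_bool (P D E a u)"]) auto
      qed
      also have "\<dots> = (\<integral>\<^sup>+a. \<integral>\<^sup>+u. ennreal (1 / \<bar>a\<bar>) * (ennreal (1 / \<bar>u\<bar>) * (of_bool (Q D E u) * of_bool (P D E a u))) \<partial>lborel \<partial>lborel)"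
        by (simp add: nn_integral_cmult)
      also have "\<dots> = (\<integral>\<^sup>+u. \<integral>\<^sup>+a. ennreal (1 / \<bar>a\<bar>) * (ennreal (1 / \<bar>u\<bar>) * (of_bool (Q D E u) * of_bool (P D E a u))) \<partial>lborel \<partial>lborel)"
        by (intro lborel_pair.Fubini') measurable
      also have "\<dots> = (\<integral>\<^sup>+u. ennreal (1 / \<bar>u\<bar>) * of_bool (Q D E u) * (\<integral>\<^sup>+a. ennreal (1 / \<bar>a\<bar>) * of_bool (P D E a u) \<partial>lborel) \<partial>lborel)"
        by (subst nn_integral_cmult[symmetric]) (auto simp: mult_ac)
      also have "\<dots> = (\<integral>\<^sup>+u. ennreal (1 / \<bar>u\<bar>) * indicator {x. D * E \<le> x\<^sup>2 \<and> x\<^sup>2 < exp (2 * l) * (D * E)} u \<partial>lborel)"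
      proof (rule nn_integral_cong_nonzero)
        fix u :: real assume u: "u \<noteq> 0"
        let ?k = "sqrt (u\<^sup>2 * D / E)"
        have k: "?k > 0" using u D E by auto
        have "(\<integral>\<^sup>+a. ennreal (1 / \<bar>a\<bar>) * of_bool (P D E a u) \<partial>lborel) =
          (\<integral>\<^sup>+a. ennreal (1 / \<bar>a\<bar>) * indicator {x. ?k / exp 1 \<le> x\<^sup>2 \<and> x\<^sup>2 < ?k} a \<partial>lborel)"
          by (intro nn_integral_cong) (auto simp: P_def indicator_def)
        \<comment> \<open>The end points of the window for \<open>a\<^sup>2\<close> have ratio
          \<open>exp 1\<close> whatever \<open>u\<close>, \<open>D\<close> and \<open>E\<close>
          are.\<close>
        also have "\<dots> = ln (?k / (?k / exp 1))"
          using k by (intro nn_integral_inverse_squares) (auto simp: field_simps)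
        also have "?k / (?k / exp 1) = exp 1"
          using k by (metis divide_divide_eq_right less_irrefl nonzero_mult_div_cancel_left)
        finally show "ennreal (1 / \<bar>u\<bar>) * of_bool (Q D E u) * (\<integral>\<^sup>+a. ennreal (1 / \<bar>a\<bar>) * of_bool (P D E a u) \<partial>lborel) =
          ennreal (1 / \<bar>u\<bar>) * indicator {x. D * E \<le> x\<^sup>2 \<and> x\<^sup>2 < exp (2 * l) * (D * E)} u"
          by (auto simp: Q_def indicator_def)
      qed
      also have "\<dots> = ln (exp (2 * l) * (D * E) / (D * E))"
        using D E l by (intro nn_integral_inverse_squares) auto
      also have "exp (2 * l) * (D * E) / (D * E) = exp (2 * l)" using D E by simp
      finally show ?thesis using True by simp
    qed
  qed
  also have "\<dots> = (\<integral>\<^sup>+D. \<integral>\<^sup>+E. indicator tri (D, E) \<partial>lborel \<partial>lborel) * ennreal (2 * l)"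
    by (subst nn_integral_multc[symmetric]) (auto simp: nn_integral_multc)
  also have "(\<integral>\<^sup>+D. \<integral>\<^sup>+E. indicator tri (D, E) \<partial>lborel \<partial>lborel) = (\<integral>\<^sup>+E. \<integral>\<^sup>+D. indicator tri (D, E) \<partial>lborel \<partial>lborel :: ennreal)"
    by (intro lborel_pair.Fubini') measurable
  also have "\<dots> = ennreal (1/2)" using emeasure_triangle unfolding tri_def .
  also have "ennreal (1/2) * ennreal (2 * l) = ennreal l"
    using l by (subst ennreal_mult[symmetric]) auto
  finally show ?thesis .
qed

section \<open>The measure on the unit tangent bundle\<close>

text \<open>The image of the upward unit vector at \<open>\<i>\<close>: the derivative of the
  Moebius transformation there is the determinant divided by \<open>(snd p)\<^sup>2\<close>, and
  only its direction is kept.\<close>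

definition tang :: "cmat \<Rightarrow> complex \<times> complex" where
  "tang p = (pt p, \<i> / (sgn (snd p))\<^sup>2)"

lemma nn_integral_scaleR:
  fixes f :: "'a::euclidean_space \<Rightarrow> ennreal"
  assumes [measurable]: "f \<in> borel_measurable borel" and c: "c \<noteq> 0"
  shows "(\<integral>\<^sup>+x. f x \<partial>lborel) = ennreal (\<bar>c\<bar> ^ DIM('a)) * (\<integral>\<^sup>+x. f (c *\<^sub>R x) \<partial>lborel)"
  by (subst lborel_affine[OF c, of 0])
     (simp add: nn_integral_density nn_integral_distr nn_integral_cmult)

text \<open>Multiplication by \<open>c\<close> is a rotation followed by a real dilation; the
  rotation is the action on rows of a matrix of determinant 1.\<close>

lemma nn_integral_complex_mult:
  fixes c :: complex
  assumes f[measurable]: "f \<in> borel_measurable borel" and c: "c \<noteq> 0"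
  shows "(\<integral>\<^sup>+w. f w \<partial>lborel) = ennreal ((cmod c)\<^sup>2) * (\<integral>\<^sup>+w. f (c * w) \<partial>lborel)"
proof -
  let ?e = "sgn c"
  have n: "cmod ?e = 1" using c by (simp add: norm_sgn)
  have "pdet (?e * \<i>, ?e) = (cmod ?e)\<^sup>2"
    by (simp only: cmod_power2) (simp add: pdet_def power2_eq_square)
  then have "lpres (rmul (?e * \<i>, ?e))" using n by (intro lpres_rmul) simp
  moreover have "rmul (?e * \<i>, ?e) = (\<lambda>w. ?e * w)"
    by (rule ext) (simp add: rmul_def complex_eq_iff mult.commute)
  ultimately have rot: "lpres (\<lambda>w. ?e * w)" by simp
  have [measurable]: "(\<lambda>w. f (cmod c *\<^sub>R w)) \<in> borel_measurable borel"
    by (rule measurable_compose[OF _ f]) simp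
  have "(\<integral>\<^sup>+w. f w \<partial>lborel) = ennreal ((cmod c)\<^sup>2) * (\<integral>\<^sup>+w. f (cmod c *\<^sub>R w) \<partial>lborel)"
    using nn_integral_scaleR[of f "cmod c"] c by simp
  also have "(\<integral>\<^sup>+w. f (cmod c *\<^sub>R w) \<partial>lborel) = (\<integral>\<^sup>+w. f (cmod c *\<^sub>R (?e * w)) \<partial>lborel)"
    using lpres_nn_integral[OF rot, of "\<lambda>w. f (cmod c *\<^sub>R w)"] by simp
  also have "(\<lambda>w. cmod c *\<^sub>R (?e * w)) = (\<lambda>w. c * w)"
    using c by (auto simp: sgn_div_norm scaleR_conv_of_real)
  then have "(\<integral>\<^sup>+w. f (cmod c *\<^sub>R (?e * w)) \<partial>lborel) = (\<integral>\<^sup>+w. f (c * w) \<partial>lborel)"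
    by (metis (no_types, lifting))
  finally show ?thesis .
qed

lemma emeasure_annulus:
  fixes s R :: real
  assumes "0 \<le> s" "s \<le> R"
  shows "emeasure lborel {w::complex. s < (cmod w)\<^sup>2 \<and> (cmod w)\<^sup>2 < R} = ennreal (pi * (R - s))"
proof -
  have eq: "{w::complex. s < (cmod w)\<^sup>2 \<and> (cmod w)\<^sup>2 < R} = ball 0 (sqrt R) - cball 0 (sqrt s)"
  proof -
    have "s < (cmod w)\<^sup>2 \<longleftrightarrow> sqrt s < cmod w" "(cmod w)\<^sup>2 < R \<longleftrightarrow> cmod w < sqrt R" for w :: complex
      using real_sqrt_less_iff[of s "(cmod w)\<^sup>2"] real_sqrt_less_iff[of "(cmod w)\<^sup>2" R] by simp_all
    then show ?thesis by auto
  qed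
  have b: "emeasure lborel (ball (0::complex) (sqrt R)) = ennreal (pi * R)"
    using emeasure_ball[of "sqrt R" "0::complex"] assms by (simp add: unit_ball_vol_2)
  have c: "emeasure lborel (cball (0::complex) (sqrt s)) = ennreal (pi * s)"
    using emeasure_cball[of "sqrt s" "0::complex"] assms by (simp add: unit_ball_vol_2)
  show ?thesis
  proof (cases "s < R")
    case True
    then have sub: "cball (0::complex) (sqrt s) \<subseteq> ball 0 (sqrt R)"
      by (auto intro: le_less_trans[OF _ real_sqrt_less_mono])
    have "emeasure lborel (ball (0::complex) (sqrt R) - cball 0 (sqrt s)) = ennreal (pi * R) - ennreal (pi * s)"
      using sub by (subst emeasure_Diff) (auto simp: b c)
    then show ?thesis unfolding eq using assms by (simp add: ennreal_minus right_diff_distrib)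
  next
    case False
    with assms have sR: "s = R" by simp
    then have e: "{w::complex. s < (cmod w)\<^sup>2 \<and> (cmod w)\<^sup>2 < R} = {}" by auto
    show ?thesis unfolding e using sR by simp
  qed
qed

text \<open>The weight \<open>(cmod w)\<^sup>2\<close> is the length of an interval. Slicing the
  resulting solid the other way gives annuli of area \<open>pi * (R - s)\<close>, whose integral
  over \<open>s\<close> is elementary.\<close>

lemma nn_integral_cmod2_disc:
  fixes R :: real
  assumes R: "R > 0"
  shows "(\<integral>\<^sup>+w. ennreal ((cmod w)\<^sup>2) * indicator {w. (cmod w)\<^sup>2 < R} w \<partial>lborel) = ennreal (pi / 2 * R\<^sup>2)"
proof -
  let ?A = "{p::complex\<times>real. 0 < snd p \<and> snd p < (cmod (fst p))\<^sup>2 \<and> (cmod (fst p))\<^sup>2 < R}"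
  have "open ?A" by (intro open_Collect_conj open_Collect_less continuous_intros)
  then have A: "?A \<in> sets borel" by simp
  have "(\<integral>\<^sup>+w. ennreal ((cmod w)\<^sup>2) * indicator {w. (cmod w)\<^sup>2 < R} w \<partial>lborel) =
     (\<integral>\<^sup>+w. emeasure lborel {s. (w, s) \<in> ?A} \<partial>lborel)"
  proof (rule nn_integral_cong)
    fix w :: complex
    have "{s. (w, s) \<in> ?A} = (if (cmod w)\<^sup>2 < R then {0<..<(cmod w)\<^sup>2} else {})" by auto
    then show "ennreal ((cmod w)\<^sup>2) * indicator {w. (cmod w)\<^sup>2 < R} w = emeasure lborel {s. (w, s) \<in> ?A}"
      by auto
  qed
  also have "\<dots> = emeasure lborel ?A" by (rule emeasure_lborel_prod(2)[OF A, symmetric])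
  also have "\<dots> = (\<integral>\<^sup>+s. emeasure lborel {w. (w, s) \<in> ?A} \<partial>lborel)" by (rule emeasure_lborel_prod(1)[OF A])
  also have "\<dots> = (\<integral>\<^sup>+s. ennreal (pi * (R - s)) * indicator {0..R} s \<partial>lborel)"
  proof (rule nn_integral_cong_nonzero)
    fix s :: real assume s: "s \<noteq> 0"
    show "emeasure lborel {w. (w, s) \<in> ?A} = ennreal (pi * (R - s)) * indicator {0..R} s"
    proof (cases "0 < s \<and> s \<le> R")
      case True
      then show ?thesis using emeasure_annulus[of s R] by simp
    next
      case False
      then have e: "{w. (w, s) \<in> ?A} = {}" by auto
      show ?thesis unfolding e using False s by (auto split: split_indicator)
    qed
  qed
  also have "\<dots> = ennreal (pi * (R * R - R\<^sup>2 / 2) - pi * (R * 0 - 0\<^sup>2 / 2))"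
    using R by (intro nn_integral_FTC_Icc[where F="\<lambda>s. pi * (R * s - s\<^sup>2 / 2)"]) (auto intro!: derivative_eq_intros)
  finally show ?thesis by (simp add: power2_eq_square algebra_simps)
qed

lemma pt_mult[simp]: "v \<noteq> 0 \<Longrightarrow> pt (v * z, v) = z"
  by (simp add: pt_def)

lemma pdet_pt: "pdet p = Im (pt p) * (cmod (snd p))\<^sup>2"
  by (cases "snd p = 0") (auto simp: pt_simps, simp add: pdet_def)

lemma borel_measurable_pt[measurable]: "pt \<in> borel_measurable borel"
  unfolding pt_def by (intro borel_measurable_divide borel_measurable_fst borel_measurable_snd)

lemma borel_measurable_pdet[measurable]: "pdet \<in> borel_measurable borel"
  by (intro borel_measurable_continuous_onI continuous_intros)

text \<open>Substitute \<open>fst p = snd p * z\<close>.\<close>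

lemma nn_integral_cmat_pt:
  assumes f[measurable]: "f \<in> borel_measurable borel"
  shows "(\<integral>\<^sup>+p. f p \<partial>lborel) = (\<integral>\<^sup>+z. \<integral>\<^sup>+v. ennreal ((cmod v)\<^sup>2) * f (v * z, v) \<partial>lborel \<partial>(lborel :: complex measure))"
proof -
  have mf: "(\<lambda>x. f (g x, h x)) \<in> borel_measurable M" if "g \<in> borel_measurable M" "h \<in> borel_measurable M" for g h and M :: "'z measure"
    using measurable_compose[OF borel_measurable_Pair[OF that] f] .
  note mf[measurable]
  have "(\<integral>\<^sup>+p. f p \<partial>lborel) = (\<integral>\<^sup>+w. \<integral>\<^sup>+v. f (w, v) \<partial>lborel \<partial>(lborel :: complex measure))"
    by (rule nn_integral_lborel_cmat[OF f])
  also have "\<dots> = (\<integral>\<^sup>+v. \<integral>\<^sup>+w. f (w, v) \<partial>lborel \<partial>(lborel :: complex measure))"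
    by (rule lborel_pair.Fubini') measurable
  also have "\<dots> = (\<integral>\<^sup>+v. \<integral>\<^sup>+z. ennreal ((cmod v)\<^sup>2) * f (v * z, v) \<partial>lborel \<partial>(lborel :: complex measure))"
  proof (rule nn_integral_cong_AE, rule AE_mp[OF AE_lborel_singleton[of 0]], rule AE_I2, rule impI)
    fix v :: complex assume "v \<noteq> 0"
    then have "(\<integral>\<^sup>+w. f (w, v) \<partial>lborel) = ennreal ((cmod v)\<^sup>2) * (\<integral>\<^sup>+z. f (v * z, v) \<partial>lborel)"
      by (intro nn_integral_complex_mult) measurable
    also have "\<dots> = (\<integral>\<^sup>+z. ennreal ((cmod v)\<^sup>2) * f (v * z, v) \<partial>lborel)"
      by (rule nn_integral_cmult[symmetric]) measurable
    finally show "(\<integral>\<^sup>+w. f (w, v) \<partial>lborel) = (\<integral>\<^sup>+z. ennreal ((cmod v)\<^sup>2) * f (v * z, v) \<partial>lborel)" .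
  qed
  also have "\<dots> = (\<integral>\<^sup>+z. \<integral>\<^sup>+v. ennreal ((cmod v)\<^sup>2) * f (v * z, v) \<partial>lborel \<partial>(lborel :: complex measure))"
    by (rule lborel_pair.Fubini') measurable
  finally show ?thesis .
qed

section \<open>Hyperbolic area from cut-off Lebesgue measure\<close>

lemma open_half_plane: "open half_plane"
  unfolding half_plane_def by (intro open_Collect_less continuous_intros)

lemma borel_half_plane[measurable]: "half_plane \<in> sets borel"
  using open_half_plane by simp

lemma sets_hyp_area: "sets hyp_area = sets (restrict_space borel half_plane)"
  by (simp add: hyp_area_def sets_restrict_space)

lemma space_hyp_area[simp]: "space hyp_area = half_plane"
  by (simp add: hyp_area_def space_restrict_space)

lemma sets_hyp_area_iff: "S \<in> sets hyp_area \<longleftrightarrow> S \<in> sets borel \<and> S \<subseteq> half_plane"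
  unfolding sets_hyp_area by (subst sets_restrict_space_iff) auto

lemma emeasure_hyp_area:
  assumes "S \<in> sets borel" "S \<subseteq> half_plane"
  shows "emeasure hyp_area S = (\<integral>\<^sup>+z. ennreal (1 / (Im z)\<^sup>2) * indicator S z \<partial>lborel)"
  unfolding hyp_area_def using assms
  by (subst emeasure_restrict_space) (auto simp: emeasure_density)

text \<open>Over the base point \<open>z\<close> the determinant is
  \<open>Im z * (cmod v)\<^sup>2\<close>, so the fibre is the disc
  \<open>(cmod v)\<^sup>2 < 1 / Im z\<close>. With the Jacobian \<open>(cmod v)\<^sup>2\<close> its
  mass is \<open>pi / 2 / (Im z)\<^sup>2\<close>: the density of hyperbolic area times
  \<open>pi / 2\<close>.\<close>

lemma emeasure_pt_hyp_area:
  assumes S[measurable]: "S \<in> sets borel" and SH: "S \<subseteq> half_plane"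
  shows "emeasure lborel {p. pt p \<in> S \<and> pdet p < 1} = ennreal (pi / 2) * emeasure hyp_area S"
proof -
  have Am[measurable]: "{p. pt p \<in> S \<and> pdet p < 1} \<in> sets borel"
  proof -
    have "pt -` S \<inter> space borel \<in> sets borel" by (rule measurable_sets[OF borel_measurable_pt S])
    moreover have "pdet -` {..<1} \<inter> space borel \<in> sets borel" by (rule measurable_sets[OF borel_measurable_pdet]) simp
    ultimately have "(pt -` S \<inter> space borel) \<inter> (pdet -` {..<1} \<inter> space borel) \<in> sets borel" by (rule sets.Int)
    also have "(pt -` S \<inter> space borel) \<inter> (pdet -` {..<1} \<inter> space borel) = {p. pt p \<in> S \<and> pdet p < 1}" by auto
    finally show ?thesis .
  qed
  let ?A = "{p. pt p \<in> S \<and> pdet p < 1}"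
  have "emeasure lborel ?A = (\<integral>\<^sup>+p. indicator ?A p \<partial>lborel)" by simp
  also have "\<dots> = (\<integral>\<^sup>+z. \<integral>\<^sup>+v. ennreal ((cmod v)\<^sup>2) * indicator ?A (v * z, v) \<partial>lborel \<partial>lborel)"
    by (rule nn_integral_cmat_pt) measurable
  also have "\<dots> = (\<integral>\<^sup>+z. ennreal (pi / 2) * (ennreal (1 / (Im z)\<^sup>2) * indicator S z) \<partial>lborel)"
  proof (rule nn_integral_cong)
    fix z :: complex
    show "(\<integral>\<^sup>+v. ennreal ((cmod v)\<^sup>2) * indicator ?A (v * z, v) \<partial>lborel) = ennreal (pi / 2) * (ennreal (1 / (Im z)\<^sup>2) * indicator S z)"
    proof (cases "z \<in> S")
      case True
      then have z: "Im z > 0" using SH by (auto simp: half_plane_def)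
      have "(\<integral>\<^sup>+v. ennreal ((cmod v)\<^sup>2) * indicator ?A (v * z, v) \<partial>lborel) =
        (\<integral>\<^sup>+v. ennreal ((cmod v)\<^sup>2) * indicator {v. (cmod v)\<^sup>2 < 1 / Im z} v \<partial>lborel)"
      proof (rule nn_integral_cong_AE, rule AE_mp[OF AE_lborel_singleton[of 0]], rule AE_I2, rule impI)
        fix v :: complex assume "v \<noteq> 0"
        then show "ennreal ((cmod v)\<^sup>2) * indicator ?A (v * z, v) = ennreal ((cmod v)\<^sup>2) * indicator {v. (cmod v)\<^sup>2 < 1 / Im z} v"
          using True z by (auto simp: indicator_def pdet_pt field_simps)
      qed
      also have "\<dots> = ennreal (pi / 2 * (1 / Im z)\<^sup>2)" using z by (intro nn_integral_cmod2_disc) simp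
      finally show ?thesis using True by (simp add: power_divide flip: ennreal_mult)
    next
      case False
      have "(\<integral>\<^sup>+v. ennreal ((cmod v)\<^sup>2) * indicator ?A (v * z, v) \<partial>lborel) = (\<integral>\<^sup>+v. 0 \<partial>(lborel :: complex measure))"
      proof (rule nn_integral_cong)
        fix v :: complex
        show "ennreal ((cmod v)\<^sup>2) * indicator ?A (v * z, v) = 0"
          using False by (cases "v = 0") auto
      qed
      then show ?thesis using False by simp
    qed
  qed
  also have "\<dots> = ennreal (pi / 2) * emeasure hyp_area S"
    by (simp add: emeasure_hyp_area[OF S SH] nn_integral_cmult)
  finally show ?thesis .
qed

lemma borel_measurable_tang[measurable]: "tang \<in> borel_measurable borel"
proof -
  have "(\<lambda>p::cmat. sgn (snd p)) \<in> borel_measurable borel"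
    by (rule measurable_compose[OF borel_measurable_snd]) (simp add: sgn_div_norm)
  then show ?thesis unfolding tang_def
    by (intro borel_measurable_Pair borel_measurable_pt borel_measurable_divide borel_measurable_power borel_measurable_const)
qed

section \<open>Null sets of the measure on the unit tangent bundle\<close>

lemma AE_lborel_ex:
  fixes P :: "'a::euclidean_space \<Rightarrow> bool"
  assumes "AE x in lborel. P x" shows "\<exists>x. P x"
proof (rule ccontr)
  assume "\<not> (\<exists>x. P x)"
  with assms have "AE x::'a in lborel. False" by simp
  then have "emeasure lborel (UNIV :: 'a set) = 0"
    by (subst (asm) AE_iff_measurable[OF _ refl]) auto
  then show False by simp
qed

text \<open>The hypothesis is stable under rotating \<open>v\<close>. By Fubini some nonzero
  \<open>v\<close> has almost all of its rotations in the good set, and along them the direction is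
  \<open>cis (b - 2 * t)\<close>, so a null set in the plane becomes a null set of angles.\<close>

lemma angle_measure_null:
  assumes U: "U \<in> sets borel" "U \<subseteq> sphere 0 1"
    and ae: "AE v in lborel. \<i> / (sgn v)\<^sup>2 \<notin> U"
  shows "emeasure angle_measure U = 0"
proof -
  have sgnm: "(\<lambda>p::complex. sgn p) \<in> borel_measurable borel"
    unfolding sgn_div_norm by measurable
  let ?P = "\<lambda>v t. \<i> / (sgn (cis t * v))\<^sup>2 \<notin> U"
  have cism: "cis \<in> borel_measurable borel" by (intro borel_measurable_continuous_onI continuous_intros)
  have Q: "Measurable.pred (lborel \<Otimes>\<^sub>M lborel) (\<lambda>q. ?P (snd q) (fst q))"
  proof -
    have "(\<lambda>q::real\<times>complex. \<i> / (sgn (cis (fst q) * snd q))\<^sup>2) \<in> borel_measurable (borel \<Otimes>\<^sub>M borel)"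
      by (intro borel_measurable_divide borel_measurable_power borel_measurable_times
          measurable_compose[OF _ sgnm] measurable_compose[OF _ cism]) auto
    from measurable_sets[OF this, of "- U"] U(1)
    show ?thesis by (simp add: pred_def vimage_def space_pair_measure)
  qed
  have "AE v in lborel. ?P v t" for t
  proof -
    have "pdet (cis t * \<i>, cis t) = 1" by (simp add: pdet_def)
    then have rot: "lpres (rmul (cis t * \<i>, cis t))" by (rule lpres_rmul)
    have req: "rmul (cis t * \<i>, cis t) = (\<lambda>w. cis t * w)"
      by (rule ext) (simp add: rmul_def complex_eq_iff)
    have V: "{v. \<i> / (sgn v)\<^sup>2 \<in> U} \<in> sets borel"
    proof -
      have "(\<lambda>v::complex. \<i> / (sgn v)\<^sup>2) -` U \<inter> space borel \<in> sets borel"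
        by (rule measurable_sets[OF _ U(1)]) (use sgnm in measurable)
      then show ?thesis by (simp add: vimage_def)
    qed
    have "emeasure lborel {v. \<i> / (sgn v)\<^sup>2 \<in> U} = 0"
      using ae V by (subst (asm) AE_iff_measurable[OF _ refl]) (auto simp: )
    then have "emeasure lborel ((\<lambda>w. cis t * w) -` {v. \<i> / (sgn v)\<^sup>2 \<in> U}) = 0"
      using lpres_emeasure[OF rot V] unfolding req by simp
    moreover have "(\<lambda>w. cis t * w) -` {v. \<i> / (sgn v)\<^sup>2 \<in> U} \<in> sets borel"
      using measurable_sets[OF lpres_measurable[OF rot] V] unfolding req by simp
    ultimately show ?thesis
      by (intro AE_I[where N="(\<lambda>w. cis t * w) -` {v. \<i> / (sgn v)\<^sup>2 \<in> U}"]) auto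
  qed
  then have "AE t in lborel. AE v in lborel. ?P v t" by simp
  then have "AE v in lborel. AE t in lborel. ?P v t"
    using lborel_pair.AE_commute[where P="\<lambda>t v. ?P v t"] Q by (simp add: pred_def split_beta')
  then have "AE v in lborel. v \<noteq> 0 \<and> (AE t in lborel. ?P v t)"
    using AE_lborel_singleton[of 0] by (simp add: AE_conj_iff)
  then obtain v :: complex where v: "v \<noteq> 0" "AE t in lborel. ?P v t"
    using AE_lborel_ex by blast
  obtain b where b: "\<i> / (sgn v)\<^sup>2 = cis b"
  proof -
    have "cmod (\<i> / (sgn v)\<^sup>2) = 1" using v by (simp add: norm_divide norm_power norm_sgn)
    then have "cis (Arg (\<i> / (sgn v)\<^sup>2)) = \<i> / (sgn v)\<^sup>2"
      by (subst cis_Arg) (auto simp: sgn_div_norm)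
    then show ?thesis using that by metis
  qed
  have "\<i> / (sgn (cis t * v))\<^sup>2 = cis (b - 2 * t)" for t
  proof -
    have "\<i> / (sgn (cis t * v))\<^sup>2 = (\<i> / (sgn v)\<^sup>2) / (cis t)\<^sup>2"
      by (simp add: sgn_mult power_mult_distrib mult.commute)
    also have "\<dots> = cis b / cis (2 * t)" by (simp only: b) (simp add: power2_eq_square cis_mult)
    finally show ?thesis by (simp add: cis_divide)
  qed
  with v(2) have 1: "AE t in lborel. cis (b - 2 * t) \<notin> U" by simp
  have "Measurable.pred borel (\<lambda>t. cis (b - 2 * t) \<notin> U)"
  proof -
    have "(\<lambda>t. cis (b - 2 * t)) \<in> borel_measurable borel" by (intro borel_measurable_continuous_onI continuous_intros)
    from measurable_sets[OF this, of "- U"] U(1) show ?thesis by (simp add: pred_def vimage_def)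
  qed
  \<comment> \<open>The affine change of variable that turns \<open>b - 2 * t\<close> into
    \<open>t\<close>.\<close>
  from AE_borel_affine[OF _ this 1, of "-1/2" "b/2"] have 2: "AE t in lborel. cis t \<notin> U"
    by (simp add: algebra_simps)
  have cu: "cis -` U \<in> sets borel" using measurable_sets[OF cism U(1)] by simp
  have "emeasure angle_measure U = emeasure (restrict_space lborel {0..<2 * pi}) (cis -` U \<inter> space (restrict_space lborel {0..<2 * pi}))"
    unfolding angle_measure_def
  proof (rule emeasure_distr)
    show "cis \<in> restrict_space lborel {0..<2 * pi} \<rightarrow>\<^sub>M restrict_space borel (sphere 0 1)"
      by (intro measurable_restrict_space1 measurable_restrict_space2) (use cism in auto)
    show "U \<in> sets (restrict_space borel (sphere 0 1))"
      using U by (subst sets_restrict_space_iff) auto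
  qed
  also have "\<dots> = emeasure lborel (cis -` U \<inter> {0..<2 * pi})"
    using cu by (subst emeasure_restrict_space) (auto simp: space_restrict_space)
  also have "\<dots> \<le> emeasure lborel (cis -` U)" using cu by (intro emeasure_mono) auto
  also have "\<dots> = 0" using 2 cu by (subst (asm) AE_iff_measurable[OF _ refl]) (auto simp: vimage_def)
  finally show ?thesis by simp
qed

lemma finite_angle_measure: "finite_measure angle_measure"
  unfolding angle_measure_def
proof (rule finite_measure.finite_measure_distr)
  show "finite_measure (restrict_space lborel {0..<2 * pi})"
    by (rule finite_measureI) (simp add: emeasure_restrict_space space_restrict_space)
  show "cis \<in> restrict_space lborel {0..<2 * pi} \<rightarrow>\<^sub>M restrict_space borel (sphere 0 1)"
    by (intro measurable_restrict_space1 measurable_restrict_space2)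
       (auto intro: borel_measurable_continuous_onI[OF continuous_on_cis[OF continuous_on_id]])
qed

lemma space_angle_measure[simp]: "space angle_measure = sphere 0 1"
  by (simp add: angle_measure_def space_restrict_space)

lemma sets_angle_measure_iff: "U \<in> sets angle_measure \<longleftrightarrow> U \<in> sets borel \<and> U \<subseteq> sphere 0 1"
  unfolding angle_measure_def sets_distr by (subst sets_restrict_space_iff) auto

lemma sets_tangent_measure:
  assumes "N \<in> sets borel" "N \<subseteq> unit_tangent"
  shows "N \<in> sets (hyp_area \<Otimes>\<^sub>M angle_measure)"
proof -
  have 1: "(\<lambda>x. x) \<in> hyp_area \<rightarrow>\<^sub>M borel"
    by (rule measurableI) (auto simp: sets_hyp_area_iff)
  have 2: "(\<lambda>x. x) \<in> angle_measure \<rightarrow>\<^sub>M borel"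
    by (rule measurableI) (auto simp: sets_angle_measure_iff)
  have "(\<lambda>q. (fst q, snd q)) \<in> (hyp_area \<Otimes>\<^sub>M angle_measure) \<rightarrow>\<^sub>M (borel :: (complex \<times> complex) measure)"
    by (intro borel_measurable_Pair measurable_compose[OF measurable_fst 1] measurable_compose[OF measurable_snd 2])
  from measurable_sets[OF this assms(1)]
  have "N \<inter> space (hyp_area \<Otimes>\<^sub>M angle_measure) \<in> sets (hyp_area \<Otimes>\<^sub>M angle_measure)" by (simp add: vimage_def Int_def)
  moreover have "N \<inter> space (hyp_area \<Otimes>\<^sub>M angle_measure) = N"
    using assms by (auto simp: space_pair_measure unit_tangent_def)
  ultimately show ?thesis by simp
qed

text \<open>The bridge from Lebesgue measure on matrices to area times angle, for null sets. Fubini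
  over the base point reduces it to the circle, since for fixed \<open>z\<close> the direction
  depends only on \<open>v\<close>.\<close>

lemma tangent_measure_null:
  assumes N: "N \<in> sets borel" "N \<subseteq> unit_tangent"
    and 0: "emeasure lborel {p. tang p \<in> N} = 0"
  shows "emeasure (hyp_area \<Otimes>\<^sub>M angle_measure) N = 0"
proof -
  interpret A: finite_measure angle_measure by (rule finite_angle_measure)
  have A: "{p. tang p \<in> N} \<in> sets borel"
    using measurable_sets[OF borel_measurable_tang N(1)] by (simp add: vimage_def)
  have sgnm: "(\<lambda>p::complex. sgn p) \<in> borel_measurable borel"
    unfolding sgn_div_norm by measurable
  have ind: "(\<lambda>q::complex\<times>complex. indicator N (fst q, \<i> / (sgn (snd q))\<^sup>2) :: ennreal) \<in> borel_measurable borel"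
    by (rule measurable_compose[OF _ borel_measurable_indicator[OF N(1)]])
       (intro borel_measurable_Pair borel_measurable_divide borel_measurable_power borel_measurable_fst
          measurable_compose[OF borel_measurable_snd sgnm], simp)
  have [measurable]: "(\<lambda>x. indicator N (g x, \<i> / (sgn (h x))\<^sup>2) :: ennreal) \<in> borel_measurable M"
    if "g \<in> borel_measurable M" "h \<in> borel_measurable M" for g h and M :: "'z measure"
    using measurable_compose[OF borel_measurable_Pair[OF that] ind] by simp
  have "0 = (\<integral>\<^sup>+p. indicator {p. tang p \<in> N} p \<partial>lborel)" using 0 A by simp
  also have "\<dots> = (\<integral>\<^sup>+z. \<integral>\<^sup>+v. ennreal ((cmod v)\<^sup>2) * indicator {p. tang p \<in> N} (v * z, v) \<partial>lborel \<partial>lborel)"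
    by (rule nn_integral_cmat_pt) (use A in measurable)
  also have "\<dots> = (\<integral>\<^sup>+z. \<integral>\<^sup>+v. ennreal ((cmod v)\<^sup>2) * indicator N (z, \<i> / (sgn v)\<^sup>2) \<partial>lborel \<partial>lborel)"
  proof (intro nn_integral_cong)
    fix z v :: complex
    show "ennreal ((cmod v)\<^sup>2) * indicator {p. tang p \<in> N} (v * z, v) = ennreal ((cmod v)\<^sup>2) * indicator N (z, \<i> / (sgn v)\<^sup>2)"
      by (cases "v = 0") (auto simp: tang_def indicator_def)
  qed
  finally have "(\<integral>\<^sup>+z. \<integral>\<^sup>+v. ennreal ((cmod v)\<^sup>2) * indicator N (z, \<i> / (sgn v)\<^sup>2) \<partial>lborel \<partial>lborel) = 0" by simp
  then have "AE z in lborel. (\<integral>\<^sup>+v. ennreal ((cmod v)\<^sup>2) * indicator N (z, \<i> / (sgn v)\<^sup>2) \<partial>lborel) = 0"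
    by (subst (asm) nn_integral_0_iff_AE) measurable
  then have ae: "AE z in lborel. emeasure angle_measure {u. (z, u) \<in> N} = 0"
  proof eventually_elim
    fix z assume "(\<integral>\<^sup>+v. ennreal ((cmod v)\<^sup>2) * indicator N (z, \<i> / (sgn v)\<^sup>2) \<partial>lborel) = 0"
    then have "AE v in lborel. ennreal ((cmod v)\<^sup>2) * indicator N (z, \<i> / (sgn v)\<^sup>2) = 0"
      by (subst (asm) nn_integral_0_iff_AE) measurable
    with AE_lborel_singleton[of 0] have "AE v in lborel. \<i> / (sgn v)\<^sup>2 \<notin> {u. (z, u) \<in> N}"
      by eventually_elim (auto simp: indicator_def split: if_splits)
    then show "emeasure angle_measure {u. (z, u) \<in> N} = 0"
      using N by (intro angle_measure_null section_borel2) (auto simp: unit_tangent_def)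
  qed
  have "emeasure (hyp_area \<Otimes>\<^sub>M angle_measure) N = (\<integral>\<^sup>+z. emeasure angle_measure (Pair z -` N) \<partial>hyp_area)"
    by (rule A.emeasure_pair_measure_alt) (rule sets_tangent_measure[OF N])
  also have "\<dots> = (\<integral>\<^sup>+z. 0 \<partial>hyp_area)"
  proof (rule nn_integral_cong_AE)
    have "AE z in density lborel (\<lambda>z. ennreal (1 / (Im z)\<^sup>2)). emeasure angle_measure (Pair z -` N) = 0"
      using ae by (subst AE_density) (auto simp: vimage_def)
    then show "AE z in hyp_area. emeasure angle_measure (Pair z -` N) = 0"
      unfolding hyp_area_def by (subst AE_restrict_space_iff) auto
  qed
  finally show ?thesis by simp
qed

section \<open>Fuchsian groups\<close>

definition mact :: "cmat \<Rightarrow> complex \<Rightarrow> complex" where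
  "mact g z = (of_real (Im (fst g)) * z + of_real (Re (fst g))) / (of_real (Im (snd g)) * z + of_real (Re (snd g)))"

text \<open>The automorphy factor: imaginary parts, differences and derivatives transform by powers
  of it.\<close>

definition mden :: "cmat \<Rightarrow> complex \<Rightarrow> complex" where
  "mden g z = of_real (Im (snd g)) * z + of_real (Re (snd g))"

lemma mden_nz:
  assumes "pdet g > 0" "Im z > 0" shows "mden g z \<noteq> 0"
proof
  assume "mden g z = 0"
  then have "Im (snd g) * Im z = 0" "Im (snd g) * Re z + Re (snd g) = 0"
    by (simp_all add: mden_def complex_eq_iff)
  with assms show False by (auto simp: pdet_def)
qed

lemma Im_mact:
  assumes "Im z > 0" shows "Im (mact g z) = pdet g * Im z / (cmod (mden g z))\<^sup>2"
  unfolding mact_def Im_divide cmod_power2 mden_def pdet_def by (simp add: algebra_simps)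

lemma mact_half_plane:
  assumes "pdet g > 0" "z \<in> half_plane" shows "mact g z \<in> half_plane"
  using assms mden_nz[of g z] by (simp add: half_plane_def Im_mact)

lemma mact_pid[simp]: "mact pid z = z"
  by (simp add: mact_def)

lemma mact_minus[simp]: "mact (- g) z = mact g z"
  unfolding mact_def by (subst minus_divide_divide[symmetric]) simp

lemma mact_pmul:
  assumes "pdet g > 0" "pdet h > 0" "Im z > 0"
  shows "mact (g \<odot> h) z = mact g (mact h z)"
proof -
  have nz: "mden h z \<noteq> 0" using mden_nz assms by blast
  let ?n = "of_real (Im (fst h)) * z + of_real (Re (fst h))"
  have "mact g (mact h z) = (of_real (Im (fst g)) * (?n / mden h z) + of_real (Re (fst g))) / (of_real (Im (snd g)) * (?n / mden h z) + of_real (Re (snd g)))"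
    by (simp add: mact_def mden_def)
  also have "\<dots> = ((of_real (Im (fst g)) * (?n / mden h z) + of_real (Re (fst g))) * mden h z) / ((of_real (Im (snd g)) * (?n / mden h z) + of_real (Re (snd g))) * mden h z)"
    using nz by simp
  also have "\<dots> = (of_real (Im (fst g)) * ?n + of_real (Re (fst g)) * mden h z) / (of_real (Im (snd g)) * ?n + of_real (Re (snd g)) * mden h z)"
    using nz by (simp add: distrib_right)
  also have "\<dots> = mact (g \<odot> h) z" by (simp add: mact_def mden_def algebra_simps)
  finally show ?thesis by simp
qed

lemma pt_pmul:
  assumes "snd p \<noteq> 0" shows "pt (g \<odot> p) = mact g (pt p)"
proof -
  have "mact g (pt p) = ((of_real (Im (fst g)) * (fst p / snd p) + of_real (Re (fst g))) * snd p) / ((of_real (Im (snd g)) * (fst p / snd p) + of_real (Re (snd g))) * snd p)"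
    using assms by (simp add: mact_def pt_def)
  also have "\<dots> = pt (g \<odot> p)" using assms by (simp add: distrib_right pt_def pmul_def scaleR_conv_of_real)
  finally show ?thesis by simp
qed

lemma continuous_on_mact[continuous_intros]:
  assumes "pdet g > 0" "S \<subseteq> half_plane" shows "continuous_on S (mact g)"
  unfolding mact_def
  by (intro continuous_intros) (use assms mden_nz[of g] in \<open>auto simp: mden_def half_plane_def\<close>)

lemma mact_pinv:
  assumes "pdet g > 0" "z \<in> half_plane"
  shows "mact (pinv g) (mact g z) = z" "mact g (mact (pinv g) z) = z"
  using assms mact_pmul[of "pinv g" g z] mact_pmul[of g "pinv g" z]
  by (simp_all add: half_plane_def pdet_pinv pinv_left pinv_right)

text \<open>Both points solve the same real quadratic equation. Dividing the difference by
  \<open>z - w\<close> leaves \<open>c * (z + w) + d - a = 0\<close>; its imaginary part forces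
  \<open>c = 0\<close>, and then the matrix is scalar.\<close>

lemma mact_fixed_unique:
  assumes g: "pdet g = 1" "g \<noteq> pid" "g \<noteq> - pid" and z: "Im z > 0" "mact g z = z" and w: "Im w > 0" "mact g w = w"
  shows "z = w"
proof (rule ccontr)
  assume ne: "z \<noteq> w"
  obtain a b c d where gg: "g = (Complex b a, Complex d c)" by (metis complex_surj prod.exhaust)
  have q: "of_real a * x + of_real b = x * (of_real c * x + of_real d)" if "Im x > 0" "mact g x = x" for x
  proof -
    have "mden g x \<noteq> 0" using mden_nz that g by simp
    then show ?thesis using that(2) by (simp add: mact_def mden_def gg field_simps)
  qed
  have "(z - w) * (of_real c * (z + w) + of_real d - of_real a) =
      z * (of_real c * z + of_real d) - w * (of_real c * w + of_real d) - of_real a * (z - w)"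
    by (simp add: algebra_simps)
  also have "\<dots> = 0"
    by (simp only: q[OF z, symmetric] q[OF w, symmetric]) (simp add: algebra_simps)
  finally have "(z - w) * (of_real c * (z + w) + of_real d - of_real a) = 0" .
  with ne have "of_real c * (z + w) + of_real d - of_real a = 0" by simp
  then have "Im (of_real c * (z + w) + of_real d - of_real a) = 0" "Re (of_real c * (z + w) + of_real d - of_real a) = 0" by simp_all
  then have c: "c = 0" and ad: "a = d" using z w by auto
  with q[OF z] have "b = 0" by simp
  with c ad g(1) have "a * a = 1" by (simp add: gg pdet_def)
  then have "a = 1 \<or> a = -1" by (simp add: square_eq_1_iff)
  with g(2,3) c ad \<open>b = 0\<close> show False by (auto simp: gg pid_def complex_eq_iff prod_eq_iff)
qed

text \<open>The group is kept in the double cover, closed under negation, so each element of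
  \<open>PSL2R\<close> appears as \<open>g\<close> and \<open>- g\<close>. Discreteness is stated at
  the identity only, the other elements following by translation.\<close>

locale fuchsian =
  fixes \<Gamma> :: "cmat set"
  assumes det1: "g \<in> \<Gamma> \<Longrightarrow> pdet g = 1"
    and id_in: "pid \<in> \<Gamma>"
    and mul_in: "g \<in> \<Gamma> \<Longrightarrow> h \<in> \<Gamma> \<Longrightarrow> g \<odot> h \<in> \<Gamma>"
    and minus_in: "g \<in> \<Gamma> \<Longrightarrow> - g \<in> \<Gamma>"
    and inv_in: "g \<in> \<Gamma> \<Longrightarrow> pinv g \<in> \<Gamma>"
    and isolated: "\<exists>e>0. \<forall>g\<in>\<Gamma>. dist g pid < e \<longrightarrow> g = pid"
begin

text \<open>Infinitely many bounded elements would accumulate at some \<open>l\<close>. Two distinct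
  ones near \<open>l\<close> have a quotient near \<open>pid\<close>, which isolation
  excludes.\<close>

lemma finite_bounded: "finite {g \<in> \<Gamma>. norm g \<le> R}"
proof (rule ccontr)
  let ?S = "{g \<in> \<Gamma>. norm g \<le> R}"
  assume inf: "infinite ?S"
  have "compact (cball (0::cmat) R)" by simp
  moreover have "?S \<subseteq> cball 0 R" by auto
  ultimately obtain l where l: "l islimpt ?S"
    using inf by (metis compact_eq_Bolzano_Weierstrass)
  \<comment> \<open>The adjugate: polynomial, hence continuous everywhere, and equal to
    \<open>pinv\<close> at determinant 1.\<close>
  define adj where "adj x = (Complex (- Re (fst x)) (Re (snd x)), Complex (Im (fst x)) (- Im (snd x)))" for x :: cmat
  have adj_l: "adj x \<odot> x = pdet x *\<^sub>R pid" for x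
    by (rule cmat_eqI) (simp_all add: adj_def pdet_def)
  have adj_inv: "adj x = pinv x" if "pdet x = 1" for x using that by (simp add: adj_def pinv_def)
  have cont_adj: "continuous_on UNIV (\<lambda>q::cmat\<times>cmat. adj (fst q) \<odot> snd q)"
    unfolding adj_def Complex_eq by (intro continuous_intros)
  have "pdet l = 1"
  proof -
    have "closed {x. pdet x = 1}" by (intro closed_Collect_eq continuous_intros)
    moreover have "l islimpt {x. pdet x = 1}" by (rule islimpt_subset[OF l]) (auto dest: det1)
    ultimately have "l \<in> {x. pdet x = 1}" unfolding closed_limpt by blast
    then show ?thesis by simp
  qed
  obtain e where e: "e > 0" "\<And>g. g \<in> \<Gamma> \<Longrightarrow> dist g pid < e \<Longrightarrow> g = pid" using isolated by blast
  have "isCont (\<lambda>q::cmat\<times>cmat. adj (fst q) \<odot> snd q) (l, l)"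
    using cont_adj continuous_on_eq_continuous_at[OF open_UNIV] by blast
  then obtain d where d: "d > 0" "\<And>q. dist q (l, l) < d \<Longrightarrow> dist (adj (fst q) \<odot> snd q) (adj l \<odot> l) < e"
    using e(1) unfolding continuous_at_eps_delta by (metis fst_conv snd_conv)
  have "infinite (?S \<inter> ball l (d/2))"
    using l d(1) by (simp add: islimpt_eq_infinite_ball)
  then obtain g where g: "g \<in> ?S \<inter> ball l (d/2)" by (metis ex_in_conv finite.emptyI)
  have "infinite (?S \<inter> ball l (d/2) - {g})" using \<open>infinite (?S \<inter> ball l (d/2))\<close> by simp
  from infinite_imp_nonempty[OF this] obtain h where h: "h \<in> ?S \<inter> ball l (d/2)" "h \<noteq> g" by blast
  have "dist (g, h) (l, l) \<le> dist g l + dist h l"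
    by (simp add: dist_Pair_Pair sqrt_sum_squares_le_sum)
  also have "\<dots> < d" using g h by (auto simp: dist_commute)
  finally have "dist (adj g \<odot> h) pid < e" using d(2)[of "(g, h)"] adj_l[of l] \<open>pdet l = 1\<close> by simp
  moreover have gin: "g \<in> \<Gamma>" "h \<in> \<Gamma>" using g h by blast+
  ultimately have "pinv g \<odot> h = pid"
    using e(2)[OF mul_in[OF inv_in[OF gin(1)] gin(2)]] adj_inv[OF det1[OF gin(1)]] by simp
  then have "g \<odot> (pinv g \<odot> h) = g \<odot> pid" by (simp only:)
  then have "h = g" using det1[OF gin(1)] by simp
  then show False using h by blast
qed

lemma countable_\<Gamma>: "countable \<Gamma>"
proof -
  have "\<Gamma> = (\<Union>n::nat. {g \<in> \<Gamma>. norm g \<le> real n})"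
    using real_arch_simple[of "norm _"] by blast
  moreover have "countable (\<Union>n::nat. {g \<in> \<Gamma>. norm g \<le> real n})"
    using countable_finite[OF finite_bounded] by (intro countable_UN) auto
  ultimately show ?thesis by simp
qed

text \<open>A lower bound for \<open>Im (mact g z)\<close> bounds the denominator, and an upper
  bound for \<open>mact g z\<close> then bounds the numerator. Both bound the entries of
  \<open>g\<close>, and only finitely many elements have bounded entries.\<close>

lemma properly_discontinuous:
  assumes K: "compact K" "K \<subseteq> half_plane"
  shows "finite {g \<in> \<Gamma>. \<exists>z\<in>K. mact g z \<in> K}"
proof (cases "K = {}")
  case False
  have "continuous_on K Im" by (intro continuous_intros)
  from continuous_attains_inf[OF K(1) False this] obtain z0 where z0: "z0 \<in> K" "\<And>z. z \<in> K \<Longrightarrow> Im z0 \<le> Im z" by blast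
  define m where "m = Im z0"
  have m: "m > 0" "\<And>z. z \<in> K \<Longrightarrow> m \<le> Im z" using z0 K by (auto simp: m_def half_plane_def)
  obtain B where B: "\<And>z. z \<in> K \<Longrightarrow> cmod z \<le> B" using compact_imp_bounded[OF K(1)] bounded_iff by blast
  define C where "C = sqrt (B / m)"
  \<comment> \<open>A real linear form in \<open>z\<close> that is small at a point of
    \<open>K\<close> has small coefficients, because \<open>Im z\<close> is at least
    \<open>m\<close> there.\<close>
  have bnd: "\<bar>u\<bar> \<le> D / m \<and> \<bar>v\<bar> \<le> D + D / m * B" if "z \<in> K" "cmod (of_real u * z + of_real v) \<le> D" for u v D z
  proof -
    have D: "D \<ge> 0" using that(2) norm_ge_zero order_trans by blast
    have "\<bar>u * Im z\<bar> \<le> D" using abs_Im_le_cmod[of "of_real u * z + of_real v"] that by simp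
    then have "\<bar>u\<bar> * m \<le> D" using m(2)[OF that(1)] m(1)
      by (metis abs_ge_zero abs_mult abs_of_nonneg less_le_trans mult_left_mono order_less_imp_le order_trans)
    then have u: "\<bar>u\<bar> \<le> D / m" using m by (simp add: field_simps)
    have "\<bar>v\<bar> = cmod ((of_real u * z + of_real v) - of_real u * z)" by simp
    also have "\<dots> \<le> D + \<bar>u\<bar> * cmod z" using that(2) norm_triangle_ineq4[of "of_real u * z + of_real v" "of_real u * z"] by (simp add: norm_mult)
    also have "\<dots> \<le> D + D / m * B" using u B[OF that(1)] D m by (intro add_left_mono mult_mono) auto
    finally show ?thesis using u by simp
  qed
  define D1 where "D1 = C / m" define D2 where "D2 = C + C / m * B"
  define E1 where "E1 = (B * C) / m" define E2 where "E2 = B * C + (B * C) / m * B"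
  have "norm g \<le> \<bar>E1\<bar> + \<bar>E2\<bar> + (\<bar>D1\<bar> + \<bar>D2\<bar>)" if g: "g \<in> \<Gamma>" and z: "z \<in> K" "mact g z \<in> K" for g z
  proof -
    have pz: "Im z > 0" using z K by (auto simp: half_plane_def)
    have nz: "mden g z \<noteq> 0" using mden_nz[of g z] det1[OF g] pz by simp
    have "m \<le> Im (mact g z)" using m z by simp
    also have "\<dots> = Im z / (cmod (mden g z))\<^sup>2" using Im_mact[OF pz] det1[OF g] by simp
    finally have "m * (cmod (mden g z))\<^sup>2 \<le> Im z" using nz by (simp add: field_simps)
    also have "\<dots> \<le> B" using B[OF z(1)] abs_Im_le_cmod[of z] by simp
    finally have "(cmod (mden g z))\<^sup>2 \<le> B / m" using m by (simp add: field_simps)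
    then have den: "cmod (mden g z) \<le> C" unfolding C_def by (rule real_le_rsqrt)
    have "of_real (Im (fst g)) * z + of_real (Re (fst g)) = mact g z * mden g z"
      using nz by (simp add: mact_def mden_def)
    then have "cmod (of_real (Im (fst g)) * z + of_real (Re (fst g))) \<le> B * C"
      using den B[OF z(2)] by (simp add: norm_mult mult_mono')
    note n = bnd[OF z(1) this] and d = bnd[OF z(1) den[unfolded mden_def]]
    have "norm g \<le> norm (fst g) + norm (snd g)"
      by (simp add: norm_prod_def sqrt_sum_squares_le_sum)
    also have "\<dots> \<le> (\<bar>Re (fst g)\<bar> + \<bar>Im (fst g)\<bar>) + (\<bar>Re (snd g)\<bar> + \<bar>Im (snd g)\<bar>)"
      by (intro add_mono cmod_le)
    also have "\<dots> \<le> \<bar>E1\<bar> + \<bar>E2\<bar> + (\<bar>D1\<bar> + \<bar>D2\<bar>)"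
      using n d unfolding D1_def D2_def E1_def E2_def by linarith
    finally show ?thesis .
  qed
  then have "{g \<in> \<Gamma>. \<exists>z\<in>K. mact g z \<in> K} \<subseteq> {g \<in> \<Gamma>. norm g \<le> \<bar>E1\<bar> + \<bar>E2\<bar> + (\<bar>D1\<bar> + \<bar>D2\<bar>)}" by blast
  then show ?thesis using finite_bounded finite_subset by blast
qed simp

text \<open>On such a set the orbit map is injective, and no point of it has a nontrivial stabilizer
  in \<open>PSL2R\<close>.\<close>

definition wandering :: "complex set \<Rightarrow> bool" where
  "wandering U \<longleftrightarrow> open U \<and> U \<subseteq> half_plane \<and> (\<forall>g\<in>\<Gamma>. (\<exists>z\<in>U. mact g z \<in> U) \<longrightarrow> g = pid \<or> g = - pid)"

definition free_part :: "complex set" where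
  "free_part = \<Union>{U. wandering U}"

text \<open>Only finitely many elements bring a small compact ball back to itself. Each nontrivial
  one moves \<open>z\<close>, so separating \<open>z\<close> from its images shrinks the ball to a
  wandering set.\<close>

lemma wandering_nbhd:
  assumes z: "z \<in> half_plane" and free: "\<And>g. g \<in> \<Gamma> \<Longrightarrow> mact g z = z \<Longrightarrow> g = pid \<or> g = - pid"
  shows "\<exists>U. wandering U \<and> z \<in> U"
proof -
  obtain e where e: "e > 0" "cball z e \<subseteq> half_plane" using open_half_plane z open_contains_cball by blast
  let ?N = "{g \<in> \<Gamma>. \<exists>w\<in>cball z e. mact g w \<in> cball z e}"
  have fin: "finite (?N - {pid, - pid})" using properly_discontinuous[OF _ e(2)] by auto
  have "\<forall>g\<in>?N - {pid, - pid}. \<exists>V. open V \<and> z \<in> V \<and> (\<forall>w\<in>V \<inter> half_plane. mact g w \<notin> V)"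
  proof
    fix g assume g: "g \<in> ?N - {pid, - pid}"
    have g1: "pdet g = 1" using g det1 by auto
    have ne: "mact g z \<noteq> z" using free[of g] g by blast
    then obtain A B where AB: "open A" "open B" "z \<in> A" "mact g z \<in> B" "A \<inter> B = {}"
      using hausdorff[of z "mact g z"] by metis
    have "continuous_on half_plane (mact g)" using g1 by (intro continuous_on_mact) auto
    then have "open (half_plane \<inter> mact g -` B)"
      using AB(2) open_half_plane by (simp add: continuous_on_open_vimage Int_commute)
    then show "\<exists>V. open V \<and> z \<in> V \<and> (\<forall>w\<in>V \<inter> half_plane. mact g w \<notin> V)"
      using AB z by (intro exI[of _ "A \<inter> (half_plane \<inter> mact g -` B)"]) auto
  qed
  from bchoice[OF this] obtain V where V: "\<And>g. g \<in> ?N - {pid, - pid} \<Longrightarrow> open (V g) \<and> z \<in> V g \<and> (\<forall>w\<in>V g \<inter> half_plane. mact g w \<notin> V g)"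
    by blast
  define U where "U = ball z e \<inter> (\<Inter>g\<in>?N - {pid, - pid}. V g)"
  have "open U" unfolding U_def using fin V by (intro open_Int open_INT) auto
  moreover have "z \<in> U" using V e by (auto simp: U_def)
  moreover have "U \<subseteq> half_plane" using e ball_subset_cball by (auto simp: U_def subset_iff)
  moreover have "g = pid \<or> g = - pid" if "g \<in> \<Gamma>" "w \<in> U" "mact g w \<in> U" for g w
  proof (rule ccontr)
    assume "\<not> (g = pid \<or> g = - pid)"
    moreover have "g \<in> ?N" using that by (auto simp: U_def intro!: bexI[of _ w])
    ultimately have gN: "g \<in> ?N - {pid, - pid}" by simp
    then have "w \<in> V g" "mact g w \<in> V g" using that by (auto simp: U_def)
    moreover have "w \<in> half_plane" using that \<open>U \<subseteq> half_plane\<close> by auto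
    ultimately show False using V[OF gN] by blast
  qed
  ultimately show ?thesis unfolding wandering_def by blast
qed

section \<open>Points without stabilizer\<close>

lemma free_part_half_plane: "free_part \<subseteq> half_plane"
  unfolding free_part_def wandering_def by blast

lemma open_free_part: "open free_part"
  unfolding free_part_def wandering_def by (rule open_Union) blast

lemma free_part_stabilizer:
  "z \<in> free_part \<Longrightarrow> g \<in> \<Gamma> \<Longrightarrow> mact g z = z \<Longrightarrow> g = pid \<or> g = - pid"
  unfolding free_part_def wandering_def by force

lemma in_free_part_iff:
  "z \<in> free_part \<longleftrightarrow> z \<in> half_plane \<and> (\<forall>g\<in>\<Gamma>. mact g z = z \<longrightarrow> g = pid \<or> g = - pid)"
  using free_part_stabilizer free_part_half_plane wandering_nbhd[of z] unfolding free_part_def by blast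

text \<open>Each nontrivial element fixes at most one point, and the group is countable. This makes
  the cone points negligible everywhere below.\<close>

lemma countable_non_free: "countable (half_plane - free_part)"
proof -
  have "half_plane - free_part \<subseteq> (\<Union>g\<in>\<Gamma> - {pid, - pid}. {z \<in> half_plane. mact g z = z})"
    by (auto simp: in_free_part_iff)
  moreover have "countable (\<Union>g\<in>\<Gamma> - {pid, - pid}. {z \<in> half_plane. mact g z = z})"
  proof (intro countable_UN countable_Diff countable_\<Gamma>)
    fix g assume g: "g \<in> \<Gamma> - {pid, - pid}"
    show "countable {z \<in> half_plane. mact g z = z}"
    proof (cases "\<exists>w \<in> half_plane. mact g w = w")
      case True
      then obtain w where "w \<in> half_plane" "mact g w = w" by blast
      then have "z = w" if "z \<in> half_plane" "mact g z = z" for z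
        using mact_fixed_unique[of g z w] det1[of g] g that by (simp add: half_plane_def)
      then have "{z \<in> half_plane. mact g z = z} \<subseteq> {w}" by blast
      then show ?thesis by (rule countable_subset) simp
    next
      case False
      then have "{z \<in> half_plane. mact g z = z} = {}" by blast
      then show ?thesis by (metis countable_empty)
    qed
  qed
  ultimately show ?thesis by (rule countable_subset)
qed

text \<open>Stabilizers along an orbit are conjugate.\<close>

lemma mact_free_part:
  assumes g: "g \<in> \<Gamma>" and z: "z \<in> free_part" shows "mact g z \<in> free_part"
proof -
  have zH: "z \<in> half_plane" using z free_part_half_plane by auto
  have gz: "mact g z \<in> half_plane" using mact_half_plane zH det1[OF g] by simp
  have "h = pid \<or> h = - pid" if h: "h \<in> \<Gamma>" "mact h (mact g z) = mact g z" for h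
  proof -
    have i: "pinv g \<in> \<Gamma>" using inv_in g by simp
    have 1: "Im z > 0" "Im (mact g z) > 0" using zH gz by (auto simp: half_plane_def)
    have "mact (pinv g \<odot> (h \<odot> g)) z = mact (pinv g) (mact h (mact g z))"
      using det1[OF g] det1[OF h(1)] det1[OF i] 1 by (simp add: mact_pmul)
    also have "\<dots> = z" using h mact_pinv[of g z] det1[OF g] zH by simp
    finally have "pinv g \<odot> (h \<odot> g) = pid \<or> pinv g \<odot> (h \<odot> g) = - pid"
      using free_part_stabilizer[OF z] mul_in i g h by blast
    then have "g \<odot> (pinv g \<odot> (h \<odot> g)) = g \<or> g \<odot> (pinv g \<odot> (h \<odot> g)) = - g"
      by (auto simp: pmul_minus_right)
    then have "h \<odot> g = g \<or> h \<odot> g = - g" using det1[OF g] by simp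
    then show ?thesis
      using det1[OF g] by (metis pmul_pinv_cancel(3) pinv_right pmul_minus_left zero_neq_one)
  qed
  then show ?thesis using gz in_free_part_iff by blast
qed

lemma wandering_cover:
  "\<exists>B :: nat \<Rightarrow> complex set. (\<forall>n. wandering (B n)) \<and> (\<Union>n. B n) = free_part"
proof -
  obtain F where F: "F \<subseteq> {U. wandering U}" "countable F" "\<Union>F = \<Union>{U. wandering U}"
    by (rule Lindelof[of "{U. wandering U}"]) (auto simp: wandering_def)
  have w0: "wandering {}" by (simp add: wandering_def)
  \<comment> \<open>The empty set is added so that the enumerated family is nonempty.\<close>
  let ?B = "from_nat_into (insert {} F)"
  have r: "range ?B = insert {} F" using F(2) by (intro range_from_nat_into) auto
  show ?thesis
  proof (intro exI[of _ ?B] conjI allI)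
    show "wandering (?B n)" for n using r w0 F(1) by (metis insertE mem_Collect_eq rangeI subsetD)
    show "(\<Union>n. ?B n) = free_part" using r F(3) by (auto simp: free_part_def)
  qed
qed

section \<open>Orbits and a Borel fundamental set\<close>

definition orb :: "complex \<Rightarrow> complex set" where "orb z = (\<lambda>g. mact g z) ` \<Gamma>"

lemma orb_self: "z \<in> orb z" using id_in by (auto simp: orb_def intro!: image_eqI[of _ _ pid])

lemma orb_mact:
  assumes g: "g \<in> \<Gamma>" and z: "z \<in> half_plane" shows "orb (mact g z) = orb z"
proof -
  have "mact h (mact g z) = mact (h \<odot> g) z" if "h \<in> \<Gamma>" for h
    using det1[OF g] det1[OF that] z by (simp add: mact_pmul half_plane_def)
  then have 1: "orb (mact g z) \<subseteq> orb z"
    unfolding orb_def by (intro image_subsetI) (metis (no_types, lifting) imageI mul_in[OF _ g])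
  have "mact h z = mact (h \<odot> pinv g) (mact g z)" if "h \<in> \<Gamma>" for h
  proof -
    have "mact (h \<odot> pinv g) (mact g z) = mact h (mact (pinv g) (mact g z))"
      using det1[OF g] det1[OF that] mact_half_plane[of g z] z
      by (intro mact_pmul) (auto simp: half_plane_def pdet_pinv)
    then show ?thesis using mact_pinv[of g z] det1[OF g] z by simp
  qed
  then have "orb z \<subseteq> orb (mact g z)"
    unfolding orb_def by (intro image_subsetI) (metis (no_types, lifting) imageI mul_in[OF _ inv_in[OF g]])
  with 1 show ?thesis by simp
qed

lemma orb_eq_iff: "z \<in> half_plane \<Longrightarrow> orb w = orb z \<longleftrightarrow> (\<exists>g\<in>\<Gamma>. w = mact g z)"
proof -
  assume z: "z \<in> half_plane"
  have "\<exists>g\<in>\<Gamma>. w = mact g z" if "orb w = orb z" using that orb_self[of w] unfolding orb_def by blast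
  moreover have "orb w = orb z" if "\<exists>g\<in>\<Gamma>. w = mact g z" using that orb_mact[OF _ z] by blast
  ultimately show ?thesis by blast
qed

text \<open>From each wandering set of the cover the saturations of its predecessors are removed. A
  free orbit then contributes only to the first member that it meets, and there exactly one point
  because the member is wandering.\<close>

lemma fundamental_set:
  obtains F where "F \<in> sets borel" "F \<subseteq> half_plane" "\<And>z. z \<in> free_part \<Longrightarrow> \<exists>!y. y \<in> F \<and> orb y = orb z"
proof -
  obtain B :: "nat \<Rightarrow> complex set" where B': "(\<forall>n. wandering (B n)) \<and> (\<Union>n. B n) = free_part"
    using wandering_cover by blast
  then have B: "\<And>n. wandering (B n)" "(\<Union>n. B n) = free_part" by simp_all
  have BH: "B n \<subseteq> half_plane" "open (B n)" for n using B(1)[of n] unfolding wandering_def by simp_all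
  define S where "S n = (\<Union>g\<in>\<Gamma>. half_plane \<inter> mact g -` B n)" for n
  have S: "open (S n)" for n unfolding S_def
  proof (intro open_UN ballI)
    fix g assume "g \<in> \<Gamma>"
    then have "continuous_on half_plane (mact g)" using det1 by (intro continuous_on_mact) auto
    then show "open (half_plane \<inter> mact g -` B n)"
      using BH open_half_plane by (simp add: continuous_on_open_vimage Int_commute)
  qed
  define F where "F = (\<Union>n. B n - (\<Union>m<n. S m))"
  have "F \<in> sets borel" unfolding F_def using BH S by (intro sets.countable_UN sets.Diff) auto
  moreover have "F \<subseteq> half_plane" using BH by (auto simp: F_def)
  moreover have "\<exists>!y. y \<in> F \<and> orb y = orb z" if z: "z \<in> free_part" for z
  proof -
    have zH: "z \<in> half_plane" using z free_part_half_plane by auto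
    have Sorb: "z \<in> S n \<longleftrightarrow> orb z \<inter> B n \<noteq> {}" if "z \<in> half_plane" for z n
      using that by (auto simp: S_def orb_def)
    define n where "n = (LEAST n. orb z \<inter> B n \<noteq> {})"
    have "\<exists>n. orb z \<inter> B n \<noteq> {}" using z B(2) orb_self by blast
    then have n: "orb z \<inter> B n \<noteq> {}" unfolding n_def by (rule LeastI_ex)
    have nl: "orb z \<inter> B m = {}" if "m < n" for m using not_less_Least that unfolding n_def by blast
    obtain y where y: "y \<in> orb z" "y \<in> B n" using n by blast
    then have yo: "orb y = orb z" using orb_eq_iff[OF zH] by (auto simp: orb_def orb_mact zH)
    have yH: "y \<in> half_plane" using BH(1)[of n] y(2) by blast
    have "y \<notin> S m" if "m < n" for m using Sorb[OF yH, of m] nl[OF that] yo by simp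
    then have yF: "y \<in> F" unfolding F_def using y(2) by blast
    have "y' = y" if y': "y' \<in> F" "orb y' = orb z" for y'
    proof -
      obtain k where k: "y' \<in> B k" "\<And>m. m < k \<Longrightarrow> y' \<notin> S m" using y'(1) unfolding F_def by blast
      have yH': "y' \<in> half_plane" using k BH by auto
      have "orb z \<inter> B k \<noteq> {}" using k(1) y'(2) orb_self by blast
      then have "\<not> k < n" using nl by blast
      moreover have "\<not> n < k" using k(2)[of n] Sorb[OF yH', of n] n y'(2) by auto
      ultimately have "k = n" by simp
      obtain g where g: "g \<in> \<Gamma>" "y' = mact g y"
        using orb_eq_iff[OF yH, of y'] y'(2) yo by auto
      then have "g = pid \<or> g = - pid" using B(1)[of n] y(2) k(1) \<open>k = n\<close> unfolding wandering_def by blast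
      then show ?thesis using g by auto
    qed
    with yF yo show ?thesis by blast
  qed
  ultimately show ?thesis by (rule that)
qed

end

section \<open>From discrete subgroups of \<open>PSL2R\<close> to groups of pairs\<close>

definition cmat_of :: "real^2^2 \<Rightarrow> cmat" where
  "cmat_of A = (Complex (A$1$2) (A$1$1), Complex (A$2$2) (A$2$1))"

lemma cmat_of_mult: "cmat_of (A ** B) = cmat_of A \<odot> cmat_of B"
  by (rule cmat_eqI) (simp_all add: cmat_of_def matrix_matrix_mult_def sum_2)

lemma cmat_of_minus: "cmat_of (- A) = - cmat_of A"
  by (rule cmat_eqI) (simp_all add: cmat_of_def)

lemma cmat_of_one: "cmat_of (mat 1) = pid"
  by (rule cmat_eqI) (simp_all add: cmat_of_def mat_def)

lemma pdet_cmat_of: "pdet (cmat_of A) = det A"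
  by (simp add: pdet_def cmat_of_def det_2)

lemma moebius_mact: "moebius A z = mact (cmat_of A) z"
  by (simp add: moebius_def mact_def cmat_of_def)

text \<open>The elements of \<open>G\<close> are cosets \<open>{A, - A}\<close>, so group laws in
  \<open>G\<close> hold for representatives up to sign, and the union is closed under negation,
  which repairs the sign.\<close>

lemma fuchsian_cmat_of:
  assumes "discrete_subgroup_PSL2R G" shows "fuchsian (cmat_of ` \<Union>G)"
proof -
  interpret S: group SL2R by (rule group_SL2R)
  interpret P: group PSL2R by (rule group_PSL2R)
  have sub: "subgroup G PSL2R" and disc: "discrete (\<Union>G)" using assms by (auto simp: discrete_subgroup_PSL2R_def)
  let ?N = "{mat 1, - mat 1} :: (real^2^2) set"
  have neg: "(- mat 1) ** A = - A" for A :: "real^2^2"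
    by (simp_all add: vec_eq_iff matrix_matrix_mult_def mat_def sum_2 forall_2)
  have carr: "\<exists>A. det A = 1 \<and> X = {A, - A}" if "X \<in> G" for X
  proof -
    have "X \<in> carrier PSL2R" using that subgroup.subset[OF sub] by auto
    then obtain A where A: "A \<in> carrier SL2R" "X = ?N #>\<^bsub>SL2R\<^esub> A"
      by (auto simp: PSL2R_def FactGroup_def RCOSETS_def)
    then show ?thesis by (intro exI[of _ A]) (auto simp: r_coset_def SL2R_def neg)
  qed
  have det: "det A = 1" if "A \<in> \<Union>G" for A
    using that by (auto dest!: carr simp: det_2)
  have minus: "- A \<in> \<Union>G" if A: "A \<in> \<Union>G" for A
  proof -
    obtain X where X: "X \<in> G" "A \<in> X" using A by blast
    obtain A' where "X = {A', - A'}" using carr[OF X(1)] by blast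
    with X(2) have "- A \<in> X" by auto
    with X(1) show ?thesis by blast
  qed
  have mult: "A ** B \<in> \<Union>G" if AB: "A \<in> \<Union>G" "B \<in> \<Union>G" for A B
  proof -
    obtain X Y where XY: "X \<in> G" "Y \<in> G" "A \<in> X" "B \<in> Y" using AB by blast
    have "X \<otimes>\<^bsub>PSL2R\<^esub> Y \<in> G" using subgroup.m_closed[OF sub] XY by blast
    moreover have "A ** B \<in> X \<otimes>\<^bsub>PSL2R\<^esub> Y"
      using XY by (auto simp: PSL2R_def FactGroup_def set_mult_def SL2R_def)
    ultimately show ?thesis by blast
  qed
  have one_carr: "\<one>\<^bsub>PSL2R\<^esub> = ?N" by (simp add: PSL2R_def FactGroup_def)
  have one: "mat 1 \<in> \<Union>G" using subgroup.one_closed[OF sub] one_carr by auto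
  have inv: "\<exists>B\<in>\<Union>G. B ** A = mat 1" if A: "A \<in> \<Union>G" for A
  proof -
    obtain X where X: "X \<in> G" "A \<in> X" using A by blast
    have XP: "X \<in> carrier PSL2R" using X subgroup.subset[OF sub] by auto
    have iX: "inv\<^bsub>PSL2R\<^esub> X \<in> G" using subgroup.m_inv_closed[OF sub] X by blast
    then obtain B where B: "B \<in> inv\<^bsub>PSL2R\<^esub> X" using carr by blast
    have "B ** A \<in> inv\<^bsub>PSL2R\<^esub> X \<otimes>\<^bsub>PSL2R\<^esub> X"
      using B X by (auto simp: PSL2R_def FactGroup_def set_mult_def SL2R_def)
    also have "inv\<^bsub>PSL2R\<^esub> X \<otimes>\<^bsub>PSL2R\<^esub> X = ?N" using P.l_inv[OF XP] one_carr by simp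
    finally have "B ** A = mat 1 \<or> B ** A = - mat 1" by simp
    then show ?thesis
    proof
      assume "B ** A = mat 1" then show ?thesis using B iX by blast
    next
      \<comment> \<open>The inverse coset determines the inverse matrix only up to sign;
        \<open>- B\<close> lies in it as well.\<close>
      assume "B ** A = - mat 1"
      then have "(- B) ** A = mat 1"
        by (simp add: vec_eq_iff matrix_matrix_mult_def sum_2 forall_2 mat_def)
      moreover have "- B \<in> \<Union>G" using minus B iX by blast
      ultimately show ?thesis by blast
    qed
  qed
  show ?thesis
  proof
    show "pdet g = 1" if "g \<in> cmat_of ` \<Union>G" for g using that by (elim imageE) (simp only: pdet_cmat_of det)
    show "pid \<in> cmat_of ` \<Union>G" using one cmat_of_one by (intro image_eqI[OF _ one]) simp
    show "g \<odot> h \<in> cmat_of ` \<Union>G" if gh: "g \<in> cmat_of ` \<Union>G" "h \<in> cmat_of ` \<Union>G" for g h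
    proof -
      obtain A B where AB: "A \<in> \<Union>G" "g = cmat_of A" "B \<in> \<Union>G" "h = cmat_of B" using gh by blast
      show ?thesis using imageI[OF mult[OF AB(1,3)], of cmat_of] by (simp only: AB cmat_of_mult)
    qed
    show "- g \<in> cmat_of ` \<Union>G" if g: "g \<in> cmat_of ` \<Union>G" for g
    proof -
      obtain A where A: "A \<in> \<Union>G" "g = cmat_of A" using g by blast
      show ?thesis using imageI[OF minus[OF A(1)], of cmat_of] by (simp only: A cmat_of_minus)
    qed
    show "pinv g \<in> cmat_of ` \<Union>G" if "g \<in> cmat_of ` \<Union>G" for g
    proof -
      obtain A where A: "A \<in> \<Union>G" "g = cmat_of A" using \<open>g \<in> cmat_of ` \<Union>G\<close> by blast
      obtain B where B: "B \<in> \<Union>G" "B ** A = mat 1" using inv[OF A(1)] by blast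
      have "cmat_of B \<odot> g = pid" using B(2) A(2) cmat_of_mult cmat_of_one by metis
      then have "(cmat_of B \<odot> g) \<odot> pinv g = pinv g" by simp
      then have "cmat_of B = pinv g" using A(2) det[OF A(1)] by (simp add: pdet_cmat_of)
      with imageI[OF B(1), of cmat_of] show ?thesis by (simp only:)
    qed
    show "\<exists>e>0. \<forall>g\<in>cmat_of ` \<Union>G. dist g pid < e \<longrightarrow> g = pid"
    proof -
      have "mat 1 isolated_in \<Union>G" using disc one discreteD by blast
      then obtain e where e: "e > 0" "\<And>A. A \<in> \<Union>G \<Longrightarrow> dist (mat 1) A < e \<Longrightarrow> A = mat 1"
        unfolding isolated_in_dist_Ex_iff by blast
      \<comment> \<open>Each of the four entries of the difference is at most the norm of the pair,
        whence the factor 4.\<close>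
      have "dist (mat 1) A \<le> 4 * dist (cmat_of A) pid" for A
      proof -
        have nc: "\<bar>Re w\<bar> \<le> cmod w" "\<bar>Im w\<bar> \<le> cmod w" for w by (simp_all add: abs_Re_le_cmod abs_Im_le_cmod)
        have c: "cmod (fst q) \<le> norm q" "cmod (snd q) \<le> norm q" for q :: cmat
          using norm_fst_le[of "fst q" "snd q"] norm_snd_le[of "snd q" "fst q"] by simp_all
        let ?q = "cmat_of A - pid"
        have "dist (mat 1) A = norm (A - mat 1)" by (simp add: dist_norm norm_minus_commute)
        also have "\<dots> \<le> norm ((A - mat 1)$1) + norm ((A - mat 1)$2)"
          using norm_le_l1_cart[of "\<chi> i. norm ((A - mat 1)$i)"] by (simp add: norm_vec_def L2_set_def sum_2 sqrt_sum_squares_le_sum)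
        also have "\<dots> \<le> (\<bar>A$1$1 - 1\<bar> + \<bar>A$1$2\<bar>) + (\<bar>A$2$1\<bar> + \<bar>A$2$2 - 1\<bar>)"
          using norm_le_l1_cart[of "(A - mat 1)$1"] norm_le_l1_cart[of "(A - mat 1)$2"]
          by (simp add: sum_2 mat_def)
        also have "\<dots> \<le> 4 * norm ?q"
          using nc[of "fst ?q"] nc[of "snd ?q"] c[of ?q] by (simp add: cmat_of_def pid_def)
        finally show ?thesis by (simp add: dist_norm)
      qed
      then have "\<forall>g\<in>cmat_of ` \<Union>G. dist g pid < e / 4 \<longrightarrow> g = pid"
      proof (intro ballI impI)
        fix g assume "g \<in> cmat_of ` \<Union>G" and d: "dist g pid < e / 4"
        then obtain A where A: "A \<in> \<Union>G" "g = cmat_of A" by blast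
        have "dist (mat 1) A < e" using d \<open>dist (mat 1) A \<le> 4 * dist (cmat_of A) pid\<close> by (simp add: A)
        then have "A = mat 1" by (rule e(2)[OF A(1)])
        then show "g = pid" by (simp add: A cmat_of_one)
      qed
      then show ?thesis using e(1) by (intro exI[of _ "e / 4"]) auto
    qed
  qed
qed

section \<open>Hyperbolic geodesics\<close>

text \<open>The halved exponents make the base point move with unit speed: \<open>dia t\<close>
  sends \<open>\<i>\<close> to \<open>\<i> * exp t\<close>.\<close>

definition dia :: "real \<Rightarrow> cmat" where
  "dia t = (Complex 0 (exp (t/2)), Complex (exp (- t/2)) 0)"

lemma dia_simps[simp]: "Re (fst (dia t)) = 0" "Im (fst (dia t)) = exp (t/2)" "Re (snd (dia t)) = exp (- t/2)" "Im (snd (dia t)) = 0"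
  by (simp_all add: dia_def)

lemma pdet_dia[simp]: "pdet (dia t) = 1"
  by (simp add: pdet_def flip: exp_add)

lemma dia_mult: "dia s \<odot> dia t = dia (s + t)"
  by (rule cmat_eqI) (simp_all add: add_divide_distrib flip: exp_add)

lemma dia_0: "dia 0 = pid"
  by (rule cmat_eqI) simp_all

lemma pt_pid[simp]: "pt pid = \<i>" by (simp add: pt_def)

definition ax :: "real \<Rightarrow> complex" where "ax t = Complex 0 (exp t)"

lemma ax_simps[simp]: "Re (ax t) = 0" "Im (ax t) = exp t"
  by (simp_all add: ax_def)

lemma ax_0[simp]: "ax 0 = \<i>" by (simp add: complex_eq_iff)

lemma ax_half_plane[simp]: "ax t \<in> half_plane" by (simp add: half_plane_def)

lemma ax_exp: "ax t = \<i> * exp (complex_of_real t)"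
  by (simp add: complex_eq_iff Re_exp Im_exp)

lemma pt_dia: "pt (dia t) = ax t"
proof -
  have "pt (dia t) = Complex 0 (exp (t/2) / exp (- t/2))"
    by (simp add: pt_def dia_def complex_eq_iff Re_divide Im_divide power2_eq_square)
  also have "exp (t/2) / exp (- t/2) = exp t" by (simp flip: exp_diff)
  finally show ?thesis by (simp add: ax_def)
qed

lemma pt_mact: "pt g = mact g \<i>"
  using pt_pmul[of pid g] by simp

lemma pt_mult_dia: "pt (g \<odot> dia t) = mact g (ax t)"
proof -
  have "snd (dia t) \<noteq> 0" by (simp add: complex_eq_iff)
  then show ?thesis using pt_pmul[of "dia t" g] by (simp add: pt_dia)
qed

section \<open>Isometries and the classification of geodesics\<close>

lemma mact_diff:
  assumes "pdet g > 0" "Im z > 0" "Im w > 0"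
  shows "mact g z - mact g w = of_real (pdet g) * (z - w) / (mden g z * mden g w)"
proof -
  have "mden g z \<noteq> 0" "mden g w \<noteq> 0" using mden_nz assms by auto
  then have "mact g z - mact g w = ((of_real (Im (fst g)) * z + of_real (Re (fst g))) * mden g w - (of_real (Im (fst g)) * w + of_real (Re (fst g))) * mden g z) / (mden g z * mden g w)"
    by (simp add: mact_def flip: mden_def) (simp add: field_simps)
  also have "(of_real (Im (fst g)) * z + of_real (Re (fst g))) * mden g w - (of_real (Im (fst g)) * w + of_real (Re (fst g))) * mden g z = of_real (pdet g) * (z - w)"
    by (simp add: mden_def pdet_def algebra_simps)
  finally show ?thesis .
qed

lemma hyp_dist_mact:
  assumes "pdet g > 0" "z \<in> half_plane" "w \<in> half_plane"
  shows "hyp_dist (mact g z) (mact g w) = hyp_dist z w"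
proof -
  have z: "Im z > 0" and w: "Im w > 0" using assms by (auto simp: half_plane_def)
  have nz: "mden g z \<noteq> 0" "mden g w \<noteq> 0" using mden_nz assms z w by auto
  have "(cmod (mact g z - mact g w))\<^sup>2 / (2 * Im (mact g z) * Im (mact g w)) = (cmod (z - w))\<^sup>2 / (2 * Im z * Im w)"
  proof -
    have "cmod (mact g z - mact g w) = pdet g * cmod (z - w) / (cmod (mden g z) * cmod (mden g w))"
      using assms(1) z w by (simp add: mact_diff norm_mult norm_divide)
    then show ?thesis using nz z w assms(1)
      by (simp add: Im_mact power_divide power_mult_distrib) (simp add: field_simps power2_eq_square)
  qed
  then show ?thesis by (simp add: hyp_dist_def)
qed

lemma cosh_hyp_dist:
  assumes "z \<in> half_plane" "w \<in> half_plane"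
  shows "cosh (hyp_dist z w) = 1 + (cmod (z - w))\<^sup>2 / (2 * Im z * Im w)"
  unfolding hyp_dist_def using assms by (intro cosh_arcosh_real) (auto simp: half_plane_def)

lemma hyp_dist_axis: "hyp_dist (ax s) (ax t) = \<bar>s - t\<bar>"
proof -
  have n: "cmod (ax s - ax t) = \<bar>exp s - exp t\<bar>"
    by (simp add: cmod_def)
  have "1 + (exp s - exp t)\<^sup>2 / (2 * exp s * exp t) = (exp s / exp t + exp t / exp s) / 2"
    by (simp add: field_simps power2_eq_square)
  also have "\<dots> = cosh (s - t)" by (simp add: cosh_def exp_diff)
  also have "\<dots> = cosh \<bar>s - t\<bar>" by simp
  finally have "hyp_dist (ax s) (ax t) = arcosh (cosh \<bar>s - t\<bar>)"
    by (simp add: hyp_dist_def n)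
  then show ?thesis by (simp add: arcosh_cosh_real del: cosh_real_abs)
qed

lemma hyp_geodesic_mact:
  assumes "pdet g > 0" shows "hyp_geodesic (\<lambda>t. mact g (ax t))"
  unfolding hyp_geodesic_def using assms
  by (simp add: mact_half_plane hyp_dist_mact) (simp add: hyp_dist_axis)

text \<open>The distances from \<open>c t\<close> to \<open>\<i>\<close> and to \<open>ax 1\<close>
  are prescribed. These are two circle equations; their difference fixes the height as
  \<open>exp t\<close>, and then the horizontal coordinate vanishes.\<close>

lemma geodesic_normal_form:
  assumes c: "hyp_geodesic c" and c0: "c 0 = \<i>" and c1: "c 1 = ax 1"
  shows "c t = ax t"
proof -
  obtain x y where xy: "c t = Complex x y" by (metis complex_surj)
  have H: "c t \<in> half_plane" "\<i> \<in> half_plane" "ax 1 \<in> half_plane"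
    using c by (auto simp: hyp_geodesic_def half_plane_def)
  then have y: "y > 0" by (simp add: xy half_plane_def)
  have "hyp_dist (c t) (c 0) = \<bar>t - 0\<bar>" "hyp_dist (c t) (c 1) = \<bar>t - 1\<bar>"
    using c unfolding hyp_geodesic_def by blast+
  then have d: "hyp_dist (c t) \<i> = \<bar>t\<bar>" "hyp_dist (c t) (ax 1) = \<bar>t - 1\<bar>"
    by (simp_all add: c0 c1)
  define E F where "E = exp t" and "F = exp (1::real)"
  have E: "E > 0" and F: "F > 1" by (simp_all add: E_def F_def)
  have "cosh t = 1 + (x\<^sup>2 + (y - 1)\<^sup>2) / (2 * y)"
    using cosh_hyp_dist[OF H(1,2)] by (simp only: d) (simp add: xy cmod_power2)
  moreover have "cosh t = (E + 1 / E) / 2" by (simp add: cosh_def E_def exp_minus inverse_eq_divide)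
  ultimately have "(E + 1 / E) / 2 = 1 + (x\<^sup>2 + (y - 1)\<^sup>2) / (2 * y)" by simp
  then have "2 * y * ((E + 1 / E) / 2) = 2 * y * (1 + (x\<^sup>2 + (y - 1)\<^sup>2) / (2 * y))" by (simp only:)
  also have "\<dots> = 2 * y + (x\<^sup>2 + (y - 1)\<^sup>2)" using y by (simp add: field_simps)
  also have "2 * y * ((E + 1 / E) / 2) = y * (E + 1 / E)" by simp
  finally have 1: "x\<^sup>2 + y\<^sup>2 + 1 = y * (E + 1 / E)" by (simp add: power2_eq_square algebra_simps)
  have "cosh (t - 1) = 1 + (x\<^sup>2 + (y - F)\<^sup>2) / (2 * y * F)"
    using cosh_hyp_dist[OF H(1,3)] by (simp only: d) (simp add: xy cmod_power2 F_def)
  moreover have "cosh (t - 1) = (E / F + F / E) / 2"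
    by (simp add: cosh_def E_def F_def exp_diff)
  ultimately have "1 + (x\<^sup>2 + (y - F)\<^sup>2) / (2 * y * F) = (E / F + F / E) / 2" by simp
  then have "2 * y * F * (1 + (x\<^sup>2 + (y - F)\<^sup>2) / (2 * y * F)) = 2 * y * F * ((E / F + F / E) / 2)" by (simp only:)
  also have "2 * y * F * (1 + (x\<^sup>2 + (y - F)\<^sup>2) / (2 * y * F)) = 2 * y * F + (x\<^sup>2 + (y - F)\<^sup>2)"
    using y F by (simp add: field_simps)
  also have "2 * y * F * ((E / F + F / E) / 2) = y * (E + F\<^sup>2 / E)"
    using F E by (simp add: power2_eq_square field_simps)
  finally have 2: "x\<^sup>2 + y\<^sup>2 + F\<^sup>2 = y * (E + F\<^sup>2 / E)" by (simp add: power2_eq_square algebra_simps)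
  \<comment> \<open>The difference of the two circle equations, in which \<open>x\<close> has
    cancelled.\<close>
  have "F\<^sup>2 - 1 = y / E * (F\<^sup>2 - 1)" using 1 2 E by (simp add: field_simps)
  moreover have "F\<^sup>2 - 1 \<noteq> 0" using F by (simp add: power2_eq_1_iff)
  ultimately have "y / E = 1" using mult_cancel_right1[of "F\<^sup>2 - 1" "y / E"] by blast
  then have yE: "y = E" using E by (simp add: field_simps)
  with 1 E have "x = 0" by (simp add: field_simps power2_eq_square)
  with yE show ?thesis by (simp add: xy E_def ax_def)
qed

text \<open>A rotation about \<open>\<i>\<close> brings \<open>w\<close> onto the imaginary axis,
  where distance 1 leaves the points \<open>ax 1\<close> and \<open>ax (- 1)\<close>; a half turn
  exchanges them.\<close>

lemma rotate_to_axis: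
  assumes w: "w \<in> half_plane" and d: "hyp_dist \<i> w = 1"
  shows "\<exists>k. pdet k = 1 \<and> mact k \<i> = \<i> \<and> mact k w = ax 1"
proof -
  obtain X Y where XY: "w = Complex X Y" by (metis complex_surj)
  \<comment> \<open>Up to a positive factor the matrix \<open>k\<close> with half angle
    \<open>\<phi> / 2\<close> gives \<open>w\<close> the real part
    \<open>X * cos \<phi> + B * sin \<phi>\<close>; the angle is chosen to make this vanish.\<close>
  define B where "B = (1 - X\<^sup>2 - Y\<^sup>2) / 2"
  obtain \<phi> where \<phi>: "X * cos \<phi> + B * sin \<phi> = 0"
  proof (cases "X\<^sup>2 + B\<^sup>2 = 0")
    case True
    then show ?thesis using that[of 0] by (simp add: sum_power2_eq_zero_iff)
  next
    case False
    define r where "r = sqrt (X\<^sup>2 + B\<^sup>2)"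
    have r: "r > 0" "r\<^sup>2 = X\<^sup>2 + B\<^sup>2" using False by (auto simp: r_def sum_power2_gt_zero_iff)
    have "(- B / r)\<^sup>2 + (X / r)\<^sup>2 = (X\<^sup>2 + B\<^sup>2) / r\<^sup>2"
      by (simp add: power_divide add_divide_distrib)
    also have "\<dots> = 1" using r False by simp
    finally have "(- B / r)\<^sup>2 + (X / r)\<^sup>2 = 1" .
    then obtain t where "- B / r = cos t" "X / r = sin t" by (metis sincos_total_2pi)
    then have "- B = r * cos t" and X: "X = r * sin t" using r by (auto simp: field_simps)
    then have B: "B = - (r * cos t)" by linarith
    show ?thesis by (rule that[of t]) (simp add: B X)
  qed
  define C S where "C = cos (\<phi> / 2)" and "S = sin (\<phi> / 2)"
  have CS: "C\<^sup>2 + S\<^sup>2 = 1" by (simp add: C_def S_def)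
  have cp: "cos \<phi> = C\<^sup>2 - S\<^sup>2" "sin \<phi> = 2 * S * C"
    using cos_double[of "\<phi>/2"] sin_double[of "\<phi>/2"] by (simp_all add: C_def S_def)
  define k where "k = (Complex S C, Complex C (- S))"
  have kd: "pdet k = 1" using CS by (simp add: k_def pdet_def power2_eq_square)
  have ki: "mact k \<i> = \<i>"
  proof -
    have "mden k \<i> \<noteq> 0" using mden_nz[of k \<i>] kd by simp
    then have nz: "of_real C - of_real S * \<i> \<noteq> 0" by (simp add: mden_def k_def algebra_simps)
    have "of_real C * \<i> + of_real S = \<i> * (of_real C - of_real S * \<i>)" by (simp add: algebra_simps)
    then show ?thesis using nz by (simp add: mact_def k_def)
  qed
  have kw: "mact k w \<in> half_plane" using w kd by (intro mact_half_plane) auto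
  have "Re (mact k w) = 0"
  proof -
    have "(C * X + S) * (- S * X + C) + (C * Y) * (- S * Y) = X * (C\<^sup>2 - S\<^sup>2) + B * (2 * S * C)"
      by (simp add: B_def field_simps power2_eq_square)
    also have "\<dots> = 0" using \<phi> cp by simp
    finally show ?thesis by (simp add: mact_def k_def XY Re_divide)
  qed
  then obtain \<eta> where \<eta>: "mact k w = Complex 0 \<eta>" "\<eta> > 0"
    using kw by (metis complex_surj half_plane_def mem_Collect_eq)
  define s where "s = ln \<eta>"
  have s: "mact k w = ax s" using \<eta> by (simp add: s_def ax_def)
  have ih: "\<i> \<in> half_plane" by (simp add: half_plane_def)
  have "hyp_dist (mact k \<i>) (mact k w) = 1" using hyp_dist_mact[of k \<i> w] kd w d ih by simp
  then have "hyp_dist (ax 0) (ax s) = 1" by (simp add: ki s)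
  then have "\<bar>s\<bar> = 1" by (simp only: hyp_dist_axis)
  then consider "s = 1" | "s = - 1" by linarith
  then show ?thesis
  proof cases
    case 1 then show ?thesis using kd ki s by blast
  next
    case 2
    \<comment> \<open>The half turn \<open>z \<mapsto> - 1 / z\<close> about
      \<open>\<i>\<close>.\<close>
    define J where "J = (Complex 1 0, Complex 0 (-1))"
    have J: "pdet J = 1" by (simp add: J_def pdet_def)
    have Ja: "mact J z = - 1 / z" for z by (simp add: mact_def J_def)
    have "pdet (J \<odot> k) = 1" using J kd by simp
    moreover have "mact (J \<odot> k) \<i> = \<i>" using mact_pmul[of J k \<i>] J kd ki by (simp add: Ja)
    moreover have "mact (J \<odot> k) w = ax 1"
      using mact_pmul[of J k w] J kd w s 2
      by (simp add: half_plane_def Ja complex_eq_iff Re_divide Im_divide power2_eq_square exp_minus inverse_eq_divide)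
    ultimately show ?thesis by blast
  qed
qed

lemma to_i:
  assumes "z \<in> half_plane" shows "\<exists>g. pdet g = 1 \<and> mact g \<i> = z"
proof -
  have y: "Im z > 0" using assms by (simp add: half_plane_def)
  let ?r = "sqrt (Im z)"
  let ?g = "(Complex (Re z / ?r) ?r, Complex (1 / ?r) 0)"
  have "pdet ?g = 1" using y by (simp add: pdet_def)
  moreover have "mact ?g \<i> = z"
    using y by (simp add: mact_def complex_eq_iff Re_divide Im_divide power2_eq_square mult.assoc)
  ultimately show ?thesis by blast
qed

lemma hyp_geodesic_comp_mact:
  assumes "hyp_geodesic c" "pdet g > 0" shows "hyp_geodesic (\<lambda>t. mact g (c t))"
  using assms by (simp add: hyp_geodesic_def mact_half_plane hyp_dist_mact)

text \<open>Move \<open>c 0\<close> to \<open>\<i>\<close>, then rotate \<open>c 1\<close> to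
  \<open>ax 1\<close>; the normal form identifies the rest, and the two isometries are
  undone.\<close>

lemma hyp_geodesic_form:
  assumes c: "hyp_geodesic c"
  shows "\<exists>g. pdet g = 1 \<and> (\<forall>t. c t = mact g (ax t))"
proof -
  have cH: "c t \<in> half_plane" for t using c by (simp add: hyp_geodesic_def)
  obtain g where g: "pdet g = 1" "mact g \<i> = c 0" using to_i[OF cH] by blast
  have ih: "\<i> \<in> half_plane" by (simp add: half_plane_def)
  have pg: "pdet (pinv g) = 1" using g by (simp add: pdet_pinv)
  define c1 where "c1 t = mact (pinv g) (c t)" for t
  have c1: "hyp_geodesic c1" unfolding c1_def using c pg by (intro hyp_geodesic_comp_mact) auto
  have c10: "c1 0 = \<i>" unfolding c1_def g(2)[symmetric] using mact_pinv(1)[of g \<i>] g ih by simp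
  have "hyp_dist (c1 0) (c1 1) = \<bar>0 - 1\<bar>" using c1 unfolding hyp_geodesic_def by blast
  then have "hyp_dist \<i> (c1 1) = 1" by (simp add: c10)
  moreover have "c1 1 \<in> half_plane" using c1 by (simp add: hyp_geodesic_def)
  ultimately obtain k where k: "pdet k = 1" "mact k \<i> = \<i>" "mact k (c1 1) = ax 1"
    using rotate_to_axis by blast
  have c2: "mact k (c1 t) = ax t" for t
    by (rule geodesic_normal_form[of "\<lambda>t. mact k (c1 t)"]) (use c1 c10 k in \<open>auto intro: hyp_geodesic_comp_mact\<close>)
  have c1H: "c1 t \<in> half_plane" for t using c1 by (simp add: hyp_geodesic_def)
  have "c t = mact (g \<odot> pinv k) (ax t)" for t
  proof -
    have "mact (g \<odot> pinv k) (ax t) = mact g (mact (pinv k) (ax t))"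
      using ax_half_plane[of t] g k by (intro mact_pmul) (auto simp: pdet_pinv half_plane_def)
    also have "mact (pinv k) (ax t) = c1 t"
      unfolding c2[symmetric] using k c1H[of t] by (simp add: mact_pinv)
    also have "mact g (c1 t) = c t" unfolding c1_def using g cH[of t] by (simp add: mact_pinv)
    finally show ?thesis by simp
  qed
  moreover have "pdet (g \<odot> pinv k) = 1" using g k by (simp add: pdet_pinv)
  ultimately show ?thesis by blast
qed

section \<open>Tangent vectors and the flow in matrix coordinates\<close>

lemma mden_i: "mden g \<i> = snd g"
  by (simp add: mden_def complex_eq_iff)

lemma has_field_derivative_mact:
  assumes "pdet g > 0" "Im z > 0"
  shows "(mact g has_field_derivative of_real (pdet g) / (mden g z)\<^sup>2) (at z)"
proof -
  have "mden g z \<noteq> 0" using mden_nz assms by blast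
  then show ?thesis
    unfolding mact_def mden_def
    by (auto intro!: derivative_eq_intros simp: pdet_def power2_eq_square algebra_simps)
qed

lemma geodesic_vector_derivative:
  assumes "pdet g > 0"
  shows "((\<lambda>t. mact g (ax t)) has_vector_derivative
     ax t * of_real (pdet g) / (mden g (ax t))\<^sup>2) (at t)"
proof -
  have 1: "((\<lambda>z. \<i> * exp z) has_field_derivative ax t) (at (complex_of_real t))"
    unfolding ax_exp by (auto intro!: derivative_eq_intros)
  have 2: "(mact g has_field_derivative of_real (pdet g) / (mden g (ax t))\<^sup>2) (at (ax t))"
    using assms ax_half_plane[of t] by (intro has_field_derivative_mact) (auto simp: half_plane_def)
  have "((\<lambda>z. mact g (\<i> * exp z)) has_field_derivative
     of_real (pdet g) / (mden g (ax t))\<^sup>2 * ax t) (at (complex_of_real t))"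
    by (rule DERIV_chain2[OF 2[unfolded ax_exp] 1, unfolded ax_exp[symmetric]])
  from has_vector_derivative_real_field[OF this] show ?thesis by (simp add: mult_ac ax_exp)
qed

lemma sgn_power2: "sgn (b\<^sup>2) = (sgn (b::complex))\<^sup>2"
  by (simp add: power2_eq_square sgn_mult)

text \<open>Uniqueness needs the classification: a competitor is the image of the axis under some
  \<open>h\<close> of determinant 1, its initial velocity is \<open>\<i> / (snd h)\<^sup>2\<close>,
  so \<open>h\<close> equals \<open>g\<close> or \<open>- g\<close>, and both give the same
  curve.\<close>

lemma geodesic_from_tang:
  assumes g: "pdet g = 1"
  shows "geodesic_from (tang g) = (\<lambda>t. mact g (ax t))"
  unfolding geodesic_from_def
proof (rule the_equality)
  have snz: "snd g \<noteq> 0" using PW_snd[of g] g by (simp add: PW_def)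
  have der: "Im (fst (tang h)) *\<^sub>R snd (tang h) = \<i> / (snd h)\<^sup>2" if h: "pdet h = 1" for h
  proof -
    have "snd h \<noteq> 0" using PW_snd[of h] h by (simp add: PW_def)
    then show ?thesis using h
      by (simp add: tang_def pt_simps sgn_div_norm scaleR_conv_of_real power_mult_distrib field_simps)
  qed
  have d0: "((\<lambda>t. mact h (ax t)) has_vector_derivative \<i> / (snd h)\<^sup>2) (at 0)" if "pdet h = 1" for h
    using geodesic_vector_derivative[of h 0] that by (simp add: mden_i)
  show "hyp_geodesic (\<lambda>t. mact g (ax t)) \<and>
    mact g (ax 0) = fst (tang g) \<and>
    ((\<lambda>t. mact g (ax t)) has_vector_derivative Im (fst (tang g)) *\<^sub>R snd (tang g)) (at 0)"
    using g hyp_geodesic_mact[of g] d0[OF g] der[OF g] by (simp add: tang_def pt_mact)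
  fix c assume c: "hyp_geodesic c \<and> c 0 = fst (tang g) \<and> (c has_vector_derivative Im (fst (tang g)) *\<^sub>R snd (tang g)) (at 0)"
  then obtain h where h: "pdet h = 1" "\<And>t. c t = mact h (ax t)"
    using hyp_geodesic_form by blast
  have ceq: "c = (\<lambda>t. mact h (ax t))" using h by auto
  have "\<i> / (snd h)\<^sup>2 = \<i> / (snd g)\<^sup>2"
    using c d0[OF h(1)] der[OF g] unfolding ceq by (metis vector_derivative_unique_at)
  moreover have snh: "snd h \<noteq> 0" using PW_snd[of h] h by (simp add: PW_def)
  ultimately have "(snd h)\<^sup>2 = (snd g)\<^sup>2" using snz by (simp add: field_simps)
  then have s: "snd h = snd g \<or> snd h = - snd g" by (simp add: power2_eq_iff)
  have "pt h = pt g" using c h(2)[of 0] by (simp add: tang_def pt_mact)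
  moreover have "fst h = pt h * snd h" "fst g = pt g * snd g" using snh snz by (simp_all add: pt_def)
  ultimately have f: "fst h = pt g * snd h" "fst g = pt g * snd g" by simp_all
  have "h = g \<or> h = - g" using s f by (auto simp: prod_eq_iff)
  then show "c = (\<lambda>t. mact g (ax t))" using ceq by auto
qed

lemma snd_mult_dia: "snd (g \<odot> dia t) = complex_of_real (exp (- t / 2)) * mden g (ax t)"
proof -
  have "exp (t/2) = exp (- t/2) * exp t" by (simp flip: exp_add)
  then show ?thesis by (simp add: complex_eq_iff mden_def Re_exp Im_exp)
qed

text \<open>The velocity involves \<open>mden g (ax t)\<close>, which differs from
  \<open>snd (g \<odot> dia t)\<close> by a positive factor that \<open>sgn\<close>
  discards.\<close>

lemma geodesic_flow_tang:
  assumes g: "pdet g = 1"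
  shows "geodesic_flow t (tang g) = tang (g \<odot> dia t)"
proof -
  let ?z = "ax t"
  have "vector_derivative (geodesic_from (tang g)) (at t) = ?z * of_real (pdet g) / (mden g ?z)\<^sup>2"
    unfolding geodesic_from_tang[OF g] by (rule vector_derivative_at, rule geodesic_vector_derivative) (simp add: g)
  moreover have "sgn (?z * of_real (pdet g) / (mden g ?z)\<^sup>2) = \<i> / (sgn (snd (g \<odot> dia t)))\<^sup>2"
  proof -
    have "sgn (complex_of_real (exp (- t / 2))) = 1" by (simp only: sgn_of_real) simp
    moreover have "sgn ?z = \<i>" by (simp add: sgn_div_norm cmod_def complex_eq_iff)
    ultimately show ?thesis by (simp add: g sgn_divide sgn_power2 sgn_mult snd_mult_dia)
  qed
  moreover have "geodesic_from (tang g) t = mact g (ax t)" by (simp only: geodesic_from_tang[OF g])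
  ultimately show ?thesis
    by (simp only: geodesic_flow_def tang_def[of "g \<odot> dia t"] pt_mult_dia)
qed

text \<open>The chain rule: the automorphy factor of a product is the product of the automorphy
  factors.\<close>

lemma moebius_tangent_tang:
  assumes A: "det A = 1" and g: "pdet g = 1"
  shows "moebius_tangent A (tang g) = tang (cmat_of A \<odot> g)"
proof -
  let ?z = "pt g" and ?h = "cmat_of A"
  have z: "Im ?z > 0" using PW_iff_pt[of g] g by (simp add: PW_def)
  have h: "pdet ?h = 1" using A by (simp add: pdet_cmat_of)
  have snz: "snd g \<noteq> 0" using PW_snd[of g] g by (simp add: PW_def)
  have m: "moebius A = mact ?h" by (rule ext) (rule moebius_mact)
  have "deriv (moebius A) ?z = 1 / (mden ?h ?z)\<^sup>2"
    unfolding m using has_field_derivative_mact[of ?h ?z] h z by (intro DERIV_imp_deriv) simp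
  moreover have "snd (?h \<odot> g) = mden ?h ?z * snd g"
    using snz by (simp add: mden_def pt_def pmul_def scaleR_conv_of_real distrib_right)
  ultimately show ?thesis
    by (simp add: moebius_tangent_def tang_def m pt_pmul[OF snz] sgn_mult sgn_divide sgn_power2 power_mult_distrib)
       (simp add: sgn_div_norm)
qed

lemma tang_scaleR[simp]:
  assumes "r \<noteq> 0" shows "tang (r *\<^sub>R p) = tang p"
  using assms by (simp add: tang_def scaleR_conv_of_real sgn_mult power_mult_distrib)
    (simp add: sgn_of_real power2_eq_square sgn_if flip: of_real_mult)

text \<open>The square of \<open>sgn (snd p)\<close> forgets only a sign, and the modulus of
  \<open>snd p\<close> is the scaling; so the fibres of \<open>tang\<close> in \<open>PW\<close> are
  punctured real lines.\<close>

lemma tang_eq_imp_scaleR: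
  assumes "tang p = tang q" "p \<in> PW" "q \<in> PW"
  shows "\<exists>r. r \<noteq> 0 \<and> p = r *\<^sub>R q"
proof -
  have nz: "snd p \<noteq> 0" "snd q \<noteq> 0" using assms PW_snd by auto
  have "(sgn (snd p))\<^sup>2 = (sgn (snd q))\<^sup>2" and pq: "pt p = pt q"
    using assms(1) nz by (auto simp: tang_def sgn_zero_iff frac_eq_eq)
  then have "sgn (snd p) = sgn (snd q) \<or> sgn (snd p) = - sgn (snd q)" by (simp add: power2_eq_iff)
  then obtain e :: real where e: "e = 1 \<or> e = -1" "sgn (snd p) = e *\<^sub>R sgn (snd q)"
    by (metis scaleR_minus1_left scaleR_one)
  let ?r = "e * cmod (snd p) / cmod (snd q)"
  have "snd p = cmod (snd p) *\<^sub>R sgn (snd p)" using nz by (simp add: sgn_div_norm)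
  also have "\<dots> = ?r *\<^sub>R snd q" using e nz by (simp add: sgn_div_norm divide_inverse mult_ac)
  finally have s: "snd p = ?r *\<^sub>R snd q" .
  have "fst p = pt p * snd p" "fst q = pt q * snd q" using nz by (auto simp: pt_def)
  then have "fst p = ?r *\<^sub>R fst q" using s pq by (metis mult_scaleR_right)
  with s have "p = ?r *\<^sub>R q" by (simp add: prod_eq_iff)
  moreover have "?r \<noteq> 0" using e nz by auto
  ultimately show ?thesis by blast
qed

text \<open>A Borel section of \<open>tang\<close> with values of determinant 1; the principal
  square root chooses one of the two matrices over a vector.\<close>

definition tsec :: "complex \<times> complex \<Rightarrow> cmat" where
  "tsec v = (let w = csqrt (\<i> / snd v) /\<^sub>R sqrt (Im (fst v)) in (fst v * w, w))"

lemma tsec: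
  assumes "v \<in> unit_tangent" shows "tang (tsec v) = v" "pdet (tsec v) = 1"
proof -
  obtain z u where v: "v = (z, u)" by (metis surj_pair)
  have z: "Im z > 0" and u: "cmod u = 1" using assms by (auto simp: v unit_tangent_def half_plane_def)
  define w where "w = csqrt (\<i> / u) /\<^sub>R sqrt (Im z)"
  have n: "cmod (csqrt (\<i> / u)) = 1" using u by (simp add: norm_divide norm_csqrt)
  then have c0: "csqrt (\<i> / u) \<noteq> 0" by auto
  have nw: "(cmod w)\<^sup>2 = 1 / Im z" using n z by (simp add: w_def power_divide inverse_eq_divide)
  have w0: "w \<noteq> 0" using c0 z by (simp add: w_def)
  have pt: "pt (z * w, w) = z" using w0 by (simp add: pt_def)
  have t: "tsec v = (z * w, w)" by (simp add: tsec_def v Let_def w_def)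
  have "Im z = pdet (z * w, w) / (cmod w)\<^sup>2" using pt_simps(1)[of "(z * w, w)"] unfolding pt by simp
  then show "pdet (tsec v) = 1" unfolding t nw using z by (simp add: field_simps)
  have "sgn w = csqrt (\<i> / u)" using z n by (simp add: w_def sgn_div_norm)
  then have "(sgn w)\<^sup>2 = \<i> / u" by simp
  moreover have "u \<noteq> 0" using u by auto
  ultimately show "tang (tsec v) = v" unfolding v t[unfolded v] tang_def pt by simp
qed

lemma borel_measurable_tsec: "tsec \<in> borel_measurable borel"
proof -
  have cs: "csqrt \<in> borel_measurable borel"
  proof -
    have "(\<lambda>z. complex_of_real (sqrt ((cmod z + Re z) / 2)) + \<i> * complex_of_real ((if Im z = 0 then 1 else sgn (Im z)) * sqrt ((cmod z - Re z) / 2))) \<in> borel_measurable borel"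
      by measurable
    moreover have "csqrt = (\<lambda>z. complex_of_real (sqrt ((cmod z + Re z) / 2)) + \<i> * complex_of_real ((if Im z = 0 then 1 else sgn (Im z)) * sqrt ((cmod z - Re z) / 2)))"
      by (rule ext) (simp add: complex_eq_iff)
    ultimately show ?thesis by (simp only:)
  qed
  have 1: "(\<lambda>v::complex\<times>complex. csqrt (\<i> / snd v)) \<in> borel_measurable borel"
    by (rule measurable_compose[OF _ cs]) (intro borel_measurable_divide borel_measurable_const borel_measurable_snd)
  have 2: "(\<lambda>v::complex\<times>complex. inverse (sqrt (Im (fst v)))) \<in> borel_measurable borel"
    by (intro borel_measurable_inverse borel_measurable_continuous_onI continuous_intros)
  show ?thesis unfolding tsec_def Let_def
    by (intro borel_measurable_Pair borel_measurable_times borel_measurable_scaleR borel_measurable_fst 1 2)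
qed

lemma borel_unit_tangent: "unit_tangent \<in> sets borel"
proof -
  have "unit_tangent = {v. 0 < Im (fst v)} \<inter> {v. cmod (snd v) = 1}" by (auto simp: unit_tangent_def half_plane_def)
  moreover have "open {v::complex\<times>complex. 0 < Im (fst v)}" by (intro open_Collect_less continuous_intros)
  moreover have "closed {v::complex\<times>complex. cmod (snd v) = 1}" by (intro closed_Collect_eq continuous_intros)
  ultimately show ?thesis by (metis borel_open borel_closed sets.Int)
qed

text \<open>For a cone \<open>N\<close> membership can be tested at the section alone, so the image
  is the preimage of \<open>N\<close> under \<open>tsec\<close>, cut down to
  \<open>unit_tangent\<close>, and this is Borel.\<close>

lemma tang_image_borel:
  assumes N: "N \<in> sets borel" "N \<subseteq> PW" and sc: "\<And>r p. r \<noteq> 0 \<Longrightarrow> p \<in> N \<Longrightarrow> r *\<^sub>R p \<in> N"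
  shows "tang ` N \<in> sets borel" "tang ` N \<subseteq> unit_tangent" "{p. tang p \<in> tang ` N} = N"
proof -
  have tu: "tang p \<in> unit_tangent" if "p \<in> PW" for p
    using that PW_iff_pt[of p] PW_snd[of p] by (simp add: tang_def unit_tangent_def half_plane_def norm_divide norm_power norm_sgn)
  show "tang ` N \<subseteq> unit_tangent" using tu N by auto
  have tn: "tang p \<in> tang ` N \<longleftrightarrow> p \<in> N" if "p \<in> PW" for p
  proof
    assume "tang p \<in> tang ` N"
    then obtain q where q: "q \<in> N" "tang p = tang q" by blast
    have "q \<in> PW" using q N by blast
    from tang_eq_imp_scaleR[OF q(2) that this] obtain r where "r \<noteq> 0" and p: "p = r *\<^sub>R q" by blast
    then show "p \<in> N" unfolding p using sc q by simp
  qed simp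
  have "p \<in> PW" if "tang p \<in> tang ` N" for p
  proof -
    have "fst (tang p) \<in> half_plane" using that \<open>tang ` N \<subseteq> unit_tangent\<close> by (auto simp: unit_tangent_def)
    then show ?thesis using PW_iff_pt[of p] by (simp add: tang_def half_plane_def)
  qed
  then show "{p. tang p \<in> tang ` N} = N" using tn N by blast
  have "tang ` N = tsec -` N \<inter> unit_tangent"
  proof (intro equalityI subsetI)
    fix v assume v: "v \<in> tang ` N"
    then have vu: "v \<in> unit_tangent" using \<open>tang ` N \<subseteq> unit_tangent\<close> by blast
    have "tsec v \<in> PW" using tsec[OF vu] by (simp add: PW_def)
    then have "tsec v \<in> N" using tn[of "tsec v"] tsec[OF vu] v by simp
    then show "v \<in> tsec -` N \<inter> unit_tangent" using vu by blast
  next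
    fix v assume "v \<in> tsec -` N \<inter> unit_tangent"
    then show "v \<in> tang ` N" using tsec[of v] by (metis IntE image_eqI vimageE)
  qed
  moreover note borel_unit_tangent
  moreover have "tsec -` N \<in> sets borel" using measurable_sets[OF borel_measurable_tsec N(1)] by simp
  ultimately show "tang ` N \<in> sets borel" by auto
qed

section \<open>Unfolding over a Fuchsian group\<close>

lemma measurable_count_integral:
  fixes f :: "'i \<Rightarrow> 'a \<Rightarrow> ennreal"
  assumes I: "countable I" and f: "\<And>i. i \<in> I \<Longrightarrow> f i \<in> borel_measurable M"
  shows "(\<lambda>x. \<integral>\<^sup>+i. f i x \<partial>count_space I) \<in> borel_measurable M"
proof -
  interpret sigma_finite_measure "count_space I" by (rule sigma_finite_measure_count_space_countable[OF I])
  have "(\<lambda>q. f (fst q) (snd q)) \<in> borel_measurable (count_space I \<Otimes>\<^sub>M M)"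
    by (rule measurable_pair_measure_countable1[OF I]) (simp add: f)
  from measurable_compose[OF measurable_pair_swap' this]
  have "(\<lambda>(x, i). f i x) \<in> borel_measurable (M \<Otimes>\<^sub>M count_space I)" by (simp add: case_prod_unfold)
  then show ?thesis by (rule borel_measurable_nn_integral)
qed

lemma emeasure_lborel_scaleR_null:
  fixes N :: "'a::euclidean_space set"
  assumes N: "N \<in> sets borel" "emeasure lborel N = 0" and r: "r \<noteq> 0"
  shows "emeasure lborel {x. r *\<^sub>R x \<in> N} = 0" "{x. r *\<^sub>R x \<in> N} \<in> sets borel"
proof -
  have m: "(\<lambda>x::'a. r *\<^sub>R x) \<in> borel_measurable borel" by (intro borel_measurable_continuous_onI continuous_intros)
  show s: "{x. r *\<^sub>R x \<in> N} \<in> sets borel" using measurable_sets[OF m N(1)] by (simp add: vimage_def)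
  have "0 = (\<integral>\<^sup>+x. indicator N x \<partial>lborel)" using N by simp
  also have "\<dots> = ennreal (\<bar>r\<bar> ^ DIM('a)) * (\<integral>\<^sup>+x. indicator N (r *\<^sub>R x) \<partial>lborel)"
    by (rule nn_integral_scaleR) (use N r in auto)
  also have "(\<lambda>x. indicator N (r *\<^sub>R x) :: ennreal) = indicator {x. r *\<^sub>R x \<in> N}" by (auto simp: indicator_def)
  finally show "emeasure lborel {x. r *\<^sub>R x \<in> N} = 0" using r s by simp
qed

lemma borel_pmul_left: "{x. g \<odot> x \<in> N} \<in> sets borel" if "N \<in> sets borel"
proof -
  have "(\<lambda>x. g \<odot> x) \<in> borel_measurable borel" by (intro borel_measurable_continuous_onI continuous_intros)
  from measurable_sets[OF this that] show ?thesis by (simp add: vimage_def)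
qed

lemma borel_pmul_right: "{x. x \<odot> g \<in> N} \<in> sets borel" if "N \<in> sets borel"
proof -
  have "(\<lambda>x. x \<odot> g) \<in> borel_measurable borel" by (intro borel_measurable_continuous_onI continuous_intros)
  from measurable_sets[OF this that] show ?thesis by (simp add: vimage_def)
qed

lemma emeasure_pmul_left:
  "pdet g = 1 \<Longrightarrow> N \<in> sets borel \<Longrightarrow> emeasure lborel {x. g \<odot> x \<in> N} = emeasure lborel N"
  using lpres_emeasure[OF lpres_left[of g]] by (simp add: vimage_def)

lemma emeasure_pmul_right:
  "pdet g = 1 \<Longrightarrow> N \<in> sets borel \<Longrightarrow> emeasure lborel {x. x \<odot> g \<in> N} = emeasure lborel N"
  using lpres_emeasure[OF lpres_right[of g]] by (simp add: vimage_def)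

text \<open>Dividing \<open>g\<close> by the square root of its determinant leaves a dilation, which
  preserves null sets.\<close>

lemma emeasure_pmul_left_null:
  assumes N: "N \<in> sets borel" "emeasure lborel N = 0" and g: "pdet g > 0"
  shows "emeasure lborel {x. g \<odot> x \<in> N} = 0"
proof -
  let ?r = "sqrt (pdet g)"
  let ?h = "(1 / ?r) *\<^sub>R g"
  have h: "pdet ?h = 1" using g by (simp add: power_divide)
  have eq: "{x. g \<odot> x \<in> N} = {x. ?h \<odot> x \<in> {y. ?r *\<^sub>R y \<in> N}}"
    using g by (auto simp: pmul_scaleR_left)
  have "?r \<noteq> 0" using g by simp
  from emeasure_lborel_scaleR_null[OF N this] show ?thesis unfolding eq
    by (subst emeasure_pmul_left[OF h]) auto
qed

definition det_lt1 :: "cmat set" where "det_lt1 = {p. pdet p < 1}"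

lemma borel_det_lt1[measurable]: "det_lt1 \<in> sets borel"
proof -
  have "open det_lt1" unfolding det_lt1_def by (intro open_Collect_less continuous_intros)
  then show ?thesis by simp
qed

lemma borel_PW[measurable]: "PW \<in> sets borel" using open_PW by simp

text \<open>A scaling by \<open>1 / Suc n\<close> with \<open>n\<close> large moves any point of the
  cone into \<open>det_lt1\<close>, so the cone is covered by countably many dilates of a null
  set.\<close>

lemma null_of_det_lt1:
  assumes E: "E \<in> sets borel" and sc: "\<And>r p. r \<noteq> 0 \<Longrightarrow> p \<in> E \<Longrightarrow> r *\<^sub>R p \<in> E"
    and 0: "emeasure lborel (E \<inter> det_lt1) = 0"
  shows "emeasure lborel E = 0"
proof -
  let ?A = "\<lambda>n::nat. {p. (1 / real (Suc n)) *\<^sub>R p \<in> E \<inter> det_lt1}"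
  have A: "emeasure lborel (?A n) = 0" "?A n \<in> sets borel" for n
    using emeasure_lborel_scaleR_null[OF _ 0, of "1 / real (Suc n)"] E by auto
  have "E \<subseteq> (\<Union>n. ?A n)"
  proof
    fix p assume p: "p \<in> E"
    obtain n :: nat where n: "\<bar>pdet p\<bar> < real n" using reals_Archimedean2 by blast
    also have "real n \<le> real (Suc n) * 1" by simp
    also have "\<dots> \<le> real (Suc n) * real (Suc n)" by (rule mult_left_mono) auto
    finally have "pdet p < real (Suc n) * real (Suc n)" by linarith
    then have "(1 / real (Suc n))\<^sup>2 * pdet p < 1"
      by (simp add: power_divide power2_eq_square field_simps del: of_nat_Suc)
    then have "p \<in> ?A n" using sc[OF _ p, of "1 / real (Suc n)"] by (simp add: det_lt1_def del: of_nat_Suc)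
    then show "p \<in> (\<Union>n. ?A n)" by blast
  qed
  then have "emeasure lborel E \<le> emeasure lborel (\<Union>n. ?A n)"
    using A(2) by (intro emeasure_mono sets.countable_UN) auto
  also have "\<dots> = 0" by (rule emeasure_UN_eq_0) (use A in auto)
  finally show ?thesis by simp
qed

lemma emeasure_pt_null:
  assumes N: "N \<in> sets borel" "emeasure lborel N = 0"
  shows "emeasure lborel {p. pt p \<in> N} = 0" "{p. pt p \<in> N} \<in> sets borel"
proof -
  show s: "{p. pt p \<in> N} \<in> sets borel" using measurable_sets[OF borel_measurable_pt N(1)] by (simp add: vimage_def)
  have "emeasure lborel {p. pt p \<in> N} = (\<integral>\<^sup>+p. indicator {p. pt p \<in> N} p \<partial>lborel)" using s by simp
  also have "\<dots> = (\<integral>\<^sup>+z. \<integral>\<^sup>+v. ennreal ((cmod v)\<^sup>2) * indicator {p. pt p \<in> N} (v * z, v) \<partial>lborel \<partial>(lborel :: complex measure))"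
    by (rule nn_integral_cmat_pt) (use s in simp)
  also have "\<dots> = (\<integral>\<^sup>+z. 0 \<partial>(lborel :: complex measure))"
  proof (rule nn_integral_cong_AE)
    have "AE z in lborel. z \<notin> N" using N by (intro AE_not_in) (auto simp: null_sets_def)
    then show "AE z in lborel. (\<integral>\<^sup>+v. ennreal ((cmod v)\<^sup>2) * indicator {p. pt p \<in> N} (v * z, v) \<partial>lborel) = 0"
    proof eventually_elim
      fix z assume z: "z \<notin> N"
      have "(\<integral>\<^sup>+v. ennreal ((cmod v)\<^sup>2) * indicator {p. pt p \<in> N} (v * z, v) \<partial>lborel) = (\<integral>\<^sup>+v. 0 \<partial>(lborel :: complex measure))"
      proof (rule nn_integral_cong)
        fix v :: complex show "ennreal ((cmod v)\<^sup>2) * indicator {p. pt p \<in> N} (v * z, v) = 0"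
          using z by (cases "v = 0") auto
      qed
      then show "(\<integral>\<^sup>+v. ennreal ((cmod v)\<^sup>2) * indicator {p. pt p \<in> N} (v * z, v) \<partial>lborel) = 0" by simp
    qed
  qed
  finally show "emeasure lborel {p. pt p \<in> N} = 0" by simp
qed

lemma AE_hyp_area_iff:
  "(AE z in hyp_area. P z) \<longleftrightarrow> (AE z in lborel. z \<in> half_plane \<longrightarrow> P z)"
proof -
  have "(AE z in hyp_area. P z) \<longleftrightarrow> (AE z in density lborel (\<lambda>z. ennreal (1 / (Im z)\<^sup>2)). z \<in> half_plane \<longrightarrow> P z)"
    unfolding hyp_area_def by (subst AE_restrict_space_iff) auto
  also have "\<dots> \<longleftrightarrow> (AE z in lborel. 0 < ennreal (1 / (Im z)\<^sup>2) \<longrightarrow> z \<in> half_plane \<longrightarrow> P z)"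
    by (rule AE_density) simp
  also have "\<dots> \<longleftrightarrow> (AE z in lborel. z \<in> half_plane \<longrightarrow> P z)"
  proof (rule AE_cong)
    fix z :: complex
    show "(0 < ennreal (1 / (Im z)\<^sup>2) \<longrightarrow> z \<in> half_plane \<longrightarrow> P z) \<longleftrightarrow> (z \<in> half_plane \<longrightarrow> P z)"
      by (cases "z \<in> half_plane") (auto simp: half_plane_def)
  qed
  finally show ?thesis .
qed

section \<open>Counting translates and unfolding integrals\<close>

context fuchsian begin

text \<open>The orbits meet \<open>A\<close> exactly once in \<open>PSL2R\<close>, hence twice here, as \<open>g\<close> and \<open>- g\<close> both count.\<close>

definition two_fold :: "cmat set \<Rightarrow> bool" where
  "two_fold A \<longleftrightarrow> A \<in> sets borel \<and> (AE p in lborel. p \<in> PW \<longrightarrow> emeasure (count_space \<Gamma>) {g \<in> \<Gamma>. g \<odot> p \<in> A} = 2)"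

text \<open>Written as an integral over the group so that it can be interchanged with Lebesgue
  integrals; it may be infinite.\<close>

definition hits :: "cmat set \<Rightarrow> cmat \<Rightarrow> ennreal" where
  "hits E p = (\<integral>\<^sup>+g. indicator E (g \<odot> p) \<partial>count_space \<Gamma>)"

lemma hits_eq: "hits E p = emeasure (count_space \<Gamma>) {g \<in> \<Gamma>. g \<odot> p \<in> E}"
proof -
  have "hits E p = (\<integral>\<^sup>+g. indicator {g \<in> \<Gamma>. g \<odot> p \<in> E} g \<partial>count_space \<Gamma>)"
    unfolding hits_def by (rule nn_integral_cong) (auto simp: indicator_def)
  then show ?thesis by simp
qed

lemma hits_eq_0: "(\<And>g. g \<in> \<Gamma> \<Longrightarrow> g \<odot> p \<notin> E) \<Longrightarrow> hits E p = 0"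
proof -
  assume "\<And>g. g \<in> \<Gamma> \<Longrightarrow> g \<odot> p \<notin> E"
  then have "{g \<in> \<Gamma>. g \<odot> p \<in> E} = {}" by blast
  then show ?thesis unfolding hits_eq by (metis emeasure_empty)
qed

lemma measurable_hits[measurable]: "E \<in> sets borel \<Longrightarrow> hits E \<in> borel_measurable borel"
  unfolding hits_def
proof (rule measurable_count_integral[OF countable_\<Gamma>])
  fix g assume E: "E \<in> sets borel"
  have "(\<lambda>x. g \<odot> x) \<in> borel_measurable borel" by (intro borel_measurable_continuous_onI continuous_intros)
  from measurable_compose[OF this borel_measurable_indicator[OF E]]
  show "(\<lambda>x. indicator E (g \<odot> x)) \<in> borel_measurable borel" .
qed

lemma bij_pinv: "bij_betw pinv \<Gamma> \<Gamma>"
proof (rule bij_betw_byWitness[where f'=pinv])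
  have "pinv (pinv g) = g" if "g \<in> \<Gamma>" for g
  proof -
    have d: "pdet g = 1" "pdet (pinv g) = 1" using det1 that inv_in by auto
    then show ?thesis by (metis pid_right pinv_left pmul_pinv_cancel(1) zero_neq_one)
  qed
  then show "\<forall>a\<in>\<Gamma>. pinv (pinv a) = a" "\<forall>a\<in>\<Gamma>. pinv (pinv a) = a" by blast+
qed (use inv_in in blast)+

text \<open>Interchange sum and integral, move each \<open>g\<close> from one set to the other by
  invariance of Lebesgue measure, and reindex the group by inversion.\<close>

lemma hits_swap:
  assumes A: "A \<in> sets borel" and E: "E \<in> sets borel"
  shows "(\<integral>\<^sup>+p. indicator A p * hits E p \<partial>lborel) = (\<integral>\<^sup>+p. indicator E p * hits A p \<partial>lborel)"
proof -
  have sw: "(\<integral>\<^sup>+p. indicator A p * hits E p \<partial>lborel) = (\<integral>\<^sup>+g. emeasure lborel {p \<in> A. g \<odot> p \<in> E} \<partial>count_space \<Gamma>)"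
    if A: "A \<in> sets borel" and E: "E \<in> sets borel" for A E
  proof -
    have s: "{p. g \<odot> p \<in> E} \<in> sets borel" for g by (rule borel_pmul_left[OF E])
    have "(\<integral>\<^sup>+p. indicator A p * hits E p \<partial>lborel) = (\<integral>\<^sup>+p. \<integral>\<^sup>+g. indicator A p * indicator {p. g \<odot> p \<in> E} p \<partial>count_space \<Gamma> \<partial>lborel)"
      unfolding hits_def by (simp add: nn_integral_cmult indicator_def)
    also have "\<dots> = (\<integral>\<^sup>+g. \<integral>\<^sup>+p. indicator A p * indicator {p. g \<odot> p \<in> E} p \<partial>lborel \<partial>count_space \<Gamma>)"
      using A s by (intro nn_integral_count_space_nn_integral[OF countable_\<Gamma>]) auto
    also have "\<dots> = (\<integral>\<^sup>+g. emeasure lborel {p \<in> A. g \<odot> p \<in> E} \<partial>count_space \<Gamma>)"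
    proof (rule nn_integral_cong)
      fix g
      have "(\<integral>\<^sup>+p. indicator A p * indicator {p. g \<odot> p \<in> E} p \<partial>lborel) = (\<integral>\<^sup>+p. indicator (A \<inter> {p. g \<odot> p \<in> E}) p \<partial>lborel)"
        by (intro nn_integral_cong) (simp add: indicator_inter_arith)
      also have "\<dots> = emeasure lborel (A \<inter> {p. g \<odot> p \<in> E})" using A s by simp
      also have "A \<inter> {p. g \<odot> p \<in> E} = {p \<in> A. g \<odot> p \<in> E}" by auto
      finally show "(\<integral>\<^sup>+p. indicator A p * indicator {p. g \<odot> p \<in> E} p \<partial>lborel) = emeasure lborel {p \<in> A. g \<odot> p \<in> E}" .
    qed
    finally show ?thesis .
  qed
  have "(\<integral>\<^sup>+g. emeasure lborel {p \<in> A. g \<odot> p \<in> E} \<partial>count_space \<Gamma>) = (\<integral>\<^sup>+g. emeasure lborel {p \<in> E. pinv g \<odot> p \<in> A} \<partial>count_space \<Gamma>)"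
  proof (rule nn_integral_cong)
    fix g assume "g \<in> space (count_space \<Gamma>)"
    then have g: "pdet g = 1" using det1 by simp
    have s: "{p \<in> A. g \<odot> p \<in> E} \<in> sets borel"
      using sets.Int[OF A borel_pmul_left[OF E, of g]] by (simp add: Int_def)
    have pg: "pdet (pinv g) = 1" using g by (simp add: pdet_pinv)
    have "emeasure lborel {p \<in> A. g \<odot> p \<in> E} = emeasure lborel {p. pinv g \<odot> p \<in> {p \<in> A. g \<odot> p \<in> E}}"
      by (rule emeasure_pmul_left[OF pg s, symmetric])
    also have "{p. pinv g \<odot> p \<in> {p \<in> A. g \<odot> p \<in> E}} = {p \<in> E. pinv g \<odot> p \<in> A}"
      using g by auto
    finally show "emeasure lborel {p \<in> A. g \<odot> p \<in> E} = emeasure lborel {p \<in> E. pinv g \<odot> p \<in> A}" .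
  qed
  also have "\<dots> = (\<integral>\<^sup>+g. emeasure lborel {p \<in> E. g \<odot> p \<in> A} \<partial>count_space \<Gamma>)"
    using nn_integral_bij_count_space[OF bij_pinv, of "\<lambda>g. emeasure lborel {p \<in> E. g \<odot> p \<in> A}"] .
  finally show ?thesis using sw[OF A E] sw[OF E A] by simp
qed

text \<open>After the swap each point of \<open>E\<close> is counted with the number of its
  translates in \<open>A\<close>, which is almost everywhere 2.\<close>

lemma unfold_integral:
  assumes A: "two_fold A" and E: "E \<in> sets borel" "E \<subseteq> PW"
  shows "(\<integral>\<^sup>+p. indicator A p * hits E p \<partial>lborel) = 2 * emeasure lborel E"
proof -
  have "(\<integral>\<^sup>+p. indicator A p * hits E p \<partial>lborel) = (\<integral>\<^sup>+p. indicator E p * hits A p \<partial>lborel)"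
    using A E by (intro hits_swap) (auto simp: two_fold_def)
  also have "\<dots> = (\<integral>\<^sup>+p. 2 * indicator E p \<partial>lborel)"
  proof (rule nn_integral_cong_AE)
    have "AE p in lborel. p \<in> PW \<longrightarrow> hits A p = 2" using A by (simp add: two_fold_def hits_eq)
    then show "AE p in lborel. indicator E p * hits A p = 2 * indicator E p"
      by eventually_elim (use E(2) in \<open>auto simp: indicator_def\<close>)
  qed
  also have "\<dots> = 2 * emeasure lborel E" using E by (simp add: nn_integral_cmult)
  finally show ?thesis .
qed

definition inv_left :: "cmat set \<Rightarrow> bool" where
  "inv_left E \<longleftrightarrow> E \<in> sets borel \<and> E \<subseteq> PW \<and> (\<forall>g\<in>\<Gamma>. \<forall>p\<in>PW. g \<odot> p \<in> E \<longleftrightarrow> p \<in> E)"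

lemma inv_left_PW: "inv_left PW"
  using borel_PW by (simp add: inv_left_def PW_def det1)

lemma inv_left_Int: "inv_left E \<Longrightarrow> inv_left E' \<Longrightarrow> inv_left (E \<inter> E')"
  and inv_left_Diff: "inv_left E \<Longrightarrow> inv_left E' \<Longrightarrow> inv_left (E - E')"
  unfolding inv_left_def by (blast intro: sets.Int sets.Diff)+

lemma inv_left_right: "pdet h > 0 \<Longrightarrow> inv_left E \<Longrightarrow> inv_left {p. p \<odot> h \<in> E}"
proof -
  assume h: "pdet h > 0" and E: "inv_left E"
  have pw: "p \<odot> h \<in> PW \<longleftrightarrow> p \<in> PW" for p using h by (simp add: PW_def zero_less_mult_iff)
  have "p \<in> PW" if "p \<odot> h \<in> E" for p using that E pw unfolding inv_left_def by blast
  moreover have "g \<odot> p \<odot> h \<in> E \<longleftrightarrow> p \<odot> h \<in> E" if "g \<in> \<Gamma>" "p \<in> PW" for g p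
    using E that pw[of p] unfolding inv_left_def pmul_assoc by blast
  ultimately show ?thesis using E borel_pmul_right[of E h] unfolding inv_left_def by blast
qed

lemma inv_left_det: "inv_left (PW \<inter> det_lt1)"
  using sets.Int[OF borel_PW borel_det_lt1] by (simp add: inv_left_def PW_def det_lt1_def det1)

text \<open>Invariant sets have the same measure in every domain: unfolding
  \<open>E \<inter> B\<close> over \<open>A\<close> counts every point of
  \<open>E \<inter> A\<close> twice.\<close>

lemma two_fold_measure_eq:
  assumes A: "two_fold A" and B: "two_fold B" and E: "inv_left E"
  shows "emeasure lborel (E \<inter> A) = emeasure lborel (E \<inter> B)"
proof -
  have AB: "A \<in> sets borel" "B \<in> sets borel" "E \<in> sets borel" "E \<subseteq> PW" using A B E by (auto simp: two_fold_def inv_left_def)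
  have "2 * emeasure lborel (E \<inter> B) = (\<integral>\<^sup>+p. indicator A p * hits (E \<inter> B) p \<partial>lborel)"
    using A AB by (intro unfold_integral[symmetric]) auto
  also have "\<dots> = (\<integral>\<^sup>+p. indicator A p * (indicator E p * hits B p) \<partial>lborel)"
  proof (rule nn_integral_cong_AE)
    have "hits (E \<inter> B) p = indicator E p * hits B p" if "p \<in> PW" for p
    proof (cases "p \<in> E")
      case True
      then have "g \<odot> p \<in> E" if "g \<in> \<Gamma>" for g using E that AB unfolding inv_left_def by blast
      then have "hits (E \<inter> B) p = hits B p" unfolding hits_eq by (metis (no_types, lifting) IntD2 IntI Collect_cong)
      then show ?thesis using True by simp
    next
      case False
      then have "g \<odot> p \<notin> E" if "g \<in> \<Gamma>" for g using E that \<open>p \<in> PW\<close> unfolding inv_left_def by blast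
      then have "hits (E \<inter> B) p = 0" by (intro hits_eq_0) blast
      then show ?thesis using False by simp
    qed
    moreover have "hits (E \<inter> B) p = 0" if "p \<notin> PW" for p
    proof -
      have "g \<odot> p \<notin> PW" if "g \<in> \<Gamma>" for g using \<open>p \<notin> PW\<close> det1[OF that] by (simp add: PW_def)
      then show ?thesis using AB by (intro hits_eq_0) blast
    qed
    moreover have "indicator E p = (0 :: ennreal)" if "p \<notin> PW" for p using that AB by (auto simp: indicator_def)
    ultimately have "indicator A p * hits (E \<inter> B) p = indicator A p * (indicator E p * hits B p)" for p by (cases "p \<in> PW") simp_all
    then show "AE p in lborel. indicator A p * hits (E \<inter> B) p = indicator A p * (indicator E p * hits B p)" by simp
  qed
  also have "\<dots> = (\<integral>\<^sup>+p. 2 * indicator (E \<inter> A) p \<partial>lborel)"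
  proof (rule nn_integral_cong_AE)
    have "AE p in lborel. p \<in> PW \<longrightarrow> hits B p = 2" using B by (simp add: two_fold_def hits_eq)
    then show "AE p in lborel. indicator A p * (indicator E p * hits B p) = 2 * indicator (E \<inter> A) p"
      by eventually_elim (use AB in \<open>auto simp: indicator_def\<close>)
  qed
  also have "\<dots> = 2 * emeasure lborel (E \<inter> A)" using AB by (simp add: nn_integral_cmult)
  finally show ?thesis by (simp add: ennreal_mult_cancel_left)
qed

text \<open>An orbit through \<open>E\<close> stays in \<open>E\<close>, so points of
  \<open>A\<close> outside \<open>E\<close> have no translates in \<open>E\<close>; the unfolding
  integral of \<open>E\<close> therefore lives on the null set \<open>E \<inter> A\<close>.\<close>

lemma two_fold_null:
  assumes A: "two_fold A" and E: "inv_left E" and 0: "emeasure lborel (E \<inter> A) = 0"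
  shows "emeasure lborel E = 0"
proof -
  have AB: "A \<in> sets borel" "E \<in> sets borel" "E \<subseteq> PW" using A E by (auto simp: two_fold_def inv_left_def)
  have "AE p in lborel. p \<notin> E \<inter> A" using 0 AB by (intro AE_not_in) (auto simp: null_sets_def)
  then have "AE p in lborel. indicator A p * hits E p = 0"
  proof eventually_elim
    fix p assume p: "p \<notin> E \<inter> A"
    show "indicator A p * hits E p = 0"
    proof (cases "p \<in> A")
      case True
      have "g \<odot> p \<notin> E" if "g \<in> \<Gamma>" for g
      proof
        assume "g \<odot> p \<in> E"
        then have "g \<odot> p \<in> PW" using AB by blast
        then have "p \<in> PW" using det1[OF that] by (simp add: PW_def)
        then have "p \<in> E" using \<open>g \<odot> p \<in> E\<close> that E unfolding inv_left_def by blast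
        with p True show False by blast
      qed
      then have "hits E p = 0" by (rule hits_eq_0)
      then show ?thesis by simp
    qed simp
  qed
  then have "(\<integral>\<^sup>+p. indicator A p * hits E p \<partial>lborel) = (\<integral>\<^sup>+p. 0 \<partial>(lborel :: cmat measure))"
    by (rule nn_integral_cong_AE)
  then show ?thesis using unfold_integral[OF A AB(2,3)] by simp
qed

text \<open>Right multiplication commutes with the group and carries null sets to null sets.\<close>

lemma two_fold_right:
  assumes A: "two_fold A" and h: "pdet h = 1" shows "two_fold {p. p \<odot> h \<in> A}"
proof -
  have Ab: "A \<in> sets borel" using A by (simp add: two_fold_def)
  have "AE p in lborel. p \<in> PW \<longrightarrow> hits A p = 2" using A by (simp add: two_fold_def hits_eq)
  then obtain N where N: "{p. \<not> (p \<in> PW \<longrightarrow> hits A p = 2)} \<subseteq> N" "N \<in> sets borel" "emeasure lborel N = 0"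
    by (auto elim!: AE_E simp: )
  have "AE p in lborel. p \<notin> {p. p \<odot> h \<in> N}"
    using emeasure_pmul_right[OF h N(2)] N(3) borel_pmul_right[OF N(2)] by (intro AE_not_in) (auto simp: null_sets_def)
  then have "AE p in lborel. p \<in> PW \<longrightarrow> hits {p. p \<odot> h \<in> A} p = 2"
  proof eventually_elim
    fix p assume p: "p \<notin> {p. p \<odot> h \<in> N}"
    show "p \<in> PW \<longrightarrow> hits {p. p \<odot> h \<in> A} p = 2"
    proof
      assume "p \<in> PW"
      then have "p \<odot> h \<in> PW" using h by (simp add: PW_def)
      then have "hits A (p \<odot> h) = 2" using p N(1) by blast
      then show "hits {p. p \<odot> h \<in> A} p = 2" by (simp add: hits_eq pmul_assoc)
    qed
  qed
  then show ?thesis using borel_pmul_right[OF Ab] by (simp add: two_fold_def hits_eq)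
qed

text \<open>Over a free base point whose orbit meets \<open>F\<close> once, in
  \<open>mact h z\<close>, exactly \<open>h\<close> and \<open>- h\<close> move the matrix into the
  cone over \<open>F\<close>. The remaining base points form a null set.\<close>

lemma two_fold_pt:
  assumes F: "F \<in> sets borel" "F \<subseteq> half_plane" and dom: "AE z in hyp_area. \<exists>!y. y \<in> F \<and> orb y = orb z"
  shows "two_fold {p. pt p \<in> F}"
proof -
  have "AE z in lborel. z \<in> half_plane \<longrightarrow> (\<exists>!y. y \<in> F \<and> orb y = orb z)"
    using dom by (simp add: AE_hyp_area_iff)
  moreover have "AE z in lborel. z \<notin> half_plane - free_part"
    using countable_non_free by (intro AE_not_in countable_imp_null_set_lborel)
  ultimately have "AE z in lborel. z \<in> half_plane \<longrightarrow> z \<in> free_part \<and> (\<exists>!y. y \<in> F \<and> orb y = orb z)"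
    by eventually_elim blast
  then obtain N where N: "{z. \<not> (z \<in> half_plane \<longrightarrow> z \<in> free_part \<and> (\<exists>!y. y \<in> F \<and> orb y = orb z))} \<subseteq> N"
    "N \<in> sets borel" "emeasure lborel N = 0"
    by (auto elim!: AE_E)
  have "AE p in lborel. p \<notin> {p. pt p \<in> N}"
    using emeasure_pt_null[OF N(2,3)] by (intro AE_not_in) (auto simp: null_sets_def)
  then have "AE p in lborel. p \<in> PW \<longrightarrow> emeasure (count_space \<Gamma>) {g \<in> \<Gamma>. g \<odot> p \<in> {p. pt p \<in> F}} = 2"
  proof eventually_elim
    fix p assume p: "p \<notin> {p. pt p \<in> N}"
    show "p \<in> PW \<longrightarrow> emeasure (count_space \<Gamma>) {g \<in> \<Gamma>. g \<odot> p \<in> {p. pt p \<in> F}} = 2"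
    proof
      assume pw: "p \<in> PW"
      let ?z = "pt p"
      have zH: "?z \<in> half_plane" using pw PW_iff_pt by (simp add: half_plane_def)
      have free: "?z \<in> free_part" and ex1: "\<exists>!y. y \<in> F \<and> orb y = orb ?z" using p N(1) zH by blast+
      obtain y where y: "y \<in> F" "orb y = orb ?z" "\<And>y'. y' \<in> F \<Longrightarrow> orb y' = orb ?z \<Longrightarrow> y' = y" using ex1 by blast
      obtain h where h: "h \<in> \<Gamma>" "y = mact h ?z" using y(2) orb_eq_iff[OF zH] by blast
      have ptg: "pt (g \<odot> p) = mact g ?z" for g using PW_snd[OF pw] by (rule pt_pmul)
      have "g \<in> \<Gamma> \<and> pt (g \<odot> p) \<in> F \<longleftrightarrow> g = h \<or> g = - h" for g
      proof
        assume g: "g \<in> \<Gamma> \<and> pt (g \<odot> p) \<in> F"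
        then have "mact g ?z = y" using y(3)[of "mact g ?z"] orb_mact[OF _ zH] ptg by simp
        then have "mact (pinv h \<odot> g) ?z = ?z"
          using mact_pmul[of "pinv h" g ?z] mact_pinv[of h ?z] h g det1[of h] det1[of g] zH
          by (simp add: pdet_pinv half_plane_def)
        moreover have "pinv h \<odot> g \<in> \<Gamma>" using h g mul_in inv_in by blast
        ultimately have "pinv h \<odot> g = pid \<or> pinv h \<odot> g = - pid" using free_part_stabilizer[OF free] by blast
        then have "h \<odot> (pinv h \<odot> g) = h \<or> h \<odot> (pinv h \<odot> g) = - h" by (metis pid_right pmul_minus_right)
        then show "g = h \<or> g = - h" using det1[OF h(1)] by simp
      next
        assume "g = h \<or> g = - h"
        then show "g \<in> \<Gamma> \<and> pt (g \<odot> p) \<in> F"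
        proof
          assume "g = h" then show ?thesis using h y(1) by (simp add: ptg)
        next
          assume "g = - h" then show ?thesis using h y(1) minus_in[OF h(1)] by (simp only: ptg mact_minus)
        qed
      qed
      then have eq: "{g \<in> \<Gamma>. g \<odot> p \<in> {p. pt p \<in> F}} = {h, - h}" by blast
      have "h \<noteq> - h"
      proof
        assume "h = - h"
        then have "fst h = - fst h" "snd h = - snd h" by (metis fst_uminus, metis snd_uminus)
        then have "Re (fst h) = 0" "Im (fst h) = 0" by (simp_all add: complex_eq_iff)
        then have "pdet h = 0" by (simp add: pdet_def)
        then show False using det1[OF h(1)] by simp
      qed
      then have "card {h, - h} = 2" by simp
      then show "emeasure (count_space \<Gamma>) {g \<in> \<Gamma>. g \<odot> p \<in> {p. pt p \<in> F}} = 2"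
        unfolding eq using h minus_in by (subst emeasure_count_space_finite) auto
    qed
  qed
  moreover have "{p. pt p \<in> F} \<in> sets borel" using measurable_sets[OF borel_measurable_pt F(1)] by (simp add: vimage_def)
  ultimately show ?thesis by (simp add: two_fold_def)
qed

end

section \<open>Ergodicity of the geodesic flow\<close>

declare split_paired_All [simp del] split_paired_Ex [simp del]

locale fuchsian_domain = fuchsian +
  fixes F :: "complex set"
  assumes F_borel: "F \<in> sets borel" and F_sub: "F \<subseteq> half_plane"
    and F_dom: "AE z in hyp_area. \<exists>!y. y \<in> F \<and> orb y = orb z"
    and F_finite: "emeasure hyp_area F < \<infinity>"
begin

text \<open>
  Functions on the unit tangent bundle are functions on \<open>PW\<close> that are invariant under scaling.
  Cutting the cone over the fundamental domain off at determinant 1 yields a finite measure, and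
  on scaling invariant sets it is a multiple of Haar measure.
\<close>

definition FF :: "cmat set" where "FF = {p. pt p \<in> F}"

definition mu :: "cmat set \<Rightarrow> ennreal" where "mu X = emeasure lborel (X \<inter> det_lt1 \<inter> FF)"

lemma two_fold_FF: "two_fold FF"
  unfolding FF_def using F_borel F_sub F_dom by (rule two_fold_pt)

lemma borel_FF[measurable]: "FF \<in> sets borel"
  using two_fold_FF by (simp add: two_fold_def)

lemma FF_PW: "FF \<subseteq> PW"
  using F_sub PW_iff_pt by (auto simp: FF_def half_plane_def)

lemma mu_FF: "mu UNIV = ennreal (pi / 2) * emeasure hyp_area F"
proof -
  have "UNIV \<inter> det_lt1 \<inter> FF = {p. pt p \<in> F \<and> pdet p < 1}" by (auto simp: det_lt1_def FF_def)
  then show ?thesis using emeasure_pt_hyp_area[OF F_borel F_sub] by (simp add: mu_def)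
qed

lemma mu_UNIV_finite: "mu UNIV < \<infinity>"
  unfolding mu_FF using F_finite by (simp add: ennreal_mult_less_top)

lemma mu_mono: "X \<subseteq> Y \<Longrightarrow> Y \<in> sets borel \<Longrightarrow> mu X \<le> mu Y"
  unfolding mu_def by (intro emeasure_mono) auto

lemma mu_subadd: "X \<in> sets borel \<Longrightarrow> Y \<in> sets borel \<Longrightarrow> mu (X \<union> Y) \<le> mu X + mu Y"
proof -
  assume "X \<in> sets borel" "Y \<in> sets borel"
  then have "emeasure lborel ((X \<inter> det_lt1 \<inter> FF) \<union> (Y \<inter> det_lt1 \<inter> FF)) \<le> mu X + mu Y"
    unfolding mu_def by (intro emeasure_subadditive) auto
  then show ?thesis by (simp add: mu_def Int_Un_distrib2)
qed

text \<open>Translation preserves Lebesgue measure and the determinant but moves the cone over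
  \<open>F\<close>. The moved cone is again a two-fold domain, in which the invariant set has the
  same measure.\<close>

lemma mu_right:
  assumes h: "pdet h = 1" and E: "inv_left E" shows "mu {p. p \<odot> h \<in> E} = mu E"
proof -
  have Eb: "E \<in> sets borel" "E \<subseteq> PW" using E by (auto simp: inv_left_def)
  let ?B = "{q. q \<odot> pinv h \<in> FF}"
  have "mu {p. p \<odot> h \<in> E} = emeasure lborel {p. p \<odot> h \<in> E \<inter> det_lt1 \<inter> ?B}"
    unfolding mu_def using h by (intro arg_cong[where f="emeasure lborel"]) (auto simp: det_lt1_def)
  also have "\<dots> = emeasure lborel (E \<inter> det_lt1 \<inter> ?B)"
    using h Eb by (intro emeasure_pmul_right sets.Int borel_pmul_right) auto
  also have "\<dots> = emeasure lborel ((E \<inter> (PW \<inter> det_lt1)) \<inter> ?B)" using Eb by (intro arg_cong[where f="emeasure lborel"]) auto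
  also have "\<dots> = emeasure lborel ((E \<inter> (PW \<inter> det_lt1)) \<inter> FF)"
    using h by (intro two_fold_measure_eq two_fold_right two_fold_FF inv_left_Int inv_left_det E) (simp add: pdet_pinv)
  also have "\<dots> = mu E" unfolding mu_def using Eb by (intro arg_cong[where f="emeasure lborel"]) auto
  finally show ?thesis .
qed

lemma mu_null:
  assumes E: "inv_left E" "mu E = 0" shows "emeasure lborel (E \<inter> det_lt1) = 0"
proof (rule two_fold_null[OF two_fold_FF])
  have "E \<inter> det_lt1 = E \<inter> (PW \<inter> det_lt1)" using E(1) unfolding inv_left_def by blast
  then show "inv_left (E \<inter> det_lt1)" using inv_left_Int[OF E(1) inv_left_det] by (simp only:)
  show "emeasure lborel (E \<inter> det_lt1 \<inter> FF) = 0" using E by (simp add: mu_def)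
qed

text \<open>Borel sets invariant under the group and under scaling: they stand for sets of vectors
  in the unit tangent bundle of the quotient.\<close>

definition Inv :: "cmat set set" where
  "Inv = {E. inv_left E \<and> (\<forall>r p. r \<noteq> 0 \<longrightarrow> (r *\<^sub>R p \<in> E \<longleftrightarrow> p \<in> E))}"

lemma InvD: "E \<in> Inv \<Longrightarrow> inv_left E" "E \<in> Inv \<Longrightarrow> E \<in> sets borel" "E \<in> Inv \<Longrightarrow> E \<subseteq> PW"
  "E \<in> Inv \<Longrightarrow> r \<noteq> 0 \<Longrightarrow> r *\<^sub>R p \<in> E \<longleftrightarrow> p \<in> E"
  by (simp_all add: Inv_def inv_left_def)

lemma PW_scaleR[simp]: "r \<noteq> 0 \<Longrightarrow> r *\<^sub>R p \<in> PW \<longleftrightarrow> p \<in> PW"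
  by (simp add: PW_def zero_less_mult_iff)

lemma PW_Inv: "PW \<in> Inv"
  using inv_left_PW by (simp add: Inv_def)

section \<open>The finite measure on invariant cones\<close>

lemma sigma_algebra_Inv: "sigma_algebra PW Inv"
proof (rule sigma_algebra_iff2[THEN iffD2], intro conjI allI ballI impI)
  show "Inv \<subseteq> Pow PW" using InvD(3) by blast
  show "{} \<in> Inv" by (simp add: Inv_def inv_left_def)
  show "PW - E \<in> Inv" if E: "E \<in> Inv" for E
  proof -
    have "inv_left (PW - E)" using InvD(1)[OF E] inv_left_PW by (intro inv_left_Diff)
    then show ?thesis using InvD(4)[OF E] by (simp add: Inv_def)
  qed
  show "(\<Union>i::nat. A i) \<in> Inv" if A: "range A \<subseteq> Inv" for A
  proof -
    have Ai: "A i \<in> Inv" for i using A by blast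
    have "inv_left (\<Union>i. A i)" unfolding inv_left_def
    proof (intro conjI ballI)
      show "(\<Union>i. A i) \<in> sets borel" using InvD(2)[OF Ai] by blast
      show "(\<Union>i. A i) \<subseteq> PW" using InvD(3)[OF Ai] by blast
      fix g p assume "g \<in> \<Gamma>" "p \<in> PW"
      then have "g \<odot> p \<in> A i \<longleftrightarrow> p \<in> A i" for i using InvD(1)[OF Ai[of i]] unfolding inv_left_def by blast
      then show "g \<odot> p \<in> (\<Union>i. A i) \<longleftrightarrow> p \<in> (\<Union>i. A i)" by blast
    qed
    then show ?thesis using InvD(4)[OF Ai] by (simp add: Inv_def)
  qed
qed

text \<open>The cut cone over \<open>F\<close> is not preserved by the flow. Restricted to the
  sigma-algebra of invariant cones its Lebesgue measure is, which makes Birkhoff's theorem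
  applicable.\<close>

definition QM :: "cmat measure" where
  "QM = distr (restrict_space lborel (FF \<inter> det_lt1)) (sigma PW Inv) (\<lambda>p. p)"

lemma sets_QM: "sets QM = Inv"
  unfolding QM_def sets_distr by (rule sigma_algebra.sets_measure_of_eq[OF sigma_algebra_Inv])

lemma space_QM[simp]: "space QM = PW"
  unfolding QM_def space_distr by (rule sigma_algebra.space_measure_of_eq[OF sigma_algebra_Inv])

lemma measurable_id_QM: "(\<lambda>p. p) \<in> restrict_space lborel (FF \<inter> det_lt1) \<rightarrow>\<^sub>M sigma PW Inv"
proof (rule measurableI)
  show "x \<in> space (sigma PW Inv)" if "x \<in> space (restrict_space lborel (FF \<inter> det_lt1))" for x
    using that FF_PW sigma_algebra.space_measure_of_eq[OF sigma_algebra_Inv] by (auto simp: space_restrict_space)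
  fix A assume "A \<in> sets (sigma PW Inv)"
  then have "A \<in> Inv" using sigma_algebra.sets_measure_of_eq[OF sigma_algebra_Inv] by blast
  then have "A \<in> sets borel" by (rule InvD)
  then show "(\<lambda>p. p) -` A \<inter> space (restrict_space lborel (FF \<inter> det_lt1)) \<in> sets (restrict_space lborel (FF \<inter> det_lt1))"
    by (auto simp: sets_restrict_space space_restrict_space Int_commute)
qed

lemma emeasure_QM: "E \<in> Inv \<Longrightarrow> emeasure QM E = mu E"
proof -
  assume E: "E \<in> Inv"
  then have Es: "E \<in> sets (sigma PW Inv)" using sigma_algebra.sets_measure_of_eq[OF sigma_algebra_Inv] by blast
  have "emeasure QM E = emeasure (restrict_space lborel (FF \<inter> det_lt1)) (E \<inter> (FF \<inter> det_lt1))"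
    unfolding QM_def by (subst emeasure_distr[OF measurable_id_QM Es]) (simp add: space_restrict_space)
  also have "\<dots> = emeasure lborel (E \<inter> (FF \<inter> det_lt1))"
    using InvD(2)[OF E] by (intro emeasure_restrict_space) auto
  also have "E \<inter> (FF \<inter> det_lt1) = E \<inter> det_lt1 \<inter> FF" by blast
  finally show ?thesis by (simp add: mu_def)
qed

lemma finite_QM: "finite_measure QM"
proof (rule finite_measureI)
  have "mu PW \<le> mu UNIV" by (rule mu_mono) auto
  then show "emeasure QM (space QM) \<noteq> \<infinity>" using mu_UNIV_finite emeasure_QM[OF PW_Inv] by (simp add: top_unique)
qed

lemma measurable_QM:
  fixes f :: "cmat \<Rightarrow> 'b::topological_space"
  assumes "f \<in> borel_measurable borel" "\<And>g p. g \<in> \<Gamma> \<Longrightarrow> p \<in> PW \<Longrightarrow> f (g \<odot> p) = f p"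
    "\<And>r p. r \<noteq> 0 \<Longrightarrow> p \<in> PW \<Longrightarrow> f (r *\<^sub>R p) = f p"
  shows "f \<in> measurable QM borel"
proof (rule measurableI)
  fix A :: "'b set" assume A: "A \<in> sets borel"
  have "f -` A \<inter> PW \<in> sets borel" using measurable_sets[OF assms(1) A] by auto
  moreover have "g \<odot> p \<in> PW" if "g \<in> \<Gamma>" "p \<in> PW" for g p using that det1 by (simp add: PW_def)
  ultimately have "inv_left (f -` A \<inter> PW)" unfolding inv_left_def using assms(2) by simp
  moreover have "r *\<^sub>R p \<in> f -` A \<inter> PW \<longleftrightarrow> p \<in> f -` A \<inter> PW" if "r \<noteq> 0" for r p
    using assms(3)[OF that, of p] that by (cases "p \<in> PW") simp_all
  ultimately show "f -` A \<inter> space QM \<in> sets QM" by (simp add: sets_QM Inv_def)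
qed simp

lemma nn_integral_QM:
  assumes "f \<in> borel_measurable QM" "f \<in> borel_measurable borel"
  shows "(\<integral>\<^sup>+p. f p \<partial>QM) = (\<integral>\<^sup>+p. f p * indicator (FF \<inter> det_lt1) p \<partial>lborel)"
proof -
  have f': "f \<in> borel_measurable (sigma PW Inv)" using assms(1) unfolding QM_def by simp
  have "(\<integral>\<^sup>+p. f p \<partial>QM) = (\<integral>\<^sup>+p. f p \<partial>restrict_space lborel (FF \<inter> det_lt1))"
    unfolding QM_def by (rule nn_integral_distr[OF measurable_id_QM]) (use f' in simp)
  also have "\<dots> = (\<integral>\<^sup>+p. f p * indicator (FF \<inter> det_lt1) p \<partial>lborel)"
    by (rule nn_integral_restrict_space) simp
  finally show ?thesis .
qed

lemma Inv_right: "pdet h > 0 \<Longrightarrow> E \<in> Inv \<Longrightarrow> {p. p \<odot> h \<in> E} \<in> Inv"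
  using inv_left_right[of h E] by (simp add: Inv_def pmul_scaleR_left)

lemma measurable_right_QM:
  assumes h: "pdet h = 1" shows "(\<lambda>p. p \<odot> h) \<in> QM \<rightarrow>\<^sub>M QM"
proof (rule measurableI)
  show "p \<odot> h \<in> space QM" if "p \<in> space QM" for p using that h by (simp add: PW_def)
  fix E assume "E \<in> sets QM"
  then have E: "E \<in> Inv" by (simp add: sets_QM)
  then have "{p. p \<odot> h \<in> E} \<in> Inv" using h by (intro Inv_right) auto
  moreover from InvD(3)[OF this] have "(\<lambda>p. p \<odot> h) -` E \<inter> space QM = {p. p \<odot> h \<in> E}" by auto
  ultimately show "(\<lambda>p. p \<odot> h) -` E \<inter> space QM \<in> sets QM" by (simp add: sets_QM)
qed

lemma distr_right_QM:
  assumes h: "pdet h = 1" shows "distr QM QM (\<lambda>p. p \<odot> h) = QM"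
proof (rule measure_eqI)
  fix E assume "E \<in> sets (distr QM QM (\<lambda>p. p \<odot> h))"
  then have E: "E \<in> Inv" by (simp add: sets_QM)
  have I: "{p. p \<odot> h \<in> E} \<in> Inv" using h E by (intro Inv_right) auto
  have "emeasure (distr QM QM (\<lambda>p. p \<odot> h)) E = emeasure QM ((\<lambda>p. p \<odot> h) -` E \<inter> space QM)"
    using E by (intro emeasure_distr measurable_right_QM h) (simp add: sets_QM)
  also have "(\<lambda>p. p \<odot> h) -` E \<inter> space QM = {p. p \<odot> h \<in> E}" using InvD(3)[OF I] by auto
  also have "emeasure QM {p. p \<odot> h \<in> E} = emeasure QM E"
    using mu_right[OF h InvD(1)[OF E]] by (simp add: emeasure_QM I E)
  finally show "emeasure (distr QM QM (\<lambda>p. p \<odot> h)) E = emeasure QM E" .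
qed simp

text \<open>Approximate by an invariant open set from outside.\<close>

lemma mu_translate_tendsto_0:
  assumes E: "inv_left E" and hn: "\<And>n. pdet (h n) = 1" and lim: "h \<longlonglongrightarrow> pid"
  shows "(\<lambda>n. mu (E - {p. p \<odot> h n \<in> E})) \<longlonglongrightarrow> 0"
proof -
  have Eb[measurable]: "E \<in> sets borel" and EPW: "E \<subseteq> PW" using E by (auto simp: inv_left_def)
  have small: "\<forall>\<^sub>F n in sequentially. mu (E - {p. p \<odot> h n \<in> E}) \<le> ennreal (3 * e)" if e: "e > 0" for e
  proof -
    \<comment> \<open>Outer regularity; the margin is \<open>e / 2\<close> because unfolding will
      double it.\<close>
    obtain U where U: "open U" "E \<inter> det_lt1 \<inter> FF \<subseteq> U" "emeasure lborel (U - (E \<inter> det_lt1 \<inter> FF)) < ennreal (e / 2)"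
      using outer_regular_lborel[of "E \<inter> det_lt1 \<inter> FF" "e / 2"] e by (metis Eb borel_FF borel_det_lt1 half_gt_zero sets.Int)
    define U' where "U' = U \<inter> PW"
    have U': "open U'" using U open_PW by (auto simp: U'_def)
    have U'b[measurable]: "U' \<in> sets borel" using U' by simp
    \<comment> \<open>The saturation of \<open>U'\<close>: open, invariant, and containing the part
      of \<open>E\<close> that \<open>mu\<close> sees.\<close>
    define V where "V = (\<Union>g\<in>\<Gamma>. {p. g \<odot> p \<in> U'})"
    have Vopen: "open V" unfolding V_def
    proof (intro open_UN ballI)
      fix g
      have "continuous_on UNIV (\<lambda>p. g \<odot> p)" by (intro continuous_intros)
      from continuous_on_open_vimage[OF open_UNIV, THEN iffD1, OF this, rule_format, OF U']
      show "open {p. g \<odot> p \<in> U'}" by (simp add: vimage_def)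
    qed
    have Vb[measurable]: "V \<in> sets borel" using Vopen by simp
    have Vinv: "inv_left V" unfolding inv_left_def
    proof (intro conjI ballI)
      show "V \<subseteq> PW"
      proof
        fix p assume "p \<in> V"
        then obtain g where "g \<in> \<Gamma>" "g \<odot> p \<in> U'" unfolding V_def by blast
        then show "p \<in> PW" using det1[of g] by (simp add: U'_def PW_def)
      qed
      fix g p assume g: "g \<in> \<Gamma>"
      show "g \<odot> p \<in> V \<longleftrightarrow> p \<in> V"
      proof
        assume "g \<odot> p \<in> V"
        then obtain k where "k \<in> \<Gamma>" "k \<odot> (g \<odot> p) \<in> U'" unfolding V_def by blast
        then show "p \<in> V" using mul_in[of k g] g unfolding V_def pmul_assoc[symmetric] by blast
      next
        assume "p \<in> V"
        then obtain k where k: "k \<in> \<Gamma>" "k \<odot> p \<in> U'" unfolding V_def by blast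
        then have "(k \<odot> pinv g) \<odot> (g \<odot> p) \<in> U'" using det1[OF g] by (simp add: pmul_assoc)
        then show "g \<odot> p \<in> V" using mul_in[OF k(1) inv_in[OF g]] unfolding V_def by blast
      qed
    qed (rule Vb)
    have EV: "mu (E - V) = 0"
    proof -
      have "E \<inter> det_lt1 \<inter> FF \<subseteq> V" using U(2) EPW id_in unfolding V_def U'_def by fastforce
      then have "(E - V) \<inter> det_lt1 \<inter> FF = {}" by blast
      then show ?thesis by (simp add: mu_def)
    qed
    have VE: "mu (V - E) \<le> ennreal e"
    proof -
      \<comment> \<open>Every point of \<open>V - E\<close> in the cut cone has a translate in
        \<open>?D\<close>, so its measure is at most the unfolding integral of
        \<open>?D\<close>.\<close>
      let ?D = "(U' - E) \<inter> det_lt1"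
      have D: "?D \<in> sets borel" using U'b Eb borel_det_lt1 by (intro sets.Int sets.Diff)
      have D': "?D \<subseteq> PW" by (auto simp: U'_def)
      have "mu (V - E) = (\<integral>\<^sup>+p. indicator ((V - E) \<inter> det_lt1 \<inter> FF) p \<partial>lborel)"
        unfolding mu_def by (subst nn_integral_indicator) auto
      also have "\<dots> \<le> (\<integral>\<^sup>+p. indicator FF p * hits ?D p \<partial>lborel)"
      proof (rule nn_integral_mono)
        fix p
        show "indicator ((V - E) \<inter> det_lt1 \<inter> FF) p \<le> indicator FF p * hits ?D p"
        proof (cases "p \<in> (V - E) \<inter> det_lt1 \<inter> FF")
          case True
          then obtain g where g: "g \<in> \<Gamma>" "g \<odot> p \<in> U'" unfolding V_def by blast
          have "p \<in> PW" using True FF_PW by blast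
          then have "g \<odot> p \<notin> E" using True g E unfolding inv_left_def by blast
          then have "g \<odot> p \<in> ?D" using g True det1[OF g(1)] by (simp add: det_lt1_def)
          then have gm: "g \<in> {g \<in> \<Gamma>. g \<odot> p \<in> ?D}" using g by blast
          have "1 = emeasure (count_space \<Gamma>) {g}" using g by simp
          also have "\<dots> \<le> emeasure (count_space \<Gamma>) {g \<in> \<Gamma>. g \<odot> p \<in> ?D}"
            using gm by (intro emeasure_mono) auto
          finally show ?thesis using True by (simp add: hits_eq)
        qed simp
      qed
      also have "\<dots> = 2 * emeasure lborel ?D" by (rule unfold_integral[OF two_fold_FF D D'])
      also have "\<dots> \<le> 2 * emeasure lborel (U - (E \<inter> det_lt1 \<inter> FF))"
        using U(1) by (intro mult_left_mono emeasure_mono) (auto simp: U'_def)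
      also have "\<dots> \<le> 2 * ennreal (e / 2)" using U(3) by (intro mult_left_mono) auto
      also have "\<dots> = ennreal e"
        using e by (metis ennreal_mult'' ennreal_numeral field_sum_of_halves mult_2 less_eq_real_def half_gt_zero)
      finally show ?thesis .
    qed
    \<comment> \<open>A point of the open set \<open>V\<close> stays in \<open>V\<close> under
      translations close to the identity, and the finite measure of the cut cone dominates.\<close>
    have "(\<lambda>n. mu (V - {p. p \<odot> h n \<in> V})) \<longlonglongrightarrow> 0"
    proof -
      let ?X = "V \<inter> det_lt1 \<inter> FF"
      have hb: "{p. p \<odot> h n \<in> V} \<in> sets borel" for n by (rule borel_pmul_right[OF Vb])
      have "(\<lambda>n. \<integral>\<^sup>+p. indicator ((V - {p. p \<odot> h n \<in> V}) \<inter> det_lt1 \<inter> FF) p \<partial>lborel) \<longlonglongrightarrow> (\<integral>\<^sup>+p. (0::ennreal) \<partial>(lborel :: cmat measure))"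
      proof (rule nn_integral_dominated_convergence[where w="indicator ?X"])
        show "indicator ((V - {p. p \<odot> h n \<in> V}) \<inter> det_lt1 \<inter> FF) \<in> borel_measurable lborel" for n
          using hb by simp
        have "(\<integral>\<^sup>+p. indicator ?X p \<partial>lborel) = mu V" unfolding mu_def by (subst nn_integral_indicator) auto
        also have "\<dots> \<le> mu UNIV" by (rule mu_mono) auto
        finally show "(\<integral>\<^sup>+p. indicator ?X p \<partial>lborel) < \<infinity>" using mu_UNIV_finite by (rule le_less_trans)
        show "AE p in lborel. indicator ((V - {p. p \<odot> h n \<in> V}) \<inter> det_lt1 \<inter> FF) p \<le> (indicator ?X p :: ennreal)" for n
          by (rule AE_I2) (auto simp: indicator_def)
        show "AE p in lborel. (\<lambda>n. indicator ((V - {p. p \<odot> h n \<in> V}) \<inter> det_lt1 \<inter> FF) p) \<longlonglongrightarrow> (0 :: ennreal)"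
        proof (rule AE_I2)
          fix p :: cmat
          show "(\<lambda>n. indicator ((V - {p. p \<odot> h n \<in> V}) \<inter> det_lt1 \<inter> FF) p) \<longlonglongrightarrow> (0 :: ennreal)"
          proof (cases "p \<in> V")
            case True
            have "(\<lambda>n. p \<odot> h n) \<longlonglongrightarrow> p \<odot> pid"
            proof -
              have "isCont (\<lambda>x. p \<odot> x) pid"
              proof -
                have "continuous_on UNIV (\<lambda>x. p \<odot> x)" by (intro continuous_intros)
                then show ?thesis using continuous_on_eq_continuous_at[OF open_UNIV] by blast
              qed
              then show ?thesis using lim by (rule isCont_tendsto_compose)
            qed
            then have "\<forall>\<^sub>F n in sequentially. p \<odot> h n \<in> V" using Vopen True by (simp add: topological_tendstoD)
            then have "\<forall>\<^sub>F n in sequentially. indicator ((V - {p. p \<odot> h n \<in> V}) \<inter> det_lt1 \<inter> FF) p = (0 :: ennreal)"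
              by eventually_elim simp
            then show ?thesis by (rule tendsto_eventually)
          qed simp
        qed
      qed simp_all
      moreover have "(\<integral>\<^sup>+p. indicator ((V - {p. p \<odot> h n \<in> V}) \<inter> det_lt1 \<inter> FF) p \<partial>lborel) = mu (V - {p. p \<odot> h n \<in> V})" for n
        unfolding mu_def using hb by (subst nn_integral_indicator) auto
      ultimately show ?thesis by simp
    qed
    then have "\<forall>\<^sub>F n in sequentially. mu (V - {p. p \<odot> h n \<in> V}) < ennreal e"
      using e by (intro order_tendstoD(2)) auto
    then show ?thesis
    proof eventually_elim
      fix n assume n: "mu (V - {p. p \<odot> h n \<in> V}) < ennreal e"
      let ?R = "\<lambda>X. {p. p \<odot> h n \<in> X}"
      have Rb: "?R X \<in> sets borel" if "X \<in> sets borel" for X by (rule borel_pmul_right[OF that])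
      \<comment> \<open>A point of \<open>E\<close> that leaves \<open>E\<close> lies outside
        \<open>V\<close>, or leaves \<open>V\<close>, or arrives in \<open>V - E\<close>.\<close>
      have "E - ?R E \<subseteq> (E - V) \<union> ((V - ?R V) \<union> ?R (V - E))" by blast
      then have "mu (E - ?R E) \<le> mu ((E - V) \<union> ((V - ?R V) \<union> ?R (V - E)))"
        using Rb[OF Vb] Rb[of "V - E"] by (intro mu_mono) auto
      also have "\<dots> \<le> mu (E - V) + (mu (V - ?R V) + mu (?R (V - E)))"
        using Rb[OF Vb] Rb[of "V - E"] by (intro order_trans[OF mu_subadd] add_left_mono mu_subadd) auto
      also have "mu (?R (V - E)) = mu (V - E)" using hn Vinv E by (intro mu_right inv_left_Diff)
      also have "mu (E - V) + (mu (V - ?R V) + mu (V - E)) \<le> 0 + (ennreal e + ennreal e)"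
        using EV VE n by (intro add_mono) auto
      also have "\<dots> \<le> ennreal (3 * e)" using e by (simp flip: ennreal_plus)
      finally show "mu (E - ?R E) \<le> ennreal (3 * e)" .
    qed
  qed
  show ?thesis
  proof (rule order_tendstoI)
    fix a :: ennreal assume "0 < a"
    then obtain b where b: "0 < b" "b < a" using dense by blast
    obtain e where e: "e > 0" "ennreal e < a" using b by (cases b) auto
    have "\<forall>\<^sub>F n in sequentially. mu (E - {p. p \<odot> h n \<in> E}) \<le> ennreal (3 * (e / 3))" using e by (intro small) simp
    then show "\<forall>\<^sub>F n in sequentially. mu (E - {p. p \<odot> h n \<in> E}) < a"
      by eventually_elim (use e in auto)
  qed simp
qed


text \<open>Because \<open>E\<close> is invariant under \<open>dia k\<close>, the points that
  \<open>h\<close> takes out of \<open>E\<close> are a right translate by \<open>dia k\<close> of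
  those that the conjugate of \<open>h\<close> takes out.\<close>

lemma mu_conj:
  assumes E: "E \<in> Inv" and h: "pdet h = 1" and k: "\<And>p. p \<in> PW \<Longrightarrow> p \<odot> dia k \<in> E \<longleftrightarrow> p \<in> E"
  shows "mu (E - {p. p \<odot> h \<in> E}) = mu (E - {p. p \<odot> (dia (- k) \<odot> h \<odot> dia k) \<in> E})"
proof -
  let ?h = "dia (- k) \<odot> h \<odot> dia k"
  have dk: "dia k \<odot> dia (- k) = pid" by (simp add: dia_mult dia_0)
  have pw: "p \<odot> x \<in> PW \<longleftrightarrow> p \<in> PW" if "pdet x = 1" for p x using that by (simp add: PW_def)
  have "p \<in> E - {p. p \<odot> h \<in> E} \<longleftrightarrow> p \<odot> dia k \<in> E - {p. p \<odot> ?h \<in> E}" for p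
  proof (cases "p \<in> PW")
    case True
    have "p \<odot> dia k \<odot> ?h = (p \<odot> (dia k \<odot> dia (- k)) \<odot> h) \<odot> dia k" by (simp only: pmul_assoc)
    also have "\<dots> = (p \<odot> h) \<odot> dia k" by (simp add: dk)
    finally have "p \<odot> dia k \<odot> ?h \<in> E \<longleftrightarrow> p \<odot> h \<in> E" using k[of "p \<odot> h"] pw[OF h, of p] True by simp
    then show ?thesis using k[OF True] by simp
  next
    case False
    then have "p \<notin> E" "p \<odot> dia k \<notin> E" using InvD(3)[OF E] pw[of "dia k" p] by auto
    then show ?thesis by simp
  qed
  then have eq: "E - {p. p \<odot> h \<in> E} = {p. p \<odot> dia k \<in> E - {p. p \<odot> ?h \<in> E}}" by blast
  have hh: "pdet ?h > 0" using h by simp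
  have "inv_left (E - {p. p \<odot> ?h \<in> E})"
    using InvD(1)[OF E] inv_left_right[OF hh] by (intro inv_left_Diff) auto
  from mu_right[OF pdet_dia this] show ?thesis unfolding eq .
qed

text \<open>Invariance under the time-one map permits conjugation by \<open>dia n\<close> for all
  integers \<open>n\<close>, which suffices for contraction. Once every right translation moves only
  a null part of \<open>E\<close>, Fubini yields one \<open>p\<close> in \<open>E\<close> with
  \<open>p \<odot> g\<close> in \<open>E\<close> for almost all \<open>g\<close> of
  \<open>PW\<close>, so that \<open>E\<close> fills \<open>PW\<close> up to a null set.\<close>

lemma ergodic_QM: "ergodic_on QM (\<lambda>p. p \<odot> dia 1)"
  unfolding ergodic_on_def sets_QM
proof (intro ballI impI)
  fix E assume E: "E \<in> Inv" and inv: "(\<lambda>p. p \<odot> dia 1) -` E \<inter> space QM = E"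
  have Eb[measurable]: "E \<in> sets borel" and EPW: "E \<subseteq> PW" using InvD[OF E] by auto
  have pw: "p \<odot> x \<in> PW \<longleftrightarrow> p \<in> PW" if "pdet x = 1" for p x using that by (simp add: PW_def)
  have i1: "p \<odot> dia 1 \<in> E \<longleftrightarrow> p \<in> E" if "p \<in> PW" for p using inv that by auto
  have ip: "p \<odot> dia (real n) \<in> E \<longleftrightarrow> p \<in> E" if "p \<in> PW" for p n
    using that
  proof (induction n arbitrary: p)
    case 0 then show ?case by (simp add: dia_0)
  next
    case (Suc n)
    have "p \<odot> dia (real (Suc n)) = (p \<odot> dia 1) \<odot> dia (real n)" by (simp add: pmul_assoc dia_mult)
    then show ?case using Suc.IH[of "p \<odot> dia 1"] i1[OF Suc.prems] pw[of "dia 1" p] Suc.prems by simp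
  qed
  have im: "p \<odot> dia (- real n) \<in> E \<longleftrightarrow> p \<in> E" if "p \<in> PW" for p n
    using ip[of "p \<odot> dia (- real n)" n] that pw[of "dia (- real n)" p] by (simp add: pmul_assoc dia_mult dia_0)
  define P where "P g \<longleftrightarrow> pdet g = 1 \<and> mu (E - {p. p \<odot> g \<in> E}) = 0" for g
  have to0: "(\<lambda>n. s * exp (- real n)) \<longlonglongrightarrow> 0" for s
  proof -
    have "(\<lambda>n. exp (- real n)) \<longlonglongrightarrow> 0"
      by (rule filterlim_compose[OF exp_at_bot]) (intro filterlim_uminus_at_bot[THEN iffD2], simp add: filterlim_real_sequentially)
    from tendsto_mult_right_zero[OF this, of s] show ?thesis .
  qed
  have Pu: "P (shear_u s)" for s
  proof -
    have d: "pdet (shear_u r) = 1" for r by (simp add: shear_u_def pdet_def)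
    \<comment> \<open>Conjugation contracts the shear by \<open>exp (- n)\<close>, while the measure
      of the displaced part stays the same; a constant sequence then tends to 0.\<close>
    have "dia (- real n) \<odot> shear_u s \<odot> dia (real n) = shear_u (s * exp (- real n))" for n
      by (rule cmat_eqI) (simp_all add: shear_u_def mult_ac flip: exp_add)
    then have "mu (E - {p. p \<odot> shear_u s \<in> E}) = mu (E - {p. p \<odot> shear_u (s * exp (- real n)) \<in> E})" for n
      using mu_conj[OF E d, of "real n" s] ip by simp
    moreover have "(\<lambda>n. mu (E - {p. p \<odot> shear_u (s * exp (- real n)) \<in> E})) \<longlonglongrightarrow> 0"
    proof (rule mu_translate_tendsto_0[OF InvD(1)[OF E] d])
      have "(\<lambda>n. (Complex (s * exp (- real n)) 1, 1 :: complex)) \<longlonglongrightarrow> (Complex 0 1, 1)"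
        by (intro tendsto_Pair tendsto_Complex to0 tendsto_const)
      then show "(\<lambda>n. shear_u (s * exp (- real n))) \<longlonglongrightarrow> pid"
        by (simp add: shear_u_def pid_def imaginary_unit.code)
    qed
    ultimately have "(\<lambda>n::nat. mu (E - {p. p \<odot> shear_u s \<in> E})) \<longlonglongrightarrow> 0" by simp
    then show ?thesis using d by (simp add: P_def LIMSEQ_const_iff)
  qed
  have Pl: "P (shear_l s)" for s
  proof -
    have d: "pdet (shear_l r) = 1" for r by (simp add: shear_l_def pdet_def)
    \<comment> \<open>The lower shears are contracted in the opposite time direction.\<close>
    have "dia (- (- real n)) \<odot> shear_l s \<odot> dia (- real n) = shear_l (s * exp (- real n))" for n
      by (rule cmat_eqI) (simp_all add: shear_l_def mult_ac flip: exp_add)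
    then have "mu (E - {p. p \<odot> shear_l s \<in> E}) = mu (E - {p. p \<odot> shear_l (s * exp (- real n)) \<in> E})" for n
      using mu_conj[OF E d, of "- real n" s] im by simp
    moreover have "(\<lambda>n. mu (E - {p. p \<odot> shear_l (s * exp (- real n)) \<in> E})) \<longlonglongrightarrow> 0"
    proof (rule mu_translate_tendsto_0[OF InvD(1)[OF E] d])
      have "(\<lambda>n. (\<i>, Complex 1 (s * exp (- real n)))) \<longlonglongrightarrow> (\<i>, Complex 1 0)"
        by (intro tendsto_Pair tendsto_Complex to0 tendsto_const)
      then show "(\<lambda>n. shear_l (s * exp (- real n))) \<longlonglongrightarrow> pid"
        by (simp add: shear_l_def pid_def one_complex.code)
    qed
    ultimately have "(\<lambda>n::nat. mu (E - {p. p \<odot> shear_l s \<in> E})) \<longlonglongrightarrow> 0" by simp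
    then show ?thesis using d by (simp add: P_def LIMSEQ_const_iff)
  qed
  have Pm: "P (g \<odot> h)" if g: "P g" and h: "P h" for g h
  proof -
    have gd: "pdet g = 1" and hd: "pdet h = 1" using g h by (auto simp: P_def)
    have ih: "inv_left (E - {p. p \<odot> h \<in> E})"
      using InvD(1)[OF E] inv_left_right[of h] hd by (intro inv_left_Diff) auto
    have ig: "inv_left (E - {p. p \<odot> g \<in> E})"
      using InvD(1)[OF E] inv_left_right[of g] gd by (intro inv_left_Diff) auto
    have b: "{p. p \<odot> g \<in> E - {p. p \<odot> h \<in> E}} \<in> sets borel" "E - {p. p \<odot> g \<in> E} \<in> sets borel"
      using borel_pmul_right[of "E - {p. p \<odot> h \<in> E}" g] ih ig unfolding inv_left_def by blast+
    \<comment> \<open>A point taken out of \<open>E\<close> by the product is taken out by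
      \<open>g\<close> or, after \<open>g\<close>, by \<open>h\<close>.\<close>
    have "E - {p. p \<odot> (g \<odot> h) \<in> E} \<subseteq> (E - {p. p \<odot> g \<in> E}) \<union> {p. p \<odot> g \<in> E - {p. p \<odot> h \<in> E}}"
      unfolding pmul_assoc[symmetric] by blast
    then have "mu (E - {p. p \<odot> (g \<odot> h) \<in> E}) \<le> mu ((E - {p. p \<odot> g \<in> E}) \<union> {p. p \<odot> g \<in> E - {p. p \<odot> h \<in> E}})"
      using b by (intro mu_mono sets.Un)
    also have "\<dots> \<le> mu (E - {p. p \<odot> g \<in> E}) + mu {p. p \<odot> g \<in> E - {p. p \<odot> h \<in> E}}"
      using b by (intro mu_subadd)
    also have "\<dots> = 0" using mu_right[OF gd ih] g h by (simp add: P_def)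
    finally show ?thesis using gd hd by (simp add: P_def)
  qed
  have Pall: "P g" if "pdet g = 1" for g using that Pm Pu Pl by (rule pdet_SL_induct)
  \<comment> \<open>Scaling extends the invariance from determinant 1 to the open set
    \<open>PW\<close>, where Lebesgue measure can serve in Fubini's theorem.\<close>
  have null: "emeasure lborel {p \<in> E. p \<odot> g \<notin> E} = 0" if g: "g \<in> PW" for g
  proof -
    let ?r = "1 / sqrt (pdet g)"
    have pg: "pdet g > 0" using g by (simp add: PW_def)
    let ?h = "?r *\<^sub>R g"
    have h1: "pdet ?h = 1" using pg by (simp add: power_divide)
    have "p \<odot> ?h \<in> E \<longleftrightarrow> p \<odot> g \<in> E" for p using InvD(4)[OF E, of ?r] pg by (simp add: pmul_scaleR_right)
    then have eq: "{p \<in> E. p \<odot> g \<notin> E} = E - {p. p \<odot> ?h \<in> E}" by auto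
    have il: "inv_left (E - {p. p \<odot> ?h \<in> E})"
      using InvD(1)[OF E] inv_left_right[of ?h] h1 by (intro inv_left_Diff) auto
    show ?thesis unfolding eq
    proof (rule null_of_det_lt1)
      show "E - {p. p \<odot> ?h \<in> E} \<in> sets borel" using il by (simp add: inv_left_def)
      show "r *\<^sub>R p \<in> E - {p. p \<odot> ?h \<in> E}" if "r \<noteq> 0" "p \<in> E - {p. p \<odot> ?h \<in> E}" for r p
        using that InvD(4)[OF E \<open>r \<noteq> 0\<close>] by (simp add: pmul_scaleR_left del: scaleR_scaleR)
      show "emeasure lborel ((E - {p. p \<odot> ?h \<in> E}) \<inter> det_lt1) = 0"
        by (rule mu_null[OF il]) (use Pall[OF h1] in \<open>simp add: P_def\<close>)
    qed
  qed
  define Q where "Q = {q :: cmat \<times> cmat. fst q \<in> E \<and> snd q \<in> PW \<and> fst q \<odot> snd q \<notin> E}"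
  have Qb: "Q \<in> sets borel"
  proof -
    have c: "(\<lambda>q :: cmat \<times> cmat. fst q \<odot> snd q) \<in> borel_measurable borel"
      by (intro borel_measurable_continuous_onI continuous_intros)
    have "fst -` E \<inter> space (borel :: (cmat \<times> cmat) measure) \<in> sets borel" by (rule measurable_sets[OF borel_measurable_fst Eb])
    moreover have "snd -` PW \<inter> space (borel :: (cmat \<times> cmat) measure) \<in> sets borel" by (rule measurable_sets[OF borel_measurable_snd borel_PW])
    moreover have "(\<lambda>q :: cmat \<times> cmat. fst q \<odot> snd q) -` E \<inter> space borel \<in> sets borel" by (rule measurable_sets[OF c Eb])
    ultimately have "(fst -` E \<inter> snd -` PW) - (\<lambda>q :: cmat \<times> cmat. fst q \<odot> snd q) -` E \<in> sets borel"
      by (intro sets.Diff sets.Int) simp_all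
    also have "(fst -` E \<inter> snd -` PW) - (\<lambda>q :: cmat \<times> cmat. fst q \<odot> snd q) -` E = Q" by (auto simp: Q_def)
    finally show ?thesis .
  qed
  have "emeasure lborel {p. (p, g) \<in> Q} = 0" for g
  proof (cases "g \<in> PW")
    case True then show ?thesis using null[OF True] by (simp add: Q_def)
  qed (simp add: Q_def)
  then have "emeasure lborel Q = 0" by (simp add: emeasure_lborel_prod(1)[OF Qb])
  then have "(\<integral>\<^sup>+p. emeasure lborel {g. (p, g) \<in> Q} \<partial>lborel) = 0" by (simp add: emeasure_lborel_prod(2)[OF Qb])
  moreover have "(\<lambda>p. emeasure lborel {g. (p, g) \<in> Q}) \<in> borel_measurable lborel"
    using lborel.measurable_emeasure_Pair[of Q lborel] Qb by (simp add: lborel_prod vimage_def)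
  ultimately have ae: "AE p in lborel. emeasure lborel {g. (p, g) \<in> Q} = 0"
    by (subst (asm) nn_integral_0_iff_AE) auto
  show "E \<in> null_sets QM \<or> space QM - E \<in> null_sets QM"
  proof (cases "emeasure lborel E = 0")
    case True
    then have "mu E \<le> 0" unfolding mu_def
      by (metis Eb Int_lower1 emeasure_mono inf_assoc sets_lborel)
    then show ?thesis using E by (simp add: null_sets_def sets_QM emeasure_QM)
  next
    case False
    have "\<exists>p\<in>E. emeasure lborel {g. (p, g) \<in> Q} = 0"
    proof (rule ccontr)
      assume *: "\<not> ?thesis"
      have "AE p in lborel. p \<notin> E" using ae by eventually_elim (use * in blast)
      then have "emeasure lborel E = 0" by (subst (asm) AE_iff_measurable[OF _ refl]) auto
      with False show False by simp
    qed
    then obtain p where p: "p \<in> E" "emeasure lborel {g. (p, g) \<in> Q} = 0" by blast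
    have pp: "pdet p > 0" using p EPW by (auto simp: PW_def)
    have N: "{g. (p, g) \<in> Q} \<in> sets borel" by (rule section_borel2[OF Qb])
    \<comment> \<open>If \<open>q\<close> is outside \<open>E\<close>, then
      \<open>pinv p \<odot> q\<close> is a translation that takes \<open>p\<close> out of
      \<open>E\<close>.\<close>
    have "PW - E \<subseteq> {q. pinv p \<odot> q \<in> {g. (p, g) \<in> Q}}"
      using p(1) pp by (auto simp: Q_def PW_def pdet_pinv)
    then have "emeasure lborel (PW - E) \<le> emeasure lborel {q. pinv p \<odot> q \<in> {g. (p, g) \<in> Q}}"
      by (intro emeasure_mono) (use borel_pmul_left[OF N] in auto)
    also have "\<dots> = 0" using pp by (intro emeasure_pmul_left_null[OF N p(2)]) (simp add: pdet_pinv)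
    finally have "emeasure lborel (PW - E) = 0" by simp
    then have "mu (PW - E) \<le> 0" unfolding mu_def
      by (metis Eb Int_lower1 borel_PW emeasure_mono inf_assoc sets.Diff sets_lborel)
    moreover have "PW - E \<in> Inv" using sigma_algebra.sets_measure_of_eq[OF sigma_algebra_Inv] E PW_Inv by (metis sets.Diff)
    ultimately show ?thesis by (simp add: null_sets_def sets_QM emeasure_QM)
  qed
qed

text \<open>The exceptional set may be taken as an invariant cone, and such a cone is Lebesgue null
  as soon as its cut over the fundamental domain is.\<close>

lemma AE_QM_E:
  assumes "AE p in QM. P p"
  obtains N where "N \<in> Inv" "emeasure lborel N = 0" "\<And>p. p \<in> PW \<Longrightarrow> p \<notin> N \<Longrightarrow> P p"
proof -
  obtain N where N: "{p \<in> space QM. \<not> P p} \<subseteq> N" "emeasure QM N = 0" "N \<in> sets QM"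
    using assms by (rule AE_E)
  have NI: "N \<in> Inv" using N by (simp add: sets_QM)
  have "mu N = 0" using N(2) emeasure_QM[OF NI] by simp
  then have "emeasure lborel (N \<inter> det_lt1) = 0" using mu_null InvD(1)[OF NI] by blast
  moreover have "r *\<^sub>R p \<in> N" if "r \<noteq> 0" "p \<in> N" for r p using InvD(4)[OF NI that(1)] that(2) by blast
  ultimately have 0: "emeasure lborel N = 0" using null_of_det_lt1[OF InvD(2)[OF NI]] by blast
  have "P p" if "p \<in> PW" "p \<notin> N" for p using N(1) that by auto
  with NI 0 show ?thesis by (rule that)
qed

text \<open>A flow box serves as a subset of \<open>PW\<close> of known positive volume.\<close>

lemma QM_pos: "measure QM (space QM) > 0"
proof (rule ccontr)
  interpret finite_measure QM by (rule finite_QM)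
  assume "\<not> ?thesis"
  then have "measure QM (space QM) = 0" by (simp add: not_less order_antisym)
  then have "emeasure QM PW = 0" by (simp add: emeasure_eq_measure)
  then have "mu PW = 0" by (simp add: emeasure_QM PW_Inv)
  then have 0: "emeasure lborel (PW \<inter> det_lt1) = 0" by (rule mu_null[OF inv_left_PW])
  have "ennreal 1 = emeasure lborel (cross_box 1 \<inter> {p. pdet p < 1})" by (rule emeasure_cross_box[symmetric]) simp
  also have "\<dots> \<le> emeasure lborel (PW \<inter> det_lt1)"
    by (intro emeasure_mono) (auto simp: cross_box_def det_lt1_def)
  finally show False using 0 by simp
qed

theorem birkhoff_QM:
  assumes f: "integrable QM f"
  shows "AE p in QM. (\<lambda>n. (\<Sum>k<n. f (p \<odot> dia (real k))) / real n) \<longlonglongrightarrow> (\<integral>p. f p \<partial>QM) / measure QM (space QM)"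
proof -
  have fp: "((\<lambda>p. p \<odot> dia 1) ^^ k) p = p \<odot> dia (real k)" for k p
    by (induction k) (simp_all add: dia_0 pmul_assoc dia_mult add.commute)
  from birkhoff_ergodic[OF finite_QM measurable_right_QM distr_right_QM ergodic_QM f QM_pos]
  show ?thesis by (simp add: birkhoff_sum_def[OF finite_QM measurable_right_QM distr_right_QM ergodic_QM] fp)
qed

end

section \<open>Excursions as alternating crossings\<close>

lemma locally_constant_connected:
  fixes S :: "real set" and A :: "real set"
  assumes S: "connected S" and loc: "\<And>x. x \<in> S \<Longrightarrow> \<exists>d>0. \<forall>y\<in>S. \<bar>y - x\<bar> < d \<longrightarrow> (y \<in> A \<longleftrightarrow> x \<in> A)"
    and x: "x \<in> S" "y \<in> S"
  shows "x \<in> A \<longleftrightarrow> y \<in> A"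
proof -
  have cont: "continuous_on S (\<lambda>x. if x \<in> A then 1 else 0 :: real)"
    unfolding continuous_on_iff
  proof (intro ballI allI impI)
    fix x e :: real assume "x \<in> S" "e > 0"
    with loc obtain d where "d > 0" "\<forall>y\<in>S. \<bar>y - x\<bar> < d \<longrightarrow> (y \<in> A \<longleftrightarrow> x \<in> A)" by blast
    then show "\<exists>d>0. \<forall>x'\<in>S. dist x' x < d \<longrightarrow> dist (if x' \<in> A then 1 else 0) (if x \<in> A then 1 else (0::real)) < e"
      using \<open>e > 0\<close> by (intro exI[of _ d]) (auto simp: dist_real_def)
  qed
  have "(\<lambda>x. if x \<in> A then 1 else 0 :: real) ` S \<subseteq> {0, 1}" by auto
  then have fin: "finite ((\<lambda>x. if x \<in> A then 1 else 0 :: real) ` S)" by (rule finite_subset) simp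
  have "(\<lambda>x. if x \<in> A then 1 else 0 :: real) constant_on S"
    by (rule continuous_finite_range_constant[OF S cont fin])
  then show ?thesis using x unfolding constant_on_def by (metis zero_neq_one)
qed

text \<open>Start at the least element and pass to the next larger one repeatedly; local finiteness
  supplies the next element and ensures that none is missed.\<close>

lemma enumerate_locally_finite:
  fixes C :: "real set"
  assumes fin: "\<And>T. finite (C \<inter> {..T})" and inf: "infinite C"
  shows "\<exists>c :: nat \<Rightarrow> real. strict_mono c \<and> range c = C"
proof -
  define nxt where "nxt x = Min (C \<inter> {x<..})" for x
  have unb: "\<exists>y\<in>C. y > x" for x
  proof (rule ccontr)
    assume "\<not> ?thesis"
    then have "C \<subseteq> C \<inter> {..x}" by (auto simp: not_less)
    then show False using fin[of x] inf finite_subset by blast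
  qed
  have least: "\<exists>m\<in>C \<inter> {x<..}. \<forall>y\<in>C \<inter> {x<..}. m \<le> y" for x
  proof -
    obtain y where y: "y \<in> C" "y > x" using unb by blast
    let ?S = "C \<inter> {x<..} \<inter> {..y}"
    have f: "finite ?S" using fin[of y] by (rule finite_subset[rotated]) auto
    have ne: "?S \<noteq> {}" using y by auto
    have "Min ?S \<in> ?S" using f ne by (rule Min_in)
    moreover have "Min ?S \<le> z" if "z \<in> C \<inter> {x<..}" for z
    proof (cases "z \<le> y")
      case True then show ?thesis using that f by (intro Min_le) auto
    next
      case False
      then have "Min ?S \<le> y" using f y by (intro Min_le) auto
      then show ?thesis using False by simp
    qed
    ultimately show ?thesis by blast
  qed
  have "\<exists>m. m \<in> C \<and> (\<forall>y\<in>C. m \<le> y)"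
  proof -
    obtain y where y: "y \<in> C" using inf by (metis ex_in_conv finite.emptyI)
    let ?S = "C \<inter> {..y}"
    have "Min ?S \<in> ?S" using fin[of y] y by (intro Min_in) auto
    moreover have "Min ?S \<le> z" if "z \<in> C" for z
    proof (cases "z \<le> y")
      case True then show ?thesis using that fin by (intro Min_le) auto
    next
      case False
      then have "Min ?S \<le> y" using fin[of y] y by (intro Min_le) auto
      then show ?thesis using False by simp
    qed
    ultimately show ?thesis by blast
  qed
  then obtain m where m: "m \<in> C" "\<And>y. y \<in> C \<Longrightarrow> m \<le> y" by blast
  have "\<exists>n. n \<in> C \<and> n > x \<and> (\<forall>y\<in>C. y > x \<longrightarrow> n \<le> y)" for x using least[of x] by force
  then have "\<forall>x. \<exists>n. n \<in> C \<and> n > x \<and> (\<forall>y\<in>C. y > x \<longrightarrow> n \<le> y)" by blast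
  from choice[OF this] obtain nx where "\<forall>x. nx x \<in> C \<and> nx x > x \<and> (\<forall>y\<in>C. y > x \<longrightarrow> nx x \<le> y)" by blast
  then have nx: "\<And>x. nx x \<in> C" "\<And>x. nx x > x" "\<And>x y. y \<in> C \<Longrightarrow> y > x \<Longrightarrow> nx x \<le> y" by blast+
  define c where "c n = (nx ^^ n) m" for n
  have cS: "c (Suc n) = nx (c n)" for n by (simp add: c_def)
  have cC: "c n \<in> C" for n by (cases n) (simp_all add: cS nx m, simp add: c_def m)
  have mono: "strict_mono c" unfolding strict_mono_Suc_iff cS using nx(2) by blast
  have "C \<subseteq> range c"
  proof
    fix y assume y: "y \<in> C"
    have "\<exists>n. c n > y"
    proof (rule ccontr)
      assume "\<not> ?thesis"
      then have "range c \<subseteq> C \<inter> {..y}" using cC by (auto simp: not_less)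
      then have "finite (range c)" using fin finite_subset by blast
      then show False using strict_mono_imp_inj_on[OF mono] finite_imageD by blast
    qed
    then obtain n where n: "c n > y" "\<And>k. k < n \<Longrightarrow> \<not> c k > y" using exists_least_iff[of "\<lambda>n. c n > y"] by blast
    obtain k where k: "n = Suc k" using n(1) m(2)[OF y] by (cases n) (auto simp: c_def)
    have "c k \<le> y" using n(2)[of k] k by simp
    moreover have "\<not> c k < y" using nx(3)[OF y, of "c k"] n(1) by (auto simp: k cS)
    ultimately have "y = c k" by simp
    then show "y \<in> range c" by blast
  qed
  then show ?thesis using mono cC by blast
qed

text \<open>\<open>A\<close> models the times at which a ray is in the subsurface, \<open>C\<close>
  its crossing times. Membership in \<open>A\<close> is locally constant off \<open>C\<close> and
  changes at each point of \<open>C\<close>. Time 0 is not a crossing, but it may belong to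
  \<open>A\<close>.\<close>

locale toggling =
  fixes A C :: "real set"
  assumes A_nonneg: "A \<subseteq> {0..}" and C_pos: "C \<subseteq> {0<..}" and C_A: "C \<subseteq> A"
    and C_fin: "\<And>T. finite (C \<inter> {..T})" and C_inf: "infinite C"
    and const: "\<And>x. 0 \<le> x \<Longrightarrow> x \<notin> C \<Longrightarrow> \<exists>d>0. \<forall>y\<ge>0. \<bar>y - x\<bar> < d \<longrightarrow> (y \<in> A \<longleftrightarrow> x \<in> A)"
    and toggle: "\<And>x. x \<in> C \<Longrightarrow> \<exists>d>0. \<forall>y z. x - d < y \<and> y < x \<and> x < z \<and> z < x + d \<longrightarrow> (y \<in> A \<longleftrightarrow> z \<notin> A)"
begin

lemma const_between:
  assumes "0 \<le> a" "\<And>z. a < z \<Longrightarrow> z < b \<Longrightarrow> z \<notin> C" and xy: "a < x" "x < b" "a < y" "y < b"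
  shows "x \<in> A \<longleftrightarrow> y \<in> A"
proof (rule locally_constant_connected[of "{a<..<b}"])
  fix z assume z: "z \<in> {a<..<b}"
  then have "\<exists>d>0. \<forall>y\<ge>0. \<bar>y - z\<bar> < d \<longrightarrow> (y \<in> A \<longleftrightarrow> z \<in> A)" using assms by (intro const) auto
  then show "\<exists>d>0. \<forall>y\<in>{a<..<b}. \<bar>y - z\<bar> < d \<longrightarrow> (y \<in> A \<longleftrightarrow> z \<in> A)" using assms(1) by force
qed (use xy in auto)

text \<open>Membership is constant between consecutive crossings and flips at each of them, so the
  parity of the number of crossings decides it.\<close>

lemma excursions_exist:
  "\<exists>t s. (\<forall>i::nat. t i < s i \<and> s i < t (Suc i)) \<and> A = (\<Union>i. {t i..s i})"
proof -
  obtain c :: "nat \<Rightarrow> real" where c: "strict_mono c" "range c = C"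
    using enumerate_locally_finite[OF C_fin C_inf] by blast
  have c0: "c n > 0" for n using c C_pos by auto
  have cA: "c n \<in> A" for n using c C_A by auto
  have cm: "c i < c j \<longleftrightarrow> i < j" for i j using c(1) by (rule strict_mono_less)
  have gap: "z \<notin> C" if "c n < z" "z < c (Suc n)" for n z
  proof
    assume "z \<in> C"
    then obtain j where "z = c j" using c by blast
    with that show False by (simp add: cm)
  qed
  have gap0: "z \<notin> C" if "z < c 0" for z
  proof
    assume "z \<in> C"
    then obtain j where "z = c j" using c by blast
    with that show False by (simp add: cm)
  qed
  define \<beta> where "\<beta> \<longleftrightarrow> 0 \<in> A"
  have first: "x \<in> A \<longleftrightarrow> \<beta>" if "0 \<le> x" "x < c 0" for x
  proof -
    have "x \<in> A \<longleftrightarrow> 0 \<in> A"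
    proof (rule locally_constant_connected[of "{0..<c 0}"])
      fix z assume z: "z \<in> {0..<c 0}"
      then have "\<exists>d>0. \<forall>y\<ge>0. \<bar>y - z\<bar> < d \<longrightarrow> (y \<in> A \<longleftrightarrow> z \<in> A)" using gap0 by (intro const) auto
      then show "\<exists>d>0. \<forall>y\<in>{0..<c 0}. \<bar>y - z\<bar> < d \<longrightarrow> (y \<in> A \<longleftrightarrow> z \<in> A)" by force
    qed (use that c0 in auto)
    then show ?thesis by (simp add: \<beta>_def)
  qed
  have flip: "y \<in> A \<longleftrightarrow> x \<notin> A"
    if x: "a < x" "x < c n" "\<And>z. a < z \<Longrightarrow> z < c n \<Longrightarrow> z \<notin> C" "0 \<le> a" and y: "c n < y" "y < c (Suc n)" for a x y n
  proof -
    have "c n \<in> C" using c by blast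
    from toggle[OF this] obtain d where d: "d > 0"
      "\<And>y z. c n - d < y \<Longrightarrow> y < c n \<Longrightarrow> c n < z \<Longrightarrow> z < c n + d \<Longrightarrow> y \<in> A \<longleftrightarrow> z \<notin> A" by blast
    \<comment> \<open>A point before the crossing that lies both in the gap and in the toggling
      neighbourhood; \<open>y'\<close> is its counterpart after the crossing.\<close>
    define x' where "x' = (max a (c n - d) + c n) / 2"
    have x': "a < x'" "c n - d < x'" "x' < c n" using x d by (auto simp: x'_def max_def)
    define y' where "y' = (min (c (Suc n)) (c n + d) + c n) / 2"
    have y': "c n < y'" "y' < c n + d" "y' < c (Suc n)" using y d by (auto simp: y'_def min_def)
    have "x \<in> A \<longleftrightarrow> x' \<in> A" using x x' by (intro const_between[of a "c n"]) auto
    moreover have "y \<in> A \<longleftrightarrow> y' \<in> A" using y y' c0[of n] gap by (intro const_between[of "c n" "c (Suc n)"]) auto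
    ultimately show ?thesis using d(2)[OF x'(2,3) y'(1,2)] by blast
  qed
  have inter: "x \<in> A \<longleftrightarrow> (\<beta> \<longleftrightarrow> odd n)" if "c n < x" "x < c (Suc n)" for n x
    using that
  proof (induction n arbitrary: x)
    case 0
    have "x \<in> A \<longleftrightarrow> c 0 / 2 \<notin> A" using c0[of 0] gap0 0 by (intro flip[of 0 _ 0]) auto
    then show ?case using first[of "c 0 / 2"] c0[of 0] by simp
  next
    case (Suc n)
    let ?x = "(c n + c (Suc n)) / 2"
    have lt: "c n < c (Suc n)" by (simp add: cm)
    have "x \<in> A \<longleftrightarrow> ?x \<notin> A" using lt c0[of n] gap Suc.prems by (intro flip[of "c n" _ "Suc n"]) auto
    then show ?case using Suc.IH[of ?x] lt by simp
  qed
  have cover: "x < c 0 \<or> (\<exists>n. x = c n) \<or> (\<exists>n. c n < x \<and> x < c (Suc n))" for x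
  proof (cases "x < c 0")
    case False
    have "\<exists>n. c n > x"
    proof (rule ccontr)
      assume "\<not> ?thesis"
      then have "range c \<subseteq> C \<inter> {..x}" using c by (auto simp: not_less)
      then have "finite C" using C_fin finite_subset c(2) by metis
      then show False using C_inf by blast
    qed
    then obtain n where n: "c n > x" "\<And>k. k < n \<Longrightarrow> \<not> c k > x" using exists_least_iff[of "\<lambda>n. c n > x"] by blast
    obtain k where k: "n = Suc k" using n(1) False by (cases n) auto
    have "c k \<le> x" using n(2)[of k] k by simp
    then show ?thesis using n(1) k by (metis le_less)
  qed simp
  show ?thesis
  proof (cases \<beta>)
    case True
    define s where "s i = c (2 * i)" for i
    \<comment> \<open>For a ray that starts inside, the first excursion begins at time 0, which is
      not a crossing.\<close>
    define t where "t i = (case i of 0 \<Rightarrow> 0 | Suc j \<Rightarrow> c (2 * j + 1))" for i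
    have ord: "t i < s i \<and> s i < t (Suc i)" for i
      by (cases i) (auto simp: t_def s_def c0 cm)
    have "x \<in> A \<longleftrightarrow> (\<exists>i. t i \<le> x \<and> x \<le> s i)" for x
    proof
      assume x: "x \<in> A"
      then have x0: "0 \<le> x" using A_nonneg by auto
      from cover[of x] consider "x < c 0" | n where "x = c n" | n where "c n < x" "x < c (Suc n)" by blast
      then show "\<exists>i. t i \<le> x \<and> x \<le> s i"
      proof cases
        case 1 then show ?thesis using x0 by (intro exI[of _ 0]) (simp add: t_def s_def)
      next
        case 2
        show ?thesis
        proof (cases "even n")
          case True
          then obtain i where "n = 2 * i" by (elim evenE)
          then have "x = s i" using 2 by (simp add: s_def)
          then show ?thesis using ord[of i] by (intro exI[of _ i]) auto
        next
          case False
          then obtain i where "n = 2 * i + 1" by (elim oddE)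
          then have "x = t (Suc i)" using 2 by (simp add: t_def)
          then show ?thesis using ord[of "Suc i"] by (intro exI[of _ "Suc i"]) auto
        qed
      next
        case 3
        then have "odd n" using inter[OF 3] x True by simp
        then obtain i where n: "n = 2 * i + 1" by (elim oddE)
        then show ?thesis using 3 by (intro exI[of _ "Suc i"]) (simp add: t_def s_def)
      qed
    next
      assume "\<exists>i. t i \<le> x \<and> x \<le> s i"
      then obtain i where i: "t i \<le> x" "x \<le> s i" by blast
      show "x \<in> A"
      proof (cases i)
        case 0
        then show ?thesis using i first[of x] True cA[of 0] by (cases "x = c 0") (auto simp: t_def s_def)
      next
        case (Suc j)
        then have "c (2 * j + 1) \<le> x" "x \<le> c (Suc (2 * j + 1))" using i by (auto simp: t_def s_def)
        then show ?thesis using inter[of "2 * j + 1" x] True cA by (metis dvd_triv_left even_plus_one_iff le_less)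
      qed
    qed
    then have "A = (\<Union>i. {t i..s i})" by auto
    with ord show ?thesis by blast
  next
    case False
    define t where "t i = c (2 * i)" for i
    define s where "s i = c (2 * i + 1)" for i
    have ord: "t i < s i \<and> s i < t (Suc i)" for i by (auto simp: t_def s_def cm)
    have "x \<in> A \<longleftrightarrow> (\<exists>i. t i \<le> x \<and> x \<le> s i)" for x
    proof
      assume x: "x \<in> A"
      then have x0: "0 \<le> x" using A_nonneg by auto
      from cover[of x] consider "x < c 0" | n where "x = c n" | n where "c n < x" "x < c (Suc n)" by blast
      then show "\<exists>i. t i \<le> x \<and> x \<le> s i"
      proof cases
        case 1 then show ?thesis using first[OF x0] x False by simp
      next
        case 2
        show ?thesis
        proof (cases "even n")
          case True
          then obtain i where "n = 2 * i" by (elim evenE)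
          then have "x = t i" using 2 by (simp add: t_def)
          then show ?thesis using ord[of i] by (intro exI[of _ i]) auto
        next
          case False
          then obtain i where "n = 2 * i + 1" by (elim oddE)
          then have "x = s i" using 2 by (simp add: s_def)
          then show ?thesis using ord[of i] by (intro exI[of _ i]) auto
        qed
      next
        case 3
        then have "even n" using inter[OF 3] x False by simp
        then obtain i where n: "n = 2 * i" by (elim evenE)
        then show ?thesis using 3 by (intro exI[of _ i]) (simp add: t_def s_def)
      qed
    next
      assume "\<exists>i. t i \<le> x \<and> x \<le> s i"
      then obtain i where i: "c (2 * i) \<le> x" "x \<le> c (Suc (2 * i))" by (auto simp: t_def s_def)
      then show "x \<in> A" using inter[of "2 * i" x] False cA by (metis dvd_triv_left le_less)
    qed
    then have "A = (\<Union>i. {t i..s i})" by auto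
    with ord show ?thesis by blast
  qed
qed

section \<open>Averages for arbitrary excursion parameters\<close>

context
  fixes t s :: "nat \<Rightarrow> real"
  assumes ord: "\<And>i. t i < s i" "\<And>i. s i < t (Suc i)" and A_eq: "A = (\<Union>i. {t i..s i})"
begin

lemma s_mono: "strict_mono s"
  unfolding strict_mono_Suc_iff using ord less_trans by blast

lemma t_mono: "strict_mono t"
  unfolding strict_mono_Suc_iff using ord less_trans by blast

lemma t_nonneg: "0 \<le> t i"
proof -
  have "t i \<in> A" using A_eq ord(1)[of i] by (auto intro!: exI[of _ i])
  then show ?thesis using A_nonneg by auto
qed

lemma gap_not_A: "s i < x \<Longrightarrow> x < t (Suc i) \<Longrightarrow> x \<notin> A"
proof
  assume x: "s i < x" "x < t (Suc i)" "x \<in> A"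
  then obtain j where j: "t j \<le> x" "x \<le> s j" using A_eq by auto
  have "j \<le> i" using strict_mono_less[OF t_mono, of j "Suc i"] j x by simp
  then have "s j \<le> s i" using strict_mono_less_eq[OF s_mono] by blast
  then show False using j x by simp
qed

lemma before_not_A: "x < t 0 \<Longrightarrow> x \<notin> A"
proof
  assume x: "x < t 0" "x \<in> A"
  then obtain j where j: "t j \<le> x" using A_eq by auto
  have "t 0 \<le> t j" using strict_mono_less_eq[OF t_mono, of 0 j] by simp
  then show False using j x by simp
qed

text \<open>Off \<open>C\<close> the point \<open>s i\<close> would have a neighbourhood in
  \<open>A\<close>, but the times right after it lie in a gap.\<close>

lemma s_in_C: "s i \<in> C"
proof (rule ccontr)
  assume "s i \<notin> C"
  have s0: "0 \<le> s i" using t_nonneg[of i] ord(1)[of i] by simp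
  from const[OF s0 \<open>s i \<notin> C\<close>] obtain d where d: "d > 0" "\<And>y. y \<ge> 0 \<Longrightarrow> \<bar>y - s i\<bar> < d \<Longrightarrow> y \<in> A \<longleftrightarrow> s i \<in> A" by blast
  have "s i \<in> A" using A_eq ord(1)[of i] by (auto intro!: exI[of _ i])
  define y where "y = (s i + min (t (Suc i)) (s i + d)) / 2"
  have y: "s i < y" "y < t (Suc i)" "y < s i + d" using ord(2)[of i] d by (auto simp: y_def min_def)
  have "y \<in> A" using d(2)[of y] y s0 \<open>s i \<in> A\<close> by simp
  then show False using gap_not_A y by blast
qed

text \<open>Off \<open>C\<close> membership would also persist right before \<open>t i\<close>, in a
  gap. An excursion starting at time 0 has no earlier time, hence the hypothesis.\<close>

lemma t_in_C: "t i > 0 \<Longrightarrow> t i \<in> C"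
proof (rule ccontr)
  assume t0: "t i > 0" and "t i \<notin> C"
  from const[OF less_imp_le[OF t0] \<open>t i \<notin> C\<close>]
  obtain d where d: "d > 0" "\<And>y. y \<ge> 0 \<Longrightarrow> \<bar>y - t i\<bar> < d \<Longrightarrow> y \<in> A \<longleftrightarrow> t i \<in> A" by blast
  have tA: "t i \<in> A" using A_eq ord(1)[of i] by (auto intro!: exI[of _ i])
  show False
  proof (cases i)
    case 0
    define y where "y = (t i + max 0 (t i - d)) / 2"
    have y: "0 \<le> y" "y < t i" "t i - d < y" using t0 d by (auto simp: y_def max_def)
    then have "y \<in> A" using d(2)[of y] tA by simp
    then show False using before_not_A y 0 by blast
  next
    case (Suc j)
    define y where "y = (t i + max (s j) (t i - d)) / 2"
    have y: "s j < y" "y < t i" "t i - d < y" using ord(2)[of j] Suc d by (auto simp: y_def max_def)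
    moreover have "0 \<le> y" using y t_nonneg[of j] ord(1)[of j] by simp
    ultimately have "y \<in> A" using d(2)[of y] tA by simp
    then show False using gap_not_A[of j y] y Suc by blast
  qed
qed

text \<open>A crossing strictly inside an excursion would have points of \<open>A\<close> on both
  sides, against toggling.\<close>

lemma C_cases: "x \<in> C \<Longrightarrow> (\<exists>i. x = s i) \<or> (\<exists>i. x = t i)"
proof (rule ccontr)
  assume x: "x \<in> C" and n: "\<not> ((\<exists>i. x = s i) \<or> (\<exists>i. x = t i))"
  have "x \<in> A" using x C_A by blast
  then obtain i where i: "t i \<le> x" "x \<le> s i" using A_eq by auto
  then have i': "t i < x" "x < s i" using n by (metis le_less)+
  from toggle[OF x] obtain d where d: "d > 0"
    "\<And>y z. x - d < y \<Longrightarrow> y < x \<Longrightarrow> x < z \<Longrightarrow> z < x + d \<Longrightarrow> y \<in> A \<longleftrightarrow> z \<notin> A" by blast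
  have inA: "y \<in> A" if "t i \<le> y" "y \<le> s i" for y using that A_eq by auto
  have 1: "x - d < (x + max (t i) (x - d)) / 2" "(x + max (t i) (x - d)) / 2 < x" "t i \<le> (x + max (t i) (x - d)) / 2"
    using i' d by (auto simp: max_def)
  have 2: "(x + min (s i) (x + d)) / 2 < x + d" "(x + min (s i) (x + d)) / 2 > x" "(x + min (s i) (x + d)) / 2 \<le> s i"
    using i' d by (auto simp: min_def)
  have "(x + max (t i) (x - d)) / 2 \<in> A" "(x + min (s i) (x + d)) / 2 \<in> A"
    using 1 2 i' by (auto intro!: inA)
  then show False using d(2)[OF 1(1,2) 2(2,1)] by blast
qed

lemma s_at_top: "filterlim s at_top sequentially"
proof -
  have "\<exists>n. s n > T" for T
  proof (rule ccontr)
    assume "\<not> ?thesis"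
    then have "range s \<subseteq> C \<inter> {..T}" using s_in_C by (auto simp: not_less)
    then have "finite (range s)" using C_fin finite_subset by blast
    then show False using strict_mono_imp_inj_on[OF s_mono] finite_imageD by blast
  qed
  then show ?thesis
    unfolding filterlim_at_top eventually_sequentially
    using strict_mono_less_eq[OF s_mono] by (metis less_le_trans order_less_imp_le)
qed

text \<open>Up to \<open>s n\<close> the crossings are the end points of the first
  \<open>n + 1\<close> excursions, except that \<open>t 0\<close> may be the initial time 0 and then
  does not count.\<close>

lemma count_crossings:
  "2 * (n + 1) - 1 \<le> card (C \<inter> {..s n})" "card (C \<inter> {..s n}) \<le> 2 * (n + 1)"
proof -
  have tpos: "t i > 0" if "i > 0" for i
    using strict_mono_less[OF t_mono, of 0 i] t_nonneg[of 0] that by simp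
  have injs: "inj_on s X" and injt: "inj_on t X" for X
    using strict_mono_imp_inj_on[OF s_mono] strict_mono_imp_inj_on[OF t_mono] inj_on_subset by blast+
  have st: "s i \<noteq> t j" for i j
  proof (cases "j \<le> i")
    case True
    then have "t j \<le> t i" using strict_mono_less_eq[OF t_mono] by blast
    then show ?thesis using ord(1)[of i] by simp
  next
    case False
    then have "t (Suc i) \<le> t j" using strict_mono_less_eq[OF t_mono] by simp
    then show ?thesis using ord(2)[of i] by simp
  qed
  have sub: "C \<inter> {..s n} \<subseteq> s ` {..n} \<union> t ` {..n}"
  proof
    fix x assume x: "x \<in> C \<inter> {..s n}"
    then consider i where "x = s i" | i where "x = t i" using C_cases by blast
    then show "x \<in> s ` {..n} \<union> t ` {..n}"
    proof cases
      case 1 then show ?thesis using x strict_mono_less_eq[OF s_mono] by auto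
    next
      case 2
      have "i \<le> n"
      proof (rule ccontr)
        assume "\<not> i \<le> n"
        then have "t (Suc n) \<le> t i" using strict_mono_less_eq[OF t_mono] by simp
        then show False using ord(2)[of n] x 2 by simp
      qed
      then show ?thesis using 2 by auto
    qed
  qed
  have "card (C \<inter> {..s n}) \<le> card (s ` {..n} \<union> t ` {..n})" by (rule card_mono[OF _ sub]) auto
  also have "\<dots> \<le> card (s ` {..n}) + card (t ` {..n})" by (rule card_Un_le)
  also have "\<dots> = 2 * (n + 1)" by (simp add: card_image[OF injs] card_image[OF injt])
  finally show "card (C \<inter> {..s n}) \<le> 2 * (n + 1)" .
  have "s ` {..n} \<union> t ` {1..n} \<subseteq> C \<inter> {..s n}"
  proof
    fix x assume "x \<in> s ` {..n} \<union> t ` {1..n}"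
    then consider i where "x = s i" "i \<le> n" | i where "x = t i" "i \<le> n" "i > 0" by auto
    then show "x \<in> C \<inter> {..s n}"
    proof cases
      case 1 then show ?thesis using s_in_C strict_mono_less_eq[OF s_mono] by auto
    next
      case 2
      have "t i \<le> t n" using strict_mono_less_eq[OF t_mono] 2 by blast
      then show ?thesis using t_in_C tpos 2 ord(1)[of n] by auto
    qed
  qed
  then have "card (s ` {..n} \<union> t ` {1..n}) \<le> card (C \<inter> {..s n})" by (rule card_mono[OF C_fin])
  moreover have "card (s ` {..n} \<union> t ` {1..n}) = card (s ` {..n}) + card (t ` {1..n})"
    using st by (intro card_Un_disjoint) auto
  ultimately show "2 * (n + 1) - 1 \<le> card (C \<inter> {..s n})"
    by (simp add: card_image[OF injs] card_image[OF injt])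
qed

lemma measure_A: "measure lborel (A \<inter> {..s n}) = (\<Sum>i\<le>n. s i - t i)"
proof -
  have eq: "A \<inter> {..s n} = (\<Union>i\<le>n. {t i..s i})"
  proof (intro equalityI subsetI)
    fix x assume x: "x \<in> A \<inter> {..s n}"
    then obtain i where i: "t i \<le> x" "x \<le> s i" using A_eq by auto
    have "i \<le> n"
    proof (rule ccontr)
      assume "\<not> i \<le> n"
      then have "t (Suc n) \<le> t i" using strict_mono_less_eq[OF t_mono] by simp
      then show False using ord(2)[of n] x i by simp
    qed
    then show "x \<in> (\<Union>i\<le>n. {t i..s i})" using i by auto
  next
    fix x assume "x \<in> (\<Union>i\<le>n. {t i..s i})"
    then obtain i where i: "i \<le> n" "t i \<le> x" "x \<le> s i" by auto
    then have "s i \<le> s n" using strict_mono_less_eq[OF s_mono] by blast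
    then show "x \<in> A \<inter> {..s n}" using i A_eq by auto
  qed
  have "disjoint_family_on (\<lambda>i. {t i..s i}) {..n}"
  proof -
    have "{t i..s i} \<inter> {t j..s j} = {}" if "i < j" for i j
    proof -
      have "t (Suc i) \<le> t j" using strict_mono_less_eq[OF t_mono] that by simp
      then show ?thesis using ord(2)[of i] by auto
    qed
    then show ?thesis unfolding disjoint_family_on_def by (metis Int_commute linorder_neqE_nat)
  qed
  then have "measure lborel (\<Union>i\<le>n. {t i..s i}) = (\<Sum>i\<le>n. measure lborel {t i..s i})"
    using ord(1) by (intro measure_finite_Union) (auto simp: less_imp_le)
  then show ?thesis unfolding eq using ord(1) by (simp add: less_imp_le)
qed

text \<open>The rates are known along integer times and are needed along the times
  \<open>s n\<close>. Both counting functions are monotone, so the limits extend to real time; the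
  average excursion is time per crossing, multiplied by crossings per excursion.\<close>

lemma excursion_average:
  assumes a: "(\<lambda>n. measure lborel (A \<inter> {..real n}) / real n) \<longlonglongrightarrow> a"
    and b: "(\<lambda>n. real (card (C \<inter> {..real n})) / real n) \<longlonglongrightarrow> b" "b > 0"
  shows "(\<lambda>n. (1 / real n) * (\<Sum>i<n. s i - t i)) \<longlonglongrightarrow> 2 * a / b"
proof -
  \<comment> \<open>A monotone function at \<open>x\<close> lies between its values at the
    neighbouring integers, whose ratios to \<open>x\<close> tend to 1.\<close>
  have real_lim: "((\<lambda>x. f x / x) \<longlongrightarrow> L) at_top"
    if f: "(\<lambda>n. f (real n) / real n) \<longlonglongrightarrow> L" and m: "mono f" and f0: "\<And>x. f x \<ge> 0" for f :: "real \<Rightarrow> real" and L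
  proof -
    have cancel: "u / N * (N / x) = u / x" if "N \<noteq> 0" for u N x :: real using that by simp
    have fl: "filterlim (\<lambda>x::real. nat \<lfloor>x\<rfloor>) sequentially at_top"
      unfolding filterlim_at_top
    proof
      fix N :: nat
      show "\<forall>\<^sub>F x::real in at_top. N \<le> nat \<lfloor>x\<rfloor>"
        using eventually_ge_at_top[of "real N"] by eventually_elim (simp add: le_nat_floor)
    qed
    have fl1: "filterlim (\<lambda>x::real. Suc (nat \<lfloor>x\<rfloor>)) sequentially at_top"
      using filterlim_compose[OF filterlim_Suc fl] .
    have q1: "((\<lambda>x::real. real (nat \<lfloor>x\<rfloor>) / x) \<longlongrightarrow> 1) at_top"
    proof (rule tendsto_sandwich[of "\<lambda>x::real. 1 - 1 / x" _ _ "\<lambda>x. 1"])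
      show "\<forall>\<^sub>F x::real in at_top. 1 - 1 / x \<le> real (nat \<lfloor>x\<rfloor>) / x"
        using eventually_gt_at_top[of 0]
      proof eventually_elim
        fix x :: real assume x: "0 < x"
        have "x - 1 \<le> real (nat \<lfloor>x\<rfloor>)" using x by linarith
        then have "(x - 1) / x \<le> real (nat \<lfloor>x\<rfloor>) / x" using x by (intro divide_right_mono) auto
        then show "1 - 1 / x \<le> real (nat \<lfloor>x\<rfloor>) / x" using x by (simp add: diff_divide_distrib)
      qed
      show "\<forall>\<^sub>F x::real in at_top. real (nat \<lfloor>x\<rfloor>) / x \<le> 1"
        using eventually_gt_at_top[of 0] by eventually_elim (simp add: of_nat_floor)
      have "((\<lambda>x::real. 1 / x) \<longlongrightarrow> 0) at_top" using tendsto_inverse_0_at_top[OF filterlim_ident] by (simp add: inverse_eq_divide)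
      from tendsto_diff[OF tendsto_const[of 1] this] show "((\<lambda>x::real. 1 - 1 / x) \<longlongrightarrow> 1) at_top" by simp
    qed simp
    have q2: "((\<lambda>x::real. real (Suc (nat \<lfloor>x\<rfloor>)) / x) \<longlongrightarrow> 1) at_top"
    proof -
      have "((\<lambda>x::real. 1 / x) \<longlongrightarrow> 0) at_top" using tendsto_inverse_0_at_top[OF filterlim_ident] by (simp add: inverse_eq_divide)
      from tendsto_add[OF q1 this] show ?thesis by (simp add: add_divide_distrib add.commute)
    qed
    have l1: "((\<lambda>x. (f (real (nat \<lfloor>x\<rfloor>)) / real (nat \<lfloor>x\<rfloor>)) * (real (nat \<lfloor>x\<rfloor>) / x)) \<longlongrightarrow> L * 1) at_top"
      by (intro tendsto_mult filterlim_compose[OF f fl] q1)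
    have l2: "((\<lambda>x. (f (real (Suc (nat \<lfloor>x\<rfloor>))) / real (Suc (nat \<lfloor>x\<rfloor>))) * (real (Suc (nat \<lfloor>x\<rfloor>)) / x)) \<longlongrightarrow> L * 1) at_top"
      by (intro tendsto_mult filterlim_compose[OF f fl1] q2)
    show ?thesis
    proof (rule tendsto_sandwich[OF _ _ l1[simplified mult_1_right] l2[simplified mult_1_right]])
      show "\<forall>\<^sub>F x in at_top. f (real (nat \<lfloor>x\<rfloor>)) / real (nat \<lfloor>x\<rfloor>) * (real (nat \<lfloor>x\<rfloor>) / x) \<le> f x / x"
        using eventually_ge_at_top[of 1]
      proof eventually_elim
        fix x :: real assume x: "1 \<le> x"
        have "0 < nat \<lfloor>x\<rfloor>" using x by linarith
        then have "0 < real (nat \<lfloor>x\<rfloor>)" by (simp only: of_nat_0_less_iff)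
        then have n0: "real (nat \<lfloor>x\<rfloor>) \<noteq> 0" by (rule less_imp_neq[THEN not_sym])
        have "f (real (nat \<lfloor>x\<rfloor>)) \<le> f x" using x by (intro monoD[OF m]) (simp add: of_nat_floor)
        then have "f (real (nat \<lfloor>x\<rfloor>)) / x \<le> f x / x" using x by (intro divide_right_mono) auto
        then show "f (real (nat \<lfloor>x\<rfloor>)) / real (nat \<lfloor>x\<rfloor>) * (real (nat \<lfloor>x\<rfloor>) / x) \<le> f x / x"
          by (simp only: cancel[OF n0])
      qed
      show "\<forall>\<^sub>F x in at_top. f x / x \<le> f (real (Suc (nat \<lfloor>x\<rfloor>))) / real (Suc (nat \<lfloor>x\<rfloor>)) * (real (Suc (nat \<lfloor>x\<rfloor>)) / x)"
        using eventually_ge_at_top[of 1]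
      proof eventually_elim
        fix x :: real assume x: "1 \<le> x"
        have n0: "real (Suc (nat \<lfloor>x\<rfloor>)) \<noteq> 0" by simp
        have "f x \<le> f (real (Suc (nat \<lfloor>x\<rfloor>)))" using x by (intro monoD[OF m]) linarith
        then have "f x / x \<le> f (real (Suc (nat \<lfloor>x\<rfloor>))) / x" using x by (intro divide_right_mono) auto
        then show "f x / x \<le> f (real (Suc (nat \<lfloor>x\<rfloor>))) / real (Suc (nat \<lfloor>x\<rfloor>)) * (real (Suc (nat \<lfloor>x\<rfloor>)) / x)"
          by (simp only: cancel[OF n0])
      qed
    qed
  qed
  have Ab: "A \<in> sets borel" unfolding A_eq by (intro sets.countable_UN) auto
  have mA: "mono (\<lambda>x. measure lborel (A \<inter> {..x}))"
  proof (rule monoI)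
    fix x y :: real assume "x \<le> y"
    have "emeasure lborel (A \<inter> {..y}) \<le> emeasure lborel {0..y}" using A_nonneg by (intro emeasure_mono) auto
    also have "\<dots> < \<infinity>" by (cases "0 \<le> y") auto
    finally have "A \<inter> {..y} \<in> fmeasurable lborel" using Ab by (intro fmeasurableI) auto
    then show "measure lborel (A \<inter> {..x}) \<le> measure lborel (A \<inter> {..y})"
      using \<open>x \<le> y\<close> Ab by (intro measure_mono_fmeasurable) auto
  qed
  have mC: "mono (\<lambda>x. real (card (C \<inter> {..x})))"
    by (rule monoI) (auto intro!: card_mono C_fin)
  have la: "(\<lambda>n. measure lborel (A \<inter> {..s n}) / s n) \<longlonglongrightarrow> a"
    using filterlim_compose[OF real_lim[OF a mA] s_at_top] by simp
  have lb: "(\<lambda>n. real (card (C \<inter> {..s n})) / s n) \<longlonglongrightarrow> b"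
    using filterlim_compose[OF real_lim[OF b(1) mC] s_at_top] by simp
  \<comment> \<open>Two crossings per excursion, with a possible defect of one in total.\<close>
  have lc: "(\<lambda>n. real (card (C \<inter> {..s n})) / real (n + 1)) \<longlonglongrightarrow> 2"
  proof (rule tendsto_sandwich[of "\<lambda>n. 2 - 1 / real (n + 1)" _ _ "\<lambda>n. 2"])
    show "\<forall>\<^sub>F n in sequentially. 2 - 1 / real (n + 1) \<le> real (card (C \<inter> {..s n})) / real (n + 1)"
    proof (rule always_eventually, rule allI)
      fix n
      have "real (2 * (n + 1)) - 1 \<le> real (card (C \<inter> {..s n}))" using count_crossings(1)[of n] by linarith
      then have "(real (2 * (n + 1)) - 1) / real (n + 1) \<le> real (card (C \<inter> {..s n})) / real (n + 1)"
        by (intro divide_right_mono) auto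
      moreover have "(real (2 * (n + 1)) - 1) / real (n + 1) = 2 - 1 / real (n + 1)" by (simp add: field_simps)
      ultimately show "2 - 1 / real (n + 1) \<le> real (card (C \<inter> {..s n})) / real (n + 1)" by simp
    qed
    show "\<forall>\<^sub>F n in sequentially. real (card (C \<inter> {..s n})) / real (n + 1) \<le> 2"
    proof (rule always_eventually, rule allI)
      fix n
      have "real (card (C \<inter> {..s n})) \<le> 2 * real (n + 1)" using count_crossings(2)[of n] by linarith
      then show "real (card (C \<inter> {..s n})) / real (n + 1) \<le> 2" by (simp add: field_simps)
    qed
    have "(\<lambda>n. 1 / real (n + 1)) \<longlonglongrightarrow> 0" using LIMSEQ_inverse_real_of_nat by (simp add: inverse_eq_divide)
    from tendsto_diff[OF tendsto_const[of 2] this] show "(\<lambda>n. 2 - 1 / real (n + 1)) \<longlonglongrightarrow> 2" by simp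
  qed simp
  have "(\<lambda>n. (measure lborel (A \<inter> {..s n}) / s n) / (real (card (C \<inter> {..s n})) / s n) * (real (card (C \<inter> {..s n})) / real (n + 1))) \<longlonglongrightarrow> a / b * 2"
    using b(2) by (intro tendsto_mult tendsto_divide la lb lc) simp
  moreover have "(measure lborel (A \<inter> {..s n}) / s n) / (real (card (C \<inter> {..s n})) / s n) * (real (card (C \<inter> {..s n})) / real (n + 1)) =
    (1 / real (Suc n)) * (\<Sum>i<Suc n. s i - t i)" for n
  proof -
    have "s n > 0" using t_nonneg[of n] ord(1)[of n] by simp
    moreover have "real (card (C \<inter> {..s n})) > 0" using count_crossings(1)[of n] by simp
    ultimately show ?thesis by (simp add: measure_A lessThan_Suc_atMost)
  qed
  ultimately have "(\<lambda>n. (1 / real (Suc n)) * (\<Sum>i<Suc n. s i - t i)) \<longlonglongrightarrow> a / b * 2" by (simp only:)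
  then have "(\<lambda>n. (1 / real n) * (\<Sum>i<n. s i - t i)) \<longlonglongrightarrow> a / b * 2"
    by (subst (asm) filterlim_sequentially_Suc)
  then show ?thesis by (simp add: mult.commute)
qed

end

end

section \<open>Crossings of closed geodesics\<close>

lemma emeasure_line_null:
  assumes "\<alpha> \<noteq> 0 \<or> \<beta> \<noteq> 0"
  shows "emeasure lborel {w::complex. \<alpha> * Re w + \<beta> * Im w = \<gamma>} = 0"
proof -
  have "negligible {w. Complex \<alpha> \<beta> \<bullet> w = \<gamma>}"
    using assms by (intro negligible_hyperplane) (auto simp: complex_eq_iff)
  moreover have "{w. Complex \<alpha> \<beta> \<bullet> w = \<gamma>} = {w. \<alpha> * Re w + \<beta> * Im w = \<gamma>}" by (simp add: inner_complex_def)
  ultimately have "{w. \<alpha> * Re w + \<beta> * Im w = \<gamma>} \<in> null_sets lebesgue" by (simp add: negligible_iff_null_sets)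
  moreover have "closed {w. \<alpha> * Re w + \<beta> * Im w = \<gamma>}" by (intro closed_Collect_eq continuous_intros)
  ultimately show ?thesis by (simp add: null_sets_completion_iff null_sets_def)
qed

lemma emeasure_hyperbola_null:
  "emeasure lborel {w::complex. (Re w - a) * (Im w - b) = c} = 0"
proof -
  let ?S = "{w::complex. (Re w - a) * (Im w - b) = c}"
  have "closed ?S" by (intro closed_Collect_eq continuous_intros)
  then have S[measurable]: "?S \<in> sets borel" by simp
  have "emeasure lborel ?S = (\<integral>\<^sup>+w. indicator ?S w \<partial>lborel)" by simp
  also have "\<dots> = (\<integral>\<^sup>+x. \<integral>\<^sup>+y. indicator ?S (Complex x y) \<partial>lborel \<partial>lborel)"
    by (rule nn_integral_lborel_complex) simp
  also have "\<dots> = (\<integral>\<^sup>+x. 0 \<partial>(lborel :: real measure))"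
  proof (rule nn_integral_cong_AE, rule AE_mp[OF AE_lborel_singleton[of a]], rule AE_I2, rule impI)
    fix x :: real assume x: "x \<noteq> a"
    have "(\<integral>\<^sup>+y. indicator ?S (Complex x y) \<partial>lborel) = (\<integral>\<^sup>+y. 0 \<partial>(lborel :: real measure))"
    proof (rule nn_integral_cong_AE, rule AE_mp[OF AE_lborel_singleton[of "b + c / (x - a)"]], rule AE_I2, rule impI)
      fix y assume "y \<noteq> b + c / (x - a)"
      then have "(x - a) * (y - b) \<noteq> c" using x by (auto simp: field_simps)
      then show "indicator ?S (Complex x y) = (0::ennreal)" by simp
    qed
    then show "(\<integral>\<^sup>+y. indicator ?S (Complex x y) \<partial>lborel) = 0" by simp
  qed
  finally show ?thesis by simp
qed

text \<open>In terms of the matrix entries this is \<open>a * c\<close>; it vanishes exactly when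
  the forward end point \<open>a / c\<close> is one of the end points 0 and infinity of the
  imaginary axis.\<close>

definition acq :: "cmat \<Rightarrow> real" where "acq q = Im (fst q) * Im (snd q)"

text \<open>
  \<open>Z1\<close> and \<open>Z2\<close> contain the geodesics asymptotic to the imaginary axis and those starting on
  it, \<open>Z3 z\<close> those passing through \<open>z\<close>.
\<close>

definition Z1 :: "cmat set" where "Z1 = {q. acq q = 0}"
definition Z2 :: "cmat set" where "Z2 = {q. Im (snd q) \<noteq> 0 \<and> Im (fst q) * Im (snd q) + Re (fst q) * Re (snd q) = 0}"
definition Z3 :: "complex \<Rightarrow> cmat set" where
  "Z3 z = {q. (Re (fst q) - Re z * Re (snd q)) * (Im (fst q) - Re z * Im (snd q)) = - ((Im z)\<^sup>2 * Re (snd q) * Im (snd q))}"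

lemma Z1_null: "Z1 \<in> sets borel" "emeasure lborel Z1 = 0"
proof -
  let ?A = "{q::cmat. Im (fst q) = 0}" and ?B = "{q::cmat. Im (snd q) = 0}"
  have "closed ?A" "closed ?B" by (intro closed_Collect_eq continuous_intros)+
  then have b: "?A \<in> sets borel" "?B \<in> sets borel" by simp_all
  have eq: "Z1 = ?A \<union> ?B" by (auto simp: Z1_def acq_def)
  show "Z1 \<in> sets borel" unfolding eq using b by (rule sets.Un)
  have 0: "emeasure lborel {w::complex. Im w = 0} = 0" using emeasure_line_null[of 0 1 0] by simp
  have "emeasure lborel ?A = 0" using 0 by (simp add: emeasure_lborel_prod(1)[OF b(1)])
  moreover have "emeasure lborel ?B = 0" using 0 by (simp add: emeasure_lborel_prod(2)[OF b(2)])
  ultimately show "emeasure lborel Z1 = 0" unfolding eq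
    by (intro emeasure_Un_null_set[THEN trans]) (use b in \<open>auto simp: null_sets_def\<close>)
qed

text \<open>For a fixed second row the condition on the first row is the equation of a line.\<close>

lemma Z2_null: "Z2 \<in> sets borel" "emeasure lborel Z2 = 0"
proof -
  let ?B = "{q::cmat. Im (snd q) = 0}" and ?C = "{q::cmat. Im (fst q) * Im (snd q) + Re (fst q) * Re (snd q) = 0}"
  have "closed ?B" "closed ?C" by (intro closed_Collect_eq continuous_intros)+
  then have "?C - ?B \<in> sets borel" by (intro sets.Diff) simp_all
  also have "?C - ?B = Z2" by (auto simp: Z2_def)
  finally show b: "Z2 \<in> sets borel" .
  have "emeasure lborel {w. (w, s) \<in> Z2} = 0" for s
  proof (cases "Im s = 0")
    case True then show ?thesis by (simp add: Z2_def)
  next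
    case False
    have "{w. (w, s) \<in> Z2} = {w. Re s * Re w + Im s * Im w = 0}" using False by (auto simp: Z2_def mult.commute add.commute)
    then show ?thesis using emeasure_line_null[of "Re s" "Im s" 0] False by simp
  qed
  then show "emeasure lborel Z2 = 0" by (simp add: emeasure_lborel_prod(1)[OF b])
qed

text \<open>For a fixed second row the condition on the first row is the equation of a (possibly
  degenerate) hyperbola.\<close>

lemma Z3_null: "Z3 z \<in> sets borel" "emeasure lborel (Z3 z) = 0"
proof -
  have "closed (Z3 z)" unfolding Z3_def by (intro closed_Collect_eq continuous_intros)
  then show b: "Z3 z \<in> sets borel" by simp
  have "emeasure lborel {w. (w, s) \<in> Z3 z} = 0" for s
    using emeasure_hyperbola_null[of "Re z * Re s" "Re z * Im s" "- ((Im z)\<^sup>2 * Re s * Im s)"] by (simp add: Z3_def)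
  then show "emeasure lborel (Z3 z) = 0" by (simp add: emeasure_lborel_prod(1)[OF b])
qed

lemma Z_scaleR:
  assumes "r \<noteq> 0"
  shows "r *\<^sub>R q \<in> Z1 \<longleftrightarrow> q \<in> Z1" "r *\<^sub>R q \<in> Z2 \<longleftrightarrow> q \<in> Z2" "r *\<^sub>R q \<in> Z3 z \<longleftrightarrow> q \<in> Z3 z"
proof -
  show "r *\<^sub>R q \<in> Z1 \<longleftrightarrow> q \<in> Z1" using assms by (simp add: Z1_def acq_def)
  have "Im (fst (r *\<^sub>R q)) * Im (snd (r *\<^sub>R q)) + Re (fst (r *\<^sub>R q)) * Re (snd (r *\<^sub>R q)) =
    (r * r) * (Im (fst q) * Im (snd q) + Re (fst q) * Re (snd q))" by (simp add: algebra_simps)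
  then show "r *\<^sub>R q \<in> Z2 \<longleftrightarrow> q \<in> Z2" using assms by (simp add: Z2_def)
  let ?L = "\<lambda>q. (Re (fst q) - Re z * Re (snd q)) * (Im (fst q) - Re z * Im (snd q)) + ((Im z)\<^sup>2 * Re (snd q) * Im (snd q))"
  have "?L (r *\<^sub>R q) = (r * r) * ?L q" by (simp add: algebra_simps)
  then have "?L (r *\<^sub>R q) = 0 \<longleftrightarrow> ?L q = 0" using assms by simp
  then show "r *\<^sub>R q \<in> Z3 z \<longleftrightarrow> q \<in> Z3 z" unfolding Z3_def mem_Collect_eq by (simp only: eq_neg_iff_add_eq_0)
qed

text \<open>Real and imaginary part of \<open>fst = z * snd\<close> give two equations in
  \<open>exp (t/2)\<close> and \<open>exp (- t/2)\<close>; multiplying them eliminates the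
  time.\<close>

lemma Z3_passes:
  assumes p: "p \<in> PW" and z: "pt (p \<odot> dia t) = z" shows "p \<in> Z3 z"
proof -
  obtain a b c d where pp: "p = (Complex b a, Complex d c)" by (metis complex_surj prod.exhaust)
  have nz: "snd (p \<odot> dia t) \<noteq> 0" using p by (intro PW_snd) (simp add: PW_def)
  then have e: "fst (p \<odot> dia t) = z * snd (p \<odot> dia t)"
    using z unfolding pt_def by (metis nonzero_divide_eq_eq)
  define u v where "u = exp (t/2)" and "v = exp (- t/2)"
  have uv: "u * v = 1" by (simp add: u_def v_def flip: exp_add)
  have "Re (fst (p \<odot> dia t)) = Re (z * snd (p \<odot> dia t))" "Im (fst (p \<odot> dia t)) = Im (z * snd (p \<odot> dia t))"
    using e by simp_all
  then have r: "b * v = Re z * (d * v) - Im z * (c * u)" and i: "a * u = Re z * (c * u) + Im z * (d * v)"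
    by (simp_all add: pp u_def v_def)
  have "(b - Re z * d) * (a - Re z * c) = ((b - Re z * d) * v) * ((a - Re z * c) * u)"
    using uv by (simp add: mult_ac)
  also have "(b - Re z * d) * v = - Im z * (c * u)" using r by (simp add: algebra_simps)
  also have "(a - Re z * c) * u = Im z * (d * v)" using i by (simp add: algebra_simps)
  also have "(- Im z * (c * u)) * (Im z * (d * v)) = - ((Im z)\<^sup>2 * d * c) * (u * v)" by (simp add: power2_eq_square algebra_simps)
  finally show ?thesis by (simp add: Z3_def pp uv)
qed

text \<open>With \<open>E = exp t\<close> and \<open>v = exp s\<close> meeting the axis at
  \<open>ax s\<close> means \<open>b = - (v * c * E)\<close> and \<open>a * E = v * d\<close>.
  Solving for the squares of \<open>E\<close> and \<open>v\<close> gives the logarithms in the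
  definitions.\<close>

lemma cross_iff:
  assumes q: "q \<in> PW" and ac: "acq q \<noteq> 0"
  shows "pt (q \<odot> dia t) = ax s \<longleftrightarrow> crosses q \<and> cross_time q = t \<and> cross_pos q = s"
proof -
  obtain a b c d where qq: "q = (Complex b a, Complex d c)" by (metis complex_surj prod.exhaust)
  have a: "a \<noteq> 0" and c: "c \<noteq> 0" using ac by (auto simp: qq acq_def)
  have det: "a * d - b * c > 0" using q by (simp add: qq PW_def pdet_def)
  define E v where "E = exp t" and "v = exp s"
  have E: "E > 0" and v: "v > 0" by (simp_all add: E_def v_def)
  have nz: "snd (q \<odot> dia t) \<noteq> 0" using q by (intro PW_snd) (simp add: PW_def)
  define u w where "u = exp (t/2)" and "w = exp (- t/2)"
  have u: "u > 0" "w > 0" and uw: "u * w = 1" and uu: "u * u = E"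
    by (simp_all add: u_def w_def E_def flip: exp_add)
  have "pt (q \<odot> dia t) = ax s \<longleftrightarrow> fst (q \<odot> dia t) = ax s * snd (q \<odot> dia t)"
    using nz by (simp add: pt_def divide_eq_eq)
  also have "\<dots> \<longleftrightarrow> b * w = - (v * (c * u)) \<and> a * u = v * (d * w)"
    by (simp add: complex_eq_iff qq v_def u_def w_def)
  also have "\<dots> \<longleftrightarrow> b = - (v * c * E) \<and> a * E = v * d"
  proof -
    have cu: "x = y \<longleftrightarrow> x * u = y * u" for x y using u by simp
    have "b * w = - (v * (c * u)) \<longleftrightarrow> (b * w) * u = (- (v * (c * u))) * u" by (rule cu)
    also have "(b * w) * u = b" using uw by (simp add: mult.assoc mult.commute[of w])
    also have "(- (v * (c * u))) * u = - (v * c * E)" by (simp add: uu[symmetric] mult_ac)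
    finally have 1: "b * w = - (v * (c * u)) \<longleftrightarrow> b = - (v * c * E)" .
    have "a * u = v * (d * w) \<longleftrightarrow> (a * u) * u = (v * (d * w)) * u" by (rule cu)
    also have "(v * (d * w)) * u = v * d" using uw by (simp add: mult.assoc mult.commute[of w])
    also have "(a * u) * u = a * E" by (simp add: uu[symmetric] mult_ac)
    finally show ?thesis using 1 by simp
  qed
  also have "\<dots> \<longleftrightarrow> crosses q \<and> cross_time q = t \<and> cross_pos q = s"
  proof
    assume *: "b = - (v * c * E) \<and> a * E = v * d"
    then have b: "b = - (v * c * E)" and d: "d = a * E / v" using v by (auto simp: field_simps)
    have "(a * c) * (b * d) = - ((a * c)\<^sup>2 * E\<^sup>2)" using v by (simp add: b d power2_eq_square)
    moreover have "(a * c)\<^sup>2 * E\<^sup>2 > 0" using a c E by simp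
    ultimately have "crosses q" by (simp add: crosses_def qq)
    moreover have "- (b * d) / (a * c) = E\<^sup>2" using a c v by (simp add: b d power2_eq_square field_simps)
    moreover have "- (a * b) / (c * d) = v\<^sup>2" using a c v E by (simp add: b d power2_eq_square field_simps)
    ultimately show "crosses q \<and> cross_time q = t \<and> cross_pos q = s"
      by (simp add: cross_time_def cross_pos_def qq E_def v_def ln_realpow)
  next
    assume *: "crosses q \<and> cross_time q = t \<and> cross_pos q = s"
    then have cr: "(a * d) * (b * c) < 0" by (simp add: crosses_def qq mult_ac)
    have bd: "b \<noteq> 0" "d \<noteq> 0" using cr by auto
    have "0 < a * d \<and> b * c < 0 \<or> a * d < 0 \<and> 0 < b * c" using cr by (simp only: mult_less_0_iff[of "a * d" "b * c"])
    \<comment> \<open>The two products have opposite signs and the determinant is positive, which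
      settles the signs lost by squaring.\<close>
    then have ad: "a * d > 0" and bc: "b * c < 0" using det by linarith+
    have neg_div: "- x / y > 0" if "x * y < 0" for x y :: real
    proof -
      have y: "y \<noteq> 0" using that by auto
      then have "- x / y = - (x * y) / (y * y)" by simp
      moreover have "y * y > 0" using y by (simp add: zero_less_mult_iff) linarith
      ultimately show ?thesis using that by (simp only: divide_pos_pos neg_0_less_iff_less)
    qed
    have p1: "- (b * d) / (a * c) > 0"
    proof -
      have "(b * d) * (a * c) < 0" using cr by (simp add: mult_ac)
      then show ?thesis by (rule neg_div)
    qed
    have p2: "- (a * b) / (c * d) > 0"
    proof -
      have "(a * b) * (c * d) < 0" using cr by (simp add: mult_ac)
      then show ?thesis by (rule neg_div)
    qed
    have "ln (- (b * d) / (a * c)) = 2 * t" using * by (simp add: cross_time_def qq)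
    then have "- (b * d) / (a * c) = exp (2 * t)" using p1 by (metis exp_ln)
    then have E2: "E\<^sup>2 = - (b * d) / (a * c)" by (simp add: E_def exp_double)
    have "ln (- (a * b) / (c * d)) = 2 * s" using * by (simp add: cross_pos_def qq)
    then have "- (a * b) / (c * d) = exp (2 * s)" using p2 by (metis exp_ln)
    then have v2: "v\<^sup>2 = - (a * b) / (c * d)" by (simp add: v_def exp_double)
    have "(v * c * E)\<^sup>2 = v\<^sup>2 * E\<^sup>2 * c\<^sup>2" by (simp add: power_mult_distrib mult_ac)
    also have "\<dots> = b\<^sup>2" unfolding E2 v2 using a c bd by (simp add: power2_eq_square field_simps)
    finally have "b = v * c * E \<or> b = - (v * c * E)" by (metis power2_eq_iff)
    moreover have "b \<noteq> v * c * E"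
    proof
      assume "b = v * c * E"
      then have "b * c = (v * E) * c\<^sup>2" by (simp add: power2_eq_square mult_ac)
      moreover have "(v * E) * c\<^sup>2 \<ge> 0" using v E by simp
      ultimately show False using bc by simp
    qed
    ultimately have b: "b = - (v * c * E)" by blast
    have "(v * d)\<^sup>2 = v\<^sup>2 * d\<^sup>2" by (simp add: power_mult_distrib)
    also have "\<dots> = a\<^sup>2 * E\<^sup>2" unfolding E2 v2 using a c bd by (simp add: power2_eq_square field_simps)
    also have "\<dots> = (a * E)\<^sup>2" by (simp add: power_mult_distrib)
    finally have "v * d = a * E \<or> v * d = - (a * E)" by (metis power2_eq_iff)
    moreover have "v * d \<noteq> - (a * E)"
    proof
      assume vd: "v * d = - (a * E)"
      have "v * (a * d) = a * (v * d)" by (simp add: mult_ac)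
      also have "\<dots> = - (E * a\<^sup>2)" unfolding vd by (simp add: power2_eq_square mult_ac)
      finally have "v * (a * d) = - (E * a\<^sup>2)" .
      moreover have "v * (a * d) > 0" using v ad by simp
      moreover have "E * a\<^sup>2 \<ge> 0" using E by simp
      ultimately show False by linarith
    qed
    ultimately show "b = - (v * c * E) \<and> a * E = v * d" using b by simp
  qed
  finally show ?thesis .
qed

text \<open>\<open>B i\<close> carries the imaginary axis, with its arc length parameter, to a lift
  of the \<open>i\<close>-th closed geodesic, whose simple period is \<open>l i\<close>.\<close>

locale geodesic_system = fuchsian_domain +
  fixes k :: nat and B :: "nat \<Rightarrow> cmat" and l :: "nat \<Rightarrow> real"
  assumes Bdet: "i \<in> {1..k} \<Longrightarrow> pdet (B i) = 1"
    and lpos: "i \<in> {1..k} \<Longrightarrow> 0 < l i"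
    and per: "i \<in> {1..k} \<Longrightarrow> orb (mact (B i) (ax (t + l i))) = orb (mact (B i) (ax t))"
    and inj: "i \<in> {1..k} \<Longrightarrow> s \<in> {0..<l i} \<Longrightarrow> t \<in> {0..<l i} \<Longrightarrow>
        orb (mact (B i) (ax s)) = orb (mact (B i) (ax t)) \<Longrightarrow> s = t"
    and disj: "i \<in> {1..k} \<Longrightarrow> j \<in> {1..k} \<Longrightarrow> i \<noteq> j \<Longrightarrow> orb (mact (B i) (ax s)) \<noteq> orb (mact (B j) (ax t))"
begin

section \<open>Periodicity and separation of the lifted boundary\<close>

definition gam :: "nat \<Rightarrow> real \<Rightarrow> complex" where "gam i t = mact (B i) (ax t)"

lemma gam_half_plane: "i \<in> {1..k} \<Longrightarrow> gam i t \<in> half_plane"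
  unfolding gam_def by (intro mact_half_plane) (simp_all add: Bdet)

lemma orb_gam_shift_nat: "i \<in> {1..k} \<Longrightarrow> orb (gam i (t + real n * l i)) = orb (gam i t)"
proof (induction n)
  case (Suc n)
  have "t + real (Suc n) * l i = (t + real n * l i) + l i" by (simp add: algebra_simps)
  then have "orb (gam i (t + real (Suc n) * l i)) = orb (gam i ((t + real n * l i) + l i))" by (simp only:)
  also have "\<dots> = orb (gam i (t + real n * l i))" unfolding gam_def by (rule per[OF Suc.prems])
  finally show ?case using Suc by simp
qed simp

lemma orb_gam_shift: "i \<in> {1..k} \<Longrightarrow> orb (gam i (t + of_int n * l i)) = orb (gam i t)"
proof (cases "n \<ge> 0")
  case True
  assume "i \<in> {1..k}"
  from orb_gam_shift_nat[OF this, of t "nat n"] True show ?thesis by simp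
next
  case False
  assume "i \<in> {1..k}"
  from orb_gam_shift_nat[OF this, of "t + of_int n * l i" "nat (- n)"] False show ?thesis by simp
qed

lemma orb_gam_reduce:
  assumes i: "i \<in> {1..k}" shows "\<exists>n::int. t + of_int n * l i \<in> {0..<l i}"
proof -
  have l: "l i > 0" by (rule lpos[OF i])
  have f: "of_int \<lfloor>t / l i\<rfloor> \<le> t / l i" "t / l i < of_int \<lfloor>t / l i\<rfloor> + 1" by linarith+
  have "of_int \<lfloor>t / l i\<rfloor> * l i \<le> t" "t < (of_int \<lfloor>t / l i\<rfloor> + 1) * l i"
    using pos_le_divide_eq[OF l, THEN iffD1, OF f(1)] pos_divide_less_eq[OF l, THEN iffD1, OF f(2)] .
  then have "t + of_int (- \<lfloor>t / l i\<rfloor>) * l i \<in> {0..<l i}" by (simp add: algebra_simps)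
  then show ?thesis by blast
qed

text \<open>After a common shift one parameter lies in the basic period, and the other is there too
  or one period further.\<close>

lemma orb_gam_inj:
  assumes i: "i \<in> {1..k}" and eq: "orb (gam i s) = orb (gam i t)" and near: "\<bar>s - t\<bar> < l i"
  shows "s = t"
proof -
  have main: "s = t" if eq: "orb (gam i s) = orb (gam i t)" and st: "s \<le> t" "t - s < l i" for s t
  proof -
    obtain n :: int where n: "s + of_int n * l i \<in> {0..<l i}" using orb_gam_reduce[OF i] by blast
    let ?s = "s + of_int n * l i" and ?t = "t + of_int n * l i"
    have e: "orb (gam i ?s) = orb (gam i ?t)" using eq by (simp only: orb_gam_shift[OF i])
    show ?thesis
    proof (cases "?t < l i")
      case True
      then have "?s = ?t" using n st e unfolding gam_def by (intro inj[OF i]) auto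
      then show ?thesis by simp
    next
      case False
      let ?t' = "t + of_int (n - 1) * l i"
      have t': "?t' = ?t - l i" by (simp add: algebra_simps)
      have "orb (gam i ?s) = orb (gam i ?t')" using eq by (simp only: orb_gam_shift[OF i])
      moreover have "?t' \<in> {0..<l i}" unfolding t' using n st False by auto
      ultimately have "?s = ?t'" using n unfolding gam_def by (intro inj[OF i])
      then show ?thesis using st t' by simp
    qed
  qed
  show ?thesis
  proof (cases "s \<le> t")
    case True then show ?thesis using main eq near by simp
  next
    case False then show ?thesis using main[of t s] eq near by simp
  qed
qed

lemma orb_gam_index: "i \<in> {1..k} \<Longrightarrow> j \<in> {1..k} \<Longrightarrow> orb (gam i s) = orb (gam j t) \<Longrightarrow> i = j"
  using disj unfolding gam_def by blast

text \<open>The full preimage of the boundary in the half-plane, that is, the union of all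
  translates of the lifts.\<close>

definition GT :: "complex set" where
  "GT = {z \<in> half_plane. \<exists>i\<in>{1..k}. \<exists>t. orb z = orb (gam i t)}"

lemma GT_iff:
  assumes z: "z \<in> half_plane"
  shows "z \<in> GT \<longleftrightarrow> (\<exists>i\<in>{1..k}. \<exists>h\<in>\<Gamma>. \<exists>s. 0 \<le> s \<and> s < l i \<and> mact h z = gam i s)"
proof
  assume "z \<in> GT"
  then obtain i t where i: "i \<in> {1..k}" and t: "orb z = orb (gam i t)" by (auto simp: GT_def)
  obtain n :: int where n: "t + of_int n * l i \<in> {0..<l i}" using orb_gam_reduce[OF i] by blast
  have "orb (gam i (t + of_int n * l i)) = orb z" using t orb_gam_shift[OF i] by simp
  then obtain h where "h \<in> \<Gamma>" "gam i (t + of_int n * l i) = mact h z" using orb_eq_iff[OF z] by blast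
  then show "\<exists>i\<in>{1..k}. \<exists>h\<in>\<Gamma>. \<exists>s. 0 \<le> s \<and> s < l i \<and> mact h z = gam i s"
    using i n by (intro bexI[of _ i] bexI[of _ h] exI[of _ "t + of_int n * l i"]) auto
next
  assume "\<exists>i\<in>{1..k}. \<exists>h\<in>\<Gamma>. \<exists>s. 0 \<le> s \<and> s < l i \<and> mact h z = gam i s"
  then obtain i h s where ihs: "i \<in> {1..k}" "h \<in> \<Gamma>" "mact h z = gam i s" by blast
  then have "orb z = orb (gam i s)" using orb_mact[OF ihs(2) z] by simp
  then show "z \<in> GT" using z ihs(1) by (auto simp: GT_def)
qed

text \<open>The matrix \<open>p\<close> seen in coordinates in which the translate by
  \<open>pinv h\<close> of the \<open>i\<close>-th lift is the imaginary axis.\<close>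

definition Q :: "nat \<Rightarrow> cmat \<Rightarrow> cmat \<Rightarrow> cmat" where "Q i h p = pinv (B i) \<odot> (h \<odot> p)"

lemma Q_PW: "i \<in> {1..k} \<Longrightarrow> h \<in> \<Gamma> \<Longrightarrow> p \<in> PW \<Longrightarrow> Q i h p \<in> PW"
  by (simp add: Q_def PW_def pdet_pinv Bdet det1)

lemma Q_dia: "Q i h (p \<odot> dia t) = Q i h p \<odot> dia t"
  by (simp add: Q_def pmul_assoc)

lemma PW_dia[simp]: "p \<odot> dia t \<in> PW \<longleftrightarrow> p \<in> PW" by (simp add: PW_def)

lemma pt_PW: "p \<in> PW \<Longrightarrow> pt p \<in> half_plane"
  using PW_iff_pt by (simp add: half_plane_def)

lemma pt_Q:
  assumes i: "i \<in> {1..k}" and h: "h \<in> \<Gamma>" and p: "p \<in> PW"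
  shows "pt (Q i h p) = mact (pinv (B i)) (mact h (pt p))"
proof -
  have "h \<odot> p \<in> PW" using h p det1 by (simp add: PW_def)
  then show ?thesis unfolding Q_def using PW_snd p by (simp add: pt_pmul)
qed

lemma mact_eq_gam_iff:
  assumes i: "i \<in> {1..k}" and h: "h \<in> \<Gamma>" and p: "p \<in> PW"
  shows "mact h (pt p) = gam i s \<longleftrightarrow> pt (Q i h p) = ax s"
proof -
  have H: "mact h (pt p) \<in> half_plane" using h p det1 pt_PW by (intro mact_half_plane) auto
  show ?thesis unfolding pt_Q[OF i h p] gam_def
    using mact_pinv[of "B i" "mact h (pt p)"] mact_pinv[of "B i" "ax s"] H Bdet[OF i] by auto
qed

text \<open>The geodesic is not forward asymptotic to any lift of the boundary and never passes
  through a point with stabilizer. Almost every matrix of positive determinant has this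
  property.\<close>

definition regular :: "cmat \<Rightarrow> bool" where
  "regular p \<longleftrightarrow> p \<in> PW \<and> (\<forall>i\<in>{1..k}. \<forall>h\<in>\<Gamma>. acq (Q i h p) \<noteq> 0) \<and> (\<forall>t. pt (p \<odot> dia t) \<in> free_part)"

lemma regular_dia: assumes "regular p" shows "regular (p \<odot> dia t)"
proof -
  have "acq (q \<odot> dia t) = exp t * acq q" for q
    by (simp add: acq_def mult_ac flip: exp_add)
  then show ?thesis using assms by (simp add: regular_def Q_dia pmul_assoc dia_mult)
qed

text \<open>The geodesic of \<open>p\<close> crosses the lift given by \<open>i\<close> and
  \<open>h\<close>. Restricting the position to one period leaves, for each crossing of a regular
  ray, just \<open>h\<close> and \<open>- h\<close>.\<close>

definition hit :: "cmat \<Rightarrow> nat \<Rightarrow> cmat \<Rightarrow> bool" where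
  "hit p i h \<longleftrightarrow> i \<in> {1..k} \<and> h \<in> \<Gamma> \<and> crosses (Q i h p) \<and> 0 \<le> cross_pos (Q i h p) \<and> cross_pos (Q i h p) < l i"

lemma pt_in_GT_iff:
  assumes p: "regular p"
  shows "pt (p \<odot> dia t) \<in> GT \<longleftrightarrow> (\<exists>i h. hit p i h \<and> cross_time (Q i h p) = t)"
proof -
  have pw: "p \<in> PW" using p by (simp add: regular_def)
  have H: "pt (p \<odot> dia t) \<in> half_plane" using pw by (intro pt_PW) simp
  have e: "mact h (pt (p \<odot> dia t)) = gam i s \<longleftrightarrow> crosses (Q i h p) \<and> cross_time (Q i h p) = t \<and> cross_pos (Q i h p) = s"
    if "i \<in> {1..k}" "h \<in> \<Gamma>" for i h s
    using that p pw mact_eq_gam_iff[of i h "p \<odot> dia t"] cross_iff[OF Q_PW[OF that pw]]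
    by (simp add: Q_dia regular_def)
  show ?thesis
  proof
    assume "pt (p \<odot> dia t) \<in> GT"
    then obtain i h s where *: "i \<in> {1..k}" "h \<in> \<Gamma>" "0 \<le> s" "s < l i" "mact h (pt (p \<odot> dia t)) = gam i s"
      unfolding GT_iff[OF H] by blast
    then show "\<exists>i h. hit p i h \<and> cross_time (Q i h p) = t"
      using e[OF *(1,2), of s] by (intro exI[of _ i] exI[of _ h]) (auto simp: hit_def)
  next
    assume "\<exists>i h. hit p i h \<and> cross_time (Q i h p) = t"
    then obtain i h where *: "hit p i h" "cross_time (Q i h p) = t" by blast
    then have ih: "i \<in> {1..k}" "h \<in> \<Gamma>" by (auto simp: hit_def)
    have "mact h (pt (p \<odot> dia t)) = gam i (cross_pos (Q i h p))"
      using * e[OF ih, of "cross_pos (Q i h p)"] by (simp add: hit_def)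
    then show "pt (p \<odot> dia t) \<in> GT" unfolding GT_iff[OF H] using ih *(1)
      by (intro bexI[of _ i] bexI[of _ h] exI[of _ "cross_pos (Q i h p)"]) (simp_all add: hit_def)
  qed
qed

text \<open>Equal times mean the same crossing point. Disjointness of the closed geodesics fixes the
  index, injectivity over a period fixes the position, and the trivial stabilizer fixes
  \<open>h\<close> up to sign.\<close>

lemma hit_unique:
  assumes p: "regular p" and 1: "hit p i h" "hit p j h'" and t: "cross_time (Q i h p) = cross_time (Q j h' p)"
  shows "i = j \<and> (h' = h \<or> h' = - h)"
proof -
  have pw: "p \<in> PW" using p by (simp add: regular_def)
  define t where "t = cross_time (Q i h p)"
  let ?z = "pt (p \<odot> dia t)"
  have H: "?z \<in> half_plane" using pw by (intro pt_PW) simp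
  have ij: "i \<in> {1..k}" "h \<in> \<Gamma>" "j \<in> {1..k}" "h' \<in> \<Gamma>" using 1 by (auto simp: hit_def)
  have e1: "mact h ?z = gam i (cross_pos (Q i h p))"
    using ij p pw mact_eq_gam_iff[of i h "p \<odot> dia t"] cross_iff[OF Q_PW[OF ij(1,2) pw]] 1
    by (simp add: Q_dia regular_def hit_def t_def)
  have e2: "mact h' ?z = gam j (cross_pos (Q j h' p))"
    using ij p pw mact_eq_gam_iff[of j h' "p \<odot> dia t"] cross_iff[OF Q_PW[OF ij(3,4) pw]] 1 t
    by (simp add: Q_dia regular_def hit_def t_def)
  have o: "orb (gam i (cross_pos (Q i h p))) = orb (gam j (cross_pos (Q j h' p)))"
    using orb_mact[OF ij(2) H] orb_mact[OF ij(4) H] e1 e2 by simp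
  then have "i = j" using orb_gam_index ij by blast
  moreover have "cross_pos (Q i h p) = cross_pos (Q j h' p)"
    using o 1 \<open>i = j\<close> by (intro orb_gam_inj[OF ij(1)]) (auto simp: hit_def)
  ultimately have "mact h ?z = mact h' ?z" using e1 e2 by simp
  then have "mact (pinv h \<odot> h') ?z = ?z"
    using mact_pmul[of "pinv h" h' ?z] mact_pinv[of h ?z] det1[OF ij(2)] det1[OF ij(4)] H
    by (simp add: pdet_pinv half_plane_def)
  moreover have "?z \<in> free_part" using p by (simp add: regular_def)
  ultimately have "pinv h \<odot> h' = pid \<or> pinv h \<odot> h' = - pid"
    using free_part_stabilizer mul_in inv_in ij by blast
  then have "h \<odot> (pinv h \<odot> h') = h \<or> h \<odot> (pinv h \<odot> h') = - h" by (metis pid_right pmul_minus_right)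
  then show ?thesis using \<open>i = j\<close> det1[OF ij(2)] by simp
qed

lemma Q_minus: "Q i (- h) p = - Q i h p"
  by (simp add: Q_def pmul_minus_left pmul_minus_right)

lemma cross_minus: "crosses (- q) = crosses q" "cross_time (- q) = cross_time q" "cross_pos (- q) = cross_pos q" "- q \<in> PW \<longleftrightarrow> q \<in> PW"
  by (simp_all add: crosses_def cross_time_def cross_pos_def PW_def pdet_def)

lemma hit_minus: "hit p i h \<Longrightarrow> hit p i (- h) \<and> cross_time (Q i (- h) p) = cross_time (Q i h p)"
  by (simp add: hit_def minus_in Q_minus cross_minus)

lemma continuous_on_pt_dia: "p \<in> PW \<Longrightarrow> continuous_on S (\<lambda>t. pt (p \<odot> dia t))"
proof -
  assume p: "p \<in> PW"
  have "continuous_on S (mact p \<circ> ax)"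
  proof (rule continuous_on_compose)
    show "continuous_on S ax" unfolding ax_exp by (intro continuous_intros)
    show "continuous_on (ax ` S) (mact p)" using p by (intro continuous_on_mact) (auto simp: PW_def)
  qed
  then show ?thesis by (simp add: pt_mult_dia comp_def)
qed

text \<open>A bounded stretch of the ray and one period of each lift form a compact set, which only
  finitely many elements bring back to itself.\<close>

lemma finite_hits:
  assumes p: "regular p"
  shows "finite {(i, h). hit p i h \<and> cross_time (Q i h p) \<in> {a..b}}"
proof -
  have pw: "p \<in> PW" using p by (simp add: regular_def)
  define K where "K = (\<lambda>t. pt (p \<odot> dia t)) ` {a..b} \<union> (\<Union>i\<in>{1..k}. gam i ` {0..l i})"
  have K: "compact K" unfolding K_def
  proof (intro compact_Un compact_UN finite_atLeastAtMost)
    show "compact ((\<lambda>t. pt (p \<odot> dia t)) ` {a..b})"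
      by (intro compact_continuous_image continuous_on_pt_dia pw) simp
    fix i assume i: "i \<in> {1..k}"
    have "B i \<in> PW" using Bdet[OF i] by (simp add: PW_def)
    from continuous_on_pt_dia[OF this] have "continuous_on {0..l i} (gam i)"
      unfolding gam_def pt_mult_dia .
    then show "compact (gam i ` {0..l i})" by (intro compact_continuous_image) auto
  qed
  have "pt (p \<odot> dia t) \<in> half_plane" for t using pw by (intro pt_PW) simp
  then have KH: "K \<subseteq> half_plane" using gam_half_plane unfolding K_def by blast
  have fin: "finite ({1..k} \<times> {h \<in> \<Gamma>. \<exists>z\<in>K. mact h z \<in> K})" using properly_discontinuous[OF K KH] by simp
  have "{(i, h). hit p i h \<and> cross_time (Q i h p) \<in> {a..b}} \<subseteq> {1..k} \<times> {h \<in> \<Gamma>. \<exists>z\<in>K. mact h z \<in> K}"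
  proof (rule subsetI)
    fix x assume "x \<in> {(i, h). hit p i h \<and> cross_time (Q i h p) \<in> {a..b}}"
    then obtain i h where x: "x = (i, h)" and h: "hit p i h" and t: "cross_time (Q i h p) \<in> {a..b}" by blast
    have ih: "i \<in> {1..k}" "h \<in> \<Gamma>" using h by (auto simp: hit_def)
    let ?z = "pt (p \<odot> dia (cross_time (Q i h p)))"
    have "mact h ?z = gam i (cross_pos (Q i h p))"
      using ih p pw mact_eq_gam_iff[of i h "p \<odot> dia (cross_time (Q i h p))"] cross_iff[OF Q_PW[OF ih pw]] h
      by (simp add: Q_dia regular_def hit_def)
    then have "mact h ?z \<in> K" using ih h unfolding K_def hit_def by force
    moreover have "?z \<in> K" using t unfolding K_def by blast
    ultimately show "x \<in> {1..k} \<times> {h \<in> \<Gamma>. \<exists>z\<in>K. mact h z \<in> K}" using x ih by blast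
  qed
  then show ?thesis using fin finite_subset by blast
qed

section \<open>Crossing times and their count\<close>

definition Cr :: "cmat \<Rightarrow> real set" where "Cr p = {t. 0 < t \<and> pt (p \<odot> dia t) \<in> GT}"

lemma Cr_eq: "regular p \<Longrightarrow> Cr p = {t. 0 < t \<and> (\<exists>i h. hit p i h \<and> cross_time (Q i h p) = t)}"
  by (simp add: Cr_def pt_in_GT_iff)

lemma finite_Cr: assumes "regular p" shows "finite (Cr p \<inter> {..T})"
proof (rule finite_subset)
  show "Cr p \<inter> {..T} \<subseteq> (\<lambda>(i, h). cross_time (Q i h p)) ` {(i, h). hit p i h \<and> cross_time (Q i h p) \<in> {0..T}}"
    unfolding Cr_eq[OF assms] by force
  show "finite ((\<lambda>(i, h). cross_time (Q i h p)) ` {(i, h). hit p i h \<and> cross_time (Q i h p) \<in> {0..T}})"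
    by (intro finite_imageI finite_hits assms)
qed

text \<open>\<open>Nc p\<close> counts the crossings during the times \<open>{0<..1}\<close> twice, once for \<open>h\<close> and once for \<open>- h\<close>.\<close>

definition BX :: "nat \<Rightarrow> cmat set" where "BX i = {p. pinv (B i) \<odot> p \<in> cross_box (l i)}"

definition Nc :: "cmat \<Rightarrow> ennreal" where "Nc p = (\<Sum>i\<in>{1..k}. hits (BX i) p)"

lemma neg_cmat_neq: "pdet h = 1 \<Longrightarrow> h \<noteq> - h"
proof
  assume d: "pdet h = 1" and e: "h = - h"
  then have "fst h = - fst h" by (metis fst_uminus)
  then have "fst h = 0" by (simp add: complex_eq_iff)
  with d show False by (simp add: pdet_def)
qed

text \<open>The map that sends a pair \<open>(i, h)\<close> to its crossing time has fibres
  consisting of exactly \<open>(i, h)\<close> and \<open>(i, - h)\<close>.\<close>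

lemma Nc_eq_card:
  assumes p: "regular p"
  shows "Nc p = ennreal (2 * real (card (Cr p \<inter> {..1})))"
proof -
  have pw: "p \<in> PW" using p by (simp add: regular_def)
  define S where "S = {(i, h). hit p i h \<and> 0 < cross_time (Q i h p) \<and> cross_time (Q i h p) \<le> 1}"
  have "S \<subseteq> {(i, h). hit p i h \<and> cross_time (Q i h p) \<in> {0..1}}" by (auto simp: S_def)
  then have finS: "finite S" using finite_hits[OF p] finite_subset by blast
  define H where "H i = {h \<in> \<Gamma>. h \<odot> p \<in> BX i}" for i
  have HS: "h \<in> H i \<longleftrightarrow> (i, h) \<in> S" if "i \<in> {1..k}" for i h
    using that Q_PW[OF that _ pw, of h] by (auto simp: H_def S_def BX_def Q_def hit_def cross_box_def)
  have finH: "finite (H i)" if "i \<in> {1..k}" for i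
  proof (rule finite_subset[of _ "snd ` S"])
    show "H i \<subseteq> snd ` S" using HS[OF that] by force
  qed (use finS in simp)
  have "Nc p = (\<Sum>i\<in>{1..k}. of_nat (card (H i)))"
    unfolding Nc_def hits_eq
  proof (rule sum.cong[OF refl])
    fix i assume "i \<in> {1..k}"
    from finH[OF this] show "emeasure (count_space \<Gamma>) {g \<in> \<Gamma>. g \<odot> p \<in> BX i} = of_nat (card (H i))"
      unfolding H_def by (intro emeasure_count_space_finite) auto
  qed
  also have "\<dots> = of_nat (\<Sum>i\<in>{1..k}. card (H i))" by simp
  also have "(\<Sum>i\<in>{1..k}. card (H i)) = card S"
  proof -
    have "S = Sigma {1..k} H" using HS by (auto simp: S_def hit_def)
    then show ?thesis using finH by (simp add: card_SigmaI)
  qed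
  also have "card S = 2 * card (Cr p \<inter> {..1})"
  proof -
    let ?T = "\<lambda>(i, h). cross_time (Q i h p)"
    have im: "?T ` S = Cr p \<inter> {..1}" unfolding Cr_eq[OF p] S_def by force
    have "card S = (\<Sum>x\<in>S. 1::nat)" by simp
    also have "\<dots> = (\<Sum>y\<in>?T ` S. \<Sum>x\<in>{x \<in> S. ?T x = y}. 1)" by (rule sum.image_gen[OF finS])
    also have "\<dots> = (\<Sum>y\<in>?T ` S. 2::nat)"
    proof (rule sum.cong[OF refl])
      fix y assume "y \<in> ?T ` S"
      then obtain i h where ih: "(i, h) \<in> S" "cross_time (Q i h p) = y" by auto
      have hi: "hit p i h" using ih by (simp add: S_def)
      have "{x \<in> S. ?T x = y} = {(i, h), (i, - h)}"
      proof (intro equalityI subsetI)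
        fix x assume x: "x \<in> {x \<in> S. ?T x = y}"
        obtain j h' where xx: "x = (j, h')" by (metis surj_pair)
        have "hit p j h'" "cross_time (Q j h' p) = y" using x by (auto simp: xx S_def)
        then show "x \<in> {(i, h), (i, - h)}" using hit_unique[OF p hi, of j h'] ih(2) xx by auto
      next
        fix x assume "x \<in> {(i, h), (i, - h)}"
        then show "x \<in> {x \<in> S. ?T x = y}" using ih hit_minus[OF hi] by (auto simp: S_def)
      qed
      moreover have "h \<noteq> - h" using neg_cmat_neq det1 hi by (simp add: hit_def)
      ultimately have "card {x \<in> S. ?T x = y} = 2" by simp
      then show "(\<Sum>x\<in>{x \<in> S. ?T x = y}. 1) = (2::nat)" by simp
    qed
    also have "\<dots> = 2 * card (Cr p \<inter> {..1})" unfolding im by simp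
    finally show ?thesis .
  qed
  also have "of_nat (2 * card (Cr p \<inter> {..1})) = ennreal (2 * real (card (Cr p \<inter> {..1})))"
    by (metis ennreal_of_nat_eq_real_of_nat of_nat_mult of_nat_numeral)
  finally show ?thesis .
qed

lemma Cr_shift: "t > 0 \<Longrightarrow> a \<ge> 0 \<Longrightarrow> t \<in> Cr (p \<odot> dia a) \<longleftrightarrow> t + a \<in> Cr p"
  by (simp add: Cr_def pmul_assoc dia_mult add.commute)

text \<open>The windows from \<open>n\<close> to \<open>n + 1\<close>, open on the left, are
  disjoint and exhaust the positive times; the factor 2 is the double count of signs.\<close>

lemma sum_Nc:
  assumes p: "regular p"
  shows "(\<Sum>j<n. enn2real (Nc (p \<odot> dia (real j)))) = 2 * real (card (Cr p \<inter> {..real n}))"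
proof (induction n)
  case 0
  have "Cr p \<inter> {..real 0} = {}" by (auto simp: Cr_def)
  then show ?case by simp
next
  case (Suc n)
  have "enn2real (Nc (p \<odot> dia (real n))) = 2 * real (card (Cr (p \<odot> dia (real n)) \<inter> {..1}))"
    by (simp add: Nc_eq_card[OF regular_dia[OF p]])
  also have "card (Cr (p \<odot> dia (real n)) \<inter> {..1}) = card (Cr p \<inter> {real n<..real (Suc n)})"
  proof (rule bij_betw_same_card)
    show "bij_betw (\<lambda>t. t + real n) (Cr (p \<odot> dia (real n)) \<inter> {..1}) (Cr p \<inter> {real n<..real (Suc n)})"
    proof (rule bij_betw_byWitness[where f'="\<lambda>t. t - real n"])
      have pos: "t > 0" if "t \<in> Cr (p \<odot> dia (real n))" for t using that by (simp add: Cr_def)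
      show "(\<lambda>t. t + real n) ` (Cr (p \<odot> dia (real n)) \<inter> {..1}) \<subseteq> Cr p \<inter> {real n<..real (Suc n)}"
      proof (rule image_subsetI)
        fix t assume t: "t \<in> Cr (p \<odot> dia (real n)) \<inter> {..1}"
        then show "t + real n \<in> Cr p \<inter> {real n<..real (Suc n)}" using pos[of t] Cr_shift[of t "real n" p] by simp
      qed
      show "(\<lambda>t. t - real n) ` (Cr p \<inter> {real n<..real (Suc n)}) \<subseteq> Cr (p \<odot> dia (real n)) \<inter> {..1}"
      proof (rule image_subsetI)
        fix t assume t: "t \<in> Cr p \<inter> {real n<..real (Suc n)}"
        then show "t - real n \<in> Cr (p \<odot> dia (real n)) \<inter> {..1}" using Cr_shift[of "t - real n" "real n" p] by simp
      qed
    qed auto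
  qed
  finally have 1: "enn2real (Nc (p \<odot> dia (real n))) = 2 * real (card (Cr p \<inter> {real n<..real (Suc n)}))" .
  have "Cr p \<inter> {..real (Suc n)} = (Cr p \<inter> {..real n}) \<union> (Cr p \<inter> {real n<..real (Suc n)})" by auto
  moreover have "finite (Cr p \<inter> {real n<..real (Suc n)})" using finite_Cr[OF p, of "real (Suc n)"] by (rule finite_subset[rotated]) auto
  ultimately have "card (Cr p \<inter> {..real (Suc n)}) = card (Cr p \<inter> {..real n}) + card (Cr p \<inter> {real n<..real (Suc n)})"
    using finite_Cr[OF p, of "real n"] by (simp add: card_Un_disjoint disjoint_iff)
  then show ?case using Suc 1 by simp
qed

section \<open>The integral of the crossing count\<close>

lemma BX_borel[measurable]: "BX i \<in> sets borel"
  unfolding BX_def by (rule borel_pmul_left) simp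

lemma BX_PW: "i \<in> {1..k} \<Longrightarrow> BX i \<subseteq> PW"
  using Bdet by (auto simp: BX_def cross_box_def PW_def pdet_pinv)

lemma measurable_Nc: "Nc \<in> borel_measurable borel"
  unfolding Nc_def by (intro borel_measurable_sum measurable_hits BX_borel)

lemma hits_mult:
  assumes g: "g \<in> \<Gamma>" shows "hits E (g \<odot> p) = hits E p"
proof -
  have "bij_betw (\<lambda>h. h \<odot> g) \<Gamma> \<Gamma>"
  proof (rule bij_betw_byWitness[where f'="\<lambda>h. h \<odot> pinv g"])
    show "(\<lambda>h. h \<odot> g) ` \<Gamma> \<subseteq> \<Gamma>" "(\<lambda>h. h \<odot> pinv g) ` \<Gamma> \<subseteq> \<Gamma>" using mul_in inv_in g by blast+
  qed (simp_all add: det1[OF g])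
  from nn_integral_bij_count_space[OF this, of "\<lambda>h. indicator E (h \<odot> p)"]
  show ?thesis by (simp add: hits_def pmul_assoc)
qed

lemma cross_box_scaleR: "r \<noteq> 0 \<Longrightarrow> r *\<^sub>R q \<in> cross_box a \<longleftrightarrow> q \<in> cross_box a"
proof -
  assume r: "r \<noteq> 0"
  have "crosses (r *\<^sub>R q) \<longleftrightarrow> crosses q"
  proof -
    have "(Im (fst (r *\<^sub>R q)) * Im (snd (r *\<^sub>R q))) * (Re (fst (r *\<^sub>R q)) * Re (snd (r *\<^sub>R q))) =
      (r * r) * (r * r) * ((Im (fst q) * Im (snd q)) * (Re (fst q) * Re (snd q)))" by (simp add: mult_ac)
    moreover have "(r * r) * (r * r) > 0" by (simp add: zero_less_mult_iff) (use r in linarith)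
    ultimately show ?thesis unfolding crosses_def by (metis mult_less_0_iff not_less_iff_gr_or_eq)
  qed
  moreover have "cross_time (r *\<^sub>R q) = cross_time q" "cross_pos (r *\<^sub>R q) = cross_pos q"
    using r by (simp_all add: cross_time_def cross_pos_def)
  ultimately show ?thesis using r by (simp add: cross_box_def)
qed

lemma measurable_Nc_QM: "Nc \<in> borel_measurable QM"
proof (rule measurable_QM[OF measurable_Nc])
  show "Nc (g \<odot> p) = Nc p" if "g \<in> \<Gamma>" for g p using that by (simp add: Nc_def hits_mult)
  show "Nc (r *\<^sub>R p) = Nc p" if "r \<noteq> 0" for r p
    using that by (simp add: Nc_def hits_def pmul_scaleR_right BX_def indicator_def cross_box_scaleR)
qed

text \<open>Cutting at determinant 1 commutes with the group, so each summand unfolds to twice the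
  volume of a cut flow box, and \<open>B i\<close> preserves that volume.\<close>

lemma nn_integral_Nc: "(\<integral>\<^sup>+p. Nc p \<partial>QM) = ennreal (2 * (\<Sum>i\<in>{1..k}. l i))"
proof -
  have "(\<integral>\<^sup>+p. Nc p \<partial>QM) = (\<integral>\<^sup>+p. Nc p * indicator (FF \<inter> det_lt1) p \<partial>lborel)"
    by (rule nn_integral_QM[OF measurable_Nc_QM measurable_Nc])
  also have "\<dots> = (\<integral>\<^sup>+p. (\<Sum>i\<in>{1..k}. indicator FF p * hits (BX i \<inter> det_lt1) p) \<partial>lborel)"
  proof (rule nn_integral_cong)
    fix p
    have "hits (BX i \<inter> det_lt1) p = indicator det_lt1 p * hits (BX i) p" for i
    proof (cases "p \<in> det_lt1")
      case True
      then have "g \<odot> p \<in> det_lt1" if "g \<in> \<Gamma>" for g using that det1 by (simp add: det_lt1_def)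
      then have "hits (BX i \<inter> det_lt1) p = hits (BX i) p"
        unfolding hits_def by (intro nn_integral_cong) (simp add: indicator_def)
      then show ?thesis using True by simp
    next
      case False
      then have "hits (BX i \<inter> det_lt1) p = 0" using det1 by (intro hits_eq_0) (simp add: det_lt1_def)
      then show ?thesis using False by simp
    qed
    then show "Nc p * indicator (FF \<inter> det_lt1) p = (\<Sum>i\<in>{1..k}. indicator FF p * hits (BX i \<inter> det_lt1) p)"
      by (cases "p \<in> FF"; cases "p \<in> det_lt1") (simp_all add: Nc_def)
  qed
  also have "\<dots> = (\<Sum>i\<in>{1..k}. \<integral>\<^sup>+p. indicator FF p * hits (BX i \<inter> det_lt1) p \<partial>lborel)"
    by (rule nn_integral_sum) (use measurable_hits[of "BX _ \<inter> det_lt1"] in auto)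
  also have "\<dots> = (\<Sum>i\<in>{1..k}. 2 * ennreal (l i))"
  proof (rule sum.cong[OF refl])
    fix i assume i: "i \<in> {1..k}"
    have "(\<integral>\<^sup>+p. indicator FF p * hits (BX i \<inter> det_lt1) p \<partial>lborel) = 2 * emeasure lborel (BX i \<inter> det_lt1)"
      using BX_PW[OF i] by (intro unfold_integral[OF two_fold_FF]) auto
    also have "emeasure lborel (BX i \<inter> det_lt1) = emeasure lborel {p. pinv (B i) \<odot> p \<in> cross_box (l i) \<inter> {p. pdet p < 1}}"
      using Bdet[OF i] by (intro arg_cong[where f="emeasure lborel"]) (auto simp: BX_def det_lt1_def pdet_pinv)
    also have "\<dots> = emeasure lborel (cross_box (l i) \<inter> {p. pdet p < 1})"
      using Bdet[OF i] by (intro emeasure_pmul_left) (auto simp: pdet_pinv borel_det_lt1[unfolded det_lt1_def])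
    also have "\<dots> = ennreal (l i)" by (rule emeasure_cross_box[OF lpos[OF i]])
    finally show "(\<integral>\<^sup>+p. indicator FF p * hits (BX i \<inter> det_lt1) p \<partial>lborel) = 2 * ennreal (l i)" .
  qed
  also have "\<dots> = ennreal (\<Sum>i\<in>{1..k}. 2 * l i)"
    using lpos by (subst sum_ennreal[symmetric]) (auto simp: ennreal_mult less_imp_le)
  finally show ?thesis by (simp add: sum_distrib_left)
qed

definition Zall :: "cmat set" where
  "Zall = (\<Union>i\<in>{1..k}. {p. pinv (B i) \<odot> p \<in> Z1 \<union> Z2}) \<union> (\<Union>z\<in>half_plane - free_part. Z3 z)"

text \<open>Saturated under the group, so that it is an invariant cone and descends to the
  quotient.\<close>

definition exceptional :: "cmat set" where
  "exceptional = PW \<inter> (\<Union>g\<in>\<Gamma>. {p. g \<odot> p \<in> Zall})"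

lemma Zall_null: "Zall \<in> sets borel" "emeasure lborel Zall = 0"
proof -
  have Z12: "Z1 \<union> Z2 \<in> sets borel" "emeasure lborel (Z1 \<union> Z2) = 0"
    using Z1_null Z2_null by (auto intro: emeasure_Un_null_set[THEN trans] simp: null_sets_def)
  have "{p. pinv (B i) \<odot> p \<in> Z1 \<union> Z2} \<in> null_sets lborel" if "i \<in> {1..k}" for i
    using emeasure_pmul_left_null[OF Z12, of "pinv (B i)"] borel_pmul_left[OF Z12(1)] Bdet[OF that]
    by (simp add: null_sets_def pdet_pinv)
  then have 1: "(\<Union>i\<in>{1..k}. {p. pinv (B i) \<odot> p \<in> Z1 \<union> Z2}) \<in> null_sets lborel" by (intro null_sets_UN') auto
  have 2: "(\<Union>z\<in>half_plane - free_part. Z3 z) \<in> null_sets lborel"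
    using Z3_null by (intro null_sets_UN' countable_non_free) (auto simp: null_sets_def)
  from null_sets.Un[OF 1 2] show "Zall \<in> sets borel" "emeasure lborel Zall = 0" by (auto simp: Zall_def null_sets_def)
qed

lemma exceptional_Inv: "exceptional \<in> Inv" "emeasure lborel exceptional = 0"
proof -
  have "{p. g \<odot> p \<in> Zall} \<in> null_sets lborel" if "g \<in> \<Gamma>" for g
    using emeasure_pmul_left_null[OF Zall_null, of g] borel_pmul_left[OF Zall_null(1)] det1[OF that] by (simp add: null_sets_def)
  then have n: "(\<Union>g\<in>\<Gamma>. {p. g \<odot> p \<in> Zall}) \<in> null_sets lborel" by (intro null_sets_UN' countable_\<Gamma>)
  then have "exceptional \<in> null_sets lborel" unfolding exceptional_def
    by (intro null_set_Int1) (auto simp: Int_commute)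
  then show "emeasure lborel exceptional = 0" and b: "exceptional \<in> Inv"
  proof -
    assume e: "exceptional \<in> null_sets lborel"
    then show "emeasure lborel exceptional = 0" by (simp add: null_sets_def)
    have sc: "r *\<^sub>R p \<in> Zall \<longleftrightarrow> p \<in> Zall" if "r \<noteq> 0" for r p
      using that by (simp add: Zall_def pmul_scaleR_right Z_scaleR)
    have "g \<odot> p \<in> exceptional \<longleftrightarrow> p \<in> exceptional" if g: "g \<in> \<Gamma>" and p: "p \<in> PW" for g p
    proof -
      have gp: "g \<odot> p \<in> PW" using g p det1 by (simp add: PW_def)
      have "(\<exists>k\<in>\<Gamma>. k \<odot> (g \<odot> p) \<in> Zall) \<longleftrightarrow> (\<exists>k\<in>\<Gamma>. k \<odot> p \<in> Zall)"
      proof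
        assume "\<exists>k\<in>\<Gamma>. k \<odot> (g \<odot> p) \<in> Zall"
        then obtain k where "k \<in> \<Gamma>" "(k \<odot> g) \<odot> p \<in> Zall" by (auto simp: pmul_assoc)
        then show "\<exists>k\<in>\<Gamma>. k \<odot> p \<in> Zall" using mul_in[of k g] g by blast
      next
        assume "\<exists>k\<in>\<Gamma>. k \<odot> p \<in> Zall"
        then obtain k where k: "k \<in> \<Gamma>" "k \<odot> p \<in> Zall" by blast
        then have "(k \<odot> pinv g) \<odot> (g \<odot> p) \<in> Zall" using det1[OF g] by (simp add: pmul_assoc)
        then show "\<exists>k\<in>\<Gamma>. k \<odot> (g \<odot> p) \<in> Zall" using mul_in[OF k(1) inv_in[OF g]] by blast
      qed
      then show ?thesis using gp p by (simp add: exceptional_def)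
    qed
    moreover have "r *\<^sub>R p \<in> exceptional \<longleftrightarrow> p \<in> exceptional" if "r \<noteq> 0" for r p
      using that by (simp add: exceptional_def pmul_scaleR_right sc)
    moreover have "exceptional \<in> sets borel" "exceptional \<subseteq> PW" using e by (auto simp: null_sets_def exceptional_def)
    ultimately show "exceptional \<in> Inv" by (simp add: Inv_def inv_left_def)
  qed
qed

lemma not_exceptional:
  assumes p: "p \<in> PW" "p \<notin> exceptional"
  shows "regular p" "pt p \<notin> GT"
proof -
  have nz: "g \<odot> p \<notin> Zall" if "g \<in> \<Gamma>" for g using p that by (auto simp: exceptional_def)
  have q: "Q i h p \<notin> Z1 \<union> Z2" if "i \<in> {1..k}" "h \<in> \<Gamma>" for i h
    using nz[OF that(2)] that(1) unfolding Zall_def Q_def by blast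
  have "pt (p \<odot> dia t) \<in> free_part" for t
  proof (rule ccontr)
    assume n: "pt (p \<odot> dia t) \<notin> free_part"
    have "pt (p \<odot> dia t) \<in> half_plane" using p(1) by (intro pt_PW) simp
    with n have "pid \<odot> p \<in> Zall" using Z3_passes[OF p(1) refl, of t] by (auto simp: Zall_def)
    then show False using nz[OF id_in] by blast
  qed
  then show reg: "regular p" using q p(1) by (auto simp: regular_def Z1_def)
  show "pt p \<notin> GT"
  proof
    assume "pt p \<in> GT"
    then obtain i h s where ihs: "i \<in> {1..k}" "h \<in> \<Gamma>" "mact h (pt p) = gam i s"
      using GT_iff[OF pt_PW[OF p(1)]] by blast
    then have e: "pt (Q i h p) = ax s" using mact_eq_gam_iff[OF ihs(1,2) p(1)] by blast
    have QP: "Q i h p \<in> PW" by (rule Q_PW[OF ihs(1,2) p(1)])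
    have "Re (pt (Q i h p)) = 0" by (simp add: e)
    then have "Im (fst (Q i h p)) * Im (snd (Q i h p)) + Re (fst (Q i h p)) * Re (snd (Q i h p)) = 0"
      using PW_snd[OF QP] by (simp add: pt_simps)
    then have "Q i h p \<in> Z1 \<union> Z2" by (auto simp: Z1_def Z2_def acq_def)
    then show False using q[OF ihs(1,2)] by blast
  qed
qed

end

section \<open>Time spent in the subsurface\<close>

text \<open>The lifted subsurface. The assumption \<open>both\<close> is what the boundary charts
  contribute: every lifted boundary point is a limit of interior points and of exterior
  points.\<close>

locale excursion_system = geodesic_system +
  fixes MT :: "complex set"
  assumes k1: "1 \<le> k"
    and MT_H: "MT \<subseteq> half_plane"
    and MT_orb: "z \<in> half_plane \<Longrightarrow> w \<in> half_plane \<Longrightarrow> orb z = orb w \<Longrightarrow> z \<in> MT \<longleftrightarrow> w \<in> MT"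
    and GT_MT: "GT \<subseteq> MT"
    and MT_closed: "open (half_plane - MT)"
    and MT_int: "open (MT - GT)"
    and both: "z \<in> GT \<Longrightarrow> open U \<Longrightarrow> z \<in> U \<Longrightarrow> (\<exists>w\<in>U. w \<in> MT - GT) \<and> (\<exists>w\<in>U. w \<in> half_plane - MT)"
begin

lemma open_vimage_mact:
  assumes "pdet g > 0" "open W" shows "open {w \<in> half_plane. mact g w \<in> W}"
proof -
  have "open (half_plane \<inter> mact g -` W)"
    using continuous_on_mact[OF assms(1) subset_refl] open_half_plane assms(2)
    by (simp add: continuous_on_open_vimage Int_commute)
  then show ?thesis by (simp add: Int_def vimage_def)
qed

text \<open>
  As the stabilizer is trivial, the lifted boundary is a single geodesic arc near the point, and
  each of the two sides of the arc is connected.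
\<close>

lemma local_sides:
  assumes z: "z \<in> half_plane" "z \<in> free_part" and i: "i \<in> {1..k}" and h: "h \<in> \<Gamma>" and zs: "mact h z = gam i s"
  shows "\<exists>U. open U \<and> z \<in> U \<and> (\<forall>w\<in>U. \<forall>w'\<in>U. Re (mact (pinv (B i)) (mact h w)) < 0 \<longrightarrow>
     Re (mact (pinv (B i)) (mact h w')) > 0 \<longrightarrow> (w \<in> MT \<longleftrightarrow> w' \<notin> MT))"
proof -
  \<comment> \<open>For the geodesic through \<open>z\<close> the parameter window is centred at
    \<open>s\<close>, so that \<open>z\<close> is not at the end of the arc; the other geodesics use
    any period.\<close>
  define J where "J j = (if j = i then {s - l i / 2..s + l i / 2} else {0..l j})" for j
  define CC where "CC j = gam j ` J j" for j
  have CC: "compact (CC j)" if j: "j \<in> {1..k}" for j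
  proof -
    have "B j \<in> PW" using Bdet[OF j] by (simp add: PW_def)
    from continuous_on_pt_dia[OF this] have "continuous_on (J j) (gam j)" unfolding gam_def pt_mult_dia .
    then show ?thesis unfolding CC_def J_def by (intro compact_continuous_image) auto
  qed
  have CCH: "CC j \<subseteq> half_plane" if "j \<in> {1..k}" for j using gam_half_plane[OF that] by (auto simp: CC_def)
  have window: "\<exists>j\<in>{1..k}. \<exists>g\<in>\<Gamma>. mact g w \<in> CC j" if w: "w \<in> GT" for w
  proof -
    have wH: "w \<in> half_plane" using w by (simp add: GT_def)
    obtain j t where j: "j \<in> {1..k}" and t: "orb w = orb (gam j t)" using w by (auto simp: GT_def)
    have "\<exists>n::int. t + of_int n * l j \<in> J j"
    proof (cases "j = i")
      case True
      obtain n :: int where "(t - (s - l i / 2)) + of_int n * l i \<in> {0..<l i}" using orb_gam_reduce[OF i] by blast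
      then have "t + of_int n * l j \<in> J j" using True by (auto simp: J_def)
      then show ?thesis by blast
    next
      case False
      obtain n :: int where "t + of_int n * l j \<in> {0..<l j}" using orb_gam_reduce[OF j] by blast
      then show ?thesis using False by (intro exI[of _ n]) (auto simp: J_def)
    qed
    then obtain n :: int where n: "t + of_int n * l j \<in> J j" by blast
    have "orb (gam j (t + of_int n * l j)) = orb w" using t orb_gam_shift[OF j] by simp
    then obtain g where g: "g \<in> \<Gamma>" "gam j (t + of_int n * l j) = mact g w" using orb_eq_iff[OF wH] by blast
    have "mact g w \<in> CC j" unfolding CC_def using g(2)[symmetric] n by (rule image_eqI)
    then show ?thesis using j g(1) by blast
  qed
  obtain e where e: "e > 0" "cball z e \<subseteq> half_plane" using open_half_plane z(1) open_contains_cball by blast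
  define K where "K = cball z e \<union> (\<Union>j\<in>{1..k}. CC j)"
  have K: "compact K" unfolding K_def by (intro compact_Un compact_UN finite_atLeastAtMost CC) auto
  have KH: "K \<subseteq> half_plane" unfolding K_def using e(2) CCH by blast
  define R where "R = {(j, g). j \<in> {1..k} \<and> g \<in> \<Gamma> \<and> (\<exists>w\<in>cball z e. mact g w \<in> CC j)}"
  have "R \<subseteq> {1..k} \<times> {g \<in> \<Gamma>. \<exists>w\<in>K. mact g w \<in> K}" unfolding R_def K_def by blast
  then have finR: "finite R" using properly_discontinuous[OF K KH] finite_subset by blast
  \<comment> \<open>Finitely many compact boundary arcs come near \<open>z\<close>; those that miss
    \<open>z\<close> are removed.\<close>
  define V where "V = ball z e \<inter> (\<Inter>(j, g)\<in>{(j, g) \<in> R. mact g z \<notin> CC j}. {w \<in> half_plane. mact g w \<in> - CC j})"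
  have openV: "open V" unfolding V_def
  proof (intro open_Int open_ball open_INT ballI)
    show "finite {(j, g) \<in> R. mact g z \<notin> CC j}" by (rule finite_subset[OF _ finR]) auto
    fix x assume "x \<in> {(j, g) \<in> R. mact g z \<notin> CC j}"
    then obtain j g where x: "x = (j, g)" "j \<in> {1..k}" "g \<in> \<Gamma>" by (auto simp: R_def)
    have "open (- CC j)" using CC[OF x(2)] by (simp add: compact_imp_closed open_Compl)
    then have "open {w \<in> half_plane. mact g w \<in> - CC j}" using det1[OF x(3)] by (intro open_vimage_mact) auto
    then show "open (case x of (j, g) \<Rightarrow> {w \<in> half_plane. mact g w \<in> - CC j})" by (simp add: x(1))
  qed
  have zV: "z \<in> V" using e z(1) by (auto simp: V_def)
  have VH: "V \<subseteq> half_plane" using e ball_subset_cball[of z e] by (auto simp: V_def)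
  define \<phi> where "\<phi> w = mact (pinv (B i)) (mact h w)" for w
  define \<psi> where "\<psi> v = mact (pinv h) (mact (B i) v)" for v
  have dB: "pdet (B i) = 1" "pdet (pinv (B i)) = 1" using Bdet[OF i] by (simp_all add: pdet_pinv)
  have dh: "pdet h = 1" "pdet (pinv h) = 1" using det1[OF h] by (simp_all add: pdet_pinv)
  have \<phi>H: "\<phi> w \<in> half_plane" if "w \<in> half_plane" for w using that dB dh unfolding \<phi>_def by (intro mact_half_plane) auto
  have \<psi>H: "\<psi> v \<in> half_plane" if "v \<in> half_plane" for v using that dB dh unfolding \<psi>_def by (intro mact_half_plane) auto
  have \<psi>\<phi>: "\<psi> (\<phi> w) = w" if "w \<in> half_plane" for w
    using that dB dh mact_half_plane[of h w] unfolding \<psi>_def \<phi>_def by (simp add: mact_pinv)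
  have \<phi>\<psi>: "\<phi> (\<psi> v) = v" if "v \<in> half_plane" for v
    using that dB dh mact_half_plane[of "B i" v] unfolding \<psi>_def \<phi>_def by (simp add: mact_pinv)
  have cont\<psi>: "continuous_on half_plane \<psi>"
  proof -
    have "continuous_on half_plane (mact (pinv h) \<circ> mact (B i))"
    proof (rule continuous_on_compose)
      show "continuous_on half_plane (mact (B i))" using dB by (intro continuous_on_mact) auto
      show "continuous_on (mact (B i) ` half_plane) (mact (pinv h))"
        using dB dh mact_half_plane[of "B i"] by (intro continuous_on_mact) auto
    qed
    then show ?thesis by (simp add: \<psi>_def comp_def)
  qed
  have \<phi>z: "\<phi> z = ax s" unfolding \<phi>_def zs gam_def using mact_pinv(1)[of "B i" "ax s"] dB by simp
  have line_GT: "w \<in> GT" if w: "w \<in> half_plane" "Re (\<phi> w) = 0" for w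
  proof -
    have "Im (\<phi> w) > 0" using \<phi>H[OF w(1)] by (simp add: half_plane_def)
    then have "\<phi> w = ax (ln (Im (\<phi> w)))" using w(2) by (simp add: complex_eq_iff)
    then have "mact (B i) (\<phi> w) = gam i (ln (Im (\<phi> w)))" by (simp add: gam_def)
    moreover have "mact (B i) (\<phi> w) = mact h w"
      unfolding \<phi>_def using mact_pinv(2)[of "B i" "mact h w"] dB dh mact_half_plane[of h w] w(1) by simp
    ultimately have "orb w = orb (gam i (ln (Im (\<phi> w))))" using orb_mact[OF h w(1)] by simp
    then show ?thesis using i w(1) by (auto simp: GT_def)
  qed
  \<comment> \<open>A remaining arc passes through \<open>z\<close>, so its index is
    \<open>i\<close> and its element agrees with \<open>h\<close> up to a stabilizer of
    \<open>z\<close>, hence up to sign.\<close>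
  have GT_line: "Re (\<phi> w) = 0" if w: "w \<in> V" "w \<in> GT" for w
  proof -
    obtain j g where jg: "j \<in> {1..k}" "g \<in> \<Gamma>" "mact g w \<in> CC j" using window[OF w(2)] by blast
    have "w \<in> cball z e" using w(1) by (auto simp: V_def)
    then have "(j, g) \<in> R" using jg by (auto simp: R_def)
    moreover have "mact g w \<notin> CC j" if "(j, g) \<in> {(j, g) \<in> R. mact g z \<notin> CC j}"
      using INT_D[OF IntD2[OF w(1)[unfolded V_def]] that] by simp
    ultimately have "mact g z \<in> CC j" using jg(3) by blast
    then obtain s' where s': "s' \<in> J j" "mact g z = gam j s'" by (auto simp: CC_def)
    have o: "orb (gam j s') = orb (gam i s)" using orb_mact[OF jg(2) z(1)] orb_mact[OF h z(1)] s' zs by simp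
    then have "j = i" using orb_gam_index jg(1) i by blast
    moreover have "s' = s" using o s'(1) lpos[OF i] \<open>j = i\<close> by (intro orb_gam_inj[OF i]) (auto simp: J_def abs_le_iff)
    ultimately have "mact g z = mact h z" using s' zs by simp
    then have "mact (pinv h \<odot> g) z = z"
      using mact_pmul[of "pinv h" g z] mact_pinv[of h z] det1[OF jg(2)] dh z(1) by (simp add: half_plane_def)
    then have "pinv h \<odot> g = pid \<or> pinv h \<odot> g = - pid"
      using free_part_stabilizer[OF z(2)] mul_in inv_in h jg by blast
    then have "h \<odot> (pinv h \<odot> g) = h \<or> h \<odot> (pinv h \<odot> g) = - h" by (metis pid_right pmul_minus_right)
    then have "g = h \<or> g = - h" using dh by simp
    then have "mact h w = mact g w" by auto
    then obtain r where "mact h w = gam i r" using jg(3) \<open>j = i\<close> by (auto simp: CC_def)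
    then have "\<phi> w = ax r" unfolding \<phi>_def gam_def using mact_pinv(1)[of "B i" "ax r"] dB by simp
    then show ?thesis by simp
  qed
  have "open {v \<in> half_plane. \<psi> v \<in> V}"
  proof -
    have "open (half_plane \<inter> \<psi> -` V)" using cont\<psi> open_half_plane openV by (simp add: continuous_on_open_vimage Int_commute)
    then show ?thesis by (simp add: Int_def vimage_def)
  qed
  moreover have "ax s \<in> {v \<in> half_plane. \<psi> v \<in> V}" using zV \<psi>\<phi>[OF z(1)] \<phi>z by simp
  ultimately obtain d where d: "d > 0" "ball (ax s) d \<subseteq> {v \<in> half_plane. \<psi> v \<in> V}" using open_contains_ball by blast
  define D where "D = ball (ax s) d"
  have DH: "v \<in> half_plane" "\<psi> v \<in> V" if "v \<in> D" for v using that d(2) by (auto simp: D_def)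
  define U where "U = {w \<in> half_plane. mact h w \<in> {w' \<in> half_plane. mact (pinv (B i)) w' \<in> D}}"
  have openU: "open U" unfolding U_def using dB dh by (intro open_vimage_mact) (auto simp: D_def)
  have U_iff: "w \<in> U \<longleftrightarrow> w \<in> half_plane \<and> \<phi> w \<in> D" for w
    using dh mact_half_plane[of h w] by (auto simp: U_def \<phi>_def)
  have zU: "z \<in> U" using z(1) \<phi>z d(1) by (simp add: U_iff D_def)
  \<comment> \<open>A half disc has connected image and misses the boundary, so it cannot meet both
    of the disjoint open sets \<open>MT - GT\<close> and \<open>half_plane - MT\<close>.\<close>
  have side: "w \<in> MT \<longleftrightarrow> w' \<in> MT" if H: "convex H" "\<And>v. v \<in> H \<Longrightarrow> Re v \<noteq> 0" and w: "w \<in> U" "w' \<in> U" "\<phi> w \<in> H" "\<phi> w' \<in> H" for H w w'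
  proof -
    let ?S = "\<psi> ` (D \<inter> H)"
    have "connected (D \<inter> H)" using H(1) by (intro convex_connected convex_Int) (simp_all add: D_def)
    then have con: "connected ?S" using DH(1) by (intro connected_continuous_image continuous_on_subset[OF cont\<psi>]) auto
    have cov: "?S \<subseteq> (MT - GT) \<union> (half_plane - MT)"
    proof
      fix x assume "x \<in> ?S"
      then obtain v where v: "v \<in> D" "v \<in> H" "x = \<psi> v" by blast
      have "Re (\<phi> x) \<noteq> 0" using H(2)[OF v(2)] \<phi>\<psi>[OF DH(1)[OF v(1)]] v(3) by simp
      then have "x \<notin> GT" using GT_line DH(2)[OF v(1)] v(3) by blast
      moreover have "x \<in> half_plane" using \<psi>H DH(1)[OF v(1)] v(3) by simp
      ultimately show "x \<in> (MT - GT) \<union> (half_plane - MT)" by blast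
    qed
    have wS: "w \<in> ?S" "w' \<in> ?S" using w \<psi>\<phi> U_iff by (metis IntI image_eqI)+
    have "(MT - GT) \<inter> ?S = {} \<or> (half_plane - MT) \<inter> ?S = {}"
      using connectedD[OF con MT_int MT_closed _ cov] by blast
    then show ?thesis using wS cov by blast
  qed
  have pos: "w \<in> MT \<longleftrightarrow> w' \<in> MT" if "w \<in> U" "w' \<in> U" "Re (\<phi> w) > 0" "Re (\<phi> w') > 0" for w w'
    by (rule side[of "{v. Re v > 0}"]) (use that in \<open>auto simp: convex_halfspace_Re_gt\<close>)
  have neg: "w \<in> MT \<longleftrightarrow> w' \<in> MT" if "w \<in> U" "w' \<in> U" "Re (\<phi> w) < 0" "Re (\<phi> w') < 0" for w w'
    by (rule side[of "{v. Re v < 0}"]) (use that in \<open>auto simp: convex_halfspace_Re_lt\<close>)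
  have zGT: "z \<in> GT" using line_GT[OF z(1)] \<phi>z by simp
  \<comment> \<open>Interior and exterior points both exist near \<open>z\<close>, and each half is
    of one kind; so the two halves are of different kinds.\<close>
  obtain w1 w2 where w1: "w1 \<in> U" "w1 \<in> MT - GT" and w2: "w2 \<in> U" "w2 \<in> half_plane - MT"
    using both[OF zGT openU zU] by blast
  have n1: "Re (\<phi> w1) \<noteq> 0" using line_GT w1 MT_H by blast
  have n2: "Re (\<phi> w2) \<noteq> 0" using line_GT w2 GT_MT by blast
  have "w \<in> MT \<longleftrightarrow> w' \<notin> MT" if ww: "w \<in> U" "w' \<in> U" "Re (\<phi> w) < 0" "Re (\<phi> w') > 0" for w w'
  proof (cases "Re (\<phi> w1) > 0")
    case True
    have "\<not> Re (\<phi> w2) > 0" using pos[OF w1(1) w2(1) True] w1 w2 by blast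
    then have "Re (\<phi> w2) < 0" using n2 by linarith
    then show ?thesis using neg[OF ww(1) w2(1) ww(3)] pos[OF ww(2) w1(1) ww(4) True] w1 w2 by blast
  next
    case False
    then have m: "Re (\<phi> w1) < 0" using n1 by linarith
    have "\<not> Re (\<phi> w2) < 0" using neg[OF w1(1) w2(1) m] w1 w2 by blast
    then have "Re (\<phi> w2) > 0" using n2 by linarith
    then show ?thesis using pos[OF ww(2) w2(1) ww(4)] neg[OF ww(1) w1(1) ww(3) m] w1 w2 by blast
  qed
  then show ?thesis using openU zU unfolding \<phi>_def by blast
qed

definition Am :: "cmat \<Rightarrow> real set" where "Am p = {t. 0 \<le> t \<and> pt (p \<odot> dia t) \<in> MT}"

lemma near_open:
  assumes p: "p \<in> PW" and U: "open U" "pt (p \<odot> dia x) \<in> U"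
  shows "\<exists>d>0. \<forall>y. \<bar>y - x\<bar> < d \<longrightarrow> pt (p \<odot> dia y) \<in> U"
proof -
  have "isCont (\<lambda>t. pt (p \<odot> dia t)) x"
    using continuous_on_pt_dia[OF p, of UNIV] continuous_on_eq_continuous_at[OF open_UNIV] by blast
  then have "((\<lambda>t. pt (p \<odot> dia t)) \<longlongrightarrow> pt (p \<odot> dia x)) (at x)" by (simp add: isCont_def)
  from topological_tendstoD[OF this U] obtain d where "d > 0" "\<And>y. y \<noteq> x \<Longrightarrow> dist y x < d \<Longrightarrow> pt (p \<odot> dia y) \<in> U"
    unfolding eventually_at by blast
  then show ?thesis using U(2) by (intro exI[of _ d]) (metis dist_real_def)
qed

text \<open>Up to a positive factor the real part at time \<open>t\<close> is
  \<open>m * exp t + n * exp (- t)\<close> with \<open>m\<close> and \<open>n\<close> of opposite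
  sign. This is strictly monotone, so the geodesic changes sides at its zero.\<close>

lemma Re_pt_dia_sign:
  assumes q: "q \<in> PW" and cr: "crosses q" and x: "Re (pt (q \<odot> dia x)) = 0" and yz: "y < x" "x < z"
  shows "(Re (pt (q \<odot> dia y)) < 0 \<and> Re (pt (q \<odot> dia z)) > 0) \<or> (Re (pt (q \<odot> dia y)) > 0 \<and> Re (pt (q \<odot> dia z)) < 0)"
proof -
  let ?m = "Im (fst q) * Im (snd q)" and ?n = "Re (fst q) * Re (snd q)"
  define f where "f t = ?m * exp t + ?n * exp (- t)" for t
  have sgn_n: "x > 0 \<Longrightarrow> y < 0" "x < 0 \<Longrightarrow> y > 0" if "x * y < 0" for x y :: real
    using that by (auto simp: mult_less_0_iff)
  have R: "Re (pt (q \<odot> dia t)) = f t / (cmod (snd (q \<odot> dia t)))\<^sup>2" for t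
    by (simp add: pt_simps f_def mult_ac flip: exp_add)
  have c: "(cmod (snd (q \<odot> dia t)))\<^sup>2 > 0" for t
    using PW_snd[of "q \<odot> dia t"] q by simp
  have s: "Re (pt (q \<odot> dia t)) < 0 \<longleftrightarrow> f t < 0" "Re (pt (q \<odot> dia t)) > 0 \<longleftrightarrow> f t > 0" "Re (pt (q \<odot> dia t)) = 0 \<longleftrightarrow> f t = 0" for t
    unfolding R using c[of t] by (auto simp: divide_less_0_iff zero_less_divide_iff)
  have fx: "f x = 0" using x s(3) by blast
  have mn: "?m * ?n < 0" using cr by (simp add: crosses_def)
  have mono: "(?m > 0 \<longrightarrow> f a < f b) \<and> (?m < 0 \<longrightarrow> f b < f a)" if "a < b" for a b
  proof -
    have e: "exp a < exp b" "exp (- b) < exp (- a)" using that by simp_all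
    show ?thesis
    proof (intro conjI impI)
      assume m: "?m > 0"
      then have n: "?n < 0" by (rule sgn_n(1)[OF mn])
      show "f a < f b" unfolding f_def using mult_strict_left_mono[OF e(1) m] mult_strict_left_mono_neg[OF e(2) n] by linarith
    next
      assume m: "?m < 0"
      then have n: "?n > 0" by (rule sgn_n(2)[OF mn])
      show "f b < f a" unfolding f_def using mult_strict_left_mono_neg[OF e(1) m] mult_strict_left_mono[OF e(2) n] by linarith
    qed
  qed
  have "?m \<noteq> 0" using mn by auto
  then consider "?m > 0" | "?m < 0" by linarith
  then show ?thesis unfolding s using mono[OF yz(1)] mono[OF yz(2)] fx by cases auto
qed

text \<open>Off the boundary the ray is in one of two open sets, which gives local constancy; at a
  crossing the real part in adapted coordinates changes sign while the two sides belong to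
  \<open>MT\<close> and to its complement.\<close>

lemma toggling_Am:
  assumes p: "p \<in> PW" "p \<notin> exceptional" and inf: "infinite (Cr p)"
  shows "toggling (Am p) (Cr p)"
proof
  have reg: "regular p" and p0: "pt p \<notin> GT" using not_exceptional[OF p] by auto
  have H: "pt (p \<odot> dia t) \<in> half_plane" for t using p(1) by (intro pt_PW) simp
  show "Am p \<subseteq> {0..}" by (auto simp: Am_def)
  show "Cr p \<subseteq> {0<..}" by (auto simp: Cr_def)
  show "Cr p \<subseteq> Am p" using GT_MT by (auto simp: Cr_def Am_def)
  show "finite (Cr p \<inter> {..T})" for T by (rule finite_Cr[OF reg])
  show "infinite (Cr p)" by (rule inf)
  show "\<exists>d>0. \<forall>y\<ge>0. \<bar>y - x\<bar> < d \<longrightarrow> (y \<in> Am p \<longleftrightarrow> x \<in> Am p)" if x: "0 \<le> x" "x \<notin> Cr p" for x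
  proof -
    have ng: "pt (p \<odot> dia x) \<notin> GT"
    proof (cases "x = 0")
      case True then show ?thesis using p0 by (simp add: dia_0)
    next
      case False then show ?thesis using x by (simp add: Cr_def)
    qed
    show ?thesis
    proof (cases "pt (p \<odot> dia x) \<in> MT")
      case True
      then obtain d where "d > 0" "\<And>y. \<bar>y - x\<bar> < d \<Longrightarrow> pt (p \<odot> dia y) \<in> MT - GT"
        using near_open[OF p(1) MT_int, of x] ng by blast
      then show ?thesis using True x by (intro exI[of _ d]) (auto simp: Am_def)
    next
      case False
      then obtain d where "d > 0" "\<And>y. \<bar>y - x\<bar> < d \<Longrightarrow> pt (p \<odot> dia y) \<in> half_plane - MT"
        using near_open[OF p(1) MT_closed, of x] H by blast
      then show ?thesis using False x by (intro exI[of _ d]) (auto simp: Am_def)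
    qed
  qed
  show "\<exists>d>0. \<forall>y z. x - d < y \<and> y < x \<and> x < z \<and> z < x + d \<longrightarrow> (y \<in> Am p \<longleftrightarrow> z \<notin> Am p)" if x: "x \<in> Cr p" for x
  proof -
    have x0: "x > 0" using x by (simp add: Cr_def)
    obtain i h where ih: "hit p i h" "cross_time (Q i h p) = x" using x by (auto simp: Cr_eq[OF reg])
    then have i: "i \<in> {1..k}" "h \<in> \<Gamma>" and cr: "crosses (Q i h p)" by (auto simp: hit_def)
    have QP: "Q i h p \<in> PW" by (rule Q_PW[OF i p(1)])
    have ac: "acq (Q i h p) \<noteq> 0" using reg i by (simp add: regular_def)
    have e: "pt (Q i h p \<odot> dia x) = ax (cross_pos (Q i h p))" using cross_iff[OF QP ac] cr ih(2) by blast
    have g: "mact h (pt (p \<odot> dia x)) = gam i (cross_pos (Q i h p))"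
      using mact_eq_gam_iff[OF i, of "p \<odot> dia x"] p(1) e by (simp add: Q_dia)
    have fr: "pt (p \<odot> dia x) \<in> free_part" using reg by (simp add: regular_def)
    obtain U where U: "open U" "pt (p \<odot> dia x) \<in> U"
      "\<And>w w'. w \<in> U \<Longrightarrow> w' \<in> U \<Longrightarrow> Re (mact (pinv (B i)) (mact h w)) < 0 \<Longrightarrow>
         Re (mact (pinv (B i)) (mact h w')) > 0 \<Longrightarrow> (w \<in> MT \<longleftrightarrow> w' \<notin> MT)"
      using local_sides[OF H fr i g] by blast
    obtain d where d: "d > 0" "\<And>y. \<bar>y - x\<bar> < d \<Longrightarrow> pt (p \<odot> dia y) \<in> U" using near_open[OF p(1) U(1,2)] by blast
    have ptq: "mact (pinv (B i)) (mact h (pt (p \<odot> dia y))) = pt (Q i h p \<odot> dia y)" for y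
      using pt_Q[OF i, of "p \<odot> dia y"] p(1) by (simp add: Q_dia)
    \<comment> \<open>The minimum with \<open>x\<close> keeps the times before the crossing
      positive, as membership in \<open>Am p\<close> requires.\<close>
    have "y \<in> Am p \<longleftrightarrow> z \<notin> Am p" if yz: "x - min d x < y" "y < x" "x < z" "z < x + min d x" for y z
    proof -
      have yU: "pt (p \<odot> dia y) \<in> U" and zU: "pt (p \<odot> dia z) \<in> U" using d(2)[of y] d(2)[of z] yz by auto
      have A: "y \<in> Am p \<longleftrightarrow> pt (p \<odot> dia y) \<in> MT" "z \<in> Am p \<longleftrightarrow> pt (p \<odot> dia z) \<in> MT" using yz x0 by (auto simp: Am_def)
      have "Re (pt (Q i h p \<odot> dia x)) = 0" by (simp add: e)
      from Re_pt_dia_sign[OF QP cr this yz(2,3)] U(3)[OF yU zU] U(3)[OF zU yU]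
      show ?thesis unfolding A ptq by blast
    qed
    moreover have "min d x > 0" using d(1) x0 by simp
    ultimately show ?thesis by blast
  qed
qed

section \<open>The time in the subsurface as an observable\<close>

definition XM :: "cmat set" where "XM = {p. pt p \<in> MT}"

lemma MT_borel: "MT \<in> sets borel"
proof -
  have "half_plane \<in> sets borel" "half_plane - MT \<in> sets borel" using MT_closed open_half_plane by (auto intro: borel_open)
  then have "half_plane - (half_plane - MT) \<in> sets borel" by (rule sets.Diff)
  moreover have "half_plane - (half_plane - MT) = MT" using MT_H by blast
  ultimately show ?thesis by (simp only:)
qed

lemma XM_borel[measurable]: "XM \<in> sets borel"
  using measurable_sets[OF borel_measurable_pt MT_borel] by (simp add: XM_def vimage_def)

lemma XM_PW: "XM \<subseteq> PW"
  using MT_H PW_iff_pt by (auto simp: XM_def half_plane_def)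

lemma XM_inv_left: "inv_left XM"
  unfolding inv_left_def
proof (intro conjI ballI XM_borel XM_PW)
  fix g p assume g: "g \<in> \<Gamma>" and p: "p \<in> PW"
  have "pt (g \<odot> p) = mact g (pt p)" using PW_snd[OF p] by (rule pt_pmul)
  moreover have "mact g (pt p) \<in> half_plane" using g det1 pt_PW[OF p] by (intro mact_half_plane) auto
  ultimately show "g \<odot> p \<in> XM \<longleftrightarrow> p \<in> XM"
    using MT_orb[OF _ pt_PW[OF p], of "mact g (pt p)"] orb_mact[OF g pt_PW[OF p]] by (simp add: XM_def)
qed

text \<open>The time spent in the subsurface during one unit, so that sums over the time-one map are
  exact occupation times.\<close>

definition F1 :: "cmat \<Rightarrow> ennreal" where
  "F1 p = (\<integral>\<^sup>+t. indicator {0<..1} t * indicator XM (p \<odot> dia t) \<partial>lborel)"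

lemma measurable_XM_dia: "(\<lambda>x. indicator XM (fst x \<odot> dia (snd x)) :: ennreal) \<in> borel_measurable (borel :: (cmat \<times> real) measure)"
proof -
  have "(\<lambda>x::cmat \<times> real. fst x \<odot> dia (snd x)) \<in> borel_measurable borel"
    unfolding dia_def Complex_eq by (intro borel_measurable_continuous_onI continuous_intros) auto
  from measurable_compose[OF this borel_measurable_indicator[OF XM_borel]] show ?thesis .
qed

lemma XM_dia_measurable[measurable]:
  assumes "f \<in> borel_measurable M" "g \<in> borel_measurable M"
  shows "(\<lambda>x. indicator XM (f x \<odot> dia (g x)) :: ennreal) \<in> borel_measurable M"
  using measurable_compose[OF borel_measurable_Pair[OF assms] measurable_XM_dia] by simp

lemma measurable_F1: "F1 \<in> borel_measurable borel"
  unfolding F1_def by measurable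

lemma measurable_F1_QM: "F1 \<in> borel_measurable QM"
proof (rule measurable_QM[OF measurable_F1])
  fix g p assume g: "g \<in> \<Gamma>" and p: "p \<in> PW"
  have "g \<odot> p \<odot> dia t \<in> XM \<longleftrightarrow> p \<odot> dia t \<in> XM" for t
    using XM_inv_left g p unfolding inv_left_def pmul_assoc by simp
  then show "F1 (g \<odot> p) = F1 p" by (simp add: F1_def indicator_def)
next
  fix r :: real and p assume "r \<noteq> 0"
  then show "F1 (r *\<^sub>R p) = F1 p" by (simp add: F1_def pmul_scaleR_left XM_def indicator_def)
qed

text \<open>Interchange the integrals: at each time the flow preserves \<open>mu\<close>, so the
  result is the measure of the cut cone over the part of the fundamental domain in
  \<open>MT\<close>.\<close>

lemma nn_integral_F1: "(\<integral>\<^sup>+p. F1 p \<partial>QM) = ennreal (pi / 2) * emeasure hyp_area (F \<inter> MT)"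
proof -
  have "(\<integral>\<^sup>+p. F1 p \<partial>QM) = (\<integral>\<^sup>+p. F1 p * indicator (FF \<inter> det_lt1) p \<partial>lborel)"
    by (rule nn_integral_QM[OF measurable_F1_QM measurable_F1])
  also have "\<dots> = (\<integral>\<^sup>+p. \<integral>\<^sup>+t. indicator {0<..1} t * indicator XM (p \<odot> dia t) * indicator (FF \<inter> det_lt1) p \<partial>lborel \<partial>lborel)"
    unfolding F1_def by (intro nn_integral_cong nn_integral_multc[symmetric]) measurable
  also have "\<dots> = (\<integral>\<^sup>+t. \<integral>\<^sup>+p. indicator {0<..1} t * indicator XM (p \<odot> dia t) * indicator (FF \<inter> det_lt1) p \<partial>lborel \<partial>lborel)"
    by (rule lborel_pair.Fubini') measurable
  also have "\<dots> = (\<integral>\<^sup>+(t::real). indicator {0<..1} t * mu XM \<partial>lborel)"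
  proof (rule nn_integral_cong)
    fix t :: real
    have b: "{p. p \<odot> dia t \<in> XM} \<in> sets borel" by (rule borel_pmul_right) simp
    have "(\<integral>\<^sup>+p. indicator {0<..1} t * indicator XM (p \<odot> dia t) * indicator (FF \<inter> det_lt1) p \<partial>lborel)
      = (\<integral>\<^sup>+p. indicator {0<..1} t * indicator ({p. p \<odot> dia t \<in> XM} \<inter> det_lt1 \<inter> FF) p \<partial>lborel)"
      by (intro nn_integral_cong) (auto simp: indicator_def)
    also have "\<dots> = indicator {0<..1} t * mu {p. p \<odot> dia t \<in> XM}"
      unfolding mu_def using b by (subst nn_integral_cmult) auto
    also have "mu {p. p \<odot> dia t \<in> XM} = mu XM" by (rule mu_right[OF _ XM_inv_left]) simp
    finally show "(\<integral>\<^sup>+p. indicator {0<..1} t * indicator XM (p \<odot> dia t) * indicator (FF \<inter> det_lt1) p \<partial>lborel) = indicator {0<..1} t * mu XM" .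
  qed
  also have "\<dots> = mu XM" by (subst nn_integral_multc) auto
  also have "\<dots> = emeasure lborel {p. pt p \<in> F \<inter> MT \<and> pdet p < 1}"
    unfolding mu_def by (intro arg_cong[where f="emeasure lborel"]) (auto simp: XM_def FF_def det_lt1_def)
  also have "\<dots> = ennreal (pi / 2) * emeasure hyp_area (F \<inter> MT)"
    using F_borel F_sub MT_borel by (intro emeasure_pt_hyp_area) auto
  finally show ?thesis .
qed

lemma Am_borel: "p \<in> PW \<Longrightarrow> Am p \<in> sets borel"
proof -
  have "(\<lambda>t. indicator XM (p \<odot> dia t) :: ennreal) \<in> borel_measurable borel" by measurable
  then have "(\<lambda>t. indicator XM (p \<odot> dia t) :: ennreal) -` {1} \<inter> space borel \<in> sets borel" by (rule measurable_sets) simp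
  also have "(\<lambda>t. indicator XM (p \<odot> dia t) :: ennreal) -` {1} \<inter> space borel = {t. pt (p \<odot> dia t) \<in> MT}"
    by (auto simp: XM_def indicator_def)
  finally have "{0..} \<inter> {t. pt (p \<odot> dia t) \<in> MT} \<in> sets borel" by (intro sets.Int) auto
  also have "{0..} \<inter> {t. pt (p \<odot> dia t) \<in> MT} = Am p" by (auto simp: Am_def)
  finally show ?thesis .
qed

lemma emeasure_Am_finite: "p \<in> PW \<Longrightarrow> emeasure lborel (Am p \<inter> {..T}) < \<infinity>"
proof -
  assume p: "p \<in> PW"
  have "emeasure lborel (Am p \<inter> {..T}) \<le> emeasure lborel {0..max 0 T}"
    by (intro emeasure_mono) (auto simp: Am_def)
  also have "\<dots> < \<infinity>" by simp
  finally show ?thesis .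
qed

lemma sum_F1:
  assumes p: "p \<in> PW"
  shows "(\<Sum>j<n. enn2real (F1 (p \<odot> dia (real j)))) = measure lborel (Am p \<inter> {..real n})"
proof (induction n)
  case 0
  have "emeasure lborel (Am p \<inter> {..0}) \<le> emeasure lborel {0::real}" by (intro emeasure_mono) (auto simp: Am_def)
  then show ?case by (simp add: measure_def)
next
  case (Suc n)
  let ?D = "Am p \<inter> {real n<..real (Suc n)}"
  have Ab: "Am p \<in> sets borel" by (rule Am_borel[OF p])
  have D: "?D \<in> sets borel" using Ab by auto
  have "F1 (p \<odot> dia (real n)) = (\<integral>\<^sup>+t. indicator ?D (t + real n) \<partial>lborel)"
    unfolding F1_def
    by (intro nn_integral_cong) (auto simp: indicator_def Am_def XM_def pmul_assoc dia_mult add.commute)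
  also have "\<dots> = (\<integral>\<^sup>+t. indicator ?D t \<partial>lborel)"
    by (rule lpres_nn_integral[OF lpres_translation]) (use D in simp)
  also have "\<dots> = emeasure lborel ?D" using D by simp
  finally have 1: "enn2real (F1 (p \<odot> dia (real n))) = measure lborel ?D" by (simp add: measure_def)
  have "Am p \<inter> {..real (Suc n)} = (Am p \<inter> {..real n}) \<union> ?D" by auto
  moreover have "emeasure lborel ?D < \<infinity>"
  proof -
    have "emeasure lborel ?D \<le> emeasure lborel (Am p \<inter> {..real (Suc n)})" using Ab by (intro emeasure_mono) auto
    then show ?thesis using emeasure_Am_finite[OF p] le_less_trans by blast
  qed
  ultimately have "measure lborel (Am p \<inter> {..real (Suc n)}) = measure lborel (Am p \<inter> {..real n}) + measure lborel ?D"
    using D Ab emeasure_Am_finite[OF p, of "real n"] by (auto intro!: measure_Union)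
  then show ?case using Suc 1 by simp
qed

text \<open>Both Birkhoff limits contain the mass of \<open>QM\<close> in the denominator, and it
  cancels in their quotient. The null set is returned as an invariant cone so that it descends to
  the orbifold.\<close>

theorem excursion_limit:
  "\<exists>N\<in>Inv. emeasure lborel N = 0 \<and> (\<forall>p\<in>PW - N.
     (\<exists>t s. (\<forall>i::nat. t i < s i \<and> s i < t (Suc i)) \<and> Am p = (\<Union>i. {t i..s i})) \<and>
     (\<forall>t s. (\<forall>i::nat. t i < s i \<and> s i < t (Suc i)) \<and> Am p = (\<Union>i. {t i..s i}) \<longrightarrow>
        (\<lambda>n. (1 / real n) * (\<Sum>i<n. s i - t i)) \<longlonglongrightarrow> pi * measure hyp_area (F \<inter> MT) / (\<Sum>i\<in>{1..k}. l i)))"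
proof -
  interpret QM: finite_measure QM by (rule finite_QM)
  let ?L = "\<Sum>i\<in>{1..k}. l i"
  let ?m = "measure QM (space QM)"
  have L: "?L > 0" using k1 lpos by (intro sum_pos) auto
  have m: "?m > 0" by (rule QM_pos)
  have "emeasure hyp_area (F \<inter> MT) \<le> emeasure hyp_area F"
    using F_borel F_sub by (intro emeasure_mono) (auto simp: sets_hyp_area_iff)
  then have fin: "emeasure hyp_area (F \<inter> MT) < \<infinity>" using F_finite by (rule le_less_trans)
  \<comment> \<open>A finite integral makes the extended-valued observables almost everywhere
    finite, so they can be replaced by real ones.\<close>
  have real_int: "integrable QM (\<lambda>p. enn2real (f p))" "(\<integral>p. enn2real (f p) \<partial>QM) = c"
    if f: "f \<in> borel_measurable QM" and c: "(\<integral>\<^sup>+p. f p \<partial>QM) = ennreal c" "c \<ge> 0" for f c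
  proof -
    have "AE p in QM. f p \<noteq> \<infinity>" using f c by (intro nn_integral_PInf_AE) auto
    then have "AE p in QM. f p = ennreal (enn2real (f p))" by eventually_elim (simp add: less_top)
    then have e: "(\<integral>\<^sup>+p. ennreal (enn2real (f p)) \<partial>QM) = ennreal c"
      using c(1) by (subst nn_integral_cong_AE[of _ f]) auto
    have fm: "(\<lambda>p. enn2real (f p)) \<in> borel_measurable QM" using f by measurable
    show "integrable QM (\<lambda>p. enn2real (f p))"
      using e fm by (intro integrableI_bounded) auto
    show "(\<integral>p. enn2real (f p) \<partial>QM) = c"
      using e fm c(2) by (subst integral_eq_nn_integral) auto
  qed
  have N: "integrable QM (\<lambda>p. enn2real (Nc p))" "(\<integral>p. enn2real (Nc p) \<partial>QM) = 2 * ?L"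
    using real_int[OF measurable_Nc_QM nn_integral_Nc] L by auto
  have "(\<integral>\<^sup>+p. F1 p \<partial>QM) = ennreal (pi / 2 * measure hyp_area (F \<inter> MT))"
    unfolding nn_integral_F1 using fin by (simp add: emeasure_eq_ennreal_measure) (simp flip: ennreal_mult)
  then have Fi: "integrable QM (\<lambda>p. enn2real (F1 p))" "(\<integral>p. enn2real (F1 p) \<partial>QM) = pi / 2 * measure hyp_area (F \<inter> MT)"
    using real_int[OF measurable_F1_QM] by (simp_all only: measure_nonneg mult_nonneg_nonneg pi_half_ge_zero)
  let ?a = "pi / 2 * measure hyp_area (F \<inter> MT) / ?m" and ?b = "2 * ?L / ?m"
  have "AE p in QM. (\<lambda>n. (\<Sum>j<n. enn2real (F1 (p \<odot> dia (real j)))) / real n) \<longlonglongrightarrow> ?a \<and>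
    (\<lambda>n. (\<Sum>j<n. enn2real (Nc (p \<odot> dia (real j)))) / real n) \<longlonglongrightarrow> ?b"
    using birkhoff_QM[OF Fi(1)] birkhoff_QM[OF N(1)] unfolding Fi(2) N(2) by eventually_elim blast
  then obtain N0 where N0: "N0 \<in> Inv" "emeasure lborel N0 = 0"
    "\<And>p. p \<in> PW \<Longrightarrow> p \<notin> N0 \<Longrightarrow> (\<lambda>n. (\<Sum>j<n. enn2real (F1 (p \<odot> dia (real j)))) / real n) \<longlonglongrightarrow> ?a \<and>
      (\<lambda>n. (\<Sum>j<n. enn2real (Nc (p \<odot> dia (real j)))) / real n) \<longlonglongrightarrow> ?b"
    by (rule AE_QM_E) blast
  define N where "N = N0 \<union> exceptional"
  have NI: "N \<in> Inv" using sigma_algebra.sets_measure_of_eq[OF sigma_algebra_Inv] N0(1) exceptional_Inv(1) unfolding N_def by (metis sets.Un)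
  have N0': "emeasure lborel N = 0" unfolding N_def
    using N0(2) exceptional_Inv(2) InvD(2)[OF N0(1)] InvD(2)[OF exceptional_Inv(1)]
    by (intro emeasure_Un_null_set[THEN trans]) (auto simp: null_sets_def)
  show ?thesis
  proof (intro bexI[OF _ NI] conjI ballI N0')
    fix p assume "p \<in> PW - N"
    then have p: "p \<in> PW" "p \<notin> exceptional" "p \<notin> N0" by (auto simp: N_def)
    have reg: "regular p" using not_exceptional[OF p(1,2)] by simp
    have a: "(\<lambda>n. measure lborel (Am p \<inter> {..real n}) / real n) \<longlonglongrightarrow> ?a"
      using N0(3)[OF p(1,3)] by (simp add: sum_F1[OF p(1)])
    have "(\<lambda>n. 2 * real (card (Cr p \<inter> {..real n})) / real n) \<longlonglongrightarrow> ?b"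
      using N0(3)[OF p(1,3)] by (simp add: sum_Nc[OF reg])
    from tendsto_mult_left[OF this, of "1/2"]
    have b: "(\<lambda>n. real (card (Cr p \<inter> {..real n})) / real n) \<longlonglongrightarrow> ?L / ?m" by simp
    have bpos: "?L / ?m > 0" using L m by simp
    \<comment> \<open>A positive crossing rate excludes finitely many crossings.\<close>
    have inf: "infinite (Cr p)"
    proof
      assume f: "finite (Cr p)"
      have "(\<lambda>n. real (card (Cr p)) / real n) \<longlonglongrightarrow> 0" by (rule lim_const_over_n)
      moreover have "(\<lambda>n. real (card (Cr p \<inter> {..real n})) / real n) \<longlonglongrightarrow> ?L / ?m" by (rule b)
      moreover have "real (card (Cr p \<inter> {..real n})) / real n \<le> real (card (Cr p)) / real n" for n
        using f by (intro divide_right_mono) (auto intro!: card_mono)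
      ultimately have "?L / ?m \<le> 0" by (intro LIMSEQ_le[of _ "?L / ?m" _ 0]) auto
      then show False using bpos by linarith
    qed
    interpret T: toggling "Am p" "Cr p" by (rule toggling_Am[OF p(1,2) inf])
    show "\<exists>t s. (\<forall>i::nat. t i < s i \<and> s i < t (Suc i)) \<and> Am p = (\<Union>i. {t i..s i})"
      by (rule T.excursions_exist)
    show "\<forall>t s. (\<forall>i::nat. t i < s i \<and> s i < t (Suc i)) \<and> Am p = (\<Union>i. {t i..s i}) \<longrightarrow>
        (\<lambda>n. (1 / real n) * (\<Sum>i<n. s i - t i)) \<longlonglongrightarrow> pi * measure hyp_area (F \<inter> MT) / ?L"
    proof (intro allI impI)
      fix t s :: "nat \<Rightarrow> real" assume ts: "(\<forall>i::nat. t i < s i \<and> s i < t (Suc i)) \<and> Am p = (\<Union>i. {t i..s i})"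
      have "(\<lambda>n. (1 / real n) * (\<Sum>i<n. s i - t i)) \<longlonglongrightarrow> 2 * ?a / (?L / ?m)"
        by (rule T.excursion_average[OF _ _ _ a b bpos]) (use ts in auto)
      also have "2 * ?a / (?L / ?m) = pi * measure hyp_area (F \<inter> MT) / ?L" using m by (simp add: field_simps)
      finally show "(\<lambda>n. (1 / real n) * (\<Sum>i<n. s i - t i)) \<longlonglongrightarrow> pi * measure hyp_area (F \<inter> MT) / ?L" .
    qed
  qed
qed

end

section \<open>Transfer to the orbifold\<close>

lemma sets_borel_of_topology: "sets (borel_of_topology X) = sigma_sets (topspace X) {U. openin X U}"
  unfolding borel_of_topology_def by (rule sets_measure_of) (auto dest: openin_subset)

lemma space_borel_of_topology: "space (borel_of_topology X) = topspace X"
  unfolding borel_of_topology_def by (rule space_measure_of) (auto dest: openin_subset)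

lemma openin_borel_of_topology: "openin X U \<Longrightarrow> U \<in> sets (borel_of_topology X)"
  unfolding sets_borel_of_topology by (intro sigma_sets.Basic) simp

lemma closedin_borel_of_topology:
  assumes "closedin X S" shows "S \<in> sets (borel_of_topology X)"
proof -
  have "topspace X - (topspace X - S) \<in> sets (borel_of_topology X)"
    using sets.compl_sets[OF openin_borel_of_topology, of X "topspace X - S"] assms
    by (simp only: space_borel_of_topology closedin_def)
  moreover have "topspace X - (topspace X - S) = S" using closedin_subset[OF assms] by blast
  ultimately show ?thesis by (simp only:)
qed

lemma measurable_quotient_map:
  assumes sp: "space M \<subseteq> topspace X" and op: "\<And>U. openin X U \<Longrightarrow> U \<inter> space M \<in> sets M"
  shows "p \<in> M \<rightarrow>\<^sub>M borel_of_topology (quotient_topology X p)"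
  unfolding borel_of_topology_def
proof (rule measurable_measure_of)
  show "{U. openin (quotient_topology X p) U} \<subseteq> Pow (topspace (quotient_topology X p))"
    by (auto dest: openin_subset)
  show "p \<in> space M \<rightarrow> topspace (quotient_topology X p)"
    using sp by (auto simp: topspace_quotient_topology)
  fix U assume "U \<in> {U. openin (quotient_topology X p) U}"
  then have "{x \<in> topspace X. p x \<in> U} \<inter> space M \<in> sets M" by (intro op) (simp add: openin_quotient_topology)
  also have "{x \<in> topspace X. p x \<in> U} \<inter> space M = p -` U \<inter> space M" using sp by blast
  finally show "p -` U \<inter> space M \<in> sets M" .
qed

lemma emeasure_quotient_measure:
  assumes ex: "\<exists>F. fundamental_domain \<mu> p F"
    and sp: "space \<mu> \<subseteq> topspace X" and op: "\<And>U. openin X U \<Longrightarrow> U \<inter> space \<mu> \<in> sets \<mu>"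
    and T: "T \<in> sets (borel_of_topology (quotient_topology X p))"
  shows "emeasure (quotient_measure \<mu> X p) T = emeasure \<mu> ((SOME F. fundamental_domain \<mu> p F) \<inter> {x. p x \<in> T})"
proof -
  define F where "F = (SOME F. fundamental_domain \<mu> p F)"
  have "fundamental_domain \<mu> p F" unfolding F_def using ex by (rule someI_ex)
  then have F: "F \<in> sets \<mu>" by (simp add: fundamental_domain_def)
  then have Fs: "F \<subseteq> space \<mu>" by (rule sets.sets_into_space)
  have spF: "space (restrict_space \<mu> F) = F" using Fs by (auto simp: space_restrict_space)
  have m: "p \<in> restrict_space \<mu> F \<rightarrow>\<^sub>M borel_of_topology (quotient_topology X p)"
    using sp op by (intro measurable_restrict_space1 measurable_quotient_map)
  have "emeasure (quotient_measure \<mu> X p) T = emeasure (restrict_space \<mu> F) (p -` T \<inter> space (restrict_space \<mu> F))"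
    unfolding quotient_measure_def F_def[symmetric] using m T by (rule emeasure_distr)
  also have "\<dots> = emeasure \<mu> (p -` T \<inter> F)"
    unfolding spF using F Fs by (intro emeasure_restrict_space) (auto simp: Int_absorb2)
  also have "p -` T \<inter> F = F \<inter> {x. p x \<in> T}" by blast
  finally show ?thesis unfolding F_def .
qed

lemma sets_quotient_measure: "sets (quotient_measure \<mu> X p) = sets (borel_of_topology (quotient_topology X p))"
  by (simp add: quotient_measure_def)

lemma space_quotient_measure: "space (quotient_measure \<mu> X p) = p ` topspace X"
  by (simp add: quotient_measure_def space_borel_of_topology topspace_quotient_topology)

lemma space_tangent_measure: "space (hyp_area \<Otimes>\<^sub>M angle_measure) = unit_tangent"
  by (simp add: space_pair_measure unit_tangent_def)

lemma openin_unit_tangent_borel: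
  assumes "openin (top_of_set unit_tangent) U" shows "U \<in> sets borel" "U \<subseteq> unit_tangent"
proof -
  obtain V where V: "open V" "U = unit_tangent \<inter> V" using assms by (auto simp: openin_open)
  then show "U \<in> sets borel" using borel_unit_tangent by (simp add: sets.Int)
  show "U \<subseteq> unit_tangent" using V(2) by blast
qed

lemma moebius_tangent_eq:
  assumes "det A = 1" "v \<in> unit_tangent"
  shows "moebius_tangent A v = (mact (cmat_of A) (fst v), sgn (snd v / (mden (cmat_of A) (fst v))\<^sup>2))"
proof -
  have "(mact (cmat_of A) has_field_derivative of_real (pdet (cmat_of A)) / (mden (cmat_of A) (fst v))\<^sup>2) (at (fst v))"
    using assms by (intro has_field_derivative_mact) (auto simp: pdet_cmat_of unit_tangent_def half_plane_def)
  then have "deriv (mact (cmat_of A)) (fst v) = 1 / (mden (cmat_of A) (fst v))\<^sup>2"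
    using assms(1) by (simp add: pdet_cmat_of DERIV_imp_deriv)
  moreover have "moebius A = mact (cmat_of A)" by (rule ext) (rule moebius_mact)
  ultimately show ?thesis by (simp add: moebius_tangent_def)
qed

lemma continuous_on_moebius_tangent:
  assumes A: "det A = 1" shows "continuous_on unit_tangent (moebius_tangent A)"
proof -
  let ?g = "cmat_of A"
  have d: "pdet ?g > 0" using A by (simp add: pdet_cmat_of)
  have nz: "mden ?g (fst v) \<noteq> 0" "snd v \<noteq> 0" if "v \<in> unit_tangent" for v
    using that mden_nz[OF d, of "fst v"] by (auto simp: unit_tangent_def half_plane_def)
  have 1: "continuous_on unit_tangent (\<lambda>v. mact ?g (fst v))"
    using continuous_on_mact[OF d subset_refl]
    by (rule continuous_on_compose2) (auto intro!: continuous_intros simp: unit_tangent_def)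
  have "continuous_on unit_tangent (\<lambda>v. sgn (snd v / (mden ?g (fst v))\<^sup>2))"
    unfolding mden_def by (rule continuous_on_sgn) (use nz in \<open>auto intro!: continuous_intros simp: mden_def\<close>)
  with 1 have "continuous_on unit_tangent (\<lambda>v. (mact ?g (fst v), sgn (snd v / (mden ?g (fst v))\<^sup>2)))"
    by (rule continuous_on_Pair)
  then show ?thesis using moebius_tangent_eq[OF A] by (simp cong: continuous_on_cong)
qed

locale discrete_PSL2R =
  fixes G :: "(real^2^2) set set"
  assumes discrete: "discrete_subgroup_PSL2R G"
begin

sublocale fuchsian "cmat_of ` \<Union>G" by (rule fuchsian_cmat_of[OF discrete])

abbreviation "\<Gamma> \<equiv> cmat_of ` \<Union>G"

lemma det_G: "A \<in> \<Union>G \<Longrightarrow> det A = 1"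
  using det1[of "cmat_of A"] by (simp add: pdet_cmat_of)

lemma orbit_orb: "orbit G = orb"
  by (rule ext) (simp add: orbit_def orb_def image_image moebius_mact)

lemma openin_orbifold: "openin (orbifold_topology G) U \<Longrightarrow> open {z \<in> half_plane. orb z \<in> U}"
  using open_half_plane by (simp add: orbifold_topology_def openin_quotient_topology orbit_orb openin_open_eq)

lemma openin_orbifoldI: "U \<subseteq> orb ` half_plane \<Longrightarrow> open {z \<in> half_plane. orb z \<in> U} \<Longrightarrow> openin (orbifold_topology G) U"
  using open_half_plane by (auto simp: orbifold_topology_def openin_quotient_topology orbit_orb openin_open_eq)

lemma topspace_orbifold: "topspace (orbifold_topology G) = orb ` half_plane"
  by (simp add: orbifold_topology_def topspace_quotient_topology orbit_orb)

text \<open>The saturation of an open set is a union of preimages under the continuous maps of the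
  group.\<close>

lemma open_map_orbit:
  assumes U: "open U" "U \<subseteq> half_plane" shows "openin (orbifold_topology G) (orb ` U)"
proof (rule openin_orbifoldI)
  show "orb ` U \<subseteq> orb ` half_plane" using U(2) by blast
  have "{z \<in> half_plane. orb z \<in> orb ` U} = (\<Union>g\<in>\<Gamma>. half_plane \<inter> mact g -` U)"
  proof (intro equalityI subsetI)
    fix z assume z: "z \<in> {z \<in> half_plane. orb z \<in> orb ` U}"
    then obtain u where u: "u \<in> U" "orb u = orb z" by auto
    then show "z \<in> (\<Union>g\<in>\<Gamma>. half_plane \<inter> mact g -` U)" using orb_eq_iff[of z u] z by auto
  next
    fix z assume "z \<in> (\<Union>g\<in>\<Gamma>. half_plane \<inter> mact g -` U)"
    then obtain g where g: "g \<in> \<Gamma>" "z \<in> half_plane" "mact g z \<in> U" by blast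
    have "orb z \<in> orb ` U" using orb_mact[OF g(1,2), symmetric] g(3) by (rule image_eqI)
    then show "z \<in> {z \<in> half_plane. orb z \<in> orb ` U}" using g(2) by simp
  qed
  moreover have "open (half_plane \<inter> mact g -` U)" if "g \<in> \<Gamma>" for g
    using continuous_on_mact[OF _ subset_refl, of g] det1[OF that] open_half_plane U(1)
    by (simp add: continuous_on_open_vimage Int_commute)
  ultimately show "open {z \<in> half_plane. orb z \<in> orb ` U}" by (simp only:) (intro open_UN ballI, blast)
qed

lemma AE_free_part: "AE z in hyp_area. z \<in> free_part"
proof -
  have "AE z in lborel. z \<notin> half_plane - free_part"
    using countable_non_free by (intro AE_not_in countable_imp_null_set_lborel)
  then show ?thesis unfolding AE_hyp_area_iff by eventually_elim blast
qed

text \<open>The very domain that the choice in \<open>quotient_measure\<close> selects, so that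
  areas in the orbifold are areas of subsets of it by definition.\<close>

definition HF :: "complex set" where "HF = (SOME F. fundamental_domain hyp_area orb F)"

lemma fundamental_domain_ex: "\<exists>F. fundamental_domain hyp_area orb F"
proof -
  obtain F where F: "F \<in> sets borel" "F \<subseteq> half_plane" "\<And>z. z \<in> free_part \<Longrightarrow> \<exists>!y. y \<in> F \<and> orb y = orb z"
    using fundamental_set by blast
  have "AE z in hyp_area. \<exists>!y. y \<in> F \<and> orb y = orb z"
    using AE_free_part by eventually_elim (rule F(3))
  then show ?thesis using F(1,2) by (auto simp: fundamental_domain_def sets_hyp_area_iff)
qed

lemma HF: "HF \<in> sets borel" "HF \<subseteq> half_plane" "AE z in hyp_area. \<exists>!y. y \<in> HF \<and> orb y = orb z"
proof -
  have "fundamental_domain hyp_area orb HF" unfolding HF_def by (rule someI_ex[OF fundamental_domain_ex])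
  then show "HF \<in> sets borel" "HF \<subseteq> half_plane" "AE z in hyp_area. \<exists>!y. y \<in> HF \<and> orb y = orb z"
    by (simp_all add: fundamental_domain_def sets_hyp_area_iff)
qed

lemma emeasure_orbifold_area:
  assumes "T \<in> sets (borel_of_topology (orbifold_topology G))"
  shows "emeasure (orbifold_area G) T = emeasure hyp_area (HF \<inter> {z \<in> half_plane. orb z \<in> T})"
proof -
  have "emeasure (orbifold_area G) T = emeasure hyp_area (HF \<inter> {z. orb z \<in> T})"
    unfolding orbifold_area_def orbit_orb HF_def
  proof (rule emeasure_quotient_measure[OF fundamental_domain_ex])
    show "U \<inter> space hyp_area \<in> sets hyp_area" if "openin (top_of_set half_plane) U" for U
      using that open_half_plane by (auto simp: sets_hyp_area_iff openin_open_eq)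
    show "T \<in> sets (borel_of_topology (quotient_topology (top_of_set half_plane) orb))"
      using assms by (simp add: orbifold_topology_def orbit_orb)
  qed simp
  also have "HF \<inter> {z. orb z \<in> T} = HF \<inter> {z \<in> half_plane. orb z \<in> T}" using HF(2) by blast
  finally show ?thesis .
qed

section \<open>Orbits of tangent vectors and images of Borel sets\<close>

lemma tangent_orbit_tang: "pdet p = 1 \<Longrightarrow> tangent_orbit G (tang p) = (\<lambda>g. tang (g \<odot> p)) ` \<Gamma>"
  unfolding tangent_orbit_def image_image by (rule image_cong[OF refl]) (rule moebius_tangent_tang[OF det_G])

lemma tangent_orbit_eq_iff:
  assumes p: "pdet p = 1" and q: "pdet q = 1"
  shows "tangent_orbit G (tang q) = tangent_orbit G (tang p) \<longleftrightarrow> (\<exists>g\<in>\<Gamma>. tang q = tang (g \<odot> p))"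
proof
  assume "tangent_orbit G (tang q) = tangent_orbit G (tang p)"
  moreover have "tang q \<in> tangent_orbit G (tang q)"
    unfolding tangent_orbit_tang[OF q] using id_in by (intro image_eqI[of _ _ pid]) simp_all
  ultimately show "\<exists>g\<in>\<Gamma>. tang q = tang (g \<odot> p)" unfolding tangent_orbit_tang[OF p] by blast
next
  assume "\<exists>g\<in>\<Gamma>. tang q = tang (g \<odot> p)"
  then obtain g where g: "g \<in> \<Gamma>" "tang q = tang (g \<odot> p)" by blast
  have gp: "pdet (g \<odot> p) = 1" using det1[OF g(1)] p by simp
  have "(\<lambda>h. tang (h \<odot> (g \<odot> p))) ` \<Gamma> = (\<lambda>h. tang (h \<odot> p)) ` \<Gamma>"
  proof (intro equalityI subsetI)
    fix v assume "v \<in> (\<lambda>h. tang (h \<odot> (g \<odot> p))) ` \<Gamma>"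
    then obtain h where h: "h \<in> \<Gamma>" "v = tang ((h \<odot> g) \<odot> p)" by (auto simp only: pmul_assoc)
    show "v \<in> (\<lambda>h. tang (h \<odot> p)) ` \<Gamma>" using h(2) mul_in[OF h(1) g(1)] by (rule image_eqI)
  next
    fix v assume "v \<in> (\<lambda>h. tang (h \<odot> p)) ` \<Gamma>"
    then obtain h where h: "h \<in> \<Gamma>" "v = tang (h \<odot> p)" by blast
    have "(h \<odot> pinv g) \<odot> (g \<odot> p) = h \<odot> p" using det1[OF g(1)] by (simp add: pmul_assoc)
    then show "v \<in> (\<lambda>h. tang (h \<odot> (g \<odot> p))) ` \<Gamma>"
      using h mul_in[OF h(1) inv_in[OF g(1)]] by (intro image_eqI[of _ _ "h \<odot> pinv g"]) simp_all
  qed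
  then show "tangent_orbit G (tang q) = tangent_orbit G (tang p)"
    unfolding g(2) tangent_orbit_tang[OF p] tangent_orbit_tang[OF gp] .
qed

definition free_tangent :: "(complex \<times> complex) set" where "free_tangent = free_part \<times> sphere 0 1"

lemma free_tangent_sub: "free_tangent \<subseteq> unit_tangent"
  using free_part_half_plane by (auto simp: free_tangent_def unit_tangent_def)

lemma pt_tsec: "v \<in> unit_tangent \<Longrightarrow> pt (tsec v) = fst v"
  using tsec(1)[of v] by (metis fst_conv tang_def)

lemma fst_tang_pmul: "pdet p = 1 \<Longrightarrow> fst (tang (g \<odot> p)) = mact g (pt p)"
  using pt_pmul[OF PW_snd, of p g] by (simp add: tang_def PW_def)

text \<open>The element relating the two vectors moves a point of \<open>W\<close> into
  \<open>W\<close>, so it is \<open>pid\<close> or \<open>- pid\<close>, and \<open>tang\<close>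
  does not see the sign.\<close>

lemma tangent_orbit_inj:
  assumes W: "wandering W" and v: "v \<in> W \<times> sphere 0 1" and w: "w \<in> W \<times> sphere 0 1"
    and eq: "tangent_orbit G w = tangent_orbit G v"
  shows "w = v"
proof -
  have WH: "W \<subseteq> half_plane" using W by (simp add: wandering_def)
  have u: "v \<in> unit_tangent" "w \<in> unit_tangent" using v w WH by (auto simp: unit_tangent_def)
  note tv = tsec[OF u(1)] and tw = tsec[OF u(2)]
  have "\<exists>g\<in>\<Gamma>. w = tang (g \<odot> tsec v)"
    using tangent_orbit_eq_iff[OF tv(2) tw(2)] eq unfolding tv(1) tw(1) by blast
  then obtain g where g: "g \<in> \<Gamma>" "w = tang (g \<odot> tsec v)" by blast
  have "fst w = mact g (fst v)" using fst_tang_pmul[OF tv(2)] pt_tsec[OF u(1)] g(2) by simp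
  then have "mact g (fst v) \<in> W" "fst v \<in> W" using v w by auto
  then have "g = pid \<or> g = - pid" using W g(1) unfolding wandering_def by blast
  then show ?thesis
  proof
    assume "g = pid" then show ?thesis using g(2) tv(1) by simp
  next
    assume "g = - pid"
    then show ?thesis using g(2) tv(1) tang_scaleR[of "-1" "tsec v"] by (simp add: pmul_minus_left)
  qed
qed

lemma tangent_orbit_mem_iff:
  assumes v: "v \<in> unit_tangent" and w: "w \<in> unit_tangent"
  shows "tangent_orbit G w = tangent_orbit G v \<longleftrightarrow> (\<exists>A\<in>\<Union>G. w = moebius_tangent A v)"
proof -
  note tv = tsec[OF v] and tw = tsec[OF w]
  have "moebius_tangent A v = tang (cmat_of A \<odot> tsec v)" if "A \<in> \<Union>G" for A
    using moebius_tangent_tang[OF det_G[OF that] tv(2)] tv(1) by simp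
  then show ?thesis using tangent_orbit_eq_iff[OF tv(2) tw(2)] tv(1) tw(1) by auto
qed

lemma moebius_tangent_unit: "A \<in> \<Union>G \<Longrightarrow> v \<in> unit_tangent \<Longrightarrow> moebius_tangent A v \<in> unit_tangent"
proof -
  assume A: "A \<in> \<Union>G" and v: "v \<in> unit_tangent"
  have d: "pdet (cmat_of A) > 0" using det_G[OF A] by (simp add: pdet_cmat_of)
  have f: "fst v \<in> half_plane" "snd v \<noteq> 0" using v by (auto simp: unit_tangent_def)
  have "mden (cmat_of A) (fst v) \<noteq> 0" using mden_nz[OF d] f(1) by (simp add: half_plane_def)
  then show ?thesis
    using f mact_half_plane[OF d f(1)] unfolding moebius_tangent_eq[OF det_G[OF A] v]
    by (simp add: unit_tangent_def norm_sgn norm_divide sgn_divide)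
qed

definition tangent_topology :: "(complex \<times> complex) set topology" where
  "tangent_topology = quotient_topology (top_of_set unit_tangent) (tangent_orbit G)"

lemma open_map_tangent_orbit:
  assumes U: "openin (top_of_set unit_tangent) U" shows "openin tangent_topology (tangent_orbit G ` U)"
proof -
  have Us: "U \<subseteq> unit_tangent" using openin_subset[OF U] by simp
  have "{v \<in> unit_tangent. tangent_orbit G v \<in> tangent_orbit G ` U} = (\<Union>A\<in>\<Union>G. unit_tangent \<inter> moebius_tangent A -` U)"
  proof (intro equalityI subsetI)
    fix v assume "v \<in> {v \<in> unit_tangent. tangent_orbit G v \<in> tangent_orbit G ` U}"
    then obtain u where v: "v \<in> unit_tangent" and u: "u \<in> U" "tangent_orbit G u = tangent_orbit G v" by auto
    then obtain A where "A \<in> \<Union>G" "u = moebius_tangent A v" using tangent_orbit_mem_iff[OF v, of u] Us by blast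
    then show "v \<in> (\<Union>A\<in>\<Union>G. unit_tangent \<inter> moebius_tangent A -` U)" using u(1) v by blast
  next
    fix v assume "v \<in> (\<Union>A\<in>\<Union>G. unit_tangent \<inter> moebius_tangent A -` U)"
    then obtain A where A: "A \<in> \<Union>G" "v \<in> unit_tangent" "moebius_tangent A v \<in> U" by blast
    have "tangent_orbit G (moebius_tangent A v) = tangent_orbit G v"
      using tangent_orbit_mem_iff[OF A(2) moebius_tangent_unit[OF A(1,2)]] A(1) by blast
    then have "tangent_orbit G v \<in> tangent_orbit G ` U" using A(3) by (metis image_eqI)
    then show "v \<in> {v \<in> unit_tangent. tangent_orbit G v \<in> tangent_orbit G ` U}" using A(2) by simp
  qed
  moreover have "openin (top_of_set unit_tangent) (\<Union>A\<in>\<Union>G. unit_tangent \<inter> moebius_tangent A -` U)"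
  proof (rule openin_Union, clarify)
    fix A X assume "A \<in> X" "X \<in> G"
    then have A: "A \<in> \<Union>G" by blast
    have "moebius_tangent A \<in> unit_tangent \<rightarrow> unit_tangent" using moebius_tangent_unit[OF A] by blast
    then show "openin (top_of_set unit_tangent) (unit_tangent \<inter> moebius_tangent A -` U)"
      using continuous_openin_preimage[OF continuous_on_moebius_tangent[OF det_G[OF A]] _ U] by blast
  qed
  ultimately have "openin (top_of_set unit_tangent) {v \<in> unit_tangent. tangent_orbit G v \<in> tangent_orbit G ` U}" by (simp only:)
  then show ?thesis unfolding tangent_topology_def openin_quotient_topology using Us by (simp add: image_mono)
qed

text \<open>Over a wandering set the orbit map is open and injective. Openness starts the induction
  over the sigma-algebra, and injectivity turns the image of a complement into a difference of
  images.\<close>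

lemma wandering_image_borel:
  assumes W: "wandering W" and E: "E \<in> sets borel"
  shows "tangent_orbit G ` (E \<inter> (W \<times> sphere 0 1)) \<in> sets (borel_of_topology tangent_topology)"
proof -
  let ?W = "W \<times> sphere (0::complex) 1" and ?Q = "borel_of_topology tangent_topology"
  have W': "open W" "W \<subseteq> half_plane" using W by (simp_all add: wandering_def)
  have inj: "inj_on (tangent_orbit G) ?W" using tangent_orbit_inj[OF W] by (intro inj_onI) blast
  have op: "tangent_orbit G ` (V \<inter> ?W) \<in> sets ?Q" if V: "open V" for V
  proof (intro openin_borel_of_topology open_map_tangent_orbit)
    have "V \<inter> ?W = unit_tangent \<inter> (V \<inter> (W \<times> UNIV))" using W'(2) by (auto simp: unit_tangent_def)
    moreover have "open (V \<inter> (W \<times> UNIV))" using V W'(1) by (intro open_Int open_Times) auto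
    ultimately show "openin (top_of_set unit_tangent) (V \<inter> ?W)" by (metis openin_open)
  qed
  have "E \<in> sigma_sets UNIV {S. open S}" using E by (simp add: borel_def)
  then show ?thesis
  proof induction
    case (Basic V) then show ?case using op by blast
  next
    case Empty show ?case by simp
  next
    case (Compl E)
    have "tangent_orbit G ` ((UNIV - E) \<inter> ?W) = tangent_orbit G ` (UNIV \<inter> ?W) - tangent_orbit G ` (E \<inter> ?W)"
      using inj by (subst inj_on_image_set_diff[symmetric, of _ ?W]) (auto intro!: arg_cong[where f="(`) (tangent_orbit G)"])
    moreover have "\<dots> \<in> sets ?Q" using op[of UNIV] Compl.IH by (intro sets.Diff) auto
    ultimately show ?case by (simp only:)
  next
    case (Union E)
    have "tangent_orbit G ` (\<Union>(range E) \<inter> ?W) = (\<Union>i. tangent_orbit G ` (E i \<inter> ?W))" by blast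
    moreover have "\<dots> \<in> sets ?Q" using Union.IH by (intro sets.countable_UN) auto
    ultimately show ?case by (simp only:)
  qed
qed

lemma free_tangent_inv:
  assumes "v \<in> unit_tangent" "w \<in> free_tangent" "tangent_orbit G v = tangent_orbit G w"
  shows "v \<in> free_tangent"
proof -
  have w: "w \<in> unit_tangent" using assms(2) free_tangent_sub by blast
  obtain A where A: "A \<in> \<Union>G" "v = moebius_tangent A w" using tangent_orbit_mem_iff[OF w assms(1)] assms(3) by blast
  have "fst v = mact (cmat_of A) (fst w)" using A(2) moebius_tangent_eq[OF det_G[OF A(1)] w] by simp
  then have "fst v \<in> free_part" using mact_free_part[of "cmat_of A" "fst w"] A(1) assms(2) by (auto simp: free_tangent_def)
  then show ?thesis using assms(1) by (auto simp: free_tangent_def unit_tangent_def mem_Times_iff)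
qed

lemma openin_free_tangent: "openin (top_of_set unit_tangent) free_tangent"
proof -
  have "free_tangent = unit_tangent \<inter> (free_part \<times> UNIV)"
    using free_part_half_plane by (auto simp: unit_tangent_def free_tangent_def)
  moreover have "open (free_part \<times> (UNIV :: complex set))" by (intro open_Times open_free_part) auto
  ultimately show ?thesis by (metis openin_open)
qed

text \<open>The base points in question are countable, so the matrices over them form a null
  set.\<close>

lemma non_free_null:
  "unit_tangent - free_tangent \<in> sets borel"
  "emeasure (hyp_area \<Otimes>\<^sub>M angle_measure) (unit_tangent - free_tangent) = 0"
proof -
  show s: "unit_tangent - free_tangent \<in> sets borel"
    using borel_unit_tangent openin_unit_tangent_borel(1)[OF openin_free_tangent] by (rule sets.Diff)
  have c: "half_plane - free_part \<in> null_sets lborel"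
    using countable_non_free by (rule countable_imp_null_set_lborel)
  then have "emeasure lborel {p. pt p \<in> half_plane - free_part} = 0" "{p. pt p \<in> half_plane - free_part} \<in> sets borel"
    using emeasure_pt_null[of "half_plane - free_part"] by (auto simp: null_sets_def)
  moreover have "{p. tang p \<in> unit_tangent - free_tangent} \<subseteq> {p. pt p \<in> half_plane - free_part}"
    by (auto simp: tang_def unit_tangent_def free_tangent_def)
  ultimately have "emeasure lborel {p. tang p \<in> unit_tangent - free_tangent} = 0"
    using emeasure_mono[of "{p. tang p \<in> unit_tangent - free_tangent}" "{p. pt p \<in> half_plane - free_part}" lborel] by simp
  then show "emeasure (hyp_area \<Otimes>\<^sub>M angle_measure) (unit_tangent - free_tangent) = 0"
    by (rule tangent_measure_null[OF s Diff_subset])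
qed

lemma tangent_orbit_image_borel:
  assumes N: "N \<in> sets borel" "N \<subseteq> free_tangent"
  shows "tangent_orbit G ` N \<in> sets (borel_of_topology tangent_topology)"
proof -
  obtain B :: "nat \<Rightarrow> complex set" where B: "(\<forall>n. wandering (B n)) \<and> (\<Union>n. B n) = free_part"
    using wandering_cover by blast
  have e: "(\<Union>n. N \<inter> (B n \<times> sphere 0 1)) = N"
  proof
    show "N \<subseteq> (\<Union>n. N \<inter> (B n \<times> sphere 0 1))"
    proof
      fix v assume v: "v \<in> N"
      then have f: "fst v \<in> (\<Union>n. B n)" "snd v \<in> sphere 0 1"
        using N(2) B by (auto simp: free_tangent_def)
      then obtain n where "fst v \<in> B n" by blast
      then have "v \<in> N \<inter> (B n \<times> sphere 0 1)" using v f(2) by (simp add: mem_Times_iff)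
      then show "v \<in> (\<Union>n. N \<inter> (B n \<times> sphere 0 1))" by (rule UN_I[OF UNIV_I])
    qed
  qed (rule UN_least, rule Int_lower1)
  have "tangent_orbit G ` N = (\<Union>n. tangent_orbit G ` (N \<inter> (B n \<times> sphere 0 1)))"
    unfolding image_UN[symmetric] e ..
  moreover have "\<dots> \<in> sets (borel_of_topology tangent_topology)"
    using wandering_image_borel[OF _ N(1)] B by (intro sets.countable_UN) auto
  ultimately show ?thesis by (simp only:)
qed

text \<open>The vectors based in a fundamental set. Over a free orbit the base point in the set is
  unique, and the trivial stabilizer makes the vector over it unique. The factor \<open>c\<close>
  covers the normalization in \<open>liouville\<close>.\<close>

lemma tangent_fundamental_domain_ex:
  fixes c :: ennreal
  shows "\<exists>F. fundamental_domain (scale_measure c (hyp_area \<Otimes>\<^sub>M angle_measure)) (tangent_orbit G) F"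
proof -
  let ?TM = "hyp_area \<Otimes>\<^sub>M angle_measure"
  obtain F where F: "F \<in> sets borel" "F \<subseteq> half_plane" "\<And>z. z \<in> free_part \<Longrightarrow> \<exists>!y. y \<in> F \<and> orb y = orb z"
    using fundamental_set by blast
  let ?F = "F \<times> sphere (0::complex) 1"
  have Fs: "?F \<in> sets ?TM" using F(1,2) by (intro pair_measureI) (auto simp: sets_hyp_area_iff sets_angle_measure_iff)
  have FU: "?F \<subseteq> unit_tangent" using F(2) by (auto simp: unit_tangent_def)
  have ex: "\<exists>!y. y \<in> ?F \<and> tangent_orbit G y = tangent_orbit G v" if v: "v \<in> free_tangent" for v
  proof -
    have vu: "v \<in> unit_tangent" using v free_tangent_sub by blast
    have vf: "fst v \<in> free_part" "fst v \<in> half_plane" using v vu by (auto simp: free_tangent_def unit_tangent_def)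
    obtain y0 where y0: "y0 \<in> F" "orb y0 = orb (fst v)" "\<And>y. y \<in> F \<Longrightarrow> orb y = orb (fst v) \<Longrightarrow> y = y0"
      using F(3)[OF vf(1)] by blast
    obtain A where A: "A \<in> \<Union>G" "y0 = mact (cmat_of A) (fst v)" using orb_eq_iff[OF vf(2)] y0(2) by blast
    let ?y = "moebius_tangent A v"
    have yu: "?y \<in> unit_tangent" by (rule moebius_tangent_unit[OF A(1) vu])
    have "fst ?y = y0" using moebius_tangent_eq[OF det_G[OF A(1)] vu] A(2) by simp
    then have yF: "?y \<in> ?F" using y0(1) yu by (auto simp: unit_tangent_def mem_Times_iff)
    have yo: "tangent_orbit G ?y = tangent_orbit G v" using tangent_orbit_mem_iff[OF vu yu] A(1) by blast
    have "y = ?y" if y: "y \<in> ?F" "tangent_orbit G y = tangent_orbit G v" for y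
    proof -
      have yu': "y \<in> unit_tangent" using y(1) FU by blast
      obtain C where C: "C \<in> \<Union>G" "y = moebius_tangent C v" using tangent_orbit_mem_iff[OF vu yu'] y(2) by blast
      have m: "fst y = mact (cmat_of C) (fst v)" using moebius_tangent_eq[OF det_G[OF C(1)] vu] C(2) by simp
      have "orb (fst y) = orb (fst v)" unfolding m using C(1) vf(2) by (intro orb_mact) auto
      then have "fst y = y0" using y(1) by (intro y0(3)) auto
      then have e: "fst y = fst ?y" using \<open>fst ?y = y0\<close> by simp
      have o: "tangent_orbit G y = tangent_orbit G ?y" using y(2) yo by simp
      have ff: "fst ?y \<in> free_part" using free_tangent_inv[OF yu v yo] by (auto simp: free_tangent_def)
      then obtain W where W: "wandering W" "fst ?y \<in> W" by (auto simp: free_part_def)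
      show ?thesis
        by (rule tangent_orbit_inj[OF W(1) _ _ o]) (use W(2) e yu yu' in \<open>auto simp: unit_tangent_def mem_Times_iff\<close>)
    qed
    then show ?thesis by (intro ex1I[of _ ?y] conjI yF yo) (elim conjE)
  qed
  have "AE v in scale_measure c ?TM. \<exists>!y. y \<in> ?F \<and> tangent_orbit G y = tangent_orbit G v"
  proof (rule AE_I')
    show "unit_tangent - free_tangent \<in> null_sets (scale_measure c ?TM)"
      using non_free_null sets_tangent_measure[OF non_free_null(1)] by (auto simp: null_sets_def)
    show "{v \<in> space (scale_measure c ?TM). \<not> (\<exists>!y. y \<in> ?F \<and> tangent_orbit G y = tangent_orbit G v)} \<subseteq> unit_tangent - free_tangent"
    proof
      fix v assume v: "v \<in> {v \<in> space (scale_measure c ?TM). \<not> (\<exists>!y. y \<in> ?F \<and> tangent_orbit G y = tangent_orbit G v)}"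
      then have "\<not> (\<exists>!y. y \<in> ?F \<and> tangent_orbit G y = tangent_orbit G v)" by (rule CollectE) (erule conjunct2)
      then have "v \<notin> free_tangent" by (rule contrapos_nn) (rule ex)
      moreover have "v \<in> unit_tangent"
        using v by (simp only: mem_Collect_eq space_scale_measure space_tangent_measure)
      ultimately show "v \<in> unit_tangent - free_tangent" by (rule DiffI[rotated])
    qed
  qed
  then show ?thesis using Fs unfolding fundamental_domain_def by (intro exI[of _ ?F]) simp
qed

text \<open>For invariant \<open>N\<close> every vector over the exceptional orbits lies in
  \<open>N\<close> or has a base point with stabilizer, so whichever domain defines
  \<open>liouville\<close>, it meets them in a null set.\<close>

lemma AE_liouvilleI:
  assumes N: "N \<in> sets borel" "N \<subseteq> unit_tangent" "emeasure (hyp_area \<Otimes>\<^sub>M angle_measure) N = 0"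
    and inv: "\<And>v w. v \<in> unit_tangent \<Longrightarrow> w \<in> N \<Longrightarrow> tangent_orbit G v = tangent_orbit G w \<Longrightarrow> v \<in> N"
    and P: "\<And>v. v \<in> unit_tangent \<Longrightarrow> v \<notin> N \<Longrightarrow> P (tangent_orbit G v)"
  shows "AE v in liouville G. P v"
proof -
  define c where "c = ennreal (1 / (2 * pi * measure (orbifold_area G) (orbifold G)))"
  define TM where "TM = hyp_area \<Otimes>\<^sub>M angle_measure"
  define D where "D = (SOME F. fundamental_domain (scale_measure c TM) (tangent_orbit G) F)"
  have L: "liouville G = quotient_measure (scale_measure c TM) (top_of_set unit_tangent) (tangent_orbit G)"
    unfolding liouville_def c_def TM_def ..
  have ex: "\<exists>F. fundamental_domain (scale_measure c TM) (tangent_orbit G) F"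
    unfolding TM_def by (rule tangent_fundamental_domain_ex)
  have D: "D \<in> sets TM"
    using someI_ex[OF ex] unfolding D_def[symmetric] by (simp add: fundamental_domain_def)
  have Du: "D \<subseteq> unit_tangent" using sets.sets_into_space[OF D] by (simp only: TM_def space_tangent_measure)
  let ?NF = "unit_tangent - free_tangent"
  \<comment> \<open>The images of Borel sets are known to be measurable over free base points; all
    other orbits are added as the complement of an open set.\<close>
  define Z where "Z = tangent_orbit G ` (N \<inter> free_tangent) \<union> (tangent_orbit G ` unit_tangent - tangent_orbit G ` free_tangent)"
  have top: "topspace tangent_topology = tangent_orbit G ` unit_tangent"
    by (simp add: tangent_topology_def topspace_quotient_topology)
  have Zs: "Z \<in> sets (borel_of_topology tangent_topology)" unfolding Z_def
  proof (rule sets.Un)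
    show "tangent_orbit G ` (N \<inter> free_tangent) \<in> sets (borel_of_topology tangent_topology)"
      using N(1) openin_unit_tangent_borel(1)[OF openin_free_tangent] by (intro tangent_orbit_image_borel) auto
    show "tangent_orbit G ` unit_tangent - tangent_orbit G ` free_tangent \<in> sets (borel_of_topology tangent_topology)"
      using sets.compl_sets[OF openin_borel_of_topology[OF open_map_tangent_orbit[OF openin_free_tangent]]]
      by (simp add: space_borel_of_topology top)
  qed
  have Zv: "v \<in> N \<or> v \<in> ?NF" if "v \<in> unit_tangent" "tangent_orbit G v \<in> Z" for v
    using that inv unfolding Z_def by blast
  have null: "emeasure TM (N \<union> ?NF) = 0"
    unfolding TM_def using N non_free_null sets_tangent_measure[OF N(1,2)] sets_tangent_measure[OF non_free_null(1)]
    by (intro emeasure_Un_null_set[THEN trans]) (auto simp: null_sets_def)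
  have Ns: "N \<union> ?NF \<in> sets TM"
    unfolding TM_def using sets_tangent_measure[OF N(1,2)] sets_tangent_measure[OF non_free_null(1)] by auto
  have "emeasure (liouville G) Z = emeasure (scale_measure c TM) (D \<inter> {v. tangent_orbit G v \<in> Z})"
    unfolding L D_def
  proof (rule emeasure_quotient_measure[OF ex])
    show "space (scale_measure c TM) \<subseteq> topspace (top_of_set unit_tangent)"
      by (simp add: TM_def space_tangent_measure space_scale_measure)
    show "U \<inter> space (scale_measure c TM) \<in> sets (scale_measure c TM)" if "openin (top_of_set unit_tangent) U" for U
      using openin_unit_tangent_borel[OF that] sets_tangent_measure[of U]
      by (simp add: TM_def space_tangent_measure space_scale_measure Int_absorb2)
    show "Z \<in> sets (borel_of_topology (quotient_topology (top_of_set unit_tangent) (tangent_orbit G)))"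
      using Zs by (simp add: tangent_topology_def)
  qed
  also have "\<dots> = c * emeasure TM (D \<inter> {v. tangent_orbit G v \<in> Z})" by (rule emeasure_scale_measure)
  also have "emeasure TM (D \<inter> {v. tangent_orbit G v \<in> Z}) = 0"
  proof -
    have "emeasure TM (D \<inter> {v. tangent_orbit G v \<in> Z}) \<le> emeasure TM (N \<union> ?NF)"
      using Zv Du Ns by (intro emeasure_mono) blast+
    then show ?thesis unfolding null by simp
  qed
  finally have "emeasure (liouville G) Z = 0" by simp
  then have "Z \<in> null_sets (liouville G)"
    using Zs by (simp add: null_sets_def L sets_quotient_measure tangent_topology_def)
  then show ?thesis
  proof (rule AE_I')
    show "{v \<in> space (liouville G). \<not> P v} \<subseteq> Z"
    proof
      fix x assume "x \<in> {v \<in> space (liouville G). \<not> P v}"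
      then obtain v where v: "v \<in> unit_tangent" "x = tangent_orbit G v" "\<not> P x"
        by (auto simp: L space_quotient_measure)
      then have "v \<in> N" using P by blast
      then show "x \<in> Z" using v free_tangent_inv[OF v(1)] unfolding Z_def by blast
    qed
  qed
qed

section \<open>Lifting rays, closed geodesics and the subsurface\<close>

lemma geodesic_ray_tang:
  assumes p: "pdet p = 1" shows "geodesic_ray (tangent_orbit G (tang p)) t = orb (pt (p \<odot> dia t))"
proof -
  have "fst (geodesic_flow t (tang (g \<odot> p))) = mact g (pt (p \<odot> dia t))" if g: "g \<in> \<Gamma>" for g
    using geodesic_flow_tang[of "g \<odot> p" t] fst_tang_pmul[of "p \<odot> dia t" g] p det1[OF g] by (simp add: pmul_assoc)
  then have "(\<lambda>g. fst (geodesic_flow t (tang (g \<odot> p)))) ` \<Gamma> = (\<lambda>g. mact g (pt (p \<odot> dia t))) ` \<Gamma>"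
    by (intro image_cong refl)
  then show ?thesis unfolding geodesic_ray_def tangent_orbit_tang[OF p] orb_def image_image .
qed

lemma simple_closed_geodesic_form:
  assumes "simple_closed_geodesic G c l"
  shows "\<exists>g. pdet g = 1 \<and> (\<forall>t. c t = orb (mact g (ax t)))"
proof -
  obtain h where h: "hyp_geodesic h" "\<And>t. c t = orb (h t)"
    using assms by (auto simp: simple_closed_geodesic_def orbit_orb)
  obtain g where g: "pdet g = 1 \<and> (\<forall>t. h t = mact g (ax t))" using hyp_geodesic_form[OF h(1)] by blast
  then show ?thesis using h(2) by (intro exI[of _ g]) simp
qed

text \<open>Closedness and the frontier condition give the two open sets. For points of both kinds
  near a boundary point, the chart is compared with the image of a neighbourhood upstairs, which is
  open since the orbit map is open.\<close>

lemma bounded_subsurface_lift: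
  assumes "bounds_subsurface G C M"
  defines "MT \<equiv> {z \<in> half_plane. orb z \<in> M}" and "CT \<equiv> {z \<in> half_plane. orb z \<in> C}"
  shows "CT \<subseteq> MT" "open (half_plane - MT)" "open (MT - CT)"
    "z \<in> CT \<Longrightarrow> open U \<Longrightarrow> z \<in> U \<Longrightarrow> (\<exists>w\<in>U. w \<in> MT - CT) \<and> (\<exists>w\<in>U. w \<in> half_plane - MT)"
proof -
  let ?T = "orbifold_topology G"
  have cl: "closedin ?T M" and fr: "?T frontier_of M = C" using assms(1) by (simp_all add: bounds_subsurface_def)
  have CM: "C \<subseteq> M" using frontier_of_subset_closedin[OF cl] fr by simp
  then show "CT \<subseteq> MT" by (auto simp: MT_def CT_def)
  have "openin ?T (topspace ?T - M)" using cl by (simp add: closedin_def)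
  from openin_orbifold[OF this] have "open {z \<in> half_plane. orb z \<in> topspace ?T - M}" .
  also have "{z \<in> half_plane. orb z \<in> topspace ?T - M} = half_plane - MT" by (auto simp: MT_def topspace_orbifold)
  finally show "open (half_plane - MT)" .
  have "M - C = ?T interior_of M"
    using fr closure_of_eq[THEN iffD2, OF cl] interior_of_subset[of ?T M] by (auto simp: frontier_of_def)
  then have "openin ?T (M - C)" by simp
  from openin_orbifold[OF this] have "open {z \<in> half_plane. orb z \<in> M - C}" .
  also have "{z \<in> half_plane. orb z \<in> M - C} = MT - CT" by (auto simp: MT_def CT_def)
  finally show "open (MT - CT)" .
  assume z: "z \<in> CT" and U: "open U" "z \<in> U"
  have zH: "z \<in> half_plane" and zC: "orb z \<in> C" using z by (simp_all add: CT_def)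
  obtain V \<phi> where V: "openin ?T V" "orb z \<in> V"
    and hm: "homeomorphic_map (subtopology ?T V) (top_of_set (ball (0::complex) 1)) \<phi>"
    and \<phi>0: "\<phi> (orb z) = 0" and \<phi>C: "\<phi> ` (V \<inter> C) = {z \<in> ball 0 1. Im z = 0}"
    and \<phi>M: "\<phi> ` (V \<inter> M) = {z \<in> ball 0 1. Im z \<ge> 0}"
    using assms(1) zC unfolding bounds_subsurface_def by blast
  have tV: "topspace (subtopology ?T V) = V" using openin_subset[OF V(1)] by auto
  have inj: "inj_on \<phi> V" using homeomorphic_imp_injective_map[OF hm] tV by simp
  let ?W = "orb ` (U \<inter> half_plane)"
  have "openin ?T ?W" using U(1) open_half_plane by (intro open_map_orbit) auto
  then have "openin ?T (V \<inter> ?W)" using V(1) by (intro openin_Int)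
  then have "openin (subtopology ?T V) (V \<inter> ?W)" by (auto simp: openin_subtopology)
  then have "openin (top_of_set (ball (0::complex) 1)) (\<phi> ` (V \<inter> ?W))"
    using homeomorphic_imp_open_map[OF hm] by (simp add: open_map_def)
  then have o: "open (\<phi> ` (V \<inter> ?W))" by (simp add: openin_open_eq)
  have "orb z \<in> V \<inter> ?W" using V(2) zH U(2) by blast
  then have "0 \<in> \<phi> ` (V \<inter> ?W)" using \<phi>0 by (metis image_eqI)
  then obtain e where e: "e > 0" "ball 0 e \<subseteq> \<phi> ` (V \<inter> ?W)" using o open_contains_ball by blast
  have pt: "\<exists>w. w \<in> U \<inter> half_plane \<and> orb w \<in> V \<and> \<phi> (orb w) = x" if x: "x \<in> ball 0 e" for x
  proof -
    obtain q where q: "q \<in> V" "q \<in> ?W" "x = \<phi> q" using x e(2) by blast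
    then show ?thesis by blast
  qed
  \<comment> \<open>One chart point strictly above and one strictly below the boundary line, both
    within the image of \<open>U\<close>.\<close>
  have "Complex 0 (e / 2) \<in> ball 0 e" "Complex 0 (- e / 2) \<in> ball 0 e" using e(1) by (simp_all add: cmod_def)
  with pt obtain w1 w2 where w1: "w1 \<in> U \<inter> half_plane" "orb w1 \<in> V" "\<phi> (orb w1) = Complex 0 (e / 2)"
    and w2: "w2 \<in> U \<inter> half_plane" "orb w2 \<in> V" "\<phi> (orb w2) = Complex 0 (- e / 2)" by meson
  have \<phi>V: "\<phi> ` V = ball 0 1" using homeomorphic_imp_surjective_map[OF hm] tV by simp
  have "\<phi> (orb w1) \<in> \<phi> ` (V \<inter> M)" unfolding \<phi>M using w1(3) e(1) imageI[OF w1(2), of \<phi>] unfolding \<phi>V by simp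
  then have "orb w1 \<in> M" using inj w1(2) by (auto dest: inj_onD)
  moreover have "orb w1 \<notin> C"
  proof
    assume "orb w1 \<in> C"
    then have "\<phi> (orb w1) \<in> \<phi> ` (V \<inter> C)" using w1(2) by blast
    then show False unfolding \<phi>C using w1(3) e(1) by simp
  qed
  ultimately have 1: "w1 \<in> MT - CT" using w1(1) by (simp add: MT_def CT_def)
  have "orb w2 \<notin> M"
  proof
    assume "orb w2 \<in> M"
    then have "\<phi> (orb w2) \<in> \<phi> ` (V \<inter> M)" using w2(2) by blast
    then show False unfolding \<phi>M using w2(3) e(1) by simp
  qed
  then have "w2 \<in> half_plane - MT" using w2(1) by (simp add: MT_def)
  with 1 show "(\<exists>w\<in>U. w \<in> MT - CT) \<and> (\<exists>w\<in>U. w \<in> half_plane - MT)" using w1(1) w2(1) by blast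
qed

end

theorem corollary1:
  fixes G :: "(real^2^2) set set"
    and k :: nat
    and \<gamma> :: "nat \<Rightarrow> real \<Rightarrow> complex set"
    and l :: "nat \<Rightarrow> real"
    and M :: "complex set set"
  assumes "discrete_subgroup_PSL2R G"
    and "emeasure (orbifold_area G) (orbifold G) < \<infinity>"
    and "1 \<le> k"
    and "\<And>i. i \<in> {1..k} \<Longrightarrow> simple_closed_geodesic G (\<gamma> i) (l i)"
    and "disjoint_family_on (\<lambda>i. range (\<gamma> i)) {1..k}"
    and "bounds_subsurface G (\<Union>i\<in>{1..k}. range (\<gamma> i)) M"
  shows "AE v in liouville G.
      (\<exists>t s. excursion_parameters M v t s) \<and>
      (\<forall>t s. excursion_parameters M v t s \<longrightarrow>
        (\<lambda>n. (1 / real n) * (\<Sum>i<n. s i - t i))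
          \<longlonglongrightarrow> pi * measure (orbifold_area G) M / (\<Sum>i=1..k. l i))"
proof -
  interpret D: discrete_PSL2R G using assms(1) by unfold_locales
  let ?C = "\<Union>i\<in>{1..k}. range (\<gamma> i)"
  have "\<forall>i\<in>{1..k}. \<exists>g. pdet g = 1 \<and> (\<forall>t. \<gamma> i t = D.orb (mact g (ax t)))"
    using D.simple_closed_geodesic_form[OF assms(4)] by blast
  from bchoice[OF this] obtain B where B': "\<forall>i\<in>{1..k}. pdet (B i) = 1 \<and> (\<forall>t. \<gamma> i t = D.orb (mact (B i) (ax t)))"
    by blast
  then have B: "pdet (B i) = 1" "\<gamma> i t = D.orb (mact (B i) (ax t))" if "i \<in> {1..k}" for i t
    using that by blast+
  have sc: "0 < l i" "\<gamma> i (t + l i) = \<gamma> i t" "inj_on (\<gamma> i) {0..<l i}" if "i \<in> {1..k}" for i t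
    using assms(4)[OF that] by (simp_all add: simple_closed_geodesic_def)
  define MT where "MT = {z \<in> half_plane. D.orb z \<in> M}"
  define CT where "CT = {z \<in> half_plane. D.orb z \<in> ?C}"
  note lift = D.bounded_subsurface_lift[OF assms(6), folded MT_def CT_def]
  have area: "emeasure (orbifold_area G) T = emeasure hyp_area (D.HF \<inter> {z \<in> half_plane. D.orb z \<in> T})"
    if "closedin (orbifold_topology G) T" for T
    using that by (intro D.emeasure_orbifold_area closedin_borel_of_topology)
  have "closedin (orbifold_topology G) (orbifold G)"
    using closedin_topspace[of "orbifold_topology G"] by (simp add: D.topspace_orbifold orbifold_def D.orbit_orb)
  moreover have "{z \<in> half_plane. D.orb z \<in> orbifold G} = half_plane" by (auto simp: orbifold_def D.orbit_orb)
  ultimately have "emeasure (orbifold_area G) (orbifold G) = emeasure hyp_area (D.HF \<inter> half_plane)"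
    using area by (simp only:)
  then have fin: "emeasure hyp_area D.HF < \<infinity>" using assms(2) D.HF(2) by (simp add: Int_absorb2)
  interpret S: geodesic_system D.\<Gamma> D.HF k B l
  proof unfold_locales
    show "D.orb (mact (B i) (ax (t + l i))) = D.orb (mact (B i) (ax t))" if "i \<in> {1..k}" for i t
      using sc(2)[OF that] unfolding B(2)[OF that] .
    show "s = t" if "i \<in> {1..k}" "s \<in> {0..<l i}" "t \<in> {0..<l i}" "D.orb (mact (B i) (ax s)) = D.orb (mact (B i) (ax t))" for i s t
      using inj_onD[OF sc(3)[OF that(1)], of s t] that by (simp add: B(2)[OF that(1)])
    show "D.orb (mact (B i) (ax s)) \<noteq> D.orb (mact (B j) (ax t))" if "i \<in> {1..k}" "j \<in> {1..k}" "i \<noteq> j" for i j s t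
    proof
      assume "D.orb (mact (B i) (ax s)) = D.orb (mact (B j) (ax t))"
      then have "\<gamma> i s = \<gamma> j t" using B(2) that by simp
      moreover have "range (\<gamma> i) \<inter> range (\<gamma> j) = {}" using assms(5) that by (auto simp: disjoint_family_on_def)
      ultimately show False by blast
    qed
  qed (use D.HF fin B(1) sc(1) in auto)
  have GT: "S.GT = CT"
    unfolding S.GT_def CT_def S.gam_def using B(2) by auto
  interpret E: excursion_system D.\<Gamma> D.HF k B l MT
  proof unfold_locales
    show "z \<in> MT \<longleftrightarrow> w \<in> MT" if "z \<in> half_plane" "w \<in> half_plane" "D.orb z = D.orb w" for z w
      using that by (simp add: MT_def)
    show "(\<exists>w\<in>U. w \<in> MT - S.GT) \<and> (\<exists>w\<in>U. w \<in> half_plane - MT)" if "z \<in> S.GT" "open U" "z \<in> U" for z U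
      using lift(4) that unfolding GT by blast
  qed (use lift(1-3) assms(3) in \<open>auto simp: MT_def GT\<close>)
  have "closedin (orbifold_topology G) M" using assms(6) by (simp add: bounds_subsurface_def)
  from area[OF this] have mM: "measure (orbifold_area G) M = measure hyp_area (D.HF \<inter> MT)"
    by (simp add: measure_def MT_def)
  obtain N where N: "N \<in> S.Inv" "emeasure lborel N = 0" and lim: "\<forall>p\<in>PW - N.
     (\<exists>t s. (\<forall>i::nat. t i < s i \<and> s i < t (Suc i)) \<and> E.Am p = (\<Union>i. {t i..s i})) \<and>
     (\<forall>t s. (\<forall>i::nat. t i < s i \<and> s i < t (Suc i)) \<and> E.Am p = (\<Union>i. {t i..s i}) \<longrightarrow>
        (\<lambda>n. (1 / real n) * (\<Sum>i<n. s i - t i)) \<longlonglongrightarrow> pi * measure (orbifold_area G) M / (\<Sum>i\<in>{1..k}. l i))"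
    using E.excursion_limit[folded mM] by (elim bexE conjE) (rule that)
  \<comment> \<open>Scaling invariance makes \<open>N\<close> the full preimage of its image under
    \<open>tang\<close>, so the image is Borel and null.\<close>
  have "r *\<^sub>R p \<in> N" if "r \<noteq> 0" "p \<in> N" for r p using S.InvD(4)[OF N(1) that(1)] that(2) by blast
  note tN = tang_image_borel[OF S.InvD(2)[OF N(1)] S.InvD(3)[OF N(1)] this]
  show ?thesis
  proof (rule D.AE_liouvilleI)
    show "tang ` N \<in> sets borel" by (rule tN(1))
    show "tang ` N \<subseteq> unit_tangent" by (rule tN(2))
    show "emeasure (hyp_area \<Otimes>\<^sub>M angle_measure) (tang ` N) = 0"
      using tN N(2) by (intro tangent_measure_null) simp_all
    show "v \<in> tang ` N" if v: "v \<in> unit_tangent" and w: "w \<in> tang ` N" and eq: "tangent_orbit G v = tangent_orbit G w" for v w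
    proof -
      have wu: "w \<in> unit_tangent" using w tN(2) by blast
      note tv = tsec[OF v] and tw = tsec[OF wu]
      have wN: "tsec w \<in> N" using w tN(3) tw(1) by auto
      obtain g where g: "g \<in> D.\<Gamma>" "v = tang (g \<odot> tsec w)"
        using D.tangent_orbit_eq_iff[OF tw(2) tv(2)] eq unfolding tv(1) tw(1) by blast
      have "tsec w \<in> PW" using tw(2) by (simp add: PW_def)
      then have "g \<odot> tsec w \<in> N" using S.InvD(1)[OF N(1)] g(1) wN unfolding D.inv_left_def by blast
      then show ?thesis using g(2) by blast
    qed
    fix v assume v: "v \<in> unit_tangent" "v \<notin> tang ` N"
    note tv = tsec[OF v(1)]
    \<comment> \<open>The section supplies a matrix of determinant 1 over \<open>v\<close>, at which
      the limit statement for matrices is evaluated.\<close>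
    have p: "tsec v \<in> PW - N" using v(2) tv by (auto simp: PW_def intro: rev_image_eqI)
    have Am: "{\<tau>. 0 \<le> \<tau> \<and> geodesic_ray (tangent_orbit G v) \<tau> \<in> M} = E.Am (tsec v)"
    proof -
      have "geodesic_ray (tangent_orbit G v) \<tau> \<in> M \<longleftrightarrow> pt (tsec v \<odot> dia \<tau>) \<in> MT" for \<tau>
        using D.geodesic_ray_tang[OF tv(2), of \<tau>] S.pt_PW[of "tsec v \<odot> dia \<tau>"] p tv(1) by (simp add: MT_def)
      then show ?thesis by (simp add: E.Am_def)
    qed
    show "(\<exists>t s. excursion_parameters M (tangent_orbit G v) t s) \<and>
      (\<forall>t s. excursion_parameters M (tangent_orbit G v) t s \<longrightarrow>
        (\<lambda>n. (1 / real n) * (\<Sum>i<n. s i - t i))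
          \<longlonglongrightarrow> pi * measure (orbifold_area G) M / (\<Sum>i=1..k. l i))"
      unfolding excursion_parameters_def Am by (rule bspec[OF lim p])
  qed
qed

end
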